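(* Let $B$ be a finite Blaschke product such that $\tau=B|_{\mathbb{T}}$ is an analytic expanding circle map. Let $z_0$ and $\hat z_0$ be the unique fixed points of $B$ in $\mathbb{D}$ and in $\hat{\mathbb{C}}\setminus\overline{\mathbb{D}}$, respectively, with multipliers $\lambda(z_0)$ and $\lambda(\hat z_0)=\overline{\lambda(z_0)}$. Then there is an annulus $A\in\mathcal{A}$ such that: (a) the transfer operator $\mathcal{L}\colon H^2(A)\to H^2(A)$ associated with $\tau$ is well defined and compact; and (b) the spectrum of $\mathcal{L}\colon H^2(A)\to H^2(A)$ is $$\sigma(\mathcal{L})=\{\lambda(z_0)^n : n\in\mathbb{N}_0\}\cup\{\lambda(\hat z_0)^n : n\in\mathbb{N}\}\cup\{0\}.$$
   Context: Notation: $\hat{\mathbb{C}}=\mathbb{C}\cup\{\infty\}$, $\mathbb{T}=\{|z|=1\}$, $\mathbb{D}=\{|z|<1\}$, and $A_{r,R}=\{z\in\mathbb{C}: r<|z|<R\}$ for $r<1<R$. $\mathbb{N}=\{1,2,\dots\}$, $\mathbb{N}_0=\mathbb{N}\cup\{0\}$, and $0^0=1$. A finite Blaschke product is a map $B(z)=C\prod_{i=1}^n\frac{z-a_i}{1-\overline{a_i}z}$ with $n\ge 2$, $a_1,\dots,a_n\in\mathbb{D}$ and $|C|=1$. It is a rational map of $\hat{\mathbb{C}}$ with $B(\mathbb{T})=\mathbb{T}$ and $B(\mathbb{D})=\mathbb{D}$. An analytic expanding circle map is a map $\tau\colon\mathbb{T}\to\mathbb{T}$ that is analytic on $\mathbb{T}$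 with $|\tau'(z)|>1$ for all $z\in\mathbb{T}$; it is a $K$-fold covering for some $K>1$. The holomorphic extension of $\tau$ to an annulus is again denoted $\tau$, and $\mathcal{A}$ is the set of annuli $A_{r,R}$ ($r<1<R$) on which $\tau$ and $1/\tau$ are holomorphic. It is known that, if $B|_{\mathbb{T}}$ is expanding, $B$ has a unique fixed point $z_0$ in $\mathbb{D}$ and a unique fixed point $\hat z_0=1/\overline{z_0}$ in $\hat{\mathbb{C}}\setminus\overline{\mathbb{D}}$, both attracting. The multiplier $\lambda(z^* )$ of a fixed point $z^*$ of a rational map $R$ is $R'(z^* )$ if $z^*\in\mathbb{C}$, and $1/R'(\infty):=\lim_{z\to\infty}1/R'(z)$ if $z^*=\infty$. The transfer operator associated with $\tau$ is $$(\mathcal{L}f)(z)=\sum_{k=1}^K\phi_k'(z)\,(f\circ\phi_k)(z),\qquad z\in A,$$ where $\phi_1,\dots,\phi_K$ are the local inverse branches of the covering $\tau\colon\mathbb{T}\to\mathbb{T}$, continued holomorphically to points of $A$, with values in $A$ (the sum over all branches is single-valued). For $\rho>0$ put $M_\rho(f)=\int_0^{2\pi}|f(\rho e^{i\theta})|^2\frac{d\theta}{2\pi}$. The Hardy-Hilbert space $H^2(A_{r,R})$ consists of all holomorphic $f$ on $A_{r,R}$ for which $M_\rho(f)$ stays bounded as $\rho\nearrow R$ and as $\rho\searrow r$. Such $f$ have radial boundary values a.e. on $\{|z|=r\}$ and $\{|z|=R\}$ (again denoted $f$), and $H^2(A_{r,R})$ is a Hilbert space with inner product $$(f,g)=\int_0^{2\pi}f(Re^{i\theta})\overline{g(Re^{i\theta})}\frac{d\theta}{2\pi}+\int_0^{2\pi}f(re^{i\theta})\overline{g(re^{i\theta})}\frac{d\theta}{2\pi}.$$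 *)

theory Defs
  imports "HOL-Complex_Analysis.Complex_Analysis"
begin

definition finite_blaschke_product :: "(complex \<Rightarrow> complex) \<Rightarrow> bool" where
  "finite_blaschke_product B \<longleftrightarrow>
     (\<exists>C n a. n \<ge> 2 \<and> cmod C = 1 \<and> (\<forall>i\<in>{1..n::nat}. a i \<in> ball 0 1) \<and>
        B = (\<lambda>z. C * (\<Prod>i=1..n. (z - a i) / (1 - cnj (a i) * z))))"

text \<open>The map of the unit circle is represented by (an extension of) it to the plane;
  \<^const>\<open>analytic_on\<close> makes it holomorphic near the circle, and there the derivative of
  the circle map is the complex derivative.\<close>

definition analytic_expanding_circle_map :: "(complex \<Rightarrow> complex) \<Rightarrow> bool" where
  "analytic_expanding_circle_map \<tau> \<longleftrightarrow>
     \<tau> ` sphere 0 1 \<subseteq> sphere 0 1 \<and> \<tau> analytic_on sphere 0 1 \<and>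
     (\<forall>z\<in>sphere 0 1. cmod (deriv \<tau> z) > 1)"

text \<open>Points of the Riemann sphere are of type \<^typ>\<open>complex option\<close>, with \<^const>\<open>None\<close> for
  infinity. A rational map is given by its values on the plane; as division by zero
  yields zero, its poles have to be sent to infinity explicitly.\<close>

definition sphere_map :: "(complex \<Rightarrow> complex) \<Rightarrow> complex option \<Rightarrow> complex option" where
  "sphere_map F p =
     (case p of
        Some z \<Rightarrow> if is_pole F z then None else Some (F z)
      | None \<Rightarrow> if filterlim F at_infinity at_infinity then None
                else Some (Lim at_infinity F))"

definition multiplier :: "(complex \<Rightarrow> complex) \<Rightarrow> complex option \<Rightarrow> complex" where
  "multiplier F p =
     (case p of
        Some z \<Rightarrow> deriv F z
      | None \<Rightarrow> Lim at_infinity (\<lambda>z. 1 / deriv F z))"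

definition annulus :: "real \<Rightarrow> real \<Rightarrow> complex set" where
  "annulus r R = {z. r < cmod z \<and> cmod z < R}"

text \<open>Nonvanishing of \<open>\<tau>\<close> is spelt out because \<open>1 / \<tau> z = 0\<close> at a zero of \<open>\<tau>\<close>.\<close>

definition admissible_annulus :: "(complex \<Rightarrow> complex) \<Rightarrow> real \<Rightarrow> real \<Rightarrow> bool" where
  "admissible_annulus \<tau> r R \<longleftrightarrow>
     0 < r \<and> r < 1 \<and> 1 < R \<and>
     \<tau> holomorphic_on annulus r R \<and>
     (\<forall>z\<in>annulus r R. \<tau> z \<noteq> 0) \<and> (\<lambda>z. 1 / \<tau> z) holomorphic_on annulus r R"

definition circle_mean_square :: "real \<Rightarrow> (complex \<Rightarrow> complex) \<Rightarrow> real" where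
  "circle_mean_square \<rho> f =
     (LINT \<theta>:{0..2*pi}|lebesgue. (cmod (f (of_real \<rho> * cis \<theta>)))\<^sup>2) / (2*pi)"

text \<open>Functions on the annulus are extended by zero, so that equality in the Hardy space is
  equality of functions.\<close>

definition hardy_space :: "real \<Rightarrow> real \<Rightarrow> (complex \<Rightarrow> complex) set" where
  "hardy_space r R =
     {f. f holomorphic_on annulus r R \<and> (\<forall>z. z \<notin> annulus r R \<longrightarrow> f z = 0) \<and>
         Bfun (\<lambda>\<rho>. circle_mean_square \<rho> f) (at_left R) \<and>
         Bfun (\<lambda>\<rho>. circle_mean_square \<rho> f) (at_right r)}"

text \<open>Radial boundary values as functions of the angle. They exist for almost every angle;
  the exceptional null set does not affect the integrals below.\<close>

definition outer_boundary_value :: "real \<Rightarrow> (complex \<Rightarrow> complex) \<Rightarrow> real \<Rightarrow> complex" where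
  "outer_boundary_value R f \<theta> = Lim (at_left R) (\<lambda>\<rho>. f (of_real \<rho> * cis \<theta>))"

definition inner_boundary_value :: "real \<Rightarrow> (complex \<Rightarrow> complex) \<Rightarrow> real \<Rightarrow> complex" where
  "inner_boundary_value r f \<theta> = Lim (at_right r) (\<lambda>\<rho>. f (of_real \<rho> * cis \<theta>))"

definition hardy_inner ::
    "real \<Rightarrow> real \<Rightarrow> (complex \<Rightarrow> complex) \<Rightarrow> (complex \<Rightarrow> complex) \<Rightarrow> complex" where
  "hardy_inner r R f g =
     (LINT \<theta>:{0..2*pi}|lebesgue.
        outer_boundary_value R f \<theta> * cnj (outer_boundary_value R g \<theta>)) / (2*pi) +
     (LINT \<theta>:{0..2*pi}|lebesgue.
        inner_boundary_value r f \<theta> * cnj (inner_boundary_value r g \<theta>)) / (2*pi)"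

definition hardy_norm :: "real \<Rightarrow> real \<Rightarrow> (complex \<Rightarrow> complex) \<Rightarrow> real" where
  "hardy_norm r R f = sqrt (Re (hardy_inner r R f f))"

text \<open>Operators on a complex normed space of functions with carrier \<open>V\<close> and norm \<open>N\<close>.
  A carrier set is needed since the Hardy space depends on the radii.\<close>

definition linear_operator ::
    "(complex \<Rightarrow> complex) set \<Rightarrow> ((complex \<Rightarrow> complex) \<Rightarrow> complex \<Rightarrow> complex) \<Rightarrow> bool" where
  "linear_operator V T \<longleftrightarrow>
     (\<forall>f\<in>V. T f \<in> V) \<and>
     (\<forall>f\<in>V. \<forall>g\<in>V. T (\<lambda>z. f z + g z) = (\<lambda>z. T f z + T g z)) \<and>
     (\<forall>c. \<forall>f\<in>V. T (\<lambda>z. c * f z) = (\<lambda>z. c * T f z))"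

definition bounded_operator ::
    "(complex \<Rightarrow> complex) set \<Rightarrow> ((complex \<Rightarrow> complex) \<Rightarrow> real) \<Rightarrow>
     ((complex \<Rightarrow> complex) \<Rightarrow> complex \<Rightarrow> complex) \<Rightarrow> bool" where
  "bounded_operator V N T \<longleftrightarrow>
     linear_operator V T \<and> (\<exists>C. \<forall>f\<in>V. N (T f) \<le> C * N f)"

abbreviation norm_topology ::
    "(complex \<Rightarrow> complex) set \<Rightarrow> ((complex \<Rightarrow> complex) \<Rightarrow> real) \<Rightarrow>
     (complex \<Rightarrow> complex) topology" where
  "norm_topology V N \<equiv> Metric_space.mtopology V (\<lambda>f g. N (\<lambda>z. f z - g z))"

definition compact_operator ::
    "(complex \<Rightarrow> complex) set \<Rightarrow> ((complex \<Rightarrow> complex) \<Rightarrow> real) \<Rightarrow>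
     ((complex \<Rightarrow> complex) \<Rightarrow> complex \<Rightarrow> complex) \<Rightarrow> bool" where
  "compact_operator V N T \<longleftrightarrow>
     linear_operator V T \<and>
     compactin (norm_topology V N) (norm_topology V N closure_of (T ` {f\<in>V. N f \<le> 1}))"

definition operator_spectrum ::
    "(complex \<Rightarrow> complex) set \<Rightarrow> ((complex \<Rightarrow> complex) \<Rightarrow> real) \<Rightarrow>
     ((complex \<Rightarrow> complex) \<Rightarrow> complex \<Rightarrow> complex) \<Rightarrow> complex set" where
  "operator_spectrum V N T =
     {\<mu>. \<not> (\<exists>S. bounded_operator V N S \<and>
                (\<forall>f\<in>V. S (\<lambda>z. \<mu> * f z - T f z) = f) \<and>
                (\<forall>f\<in>V. (\<lambda>z. \<mu> * S f z - T (S f) z) = f))}"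

text \<open>\<open>\<phi> 0, \<dots>, \<phi> (K - 1)\<close> are the inverse branches of the covering \<open>\<tau>\<close> of the unit
  circle, continued holomorphically over the connected open set \<open>U \<subseteq> A\<close>, which meets the
  circle, with values in \<open>A\<close>. Over each point of the circle in \<open>U\<close> they list the fibre
  of the circle map without repetition, so that \<open>K\<close> is its degree.\<close>

definition inverse_branches ::
    "(complex \<Rightarrow> complex) \<Rightarrow> complex set \<Rightarrow> complex set \<Rightarrow> nat \<Rightarrow>
     (nat \<Rightarrow> complex \<Rightarrow> complex) \<Rightarrow> bool" where
  "inverse_branches \<tau> A U K \<phi> \<longleftrightarrow>
     open U \<and> connected U \<and> U \<subseteq> A \<and> U \<inter> sphere 0 1 \<noteq> {} \<and>
     (\<forall>k<K. \<phi> k holomorphic_on U \<and> \<phi> k ` U \<subseteq> A \<and> (\<forall>z\<in>U. \<tau> (\<phi> k z) = z)) \<and>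
     (\<forall>z\<in>U \<inter> sphere 0 1. bij_betw (\<lambda>k. \<phi> k z) {..<K} {w \<in> sphere 0 1. \<tau> w = z})"

definition transfer_value ::
    "(complex \<Rightarrow> complex) \<Rightarrow> complex set \<Rightarrow> (complex \<Rightarrow> complex) \<Rightarrow> complex \<Rightarrow> complex \<Rightarrow> bool"
  where
  "transfer_value \<tau> A f z w \<longleftrightarrow>
     (\<exists>U K \<phi>. inverse_branches \<tau> A U K \<phi> \<and> z \<in> U \<and>
        w = (\<Sum>k<K. deriv (\<phi> k) z * (f \<circ> \<phi> k) z))"

definition transfer_operator ::
    "(complex \<Rightarrow> complex) \<Rightarrow> complex set \<Rightarrow> (complex \<Rightarrow> complex) \<Rightarrow> complex \<Rightarrow> complex" where
  "transfer_operator \<tau> A f z = (if z \<in> A then THE w. transfer_value \<tau> A f z w else 0)"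

text \<open>The branches exist near every point of \<open>A\<close>, the sum does not depend on their choice, and
  the resulting function belongs to the space \<open>V\<close> again.\<close>

definition transfer_operator_well_defined ::
    "(complex \<Rightarrow> complex) \<Rightarrow> complex set \<Rightarrow> (complex \<Rightarrow> complex) set \<Rightarrow> bool" where
  "transfer_operator_well_defined \<tau> A V \<longleftrightarrow>
     (\<forall>f\<in>V. (\<forall>z\<in>A. \<exists>!w. transfer_value \<tau> A f z w) \<and> transfer_operator \<tau> A f \<in> V)"

end

theory Submission
  imports Defs "HOL-Computational_Algebra.Fundamental_Theorem_Algebra"
begin

text \<open>
  Choose radii \<open>s < r < t < 1\<close> with \<open>B\<close> mapping \<open>|w| \<le> t\<close> into \<open>|w| \<le> s\<close>; expansion on the circle
  provides them, since there \<open>|B'|\<close> is the sum of Poisson kernels at the \<open>a i\<close>, which governs how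
  fast \<open>|B|\<close> drops inside. The transfer operator \<open>L\<close> then maps functions on \<open>A = annulus r (1 / r)\<close>
  to functions on the larger annulus \<open>A' = annulus s (1 / s)\<close>, so it is compact by Montel's theorem,
  and not surjective because a pole can be placed in \<open>A' - A\<close>.

  By partial fractions \<open>L\<close> sends the Cauchy kernel \<open>1 / (z - q)\<close> to the kernel at \<open>B q\<close>, up to a term
  that cancels against the one of the reflected kernel \<open>cnj (q / (1 - q * cnj z))\<close>. As every function on
  \<open>A\<close> is an integral of these kernels, \<open>L\<close> is dual to composition with \<open>B\<close> near \<open>z0\<close> and to its
  conjugate. There \<open>\<Prod>j<N. (C\<^sub>B - \<nu>^j)\<close>, where \<open>C\<^sub>B\<close> is composition with \<open>B\<close> and \<open>\<nu>\<close> the multiplier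
  of \<open>z0\<close>, raises the order of vanishing at \<open>z0\<close> to \<open>N\<close>. Hence iterates of \<open>L\<close> composed with the
  product \<open>Q\<close> of all \<open>L - \<nu>^j\<close> and \<open>L - cnj \<nu>^j\<close>, \<open>j < N\<close>, decay geometrically at any prescribed rate
  for large \<open>N\<close>, the series \<open>\<Sum>k. L^k Q / \<mu>^(k+1)\<close> converges, and \<open>\<mu> - L\<close> is invertible unless
  \<open>\<mu>\<close> is a root of the product. Conversely, if \<open>\<nu> \<noteq> 0\<close>, the functional sending \<open>h\<close> to the
  \<open>n\<close>-th Taylor coefficient of \<open>(\<Prod>1\<le>j<n. (C\<^sub>B - \<nu>^j)) h\<close> at \<open>z0\<close> is an eigenvector of the adjoint of
  \<open>C\<^sub>B\<close>, and its values on the two kernels are eigenfunctions of \<open>L\<close> for \<open>\<nu>^n\<close> and \<open>cnj \<nu>^n\<close>.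
\<close>

subsection \<open>Radial limits in the disc\<close>

text \<open>The norm of the space is built from radial limits taken with \<open>Lim\<close>, which
  has an unspecified value where no limit exists. Before \<open>hardy_norm\<close> can be estimated,
  Fatou's theorem has to be established on an annulus: radial limits exist almost everywhere, and
  the quadratic means over circles converge to their square integrals. This accounts for the first
  third of the proof.

  \<open>transfer_operator\<close> is a \<open>THE\<close> over all choices of inverse branches. It
  is replaced by a sum over the fibre \<open>{w. B w = z}\<close>, which is free of choices;
  branches, obtained by lifting along a covering, show that the two agree and that the sum is
  holomorphic.

  The annulus is symmetric because \<open>B\<close> commutes with the reflection
  \<open>1 / cnj z\<close>, so that inner estimates carry over to the outside.

  The term that disturbs the action on the Cauchy kernels is constant in \<open>q\<close>. Taylor
  coefficients of positive order do not see it, whereas the eigenvalue 1 needs an eigenfunction of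
  its own. For \<open>\<nu> = 0\<close> all other powers are 0, a point of the spectrum by failing
  surjectivity.\<close>

text \<open>On the unit circle \<open>1 - cnj z * u = u * cnj (u - z)\<close>, which turns Cauchy's
  formula at \<open>z\<close> for the function \<open>1 / (1 - cnj z * u)\<close> into an integral
  of \<open>1 / (cmod (u - z))^2\<close>, up to the constant \<open>2 * pi * \<i>\<close>.\<close>

lemma poisson_integral_circle:
  fixes z :: complex
  assumes z: "cmod z < 1"
  shows "((\<lambda>t. 1 / (cmod (circlepath 0 1 t - z))\<^sup>2) has_integral 1 / (1 - (cmod z)\<^sup>2)) {0..1}"
proof -
  have nz: "1 - cnj z * u \<noteq> 0" if "cmod u \<le> 1" for u
  proof
    assume "1 - cnj z * u = 0"
    hence "cmod (cnj z * u) = 1" by simp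
    moreover have "cmod z * cmod u \<le> cmod z * 1" using that by (intro mult_left_mono) auto
    ultimately show False using z by (simp add: norm_mult)
  qed
  have "((\<lambda>u. (1 / (1 - cnj z * u)) / (u - z)) has_contour_integral
           (2 * of_real pi * \<i> * (1 / (1 - cnj z * z)))) (circlepath 0 1)"
    using z by (intro Cauchy_integral_circlepath continuous_intros holomorphic_intros) (use nz in fastforce)+
  hence "((\<lambda>t. (1 / (1 - cnj z * circlepath 0 1 t)) / (circlepath 0 1 t - z) *
           vector_derivative (circlepath 0 1) (at t)) has_integral
           (2 * of_real pi * \<i> * (1 / (1 - cnj z * z)))) {0..1}"
    by (simp add: has_contour_integral)
  moreover have "(1 / (1 - cnj z * circlepath 0 1 t)) / (circlepath 0 1 t - z) *
           vector_derivative (circlepath 0 1) (at t) =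
          2 * of_real pi * \<i> * of_real (1 / (cmod (circlepath 0 1 t - z))\<^sup>2)" for t
  proof -
    define u where "u = circlepath 0 1 t"
    have u: "u = exp (2 * of_real pi * \<i> * of_real t)" by (simp add: u_def circlepath)
    have uu: "u * cnj u = 1"
      by (simp add: u exp_cnj exp_minus [symmetric] flip: exp_add)
    have nu: "cmod u = 1" by (simp add: u)
    have d: "vector_derivative (circlepath 0 1) (at t) = 2 * of_real pi * \<i> * u"
      by (simp add: vector_derivative_circlepath u)
    have "1 - cnj z * u = u * cnj (u - z)" using uu by (simp add: algebra_simps)
    moreover have "u \<noteq> 0" using nu by auto
    moreover have "complex_of_real ((cmod (u - z))\<^sup>2) = (u - z) * cnj (u - z)"
      by (rule complex_norm_square)
    moreover have "u \<noteq> z" using nu z by auto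
    ultimately show ?thesis
      unfolding u_def [symmetric] d by (simp del: complex_cnj_diff add: divide_simps)
  qed
  ultimately have "((\<lambda>t. 2 * of_real pi * \<i> * of_real (1 / (cmod (circlepath 0 1 t - z))\<^sup>2)) has_integral
           (2 * of_real pi * \<i> * (1 / (1 - cnj z * z)))) {0..1}" by simp
  from has_integral_linear [OF this, of "\<lambda>x. Im x / (2*pi)"] bounded_linear_Im
  have "((\<lambda>t. Im (2 * of_real pi * \<i> * of_real (1 / (cmod (circlepath 0 1 t - z))\<^sup>2)) / (2*pi)) has_integral
           Im (2 * of_real pi * \<i> * (1 / (1 - cnj z * z))) / (2*pi)) {0..1}"
    by (simp add: o_def bounded_linear_divide bounded_linear_compose [OF bounded_linear_divide bounded_linear_Im])
  moreover have "(1 / (1 - cnj z * z)) = of_real (1 / (1 - (cmod z)\<^sup>2))"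
    by (simp add: complex_norm_square [symmetric] mult.commute)
  ultimately show ?thesis by simp
qed

text \<open>With \<open>E\<close> the deviation of \<open>F\<close> from its tangent,
  \<open>deriv F - d\<close> is \<open>deriv E\<close>. The kernel \<open>1 / (u - z)^2\<close> of
  Cauchy's formula is too large for a deviation that is merely small relative to the distance from
  \<open>\<zeta>\<close>: a logarithm would remain. Subtracting the kernel with its pole at the
  reflected point \<open>zs\<close>, whose integral is zero, gains a factor of order
  \<open>(1 - \<rho>^2) / cmod (u - z)\<close> and leaves the Poisson kernel, of bounded
  integral.\<close>

lemma radial_limit_deriv:
  fixes F :: "complex \<Rightarrow> complex" and \<zeta> d :: complex
  assumes contF: "continuous_on (cball 0 1) F" and holF: "F holomorphic_on ball 0 1"
    and \<zeta>: "cmod \<zeta> = 1"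
    and tangent: "\<And>e. e > 0 \<Longrightarrow> \<exists>\<delta>>0. \<forall>w. cmod w = 1 \<longrightarrow> cmod (w - \<zeta>) < \<delta> \<longrightarrow>
            cmod (F w - F \<zeta> - d * (w - \<zeta>)) \<le> e * cmod (w - \<zeta>)"
  shows "((\<lambda>\<rho>. deriv F (of_real \<rho> * \<zeta>)) \<longlongrightarrow> d) (at_left 1)"
proof -
  define E where "E w = F w - F \<zeta> - d * (w - \<zeta>)" for w
  have contE: "continuous_on (cball 0 1) E" unfolding E_def by (intro continuous_intros contF)
  have holE: "E holomorphic_on ball 0 1" unfolding E_def by (intro holomorphic_intros holF)
  obtain M0 where M0: "\<And>w. cmod w \<le> 1 \<Longrightarrow> cmod (E w) \<le> M0"
  proof -
    have "compact (E ` cball 0 1)" using contE by (intro compact_continuous_image) auto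
    hence "bounded (E ` cball 0 1)" by (rule compact_imp_bounded)
    thus ?thesis using that unfolding bounded_iff by (metis image_eqI mem_cball_0)
  qed
  have M00: "0 \<le> M0" using order_trans[OF norm_ge_zero[of "E 0"] M0[of 0]] by simp
  \<comment> \<open>The linear term describes \<open>E\<close> near \<open>\<zeta>\<close>, the
    cubic one dominates it on the rest of the circle. The difference of the two kernels is of order
    \<open>(1 - \<rho>^2) / cmod (u - z) ^ 3\<close>, so the cubic term contributes only a multiple
    of \<open>1 - \<rho>^2\<close>.\<close>
  have key: "cmod (deriv F (of_real \<rho> * \<zeta>) - d) \<le> 4 * e + 16 * M * (1 - \<rho>\<^sup>2)"
    if \<rho>: "0 < \<rho>" "\<rho> < 1" and e: "0 \<le> e" and M: "0 \<le> M"
    and EM: "\<And>u. cmod u = 1 \<Longrightarrow> cmod (E u) \<le> e * cmod (u - \<zeta>) + M * cmod (u - \<zeta>) ^ 3" for \<rho> e M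
  proof -
    define z where "z = of_real \<rho> * \<zeta>"
    define zs where "zs = \<zeta> / of_real \<rho>"
    have nz: "cmod z = \<rho>" using \<rho> \<zeta> by (simp add: z_def norm_mult)
    have nzs: "cmod zs > 1" using \<rho> \<zeta> by (simp add: zs_def norm_divide)
    have zsne: "u \<noteq> zs" if "cmod u \<le> 1" for u using that nzs by auto
    have dE: "deriv E z = deriv F z - d"
    proof -
      have "(F has_field_derivative deriv F z) (at z)"
        using holF nz \<rho> by (intro holomorphic_derivI[of F "ball 0 1"]) auto
      hence "(E has_field_derivative deriv F z - 0 - d * (1 - 0)) (at z)"
        unfolding E_def by (auto intro!: derivative_eq_intros)
      thus ?thesis by (simp add: DERIV_imp_deriv)
    qed
    have i1: "((\<lambda>u. E u / (u - z) ^ 2) has_contour_integral 2 * pi * \<i> * deriv E z) (circlepath 0 1)"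
      using Cauchy_has_contour_integral_higher_derivative_circlepath[OF contE holE, of z 1] nz \<rho>
      by (simp add: numeral_2_eq_2)
    \<comment> \<open>The integrand is holomorphic inside and only continuous up to the circle;
      multiplied by \<open>u\<close> it falls under Cauchy's formula at the centre, with value
      zero.\<close>
    have "((\<lambda>u. (u * (E u / (u - zs)\<^sup>2)) / (u - 0)) has_contour_integral
             (2 * of_real pi * \<i> * (0 * (E 0 / (0 - zs)\<^sup>2)))) (circlepath 0 1)"
      by (intro Cauchy_integral_circlepath continuous_intros holomorphic_intros contE holE)
         (use zsne in auto)
    hence i2: "((\<lambda>u. E u / (u - zs)\<^sup>2) has_contour_integral 0) (circlepath 0 1)"
      by (rule has_contour_integral_eq [where g = "\<lambda>u. E u / (u - zs)\<^sup>2", THEN back_subst[of "\<lambda>x. (_ has_contour_integral x) _"]]) auto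
    have "((\<lambda>u. E u / (u - z)^2 - E u / (u - zs)\<^sup>2) has_contour_integral 2 * pi * \<i> * deriv E z) (circlepath 0 1)"
      using has_contour_integral_diff[OF i1 i2] by simp
    hence I: "((\<lambda>t. (E (circlepath 0 1 t) / (circlepath 0 1 t - z)^2 - E (circlepath 0 1 t) / (circlepath 0 1 t - zs)\<^sup>2)
        * vector_derivative (circlepath 0 1) (at t)) has_integral 2 * pi * \<i> * deriv E z) {0..1}"
      by (simp add: has_contour_integral)
    define b where "b t = 2 * pi * (2 * (1 - \<rho>\<^sup>2) * (2 * e * (1 / (cmod (circlepath 0 1 t - z))\<^sup>2) + 8 * M))" for t
    have J: "(b has_integral 2 * pi * (2 * (1 - \<rho>\<^sup>2) * (2 * e * (1 / (1 - \<rho>\<^sup>2)) + 8 * M))) {0..1}"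
    proof -
      have z1: "cmod z < 1" using nz \<rho> by simp
      have c: "((\<lambda>t::real. 8 * M) has_integral 8 * M) {0..1}"
        using has_integral_const_real[of "8*M" 0 1] by simp
      show ?thesis
        unfolding b_def
        using has_integral_mult_right[OF has_integral_mult_right[OF has_integral_add[OF has_integral_mult_right[OF poisson_integral_circle[OF z1], of "2*e"] c], of "2 * (1 - \<rho>\<^sup>2)"], of "2*pi"]
        by (simp only: nz)
    qed
    have le: "norm ((E (circlepath 0 1 t) / (circlepath 0 1 t - z)^2 - E (circlepath 0 1 t) / (circlepath 0 1 t - zs)\<^sup>2)
        * vector_derivative (circlepath 0 1) (at t)) \<le> b t" for t
    proof -
      define u where "u = circlepath 0 1 t"
      have u: "u = exp (2 * of_real pi * \<i> * of_real t)" by (simp add: u_def circlepath)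
      have nu: "cmod u = 1" by (simp add: u)
      define x where "x = cmod (u - z)"
      have uz: "u \<noteq> z" "u \<noteq> zs" using nu nz nzs \<rho> by auto
      hence x0: "x > 0" by (simp add: x_def)
      \<comment> \<open>Points of the circle have proportional distances to \<open>z\<close> and to
        its reflection.\<close>
      have xs: "cmod (u - zs) = x / \<rho>"
      proof -
        have uu: "u * cnj u = 1" using nu by (simp add: complex_norm_square [symmetric])
        have zz: "\<zeta> * cnj \<zeta> = 1" using \<zeta> by (simp add: complex_norm_square [symmetric])
        have "u - zs = - (u * \<zeta> * cnj (u - z)) / of_real \<rho>"
        proof -
          have "u * \<zeta> * cnj (u - z) = (u * cnj u) * \<zeta> - of_real \<rho> * u * (\<zeta> * cnj \<zeta>)"
            by (simp add: z_def algebra_simps)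
          also have "\<dots> = \<zeta> - of_real \<rho> * u" by (simp add: uu zz)
          finally show ?thesis using \<rho> by (simp add: zs_def field_simps)
        qed
        thus ?thesis using nu \<zeta> \<rho> by (simp only: norm_divide norm_minus_cancel norm_mult complex_mod_cnj x_def norm_of_real mult_1 abs_of_pos)
      qed
      have "1 - \<rho> \<le> x" using norm_triangle_ineq2[of u z] nu nz by (simp add: x_def)
      moreover have "cmod (z - \<zeta>) = 1 - \<rho>"
      proof -
        have "z - \<zeta> = - (of_real (1 - \<rho>) * \<zeta>)" by (simp add: z_def algebra_simps)
        thus ?thesis using \<zeta> \<rho> by (simp only: norm_minus_cancel norm_mult norm_of_real) simp
      qed
      ultimately have ux: "cmod (u - \<zeta>) \<le> 2 * x"
        using norm_triangle_ineq[of "u - z" "z - \<zeta>"] by (simp add: x_def)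
      have K: "E u / (u - z)^2 - E u / (u - zs)\<^sup>2 =
          E u * ((z - zs) * ((u - z) + (u - zs))) / ((u - z)\<^sup>2 * (u - zs)\<^sup>2)"
      proof -
        define p q where "p = u - z" and "q = u - zs"
        have "p \<noteq> 0" "q \<noteq> 0" and qp: "z - zs = q - p" using uz by (auto simp: p_def q_def)
        thus ?thesis
          unfolding p_def [symmetric] q_def [symmetric] qp by (simp add: field_simps power2_eq_square)
      qed
      have zzs: "cmod (z - zs) = (1 - \<rho>\<^sup>2) / \<rho>"
      proof -
        have "z - zs = - (of_real ((1 - \<rho>\<^sup>2) / \<rho>) * \<zeta>)"
          using \<rho> by (simp add: z_def zs_def field_simps power2_eq_square)
        moreover have "0 \<le> (1 - \<rho>\<^sup>2) / \<rho>" using \<rho> by (simp add: power_le_one)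
        ultimately show ?thesis using \<zeta> by (simp only: norm_minus_cancel norm_mult norm_of_real abs_of_nonneg mult_1_right)
      qed
      have r2: "0 \<le> 1 - \<rho>\<^sup>2" using \<rho> by (simp add: power_le_one)
      have "cmod (E u / (u - z)^2 - E u / (u - zs)\<^sup>2) = 
          cmod (E u) * ((1 - \<rho>\<^sup>2) / \<rho> * cmod ((u - z) + (u - zs))) / (x\<^sup>2 * (x/\<rho>)\<^sup>2)"
        unfolding K by (simp add: norm_mult norm_divide norm_power zzs xs flip: x_def)
      also have "\<dots> \<le> (e * (2 * x) + M * (2 * x) ^ 3) * ((1 - \<rho>\<^sup>2) / \<rho> * (x + x / \<rho>)) / (x\<^sup>2 * (x/\<rho>)\<^sup>2)"
      proof (intro divide_right_mono mult_mono)
        show "cmod (E u) \<le> e * (2 * x) + M * (2 * x) ^ 3"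
          by (rule order_trans[OF EM[OF nu]]) (intro add_mono mult_left_mono power_mono ux e M; simp)
        show "cmod ((u - z) + (u - zs)) \<le> x + x / \<rho>"
          using norm_triangle_ineq[of "u - z" "u - zs"] by (simp add: xs flip: x_def)
      qed (use x0 e M \<rho> r2 in \<open>auto intro!: add_nonneg_nonneg mult_nonneg_nonneg\<close>)
      also have "\<dots> = (1 + \<rho>) * ((1 - \<rho>\<^sup>2) * (2 * e * (1 / x\<^sup>2) + 8 * M))"
        using x0 \<rho> by (simp add: field_simps power2_eq_square power3_eq_cube)
      also have "\<dots> \<le> 2 * ((1 - \<rho>\<^sup>2) * (2 * e * (1 / x\<^sup>2) + 8 * M))"
        using \<rho> r2 e M x0 by (intro mult_right_mono mult_nonneg_nonneg add_nonneg_nonneg) auto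
      finally have "cmod (E u / (u - z)^2 - E u / (u - zs)\<^sup>2) * (2 * pi) \<le> 2 * ((1 - \<rho>\<^sup>2) * (2 * e * (1 / x\<^sup>2) + 8 * M)) * (2 * pi)"
        by (intro mult_right_mono) auto
      moreover have "cmod (vector_derivative (circlepath 0 1) (at t)) = 2 * pi"
        by (simp add: vector_derivative_circlepath norm_mult)
      ultimately show ?thesis
        unfolding norm_mult b_def u_def [symmetric] x_def [symmetric] by (simp only: mult_ac)
    qed
    have "norm (2 * pi * \<i> * deriv E z) \<le> 2 * pi * (2 * (1 - \<rho>\<^sup>2) * (2 * e * (1 / (1 - \<rho>\<^sup>2)) + 8 * M))"
      using integral_norm_bound_integral[OF has_integral_integrable[OF I] has_integral_integrable[OF J]] le
      by (simp only: integral_unique[OF I] integral_unique[OF J])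
    moreover have "1 - \<rho>\<^sup>2 > 0" using \<rho> by (simp add: power_less_one_iff)
    ultimately have "cmod (deriv E z) \<le> 2 * (1 - \<rho>\<^sup>2) * (2 * e * (1 / (1 - \<rho>\<^sup>2)) + 8 * M)"
      by (simp add: norm_mult)
    also have "\<dots> = 4 * e + 16 * M * (1 - \<rho>\<^sup>2)" using \<open>1 - \<rho>\<^sup>2 > 0\<close> by (simp add: field_simps)
    finally show ?thesis by (simp add: dE flip: z_def)
  qed
  show ?thesis
  proof (rule tendstoI)
    fix e :: real assume e: "e > 0"
    obtain \<delta> where \<delta>: "\<delta> > 0" and near: "\<And>w. cmod w = 1 \<Longrightarrow> cmod (w - \<zeta>) < \<delta> \<Longrightarrow>
            cmod (F w - F \<zeta> - d * (w - \<zeta>)) \<le> e / 16 * cmod (w - \<zeta>)"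
      using tangent[of "e/16"] e by auto
    \<comment> \<open>Outside the \<open>\<delta>\<close>-neighbourhood of \<open>\<zeta>\<close>
      the cube of the distance is at least \<open>\<delta> ^ 3\<close>, hence \<open>M\<close> times
      it exceeds the bound \<open>M0\<close> of \<open>E\<close>.\<close>
    define M where "M = M0 / \<delta> ^ 3"
    have M: "M \<ge> 0" using M00 \<delta> by (simp add: M_def)
    have EM: "cmod (E u) \<le> e / 16 * cmod (u - \<zeta>) + M * cmod (u - \<zeta>) ^ 3" if "cmod u = 1" for u
    proof (cases "cmod (u - \<zeta>) < \<delta>")
      case True
      have "0 \<le> M * cmod (u - \<zeta>) ^ 3" using M by simp
      then show ?thesis using near[OF that True] by (simp add: E_def)
    next
      case False
      hence "M * \<delta> ^ 3 \<le> M * cmod (u - \<zeta>) ^ 3" using \<delta> M by (intro mult_left_mono power_mono) auto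
      moreover have "M * \<delta> ^ 3 = M0" using \<delta> by (simp add: M_def)
      moreover have "0 \<le> e / 16 * cmod (u - \<zeta>)" using e by simp
      ultimately show ?thesis using M0[of u] that by linarith
    qed
    have "((\<lambda>\<rho>::real. 4 * (e/16) + 16 * M * (1 - \<rho>\<^sup>2)) \<longlongrightarrow> 4 * (e/16) + 16 * M * (1 - 1\<^sup>2)) (at_left 1)"
      by (intro tendsto_intros)
    from order_tendstoD(2)[OF this, of e]
    have "\<forall>\<^sub>F \<rho> in at_left 1. 4 * (e/16) + 16 * M * (1 - \<rho>\<^sup>2) < e"
      using e by simp
    moreover have "\<forall>\<^sub>F \<rho> in at_left 1. \<rho> > (0::real)"
      by (intro order_tendstoD[OF tendsto_ident_at]) auto
    moreover have "\<forall>\<^sub>F \<rho> in at_left 1. \<rho> < (1::real)"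
      by (simp add: eventually_at_filter)
    ultimately show "\<forall>\<^sub>F \<rho> in at_left 1. dist (deriv F (of_real \<rho> * \<zeta>)) d < e"
    proof eventually_elim
      case (elim \<rho>)
      have "cmod (deriv F (of_real \<rho> * \<zeta>) - d) \<le> 4 * (e/16) + 16 * M * (1 - \<rho>\<^sup>2)"
        by (rule key) (use elim e M EM in auto)
      then show ?case using elim by (simp add: dist_norm)
    qed
  qed
qed

text \<open>Differentiation of an integral gives an estimate in the angle, while
  \<open>radial_limit_deriv\<close> asks for one in the chord \<open>w - cis \<theta>\<close>. On
  the circle \<open>Ln (w / \<zeta>)\<close> is \<open>\<i>\<close> times the angle, and its
  derivative at \<open>\<zeta>\<close> compares the two.\<close>

lemma tangent_of_angular_derivative:
  fixes F :: "complex \<Rightarrow> complex"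
  assumes deriv: "((\<lambda>t. F (cis t)) has_vector_derivative D) (at \<theta>)" and e: "e > 0"
  shows "\<exists>\<delta>>0. \<forall>w. cmod w = 1 \<longrightarrow> cmod (w - cis \<theta>) < \<delta> \<longrightarrow>
            cmod (F w - F (cis \<theta>) - D / (\<i> * cis \<theta>) * (w - cis \<theta>)) \<le> e * cmod (w - cis \<theta>)"
proof -
  define \<zeta> where "\<zeta> = cis \<theta>"
  have \<zeta>: "cmod \<zeta> = 1" "\<zeta> \<noteq> 0" by (auto simp: \<zeta>_def)
  define e1 where "e1 = e / 4"
  have e1: "e1 > 0" using e by (simp add: e1_def)
  obtain \<eta> where \<eta>: "\<eta> > 0" and F: "\<And>t. \<bar>t - \<theta>\<bar> < \<eta> \<Longrightarrow> cmod (F (cis t) - F \<zeta> - (t - \<theta>) *\<^sub>R D) \<le> e1 * \<bar>t - \<theta>\<bar>"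
    using deriv e1 unfolding has_vector_derivative_def has_derivative_at_alt \<zeta>_def real_norm_def
    by blast
  \<comment> \<open>The bound 1 keeps the angle below twice the chord; the other bound makes the
    error of replacing the angle by the chord, multiplied by \<open>D\<close>, at most half of the
    allowance.\<close>
  define e2 where "e2 = min 1 (e / (2 * (cmod D + 1)))"
  have e2: "e2 > 0" "e2 \<le> 1" "e2 * cmod D \<le> e / 2"
  proof -
    have D1: "cmod D + 1 > 0" using norm_ge_zero[of D] by linarith
    show "e2 > 0" using e D1 by (simp add: e2_def)
    have "e2 * cmod D \<le> e / (2 * (cmod D + 1)) * (cmod D + 1)"
      using D1 \<open>e2 > 0\<close> by (intro mult_mono) (auto simp: e2_def)
    also have "\<dots> = e / 2" using D1 by (simp add: field_simps)
    finally show "e2 * cmod D \<le> e / 2" .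
  qed (simp add: e2_def)
  have "((\<lambda>w. Ln (w / \<zeta>)) has_field_derivative (1 / \<zeta>)) (at \<zeta>)"
    using \<zeta> by (auto intro!: derivative_eq_intros)
  then obtain \<delta>1 where \<delta>1: "\<delta>1 > 0" and L: "\<And>w. cmod (w - \<zeta>) < \<delta>1 \<Longrightarrow>
      cmod (Ln (w / \<zeta>) - Ln (\<zeta> / \<zeta>) - (1 / \<zeta>) * (w - \<zeta>)) \<le> e2 * cmod (w - \<zeta>)"
    using e2(1) unfolding has_field_derivative_def has_derivative_at_alt by blast
  define \<delta> where "\<delta> = min \<delta>1 (\<eta> / 2)"
  have "\<delta> > 0" using \<delta>1 \<eta> by (simp add: \<delta>_def)
  moreover have "cmod (F w - F \<zeta> - D / (\<i> * \<zeta>) * (w - \<zeta>)) \<le> e * cmod (w - \<zeta>)"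
    if w: "cmod w = 1" "cmod (w - \<zeta>) < \<delta>" for w
  proof -
    define h where "h = Im (Ln (w / \<zeta>))"
    have w0: "w \<noteq> 0" using w by auto
    have "Re (Ln (w / \<zeta>)) = 0" using w \<zeta> by (simp add: norm_divide w0)
    hence Lh: "Ln (w / \<zeta>) = \<i> * of_real h" by (auto simp: complex_eq_iff h_def)
    have "exp (Ln (w / \<zeta>)) = w / \<zeta>" using w0 \<zeta> by simp
    hence "w = \<zeta> * exp (\<i> * of_real h)" using \<zeta> by (simp add: Lh field_simps)
    hence wc: "w = cis (\<theta> + h)" by (simp add: \<zeta>_def cis_conv_exp exp_add algebra_simps)
    have A: "cmod (\<i> * of_real h - (w - \<zeta>) / \<zeta>) \<le> e2 * cmod (w - \<zeta>)"
      using L[of w] w \<zeta> by (simp add: Lh \<delta>_def)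
    have "\<bar>h\<bar> = cmod (\<i> * of_real h)" by (simp add: norm_mult)
    also have "\<dots> \<le> cmod (\<i> * of_real h - (w - \<zeta>) / \<zeta>) + cmod ((w - \<zeta>) / \<zeta>)"
      by (metis diff_add_cancel norm_triangle_ineq)
    also have "\<dots> \<le> e2 * cmod (w - \<zeta>) + cmod (w - \<zeta>)" using A \<zeta> by (simp add: norm_divide)
    also have "\<dots> \<le> 2 * cmod (w - \<zeta>)" using mult_right_mono[OF e2(2), of "cmod (w - \<zeta>)"] by simp
    finally have h: "\<bar>h\<bar> \<le> 2 * cmod (w - \<zeta>)" .
    have "cmod (F w - F \<zeta> - h *\<^sub>R D) \<le> e1 * \<bar>h\<bar>"
      using F[of "\<theta> + h"] h w by (simp add: wc \<delta>_def)
    also have "\<dots> \<le> e1 * (2 * cmod (w - \<zeta>))" using h e1 by simp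
    finally have 1: "cmod (F w - F \<zeta> - h *\<^sub>R D) \<le> e / 2 * cmod (w - \<zeta>)" by (simp add: e1_def)
    have "h *\<^sub>R D - D / (\<i> * \<zeta>) * (w - \<zeta>) = (D / \<i>) * (\<i> * of_real h - (w - \<zeta>) / \<zeta>)"
      using \<zeta> by (simp add: scaleR_conv_of_real field_simps)
    hence "cmod (h *\<^sub>R D - D / (\<i> * \<zeta>) * (w - \<zeta>)) = cmod D * cmod (\<i> * of_real h - (w - \<zeta>) / \<zeta>)"
      by (simp only: norm_mult norm_divide norm_ii div_by_1)
    also have "\<dots> \<le> cmod D * (e2 * cmod (w - \<zeta>))" using A by (intro mult_left_mono) auto
    also have "\<dots> \<le> e / 2 * cmod (w - \<zeta>)" using mult_right_mono[OF e2(3), of "cmod (w - \<zeta>)"] by (simp add: mult_ac)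
    finally have 2: "cmod (h *\<^sub>R D - D / (\<i> * \<zeta>) * (w - \<zeta>)) \<le> e / 2 * cmod (w - \<zeta>)" .
    have eq: "F w - F \<zeta> - D / (\<i> * \<zeta>) * (w - \<zeta>) = (F w - F \<zeta> - h *\<^sub>R D) + (h *\<^sub>R D - D / (\<i> * \<zeta>) * (w - \<zeta>))"
      by simp
    have "cmod (F w - F \<zeta> - D / (\<i> * \<zeta>) * (w - \<zeta>)) \<le> e / 2 * cmod (w - \<zeta>) + e / 2 * cmod (w - \<zeta>)"
      by (subst eq) (rule norm_triangle_mono[OF 1 2])
    also have "\<dots> = e * cmod (w - \<zeta>)" by (simp add: field_simps)
    finally show ?thesis .
  qed
  ultimately show ?thesis unfolding \<zeta>_def by blast
qed

section \<open>Parseval's identity and limits in the quadratic mean\<close>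

lemma has_integral_cis:
  fixes k :: int and m :: nat and a b :: real
  assumes ab: "b - a = 2 * pi * real m"
  shows "((\<lambda>\<theta>. cis (of_int k * \<theta>)) has_integral (if k = 0 then of_real (b - a) else 0)) {a..b}"
proof -
  have le: "a \<le> b"
  proof -
    have "0 \<le> 2 * pi * real m" by simp
    thus ?thesis using ab by linarith
  qed
  show ?thesis
  proof (cases "k = 0")
    case True
    then show ?thesis using has_integral_const_real[of "1::complex" a b] le by (simp add: scaleR_conv_of_real)
  next
    case False
    have "((\<lambda>\<theta>. cis (of_int k * \<theta>)) has_integral
        (cis (of_int k * b) / (\<i> * of_int k) - cis (of_int k * a) / (\<i> * of_int k))) {a..b}"
    proof (rule fundamental_theorem_of_calculus[OF le])
      fix x
      have "((\<lambda>x. exp (\<i> * of_int k * of_real x) / (\<i> * of_int k)) has_vector_derivative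
         (exp (\<i> * of_int k * of_real x) * (\<i> * of_int k * 1) / (\<i> * of_int k))) (at x within {a..b})"
        by (auto intro!: derivative_eq_intros has_vector_derivative_real_field simp: False)
      thus "((\<lambda>x. cis (of_int k * x) / (\<i> * of_int k)) has_vector_derivative cis (of_int k * x)) (at x within {a..b})"
        using False by (simp add: cis_conv_exp mult_ac)
    qed
    moreover have "cis (of_int k * b) = cis (of_int k * a)"
    proof -
      have "of_int k * b = of_int k * a + 2 * pi * real_of_int (k * int m)"
      proof -
        have "b = a + 2 * pi * real m" using ab by simp
        thus ?thesis by (simp add: algebra_simps)
      qed
      thus ?thesis by (simp add: cis_multiple_2pi flip: cis_mult)
    qed
    ultimately show ?thesis using False by simp
  qed
qed

lemma has_integral_norm_sq_trig_poly:
  fixes c :: "nat \<Rightarrow> complex" and a b :: real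
  assumes ab: "b - a = 2 * pi * real m"
  shows "((\<lambda>\<theta>. (cmod (\<Sum>n<N. c n * cis (real n * \<theta>)))\<^sup>2) has_integral
            (b - a) * (\<Sum>n<N. (cmod (c n))\<^sup>2)) {a..b}"
proof -
  have "((\<lambda>\<theta>. \<Sum>n<N. \<Sum>k<N. c n * cnj (c k) * cis (of_int (int n - int k) * \<theta>)) has_integral
      (\<Sum>n<N. \<Sum>k<N. c n * cnj (c k) * (if int n - int k = 0 then of_real (b - a) else 0))) {a..b}"
    by (intro has_integral_sum has_integral_mult_right has_integral_cis[OF ab]) auto
  moreover have "(\<Sum>n<N. \<Sum>k<N. c n * cnj (c k) * cis (of_int (int n - int k) * \<theta>)) =
       of_real ((cmod (\<Sum>n<N. c n * cis (real n * \<theta>)))\<^sup>2)" for \<theta>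
  proof -
    have "of_real ((cmod (\<Sum>n<N. c n * cis (real n * \<theta>)))\<^sup>2) =
        (\<Sum>n<N. c n * cis (real n * \<theta>)) * cnj (\<Sum>n<N. c n * cis (real n * \<theta>))"
      by (rule complex_norm_square)
    also have "\<dots> = (\<Sum>n<N. \<Sum>k<N. (c n * cis (real n * \<theta>)) * (cnj (c k) * cnj (cis (real k * \<theta>))))"
      by (simp add: sum_product)
    also have "\<dots> = (\<Sum>n<N. \<Sum>k<N. c n * cnj (c k) * cis (of_int (int n - int k) * \<theta>))"
    proof (intro sum.cong refl)
      fix n k
      have "cis (of_int (int n - int k) * \<theta>) = cis (real n * \<theta>) * cnj (cis (real k * \<theta>))"
        by (simp add: cis_cnj cis_mult algebra_simps)
      thus "(c n * cis (real n * \<theta>)) * (cnj (c k) * cnj (cis (real k * \<theta>))) = c n * cnj (c k) * cis (of_int (int n - int k) * \<theta>)"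
        by (simp add: mult_ac)
    qed
    finally show ?thesis by simp
  qed
  moreover have "(\<Sum>n<N. \<Sum>k<N. c n * cnj (c k) * (if int n - int k = 0 then of_real (b - a) else 0)) =
       of_real ((b - a) * (\<Sum>n<N. (cmod (c n))\<^sup>2))"
  proof -
    have "(\<Sum>k<N. c n * cnj (c k) * (if int n - int k = 0 then of_real (b - a) else 0)) =
        of_real ((b - a) * (cmod (c n))\<^sup>2)" if "n < N" for n
    proof -
      have "(\<Sum>k<N. c n * cnj (c k) * (if int n - int k = 0 then of_real (b - a) else 0)) =
          (\<Sum>k<N. if k = n then c n * cnj (c n) * of_real (b - a) else 0)"
        by (intro sum.cong) auto
      also have "\<dots> = of_real ((b - a) * (cmod (c n))\<^sup>2)"
        using that by (simp add: complex_norm_square[symmetric] mult_ac del: of_real_diff)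
      finally show ?thesis .
    qed
    thus ?thesis by (simp add: sum_distrib_left)
  qed
  ultimately have "((\<lambda>\<theta>. complex_of_real ((cmod (\<Sum>n<N. c n * cis (real n * \<theta>)))\<^sup>2)) has_integral
            of_real ((b - a) * (\<Sum>n<N. (cmod (c n))\<^sup>2))) {a..b}" by simp
  from has_integral_Re[OF this] show ?thesis by simp
qed

text \<open>Fatou's lemma for the squared moduli. It carries mean square bounds from partial sums
  over to their almost everywhere limit.\<close>

lemma fatou_norm_sq:
  fixes u :: "nat \<Rightarrow> 'a \<Rightarrow> complex"
  assumes u[measurable]: "\<And>i. u i \<in> borel_measurable M" and v[measurable]: "v \<in> borel_measurable M"
    and lim: "AE x in M. (\<lambda>i. u i x) \<longlonglongrightarrow> v x"
    and int: "\<And>i. integrable M (\<lambda>x. (cmod (u i x))\<^sup>2)"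
    and bd: "\<And>i. integral\<^sup>L M (\<lambda>x. (cmod (u i x))\<^sup>2) \<le> c"
  shows "integrable M (\<lambda>x. (cmod (v x))\<^sup>2)" "integral\<^sup>L M (\<lambda>x. (cmod (v x))\<^sup>2) \<le> c"
proof -
  have c: "0 \<le> c" using bd[of 0] by (rule order_trans[rotated]) simp
  have "(\<integral>\<^sup>+x. ennreal ((cmod (v x))\<^sup>2) \<partial>M) = (\<integral>\<^sup>+x. liminf (\<lambda>i. ennreal ((cmod (u i x))\<^sup>2)) \<partial>M)"
  proof (rule nn_integral_cong_AE)
    show "AE x in M. ennreal ((cmod (v x))\<^sup>2) = liminf (\<lambda>i. ennreal ((cmod (u i x))\<^sup>2))"
      using lim
    proof eventually_elim
      case (elim x)
      have "(\<lambda>i. ennreal ((cmod (u i x))\<^sup>2)) \<longlonglongrightarrow> ennreal ((cmod (v x))\<^sup>2)"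
        by (intro tendsto_ennrealI tendsto_intros elim)
      from lim_imp_Liminf[OF sequentially_bot this] show ?case by (rule sym)
    qed
  qed
  also have "\<dots> \<le> liminf (\<lambda>i. (\<integral>\<^sup>+x. ennreal ((cmod (u i x))\<^sup>2) \<partial>M))"
    by (rule nn_integral_liminf) simp
  also have "\<dots> \<le> liminf (\<lambda>i::nat. ennreal c)"
  proof (rule Liminf_mono, rule always_eventually, rule allI)
    fix i
    have "(\<integral>\<^sup>+x. ennreal ((cmod (u i x))\<^sup>2) \<partial>M) = ennreal (integral\<^sup>L M (\<lambda>x. (cmod (u i x))\<^sup>2))"
      by (rule nn_integral_eq_integral[OF int]) simp
    thus "(\<integral>\<^sup>+x. ennreal ((cmod (u i x))\<^sup>2) \<partial>M) \<le> ennreal c" using bd by (simp add: ennreal_leI)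
  qed
  also have "\<dots> = ennreal c" by (simp add: Liminf_const)
  finally have le: "(\<integral>\<^sup>+x. ennreal ((cmod (v x))\<^sup>2) \<partial>M) \<le> ennreal c" .
  show i: "integrable M (\<lambda>x. (cmod (v x))\<^sup>2)"
    by (rule integrableI_nonneg) (use le in \<open>auto simp: less_top[symmetric] top_unique intro: le_less_trans\<close>)
  have "ennreal (integral\<^sup>L M (\<lambda>x. (cmod (v x))\<^sup>2)) \<le> ennreal c"
    using le nn_integral_eq_integral[OF i] by simp
  thus "integral\<^sup>L M (\<lambda>x. (cmod (v x))\<^sup>2) \<le> c" using c by (simp add: ennreal_le_iff)
qed

lemma (in finite_measure) integral_norm_sq_le:
  fixes u :: "'a \<Rightarrow> complex"
  assumes u[measurable]: "u \<in> borel_measurable M" and int: "integrable M (\<lambda>x. (cmod (u x))\<^sup>2)"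
    and pos: "measure M (space M) > 0"
  shows "integrable M u" "(integral\<^sup>L M (\<lambda>x. cmod (u x)))\<^sup>2 \<le> measure M (space M) * integral\<^sup>L M (\<lambda>x. (cmod (u x))\<^sup>2)"
proof -
  show i: "integrable M u"
  proof (rule Bochner_Integration.integrable_bound[of M "\<lambda>x. 1 + (cmod (u x))\<^sup>2"])
    show "AE x in M. norm (u x) \<le> norm (1 + (cmod (u x))\<^sup>2)"
    proof (rule AE_I2)
      fix x
      have "0 \<le> (cmod (u x) - 1)\<^sup>2" by simp
      hence "2 * cmod (u x) \<le> 1 + (cmod (u x))\<^sup>2" by (simp add: power2_diff)
      thus "norm (u x) \<le> norm (1 + (cmod (u x))\<^sup>2)" using norm_ge_zero[of "u x"]
        by (simp del: norm_ge_zero)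
    qed
  qed (use int in auto)
  define K where "K = measure M (space M)"
  define J where "J = integral\<^sup>L M (\<lambda>x. cmod (u x))"
  \<comment> \<open>The mean of \<open>cmod (u x)\<close>; that the variance about it is nonnegative
    is the asserted inequality.\<close>
  define m where "m = J / K"
  have "0 \<le> integral\<^sup>L M (\<lambda>x. (cmod (u x) - m)\<^sup>2)" by simp
  also have "(\<lambda>x. (cmod (u x) - m)\<^sup>2) = (\<lambda>x. (cmod (u x))\<^sup>2 - (2 * m) * cmod (u x) + m\<^sup>2)"
    by (auto simp: power2_diff algebra_simps)
  also have "integral\<^sup>L M (\<lambda>x. (cmod (u x))\<^sup>2 - (2 * m) * cmod (u x) + m\<^sup>2) =
      integral\<^sup>L M (\<lambda>x. (cmod (u x))\<^sup>2) - 2 * m * J + m\<^sup>2 * K"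
    using int i by (simp add: J_def K_def)
  finally have "2 * m * J - m\<^sup>2 * K \<le> integral\<^sup>L M (\<lambda>x. (cmod (u x))\<^sup>2)" by simp
  moreover have "2 * m * J - m\<^sup>2 * K = J\<^sup>2 / K"
    using pos by (simp add: m_def K_def field_simps power2_eq_square)
  ultimately have "J\<^sup>2 / K \<le> integral\<^sup>L M (\<lambda>x. (cmod (u x))\<^sup>2)" by simp
  thus "J\<^sup>2 \<le> K * integral\<^sup>L M (\<lambda>x. (cmod (u x))\<^sup>2)"
    using pos by (simp add: K_def pos_divide_le_eq mult.commute)
qed

section \<open>Differentiation of indefinite integrals\<close>

text \<open>The one-dimensional case of Lebesgue's differentiation theorem, where the cubes with
  corner \<open>x\<close> are intervals to the right of \<open>x\<close>.\<close>

lemma integral_right_continuous_explicit: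
  fixes g :: "real \<Rightarrow> complex"
  assumes "\<And>c d. g integrable_on {c..d}"
  obtains N where "negligible N"
    "\<And>x e. \<lbrakk>x \<notin> N; 0 < e\<rbrakk> \<Longrightarrow> \<exists>d>0. \<forall>h. 0 < h \<and> h < d \<longrightarrow> norm (integral {x..x+h} g /\<^sub>R h - g x) < e"
proof -
  have One: "(\<Sum>(Basis :: real set)) = 1" by simp
  have "\<And>c d. g integrable_on cbox c d" using assms by (simp add: cbox_interval)
  from integrable_ccontinuous_explicit[OF this, unfolded One cbox_interval real_scaleR_def mult_1_right DIM_real power_one_right]
  show ?thesis using that by blast
qed

text \<open>The differentiation theorem yields right derivatives. Left derivatives follow from it
  for the reflected integrand \<open>G2\<close>, outside the reflected null set.\<close>

lemma indefinite_integral_differentiable_AE: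
  fixes G H :: "real \<Rightarrow> complex"
  assumes G: "G integrable_on {a..b}"
    and H: "\<And>x y. a \<le> x \<Longrightarrow> x \<le> y \<Longrightarrow> y \<le> b \<Longrightarrow> integral {x..y} G = H y - H x"
  obtains N where "negligible N" "\<And>x. x \<in> {a<..<b} - N \<Longrightarrow> (H has_vector_derivative G x) (at x)"
proof -
  define G1 where "G1 x = (if x \<in> {a..b} then G x else 0)" for x
  define G2 where "G2 x = G1 (- x)" for x
  have G1_int: "G1 integrable_on {c..d}" for c d
  proof -
    have "G1 integrable_on UNIV" unfolding G1_def by (rule iffD2[OF integrable_restrict_UNIV G])
    thus ?thesis by (rule integrable_on_subinterval) auto
  qed
  have G2_int: "G2 integrable_on {c..d}" for c d
    unfolding G2_def using G1_int[of "-d" "-c"] Henstock_Kurzweil_Integration.integrable_reflect_real[where f = G1 and a = "-d" and b = "-c"] by simp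
  obtain N1 where N1: "negligible N1" "\<And>x e. \<lbrakk>x \<notin> N1; 0 < e\<rbrakk> \<Longrightarrow>
     \<exists>d>0. \<forall>h. 0 < h \<and> h < d \<longrightarrow> norm (integral {x..x+h} G1 /\<^sub>R h - G1 x) < e"
    using integral_right_continuous_explicit[OF G1_int] by blast
  obtain N2 where N2: "negligible N2" "\<And>x e. \<lbrakk>x \<notin> N2; 0 < e\<rbrakk> \<Longrightarrow>
     \<exists>d>0. \<forall>h. 0 < h \<and> h < d \<longrightarrow> norm (integral {x..x+h} G2 /\<^sub>R h - G2 x) < e"
    using integral_right_continuous_explicit[OF G2_int] by blast
  have "negligible (N1 \<union> uminus ` N2)"
  proof (rule negligible_Un[OF N1(1)])
    show "negligible (uminus ` N2)"
      by (rule negligible_differentiable_image_negligible[OF _ N2(1)])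
         (auto intro!: derivative_intros simp: differentiable_on_def)
  qed
  moreover have "(H has_vector_derivative G x) (at x)" if x: "x \<in> {a<..<b} - (N1 \<union> uminus ` N2)" for x
    unfolding has_vector_derivative_def has_derivative_at_alt
  proof (intro conjI allI impI)
    show "bounded_linear (\<lambda>h. h *\<^sub>R G x)" by (rule bounded_linear_scaleR_left)
    fix e :: real assume e: "e > 0"
    have xa: "a < x" "x < b" using x by simp_all
    have x1: "x \<notin> N1" using x by simp
    have x2: "-x \<notin> N2"
    proof
      assume "-x \<in> N2"
      hence "- (- x) \<in> uminus ` N2" by (rule imageI)
      thus False using x by simp
    qed
    obtain d1 where d1: "d1 > 0" "\<And>h. 0 < h \<Longrightarrow> h < d1 \<Longrightarrow> norm (integral {x..x+h} G1 /\<^sub>R h - G1 x) < e"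
      using N1(2)[OF x1 e] by auto
    obtain d2 where d2: "d2 > 0" "\<And>h. 0 < h \<Longrightarrow> h < d2 \<Longrightarrow> norm (integral {-x..-x+h} G2 /\<^sub>R h - G2 (-x)) < e"
      using N2(2)[OF x2 e] by auto
    define d where "d = Min {d1, d2, x - a, b - x}"
    have d: "d > 0" "d \<le> d1" "d \<le> d2" "d \<le> x - a" "d \<le> b - x" using d1(1) d2(1) xa by (auto simp: d_def)
    have aux: "norm (D - h *\<^sub>R g) \<le> e * h" if "h > 0" "norm (D /\<^sub>R h - g) < e" for h :: real and D g :: complex
    proof -
      have "D - h *\<^sub>R g = h *\<^sub>R (D /\<^sub>R h - g)" using that(1) by (simp add: scaleR_diff_right)
      hence "norm (D - h *\<^sub>R g) = h * norm (D /\<^sub>R h - g)" using that(1) by simp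
      also have "\<dots> \<le> h * e" using that by (intro mult_left_mono) auto
      finally show ?thesis by (simp only: mult.commute)
    qed
    have G1x: "G1 x = G x" using xa by (simp add: G1_def)
    have I: "integral {u..v} G1 = H v - H u" if "a \<le> u" "u \<le> v" "v \<le> b" for u v
    proof -
      have "integral {u..v} G1 = integral {u..v} G"
        by (rule integral_cong) (use that in \<open>simp add: G1_def\<close>)
      thus ?thesis using H[OF that] by simp
    qed
    have right: "norm (H (x + h) - H x - h *\<^sub>R G x) \<le> e * h" if h: "0 < h" "h < d" for h
    proof (rule aux[OF h(1)])
      have "integral {x..x+h} G1 = H (x + h) - H x" by (rule I) (use h d xa in linarith)+
      thus "norm ((H (x + h) - H x) /\<^sub>R h - G x) < e" using d1(2)[of h] h d G1x by simp
    qed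
    have left: "norm (H x - H (x - h) - h *\<^sub>R G x) \<le> e * h" if h: "0 < h" "h < d" for h
    proof (rule aux[OF h(1)])
      have "integral {-x..-x+h} G2 = integral {x-h..x} G1"
        unfolding G2_def using Henstock_Kurzweil_Integration.integral_reflect_real[where f = G1 and a = "x - h" and b = x] by simp
      also have "\<dots> = H x - H (x - h)" by (rule I) (use h d xa in linarith)+
      finally have "integral {-x..-x+h} G2 = H x - H (x - h)" .
      moreover have "G2 (-x) = G x" using G1x by (simp add: G2_def)
      ultimately show "norm ((H x - H (x - h)) /\<^sub>R h - G x) < e" using d2(2)[of h] h d by simp
    qed
    have 1: "norm (H y - H x - (y - x) *\<^sub>R G x) \<le> e * norm (y - x)" if y: "norm (y - x) < d" for y
    proof (cases y x rule: linorder_cases)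
      case equal thus ?thesis by simp
    next
      case greater
      thus ?thesis using right[of "y - x"] y by simp
    next
      case less
      have "H y - H x - (y - x) *\<^sub>R G x = - (H x - H (x - (x - y)) - (x - y) *\<^sub>R G x)"
        by (simp add: scaleR_diff_left)
      hence "norm (H y - H x - (y - x) *\<^sub>R G x) = norm (H x - H (x - (x - y)) - (x - y) *\<^sub>R G x)"
        by (simp only: norm_minus_cancel)
      thus ?thesis using left[of "x - y"] less y by simp
    qed
    show "\<exists>d>0. \<forall>y. norm (y - x) < d \<longrightarrow> norm (H y - H x - (y - x) *\<^sub>R G x) \<le> e * norm (y - x)"
      using d(1) 1 by blast
  qed
  ultimately show ?thesis by (rule that)
qed

text \<open>The Taylor coefficients provide a square integrable boundary function. Its primitive is
  differentiable almost everywhere, and \<open>radial_limit_deriv\<close> yields the radial limit at these points.\<close>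

lemma fatou_disc:
  fixes g :: "complex \<Rightarrow> complex"
  assumes hol: "g holomorphic_on ball 0 1"
    and bd: "\<forall>\<^sub>F \<rho> in at_left 1. integral {0..2*pi} (\<lambda>\<theta>. (cmod (g (of_real \<rho> * cis \<theta>)))\<^sup>2) \<le> C"
  obtains G where
    "G \<in> borel_measurable (lebesgue_on {0..2*pi})"
    "AE \<theta> in lebesgue_on {0..2*pi}. ((\<lambda>\<rho>. g (of_real \<rho> * cis \<theta>)) \<longlongrightarrow> G \<theta>) (at_left 1)"
    "integrable (lebesgue_on {0..2*pi}) (\<lambda>\<theta>. (cmod (G \<theta>))\<^sup>2)"
    "((\<lambda>\<rho>. integral\<^sup>L (lebesgue_on {0..2*pi}) (\<lambda>\<theta>. (cmod (g (of_real \<rho> * cis \<theta>) - G \<theta>))\<^sup>2)) \<longlongrightarrow> 0) (at_left 1)"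
proof -
  define a where "a n = (deriv ^^ n) g 0 / fact n" for n
  have pow: "(\<lambda>n. a n * z ^ n) sums g z" if "cmod z < 1" for z
    using holomorphic_power_series[OF hol, of z] that by (simp add: a_def)
  have pow_cis: "(\<lambda>n. (a n * of_real \<rho> ^ n) * cis (real n * \<theta>)) sums g (of_real \<rho> * cis \<theta>)"
    if "0 \<le> \<rho>" "\<rho> < 1" for \<rho> \<theta> :: real
  proof -
    have "(\<lambda>n. a n * (of_real \<rho> * cis \<theta>) ^ n) sums g (of_real \<rho> * cis \<theta>)"
      by (rule pow) (use that in \<open>simp add: norm_mult\<close>)
    moreover have "a n * (of_real \<rho> * cis \<theta>) ^ n = (a n * of_real \<rho> ^ n) * cis (real n * \<theta>)" for n
      unfolding power_mult_distrib Complex.DeMoivre by (rule mult.assoc[symmetric])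
    ultimately show ?thesis by simp
  qed
  have ev01: "\<forall>\<^sub>F \<rho> in at_left 1. 0 < \<rho> \<and> \<rho> < (1::real)"
  proof (rule eventually_conj)
    show "\<forall>\<^sub>F \<rho> in at_left 1. 0 < (\<rho>::real)" by (intro order_tendstoD[OF tendsto_ident_at]) auto
    show "\<forall>\<^sub>F \<rho> in at_left 1. \<rho> < (1::real)" by (simp add: eventually_at_filter)
  qed
  \<comment> \<open>One half of Parseval's identity suffices: the partial sums increase to the
    integral. Letting \<open>\<rho>\<close> tend to 1 with \<open>N\<close> fixed then bounds the
    squares of the coefficients themselves.\<close>
  have partial_le: "2 * pi * (\<Sum>n<N. (cmod (a n))\<^sup>2 * \<rho> ^ (2 * n)) \<le> integral {0..2*pi} (\<lambda>\<theta>. (cmod (g (of_real \<rho> * cis \<theta>)))\<^sup>2)"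
    if \<rho>: "0 \<le> \<rho>" "\<rho> < 1" for N \<rho>
  proof -
    define s where "s k \<theta> = (\<Sum>n<k. (a n * of_real \<rho> ^ n) * cis (real n * \<theta>))" for k \<theta>
    have s_int: "((\<lambda>\<theta>. (cmod (s k \<theta>))\<^sup>2) has_integral 2 * pi * (\<Sum>n<k. (cmod (a n))\<^sup>2 * \<rho> ^ (2 * n))) {0..2*pi}" for k
      unfolding s_def
      using has_integral_norm_sq_trig_poly[where c = "\<lambda>n. a n * of_real \<rho> ^ n" and a = 0 and b = "2*pi" and m = 1 and N = k] \<rho>
      by (simp add: norm_mult norm_power power_mult_distrib power_mult mult.commute flip: power_mult)
    obtain r' where r': "\<rho> < r'" "r' < 1" using \<rho> dense by blast
    have "summable (\<lambda>n. cmod (a n * of_real \<rho> ^ n))"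
      using powser_insidea[of a "of_real r'" "of_real \<rho>"] pow[of "of_real r'"] r' \<rho>
      by (simp add: sums_summable)
    hence "uniform_limit UNIV s (\<lambda>\<theta>. \<Sum>n. (a n * of_real \<rho> ^ n) * cis (real n * \<theta>)) sequentially"
      unfolding s_def by (intro Weierstrass_m_test_ev always_eventually) (auto simp: norm_mult)
    moreover have "(\<Sum>n. (a n * of_real \<rho> ^ n) * cis (real n * \<theta>)) = g (of_real \<rho> * cis \<theta>)" for \<theta>
      using pow_cis[OF \<rho>] by (simp add: sums_iff)
    ultimately have u: "uniform_limit {0..2*pi} s (\<lambda>\<theta>. g (of_real \<rho> * cis \<theta>)) sequentially"
      by (auto intro: uniform_limit_on_subset)
    have bnd: "bounded ((\<lambda>\<theta>. g (of_real \<rho> * cis \<theta>)) ` {0..2*pi})"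
    proof (intro compact_imp_bounded compact_continuous_image)
      show "continuous_on {0..2*pi} (\<lambda>\<theta>. g (of_real \<rho> * cis \<theta>))"
        by (intro continuous_on_compose2[OF holomorphic_on_imp_continuous_on[OF hol]] continuous_intros)
           (use \<rho> in \<open>auto simp: norm_mult\<close>)
    qed simp
    have sq: "uniform_limit {0..2*pi} (\<lambda>k \<theta>. (cmod (s k \<theta>))\<^sup>2) (\<lambda>\<theta>. (cmod (g (of_real \<rho> * cis \<theta>)))\<^sup>2) sequentially"
      unfolding power2_eq_square
      by (intro uniform_lim_mult uniform_limit_intros u)
         (use bnd in \<open>auto simp: bounded_iff\<close>)
    have sc: "continuous_on {0..2*pi} (\<lambda>\<theta>. (cmod (s k \<theta>))\<^sup>2)" for k
      unfolding s_def by (intro continuous_intros)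
    obtain I J where IJ: "\<And>k. ((\<lambda>\<theta>. (cmod (s k \<theta>))\<^sup>2) has_integral I k) {0..2*pi}"
        "((\<lambda>\<theta>. (cmod (g (of_real \<rho> * cis \<theta>)))\<^sup>2) has_integral J) {0..2*pi}" "I \<longlonglongrightarrow> J"
      using uniform_limit_integral[OF sq sc] by auto
    have "(\<lambda>k. integral {0..2*pi} (\<lambda>\<theta>. (cmod (s k \<theta>))\<^sup>2)) \<longlonglongrightarrow> integral {0..2*pi} (\<lambda>\<theta>. (cmod (g (of_real \<rho> * cis \<theta>)))\<^sup>2)"
      using IJ(3) by (simp only: integral_unique[OF IJ(1)] integral_unique[OF IJ(2)])
    hence lim: "(\<lambda>k. 2 * pi * (\<Sum>n<k. (cmod (a n))\<^sup>2 * \<rho> ^ (2 * n))) \<longlonglongrightarrow> integral {0..2*pi} (\<lambda>\<theta>. (cmod (g (of_real \<rho> * cis \<theta>)))\<^sup>2)"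
      by (simp only: integral_unique[OF s_int])
    show ?thesis
      by (rule incseq_le[OF _ lim]) (auto intro!: incseq_SucI simp: \<rho>)
  qed
  have C: "2 * pi * (\<Sum>n<N. (cmod (a n))\<^sup>2) \<le> C" for N
  proof (rule tendsto_upperbound)
    show "((\<lambda>\<rho>::real. 2 * pi * (\<Sum>n<N. (cmod (a n))\<^sup>2 * \<rho> ^ (2 * n))) \<longlongrightarrow> 2 * pi * (\<Sum>n<N. (cmod (a n))\<^sup>2)) (at_left 1)"
      by (auto intro!: tendsto_eq_intros)
    have "\<forall>\<^sub>F \<rho> in at_left 1. \<rho> > (0::real)" by (intro order_tendstoD[OF tendsto_ident_at]) auto
    moreover have "\<forall>\<^sub>F \<rho> in at_left 1. \<rho> < (1::real)" by (simp add: eventually_at_filter)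
    ultimately show "\<forall>\<^sub>F \<rho> in at_left 1. 2 * pi * (\<Sum>n<N. (cmod (a n))\<^sup>2 * \<rho> ^ (2 * n)) \<le> C"
      using bd
    proof eventually_elim
      case (elim \<rho>)
      from partial_le[of \<rho> N] elim show ?case by linarith
    qed
  qed auto
  have sum_a: "summable (\<lambda>n. (cmod (a n))\<^sup>2)"
  proof (rule bounded_imp_summable)
    show "(\<Sum>k\<le>n. (cmod (a k))\<^sup>2) \<le> C / (2 * pi)" for n
      using C[of "Suc n"] by (simp add: field_simps lessThan_Suc_atMost)
  qed auto

  define S where "S m \<theta> = (\<Sum>n<m. a n * cis (real n * \<theta>))" for m \<theta>
  \<comment> \<open>Three periods, so that every angle in \<open>{0..2*pi}\<close>, the endpoints
    included, is interior and the primitive can be differentiated from both sides.\<close>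
  define I where "I = {-2*pi..4*pi}"
  define M where "M = lebesgue_on I"
  have I_sets: "I \<in> sets lebesgue" by (simp add: I_def)
  interpret M: finite_measure M unfolding M_def I_def by (intro finite_measureI) (simp add: emeasure_restrict_space)
  have mM: "measure M (space M) = 6 * pi" by (simp add: M_def I_def measure_restrict_space)
  have contS: "continuous_on A (S m)" for A m unfolding S_def by (intro continuous_intros)
  have int_cont: "integrable M f" if "continuous_on I f" for f :: "real \<Rightarrow> 'b :: euclidean_space"
    using that unfolding M_def I_def by (rule continuous_imp_integrable_real)
  have S_int[simp]: "integrable M (S m)" for m by (intro int_cont contS)
  have S_meas[measurable]: "S m \<in> borel_measurable M" for m by (rule borel_measurable_integrable[OF S_int])
  have sq_int: "integrable M (\<lambda>\<theta>. (cmod (S i \<theta> - S j \<theta>))\<^sup>2)" for i j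
    by (intro int_cont continuous_intros contS)
  have sq_val: "integral\<^sup>L M (\<lambda>\<theta>. (cmod (S i \<theta> - S j \<theta>))\<^sup>2) = 6 * pi * (\<Sum>n=j..<i. (cmod (a n))\<^sup>2)" if "j \<le> i" for i j
  proof -
    have eq: "S i \<theta> - S j \<theta> = (\<Sum>n<i. (if n < j then 0 else a n) * cis (real n * \<theta>))" for \<theta>
    proof -
      have "S i \<theta> - S j \<theta> = (\<Sum>n\<in>{..<i}-{..<j}. a n * cis (real n * \<theta>))"
        unfolding S_def using that by (subst sum_diff) auto
      also have "\<dots> = (\<Sum>n\<in>{..<i}. if n \<in> {..<j} then 0 else a n * cis (real n * \<theta>))"
        by (rule sum.mono_neutral_cong_left) auto
      also have "\<dots> = (\<Sum>n<i. (if n < j then 0 else a n) * cis (real n * \<theta>))"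
        by (intro sum.cong) auto
      finally show ?thesis .
    qed
    have "integral\<^sup>L M (\<lambda>\<theta>. (cmod (S i \<theta> - S j \<theta>))\<^sup>2) = integral I (\<lambda>\<theta>. (cmod (S i \<theta> - S j \<theta>))\<^sup>2)"
      unfolding M_def by (rule lebesgue_integral_eq_integral) (use sq_int I_sets in \<open>auto simp: M_def\<close>)
    also have "\<dots> = 6 * pi * (\<Sum>n<i. (cmod (if n < j then 0 else a n))\<^sup>2)"
      unfolding eq I_def
      using has_integral_norm_sq_trig_poly[where c = "\<lambda>n. if n < j then 0 else a n" and a = "-2*pi" and b = "4*pi" and m = 3 and N = i]
      by (simp add: integral_unique)
    also have "(\<Sum>n<i. (cmod (if n < j then 0 else a n))\<^sup>2) = (\<Sum>n=j..<i. (cmod (a n))\<^sup>2)"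
      by (rule sum.mono_neutral_cong_right) (auto split: if_splits)
    finally show ?thesis .
  qed
  define \<tau> where "\<tau> m = (\<Sum>n. (cmod (a (n + m)))\<^sup>2)" for m
  have tail: "(\<Sum>n=j..<i. (cmod (a n))\<^sup>2) \<le> \<tau> j" for i j
  proof -
    have "(\<Sum>n=j..<i. (cmod (a n))\<^sup>2) = (\<Sum>n<i-j. (cmod (a (n + j)))\<^sup>2)"
      by (rule sum.reindex_bij_witness[of _ "\<lambda>n. n + j" "\<lambda>n. n - j"]) auto
    also have "\<dots> \<le> \<tau> j" unfolding \<tau>_def
      by (rule sum_le_suminf) (use sum_a in \<open>auto simp: summable_iff_shift[of "\<lambda>n. (cmod (a n))\<^sup>2"]\<close>)
    finally show ?thesis .
  qed
  have \<tau>0: "\<tau> \<longlonglongrightarrow> 0" unfolding \<tau>_def using suminf_exist_split2[OF sum_a] by simp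
  \<comment> \<open>An almost everywhere convergent subsequence is extracted from a Cauchy sequence
    in the mean, so the mean square estimates are converted to estimates of first order.\<close>
  have L1: "integral\<^sup>L M (\<lambda>x. cmod (u x)) \<le> sqrt (6 * pi * c)"
    if [measurable]: "u \<in> borel_measurable M" and "integrable M (\<lambda>x. (cmod (u x))\<^sup>2)" "integral\<^sup>L M (\<lambda>x. (cmod (u x))\<^sup>2) \<le> c" for u c
  proof (rule real_le_rsqrt)
    have "(integral\<^sup>L M (\<lambda>x. cmod (u x)))\<^sup>2 \<le> 6 * pi * integral\<^sup>L M (\<lambda>x. (cmod (u x))\<^sup>2)"
      using M.integral_norm_sq_le(2)[OF that(1,2)] mM by simp
    also have "\<dots> \<le> 6 * pi * c" using that(3) by simp
    finally show "(integral\<^sup>L M (\<lambda>x. cmod (u x)))\<^sup>2 \<le> 6 * pi * c" .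
  qed
  have sqrt0: "(\<lambda>m. sqrt (6 * pi * (6 * pi * \<tau> m))) \<longlonglongrightarrow> 0"
    using tendsto_real_sqrt[OF tendsto_mult_left[OF tendsto_mult_left[OF \<tau>0, of "6*pi"], of "6*pi"]] by simp
  have "\<exists>N. \<forall>i\<ge>N. \<forall>j\<ge>N. LINT x|M. norm (S i x - S j x) < e" if e: "e > 0" for e
  proof -
    obtain N where N: "\<And>m. m \<ge> N \<Longrightarrow> sqrt (6 * pi * (6 * pi * \<tau> m)) < e"
      using order_tendstoD(2)[OF sqrt0 e] by (auto simp: eventually_sequentially)
    have 1: "LINT x|M. norm (S i x - S j x) < e" if "j \<ge> N" "j \<le> i" for i j
    proof -
      have "LINT x|M. norm (S i x - S j x) \<le> sqrt (6 * pi * (6 * pi * \<tau> j))"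
        by (rule L1) (use sq_int sq_val[OF that(2)] tail[of j i] in auto)
      thus ?thesis using N[OF that(1)] by linarith
    qed
    show ?thesis
    proof (intro exI[of _ N] allI impI)
      fix i j assume "i \<ge> N" "j \<ge> N"
      thus "LINT x|M. norm (S i x - S j x) < e"
        using 1[of j i] 1[of i j] by (cases "j \<le> i") (auto simp: norm_minus_commute)
    qed
  qed
  then obtain r where r: "strict_mono r" "AE x in M. Cauchy (\<lambda>i. S (r i) x)"
    using cauchy_L1_AE_cauchy_subseq[where s = S and M = M, OF S_int] by blast
  define G where "G \<theta> = lim (\<lambda>i. S (r i) \<theta>)" for \<theta>
  have G_meas[measurable]: "G \<in> borel_measurable M" unfolding G_def by measurable
  have G_lim: "AE x in M. (\<lambda>i. S (r i) x) \<longlonglongrightarrow> G x"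
    using r(2) by eventually_elim (simp add: G_def Cauchy_convergent_iff convergent_LIMSEQ_iff)
  have GS: "integrable M (\<lambda>x. (cmod (G x - S m x))\<^sup>2) \<and> integral\<^sup>L M (\<lambda>x. (cmod (G x - S m x))\<^sup>2) \<le> 6 * pi * \<tau> m" for m
  proof -
    have lim: "AE x in M. (\<lambda>i. S (r (i + m)) x - S m x) \<longlonglongrightarrow> G x - S m x"
      using G_lim
    proof eventually_elim
      case (elim x)
      from LIMSEQ_ignore_initial_segment[OF this, of m] show ?case by (intro tendsto_intros)
    qed
    have le: "m \<le> r (i + m)" for i using seq_suble[OF r(1), of "i + m"] by linarith
    have bnd: "integral\<^sup>L M (\<lambda>x. (cmod (S (r (i + m)) x - S m x))\<^sup>2) \<le> 6 * pi * \<tau> m" for i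
      using sq_val[OF le] tail[of m "r (i + m)"] by simp
    show ?thesis
      using fatou_norm_sq[of "\<lambda>i x. S (r (i + m)) x - S m x" M "\<lambda>x. G x - S m x" "6 * pi * \<tau> m"] lim sq_int bnd by simp
  qed
  have GS1: "integral\<^sup>L M (\<lambda>x. cmod (G x - S m x)) \<le> sqrt (6 * pi * (6 * pi * \<tau> m))" for m
    by (rule L1) (use GS in auto)
  have G_sq: "integrable M (\<lambda>x. (cmod (G x))\<^sup>2)" using GS[of 0] by (simp add: S_def)
  have G_int: "integrable M G" by (rule M.integral_norm_sq_le(1)) (use G_sq mM in auto)

  \<comment> \<open>Coefficients of the primitive with respect to the angle. Division by zero makes
    \<open>b 0 = 0\<close>; the constant coefficient is carried by the linear term of
    \<open>H\<close>.\<close>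
  define b where "b n = a n / (\<i> * of_nat n)" for n
  define F where "F z = (\<Sum>n. b n * z ^ n)" for z
  \<comment> \<open>By \<open>2 * x * y \<le> x^2 + y^2\<close> the coefficients are absolutely
    summable, which makes \<open>F\<close> continuous up to the circle.\<close>
  have sum_b: "summable (\<lambda>n. cmod (b n))"
  proof (rule summable_comparison_test')
    show "summable (\<lambda>n. (cmod (a n))\<^sup>2 + 1 / (real n)\<^sup>2)"
      using summable_add[OF sum_a inverse_power_summable[of 2, where ?'a = real]] by (simp add: field_simps)
    fix n :: nat assume "n \<ge> 0"
    have "cmod (b n) = cmod (a n) * (1 / real n)" by (simp add: b_def norm_divide norm_mult)
    also have "2 * \<dots> \<le> (cmod (a n))\<^sup>2 + (1 / real n)\<^sup>2"
      using sum_squares_bound[of "cmod (a n)" "1 / real n"] by (simp add: mult.assoc)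
    finally have "2 * cmod (b n) \<le> (cmod (a n))\<^sup>2 + 1 / (real n)\<^sup>2" by (simp add: power_divide)
    thus "norm (cmod (b n)) \<le> (cmod (a n))\<^sup>2 + 1 / (real n)\<^sup>2" using norm_ge_zero[of "b n"] by (simp del: norm_ge_zero)
  qed
  have F_unif: "uniform_limit (cball 0 1) (\<lambda>k z. \<Sum>n<k. b n * z ^ n) F sequentially"
    unfolding F_def
    by (rule Weierstrass_m_test[OF _ sum_b]) (auto simp: norm_mult norm_power intro!: mult_left_le power_le_one)
  have contF: "continuous_on (cball 0 1) F"
    by (rule uniform_limit_theorem[OF _ F_unif]) (auto intro!: always_eventually continuous_intros)
  have derF: "(F has_field_derivative (\<Sum>n. diffs b n * z ^ n)) (at z)" if "cmod z < 1" for z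
    unfolding F_def
    by (rule termdiffs_strong[where K = 1]) (use that summable_norm_cancel[OF sum_b] in auto)
  have holF: "F holomorphic_on ball 0 1"
    unfolding holomorphic_on_open[OF open_ball] using derF by (meson mem_ball_0)
  have gF: "g z = a 0 + \<i> * z * deriv F z" if z: "cmod z < 1" for z
  proof -
    have "diffs b n = a (Suc n) / \<i>" for n by (simp add: diffs_def b_def field_simps del: of_nat_Suc)
    hence dF: "deriv F z = (\<Sum>n. a (Suc n) / \<i> * z ^ n)" using derF[OF z] by (simp add: DERIV_imp_deriv)
    have "(\<lambda>n. a (Suc n) * z ^ Suc n) sums (g z - a 0)"
      using pow[OF z] by (subst sums_Suc_iff) simp
    show ?thesis
    proof (cases "z = 0")
      case True
      have "g 0 = a 0" using pow[of 0] powser_sums_zero_iff[of a "g 0"] by simp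
      thus ?thesis using True by simp
    next
      case False
      have "(\<lambda>n. (a (Suc n) * z ^ Suc n) / (\<i> * z)) sums ((g z - a 0) / (\<i> * z))"
        by (rule sums_divide) fact
      moreover have "(a (Suc n) * z ^ Suc n) / (\<i> * z) = a (Suc n) / \<i> * z ^ n" for n using False by simp
      ultimately have "(\<lambda>n. a (Suc n) / \<i> * z ^ n) sums ((g z - a 0) / (\<i> * z))" by simp
      hence "deriv F z = (g z - a 0) / (\<i> * z)" using dF by (simp add: sums_iff)
      thus ?thesis using False by (simp add: field_simps)
    qed
  qed
  \<comment> \<open>The primitive of \<open>G\<close>; its linear part is not periodic and has to be
    removed again before \<open>radial_limit_deriv\<close> is applied to \<open>F\<close>.\<close>
  define H where "H \<theta> = a 0 * of_real \<theta> + F (cis \<theta>)" for \<theta>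
  have prim: "integral {x..y} G = H y - H x" if xy: "-2*pi \<le> x" "x \<le> y" "y \<le> 4*pi" for x y
  proof -
    have sub: "{x..y} \<subseteq> I" using xy by (auto simp: I_def)
    have Sxy: "integral {x..y} (S m) = a 0 * (y - x) + ((\<Sum>n<m. b n * cis y ^ n) - (\<Sum>n<m. b n * cis x ^ n))" if "m \<ge> 1" for m
    proof (rule integral_unique)
      have "(S m has_integral ((a 0 * of_real y + (\<Sum>n<m. b n * cis y ^ n)) - (a 0 * of_real x + (\<Sum>n<m. b n * cis x ^ n)))) {x..y}"
      proof (rule fundamental_theorem_of_calculus[OF xy(2)])
        fix t
        have d: "((\<lambda>t. b n * exp (\<i> * of_nat n * of_real t)) has_vector_derivative b n * (exp (\<i> * of_nat n * of_real t) * (\<i> * of_nat n))) (at t within {x..y})" for n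
          by (auto intro!: derivative_eq_intros has_vector_derivative_real_field)
        have "((\<lambda>t. a 0 * of_real t + (\<Sum>n<m. b n * exp (\<i> * of_nat n * of_real t))) has_vector_derivative
           a 0 * 1 + (\<Sum>n<m. b n * (exp (\<i> * of_nat n * of_real t) * (\<i> * of_nat n)))) (at t within {x..y})"
          by (intro has_vector_derivative_add has_vector_derivative_sum d has_vector_derivative_mult_right)
             (auto intro!: derivative_eq_intros has_vector_derivative_real_field)
        moreover have "cis t ^ n = exp (\<i> * of_nat n * of_real t)" for t n
          unfolding Complex.DeMoivre by (simp add: cis_conv_exp mult_ac)
        moreover have "a 0 * 1 + (\<Sum>n<m. b n * (exp (\<i> * of_nat n * of_real t) * (\<i> * of_nat n))) = S m t"
        proof -
          obtain m' where m': "m = Suc m'" using \<open>m \<ge> 1\<close> by (cases m) auto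
          have 1: "b (Suc n) * (exp (\<i> * of_nat (Suc n) * of_real t) * (\<i> * of_nat (Suc n))) = a (Suc n) * cis (real (Suc n) * t)" for n
            by (simp add: b_def cis_conv_exp mult_ac del: of_nat_Suc)
          show ?thesis unfolding S_def m' sum.lessThan_Suc_shift 1 by simp
        qed
        ultimately show "((\<lambda>t. a 0 * of_real t + (\<Sum>n<m. b n * cis t ^ n)) has_vector_derivative S m t) (at t within {x..y})"
          by simp
      qed
      thus "(S m has_integral a 0 * (y - x) + ((\<Sum>n<m. b n * cis y ^ n) - (\<Sum>n<m. b n * cis x ^ n))) {x..y}"
        by (simp add: algebra_simps)
    qed
    have F_lim: "(\<lambda>m. \<Sum>n<m. b n * cis t ^ n) \<longlonglongrightarrow> F (cis t)" for t
      using F_unif by (rule tendsto_uniform_limitI) simp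
    have "(\<lambda>m. a 0 * (y - x) + ((\<Sum>n<m. b n * cis y ^ n) - (\<Sum>n<m. b n * cis x ^ n))) \<longlonglongrightarrow> a 0 * (y - x) + (F (cis y) - F (cis x))"
      by (intro tendsto_intros F_lim)
    moreover have "a 0 * (y - x) + (F (cis y) - F (cis x)) = H y - H x" by (simp add: H_def algebra_simps)
    ultimately have "(\<lambda>m. a 0 * (y - x) + ((\<Sum>n<m. b n * cis y ^ n) - (\<Sum>n<m. b n * cis x ^ n))) \<longlonglongrightarrow> H y - H x" by simp
    hence lim1: "(\<lambda>m. integral {x..y} (S m)) \<longlonglongrightarrow> H y - H x"
      by (rule Lim_transform_eventually) (use Sxy in \<open>auto simp: eventually_sequentially intro!: exI[of _ 1]\<close>)
    have "(\<lambda>m. integral {x..y} (S m)) \<longlonglongrightarrow> integral {x..y} G"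
    proof (rule LIM_zero_cancel, rule Lim_null_comparison[OF _ sqrt0], rule always_eventually, rule allI)
      fix m
      have D: "integrable (lebesgue_on I) (\<lambda>x. norm (S m x - G x))"
        unfolding M_def[symmetric] by (intro integrable_norm Bochner_Integration.integrable_diff S_int G_int)
      have on: "f integrable_on {x..y}" if "integrable M f" for f :: "real \<Rightarrow> complex"
        using integrable_on_lebesgue_on[of I f] that I_sets sub
        by (auto simp: M_def I_def intro: integrable_on_subinterval)
      have nI: "(\<lambda>x. norm (S m x - G x)) integrable_on I"
        using integrable_on_lebesgue_on[OF D] I_sets by simp
      have nxy: "(\<lambda>x. norm (S m x - G x)) integrable_on {x..y}"
        using nI sub unfolding I_def by (rule integrable_on_subinterval)
      have "norm (integral {x..y} (S m) - integral {x..y} G) = norm (integral {x..y} (\<lambda>x. S m x - G x))"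
        using on[OF S_int] on[OF G_int] by (simp add: Henstock_Kurzweil_Integration.integral_diff)
      also have "\<dots> \<le> integral {x..y} (\<lambda>x. norm (S m x - G x))"
        by (intro integral_norm_bound_integral nxy order_refl Henstock_Kurzweil_Integration.integrable_diff on S_int G_int)
      also have "\<dots> \<le> integral I (\<lambda>x. norm (S m x - G x))"
        by (intro integral_subset_le sub nI nxy) auto
      also have "\<dots> = integral\<^sup>L M (\<lambda>x. cmod (G x - S m x))"
        using lebesgue_integral_eq_integral[OF D I_sets] by (simp add: M_def norm_minus_commute)
      also have "\<dots> \<le> sqrt (6 * pi * (6 * pi * \<tau> m))" by (rule GS1)
      finally show "norm (integral {x..y} (S m) - integral {x..y} G) \<le> sqrt (6 * pi * (6 * pi * \<tau> m))" .
    qed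
    thus ?thesis using lim1 by (rule LIMSEQ_unique)
  qed
  have G_on: "G integrable_on {-2*pi..4*pi}"
    using G_int integrable_on_lebesgue_on[of I G] by (simp add: M_def I_def)
  obtain N where N: "negligible N" "\<And>x. x \<in> {-2*pi<..<4*pi} - N \<Longrightarrow> (H has_vector_derivative G x) (at x)"
    using indefinite_integral_differentiable_AE[OF G_on prim] by blast
  have radial: "((\<lambda>\<rho>. g (of_real \<rho> * cis \<theta>)) \<longlongrightarrow> G \<theta>) (at_left 1)" if \<theta>: "\<theta> \<in> {0..2*pi} - N" for \<theta>
  proof -
    have "-2*pi < \<theta>" "\<theta> < 4*pi" using \<theta> pi_gt_zero unfolding Diff_iff atLeastAtMost_iff by linarith+
    hence "\<theta> \<in> {-2*pi<..<4*pi} - N" using \<theta> by simp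
    hence "(H has_vector_derivative G \<theta>) (at \<theta>)" by (rule N(2))
    hence "((\<lambda>t. H t - a 0 * of_real t) has_vector_derivative G \<theta> - a 0 * 1) (at \<theta>)"
      by (intro has_vector_derivative_diff has_vector_derivative_mult_right) (auto intro!: derivative_eq_intros has_vector_derivative_real_field)
    hence D: "((\<lambda>t. F (cis t)) has_vector_derivative G \<theta> - a 0) (at \<theta>)" by (simp add: H_def)
    have "((\<lambda>\<rho>. deriv F (of_real \<rho> * cis \<theta>)) \<longlongrightarrow> (G \<theta> - a 0) / (\<i> * cis \<theta>)) (at_left 1)"
      by (rule radial_limit_deriv[OF contF holF _ tangent_of_angular_derivative[OF D]]) auto
    hence "((\<lambda>\<rho>. a 0 + \<i> * (of_real \<rho> * cis \<theta>) * deriv F (of_real \<rho> * cis \<theta>)) \<longlongrightarrow> a 0 + \<i> * (of_real 1 * cis \<theta>) * ((G \<theta> - a 0) / (\<i> * cis \<theta>))) (at_left 1)"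
      by (intro tendsto_intros)
    hence lim: "((\<lambda>\<rho>. a 0 + \<i> * (of_real \<rho> * cis \<theta>) * deriv F (of_real \<rho> * cis \<theta>)) \<longlongrightarrow> G \<theta>) (at_left 1)"
      by (simp add: field_simps)
    have "\<forall>\<^sub>F \<rho> in at_left 1. \<rho> > (0::real)" by (intro order_tendstoD[OF tendsto_ident_at]) auto
    moreover have "\<forall>\<^sub>F \<rho> in at_left 1. \<rho> < (1::real)" by (simp add: eventually_at_filter)
    ultimately have "\<forall>\<^sub>F \<rho> in at_left 1. a 0 + \<i> * (of_real \<rho> * cis \<theta>) * deriv F (of_real \<rho> * cis \<theta>) = g (of_real \<rho> * cis \<theta>)"
      by eventually_elim (subst gF, auto simp: norm_mult)
    with lim show ?thesis by (rule Lim_transform_eventually)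
  qed
  define J where "J = {0..2*pi}"
  have JI: "J \<subseteq> I" by (auto simp: J_def I_def intro: order_trans)
  have AE_J: "AE x in lebesgue_on J. P x" if "AE x in M. P x" for P
    using that JI unfolding M_def by (auto simp: AE_restrict_space_iff I_def J_def elim: eventually_mono)
  have meas_J: "f \<in> borel_measurable (lebesgue_on J)" if "f \<in> borel_measurable M" for f :: "real \<Rightarrow> complex"
    using that JI unfolding M_def by (rule measurable_restrict_mono)
  have 3: "integrable (lebesgue_on J) (\<lambda>\<theta>. (cmod (G \<theta>))\<^sup>2)"
  proof -
    have "set_integrable lebesgue I (\<lambda>\<theta>. (cmod (G \<theta>))\<^sup>2)"
      using G_sq I_sets by (simp add: set_integrable_eq M_def)
    hence "set_integrable lebesgue J (\<lambda>\<theta>. (cmod (G \<theta>))\<^sup>2)"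
      by (rule set_integrable_subset) (use JI in \<open>auto simp: J_def\<close>)
    thus ?thesis by (simp add: set_integrable_eq J_def)
  qed
  have lim_G_J: "AE x in lebesgue_on J. (\<lambda>i. S (r i) x) \<longlonglongrightarrow> G x" by (rule AE_J[OF G_lim])
  \<comment> \<open>Parseval's value of the squared distance between \<open>g\<close> on the circle
    of radius \<open>\<rho>\<close> and \<open>G\<close>, divided by \<open>2 * pi\<close>. It tends
    to 0 by dominated convergence of the series.\<close>
  define \<epsilon> where "\<epsilon> \<rho> = (\<Sum>n. (cmod (a n))\<^sup>2 * (\<rho> ^ n - 1)\<^sup>2)" for \<rho> :: real
  have pow1: "\<bar>(\<rho> ^ n - 1)\<^sup>2\<bar> \<le> 1" if "0 \<le> \<rho>" "\<rho> \<le> 1" for \<rho> :: real and n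
  proof -
    have "0 \<le> \<rho> ^ n" "\<rho> ^ n \<le> 1" using that by (auto simp: power_le_one)
    hence "\<bar>\<rho> ^ n - 1\<bar> \<le> 1" by linarith
    thus ?thesis by (simp add: abs_square_le_1)
  qed
  have L2: "integral\<^sup>L (lebesgue_on J) (\<lambda>\<theta>. (cmod (g (of_real \<rho> * cis \<theta>) - G \<theta>))\<^sup>2) \<le> 2 * pi * \<epsilon> \<rho>"
    if \<rho>: "0 < \<rho>" "\<rho> < 1" for \<rho>
  proof -
    define v where "v i \<theta> = (\<Sum>n<r i. (a n * (of_real \<rho> ^ n - 1)) * cis (real n * \<theta>))" for i \<theta>
    have vc: "continuous_on J (v i)" for i unfolding v_def by (intro continuous_intros)
    have gc: "continuous_on J (\<lambda>\<theta>. g (of_real \<rho> * cis \<theta>))"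
      by (intro continuous_on_compose2[OF holomorphic_on_imp_continuous_on[OF hol]] continuous_intros)
         (use \<rho> in \<open>auto simp: norm_mult\<close>)
    have sg: "(\<lambda>i. \<Sum>n<r i. (a n * of_real \<rho> ^ n) * cis (real n * \<theta>)) \<longlonglongrightarrow> g (of_real \<rho> * cis \<theta>)" for \<theta>
    proof -
      have "(\<lambda>n. (a n * of_real \<rho> ^ n) * cis (real n * \<theta>)) sums g (of_real \<rho> * cis \<theta>)"
        using pow_cis[of \<rho>] \<rho> by simp
      thus ?thesis unfolding sums_def using LIMSEQ_subseq_LIMSEQ[OF _ r(1)] by (auto simp: o_def)
    qed
    have lim: "AE x in lebesgue_on J. (\<lambda>i. v i x) \<longlonglongrightarrow> g (of_real \<rho> * cis x) - G x"
      using lim_G_J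
    proof eventually_elim
      case (elim x)
      have "(\<lambda>i. (\<Sum>n<r i. (a n * of_real \<rho> ^ n) * cis (real n * x)) - S (r i) x) \<longlonglongrightarrow> g (of_real \<rho> * cis x) - G x"
        by (intro tendsto_diff sg elim)
      thus ?case by (simp add: v_def S_def sum_subtractf[symmetric] algebra_simps)
    qed
    have vint: "integrable (lebesgue_on J) (\<lambda>\<theta>. (cmod (v i \<theta>))\<^sup>2)" for i
      unfolding J_def by (intro continuous_imp_integrable_real continuous_intros) (use vc in \<open>simp add: J_def\<close>)
    have bound: "integral\<^sup>L (lebesgue_on J) (\<lambda>\<theta>. (cmod (v i \<theta>))\<^sup>2) \<le> 2 * pi * \<epsilon> \<rho>" for i
    proof -
      have "integral\<^sup>L (lebesgue_on J) (\<lambda>\<theta>. (cmod (v i \<theta>))\<^sup>2) = integral J (\<lambda>\<theta>. (cmod (v i \<theta>))\<^sup>2)"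
        by (rule lebesgue_integral_eq_integral[OF vint]) (simp add: J_def)
      also have "\<dots> = 2 * pi * (\<Sum>n<r i. (cmod (a n * (of_real \<rho> ^ n - 1)))\<^sup>2)"
        unfolding v_def J_def
        using has_integral_norm_sq_trig_poly[where c = "\<lambda>n. a n * (of_real \<rho> ^ n - 1)" and a = 0 and b = "2*pi" and m = 1 and N = "r i"]
        by (simp add: integral_unique)
      also have "(\<Sum>n<r i. (cmod (a n * (of_real \<rho> ^ n - 1)))\<^sup>2) = (\<Sum>n<r i. (cmod (a n))\<^sup>2 * (\<rho> ^ n - 1)\<^sup>2)"
      proof (intro sum.cong refl)
        fix n
        have "complex_of_real \<rho> ^ n - 1 = of_real (\<rho> ^ n - 1)" by simp
        hence "cmod (complex_of_real \<rho> ^ n - 1) = \<bar>\<rho> ^ n - 1\<bar>" by (simp only: norm_of_real)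
        thus "(cmod (a n * (of_real \<rho> ^ n - 1)))\<^sup>2 = (cmod (a n))\<^sup>2 * (\<rho> ^ n - 1)\<^sup>2"
          by (simp add: norm_mult power_mult_distrib)
      qed
      also have "\<dots> \<le> \<epsilon> \<rho>" unfolding \<epsilon>_def
      proof (rule sum_le_suminf)
        show "summable (\<lambda>n. (cmod (a n))\<^sup>2 * (\<rho> ^ n - 1)\<^sup>2)"
          by (rule summable_comparison_test'[OF sum_a]) (use pow1 \<rho> in \<open>auto simp: abs_mult intro!: mult_left_le\<close>)
      qed auto
      finally show ?thesis by simp
    qed
    have J_sets: "J \<in> sets lebesgue" by (simp add: J_def)
    show ?thesis
      by (rule fatou_norm_sq(2)[OF _ _ lim vint bound]; intro borel_measurable_diff meas_J[OF G_meas]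
           continuous_imp_measurable_on_sets_lebesgue[OF vc J_sets] continuous_imp_measurable_on_sets_lebesgue[OF gc J_sets])
  qed
  have \<epsilon>0: "(\<epsilon> \<longlongrightarrow> 0) (at_left 1)"
  proof -
    have ev: "\<forall>\<^sub>F \<rho> in at_left 1. 0 < \<rho> \<and> \<rho> < (1::real)"
      by (rule ev01)
    have "((\<lambda>\<rho>. \<Sum>n. (cmod (a n))\<^sup>2 * (\<rho> ^ n - 1)\<^sup>2) \<longlongrightarrow> (\<Sum>n. (0::real))) (at_left 1)"
    proof (rule tannerys_theorem[where M = "\<lambda>n. (cmod (a n))\<^sup>2", THEN conjunct2, THEN conjunct2])
      show "((\<lambda>\<rho>. (cmod (a n))\<^sup>2 * (\<rho> ^ n - 1)\<^sup>2) \<longlongrightarrow> 0) (at_left 1)" for n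
        by (auto intro!: tendsto_eq_intros)
      show "\<forall>\<^sub>F (n, \<rho>) in at_top \<times>\<^sub>F at_left 1. norm ((cmod (a n))\<^sup>2 * (\<rho> ^ n - 1)\<^sup>2) \<le> (cmod (a n))\<^sup>2"
      proof -
        have "\<forall>\<^sub>F p in at_top \<times>\<^sub>F at_left 1. 0 < snd p \<and> snd p < (1::real)"
          unfolding eventually_prod_filter
          by (intro exI[of _ "\<lambda>_. True"] exI[of _ "\<lambda>\<rho>::real. 0 < \<rho> \<and> \<rho> < 1"]) (use ev in simp)
        thus ?thesis by (rule eventually_mono) (auto simp: abs_mult intro!: mult_left_le pow1[unfolded abs_power2])
      qed
    qed (use sum_a in auto)
    thus ?thesis by (simp add: \<epsilon>_def[abs_def])
  qed
  have 4: "((\<lambda>\<rho>. integral\<^sup>L (lebesgue_on J) (\<lambda>\<theta>. (cmod (g (of_real \<rho> * cis \<theta>) - G \<theta>))\<^sup>2)) \<longlongrightarrow> 0) (at_left 1)"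
  proof (rule tendsto_sandwich[OF _ _ tendsto_const])
    show "((\<lambda>\<rho>. 2 * pi * \<epsilon> \<rho>) \<longlongrightarrow> 0) (at_left 1)" using tendsto_mult_left[OF \<epsilon>0, of "2*pi"] by simp
    have "\<forall>\<^sub>F \<rho> in at_left 1. 0 < \<rho> \<and> \<rho> < (1::real)"
      by (rule ev01)
    thus "\<forall>\<^sub>F \<rho> in at_left 1. integral\<^sup>L (lebesgue_on J) (\<lambda>\<theta>. (cmod (g (of_real \<rho> * cis \<theta>) - G \<theta>))\<^sup>2) \<le> 2 * pi * \<epsilon> \<rho>"
      by eventually_elim (use L2 in auto)
  qed (auto intro!: always_eventually)
  have 2: "AE \<theta> in lebesgue_on J. ((\<lambda>\<rho>. g (of_real \<rho> * cis \<theta>)) \<longlongrightarrow> G \<theta>) (at_left 1)"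
  proof -
    have "AE \<theta> in lebesgue. \<theta> \<notin> N" using N(1) by (intro AE_not_in) (simp add: negligible_iff_null_sets)
    thus ?thesis using radial by (auto simp: AE_restrict_space_iff J_def elim!: eventually_mono)
  qed
  show ?thesis
    using that[of G] meas_J[OF G_meas] 2 3 4 unfolding J_def by blast
qed

subsection \<open>The Hardy space of an annulus\<close>

lemma open_annulus [simp]: "open (annulus r R)"
  unfolding annulus_def by (intro open_Collect_conj open_Collect_less continuous_intros)

lemma annulus_iff: "z \<in> annulus r R \<longleftrightarrow> r < cmod z \<and> cmod z < R"
  by (simp add: annulus_def)

lemma of_real_cis_in_annulus: "0 \<le> r \<Longrightarrow> r < \<rho> \<Longrightarrow> \<rho> < R \<Longrightarrow> of_real \<rho> * cis \<theta> \<in> annulus r R"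
  by (simp add: annulus_iff norm_mult)

lemma contour_integral_circlepath_radius_independent:
  assumes hol: "f holomorphic_on annulus r R" and \<rho>: "0 \<le> r" "r < \<rho>1" "\<rho>1 < R" "r < \<rho>2" "\<rho>2 < R"
  shows "contour_integral (circlepath 0 \<rho>1) f = contour_integral (circlepath 0 \<rho>2) f"
proof (rule Cauchy_theorem_homotopic_loops[OF _ open_annulus hol])
  show "homotopic_loops (annulus r R) (circlepath 0 \<rho>1) (circlepath 0 \<rho>2)"
  proof (rule homotopic_loops_linear)
    fix t :: real assume "t \<in> {0..1}"
    show "closed_segment (circlepath 0 \<rho>1 t) (circlepath 0 \<rho>2 t) \<subseteq> annulus r R"
    proof
      fix w assume "w \<in> closed_segment (circlepath 0 \<rho>1 t) (circlepath 0 \<rho>2 t)"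
      then obtain u where u: "0 \<le> u" "u \<le> 1" "w = (1 - u) *\<^sub>R circlepath 0 \<rho>1 t + u *\<^sub>R circlepath 0 \<rho>2 t"
        by (auto simp: closed_segment_def)
      have "w = of_real ((1 - u) * \<rho>1 + u * \<rho>2) * exp (2 * of_real pi * \<i> * of_real t)"
        by (simp add: u(3) circlepath scaleR_conv_of_real algebra_simps)
      hence "cmod w = \<bar>(1 - u) * \<rho>1 + u * \<rho>2\<bar>" by (simp only: norm_mult norm_of_real) simp
      moreover have "r < (1 - u) * \<rho>1 + u * \<rho>2" 
        using convex_bound_lt[of "-\<rho>1" "-r" "-\<rho>2" "1 - u" u] \<rho> u by (simp add: algebra_simps)
      moreover have "(1 - u) * \<rho>1 + u * \<rho>2 < R"
        using convex_bound_lt[of \<rho>1 R \<rho>2 "1 - u" u] \<rho> u by simp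
      ultimately show "w \<in> annulus r R" using \<rho> by (simp add: annulus_iff)
    qed
  qed auto
qed auto

text \<open>The difference quotient of \<open>f\<close> at \<open>z\<close> extends holomorphically
  over \<open>z\<close>, so its integrals over the two circles agree. The remaining kernel
  \<open>1 / (w - z)\<close> contributes only on the circle that encloses \<open>z\<close>.\<close>

lemma Cauchy_integral_annulus:
  assumes hol: "f holomorphic_on annulus r R" and r: "0 \<le> r" "r < \<rho>1" "\<rho>1 < cmod z" "cmod z < \<rho>2" "\<rho>2 < R"
  shows "2 * of_real pi * \<i> * f z =
    contour_integral (circlepath 0 \<rho>2) (\<lambda>w. f w / (w - z)) - contour_integral (circlepath 0 \<rho>1) (\<lambda>w. f w / (w - z))"
proof -
  define h where "h w = (if w = z then deriv f z else (f w - f z) / (w - z))" for w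
  have z: "z \<in> annulus r R" using r by (simp add: annulus_iff)
  have holh: "h holomorphic_on annulus r R"
    unfolding h_def by (rule pole_lemma[OF hol]) (use z in \<open>simp add: interior_open\<close>)
  have eq: "contour_integral (circlepath 0 \<rho>1) h = contour_integral (circlepath 0 \<rho>2) h"
    by (rule contour_integral_circlepath_radius_independent[OF holh]) (use r in auto)
  have split: "contour_integral (circlepath 0 \<rho>) (\<lambda>w. f w / (w - z)) =
      contour_integral (circlepath 0 \<rho>) h + f z * contour_integral (circlepath 0 \<rho>) (\<lambda>w. 1 / (w - z))"
    if "r < \<rho>" "\<rho> < R" "\<rho> \<noteq> cmod z" for \<rho>
  proof -
    have sub: "sphere 0 \<rho> \<subseteq> annulus r R" using that r by (auto simp: annulus_iff)
    have nz: "w - z \<noteq> 0" if "w \<in> sphere 0 \<rho>" for w using that \<open>\<rho> \<noteq> cmod z\<close> by auto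
    have lead_Q: "h contour_integrable_on circlepath 0 \<rho>"
      by (rule contour_integrable_continuous_circlepath)
         (use sub r that in \<open>auto intro: continuous_on_subset[OF holomorphic_on_imp_continuous_on[OF holh]]\<close>)
    have c2: "(\<lambda>w. f z * (1 / (w - z))) contour_integrable_on circlepath 0 \<rho>"
      by (rule contour_integrable_continuous_circlepath)
         (use nz r that in \<open>auto intro!: continuous_intros\<close>)
    have "contour_integral (circlepath 0 \<rho>) (\<lambda>w. f w / (w - z)) = contour_integral (circlepath 0 \<rho>) (\<lambda>w. h w + f z * (1 / (w - z)))"
    proof (rule contour_integral_cong[OF refl])
      fix w assume "w \<in> path_image (circlepath 0 \<rho>)"
      hence "w \<noteq> z" using nz r that by auto
      thus "f w / (w - z) = h w + f z * (1 / (w - z))" by (simp add: h_def diff_divide_distrib)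
    qed
    also have "\<dots> = contour_integral (circlepath 0 \<rho>) h + contour_integral (circlepath 0 \<rho>) (\<lambda>w. f z * (1 / (w - z)))"
      by (rule contour_integral_add[OF lead_Q c2])
    also have "contour_integral (circlepath 0 \<rho>) (\<lambda>w. f z * (1 / (w - z))) = f z * contour_integral (circlepath 0 \<rho>) (\<lambda>w. 1 / (w - z))"
    proof (rule contour_integral_lmul)
      show "(\<lambda>w. 1 / (w - z)) contour_integrable_on circlepath 0 \<rho>"
        by (rule contour_integrable_continuous_circlepath)
           (use nz r that in \<open>auto intro!: continuous_intros\<close>)
    qed
    finally show ?thesis .
  qed
  have "contour_integral (circlepath 0 \<rho>2) (\<lambda>w. 1 / (w - z)) = 2 * of_real pi * \<i> * 1"
    using r by (intro contour_integral_unique Cauchy_integral_circlepath_simple) auto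
  moreover have "contour_integral (circlepath 0 \<rho>1) (\<lambda>w. 1 / (w - z)) = 0"
  proof (rule contour_integral_unique, rule Cauchy_theorem_disc_simple[of _ 0 "cmod z"])
    show "(\<lambda>w. 1 / (w - z)) holomorphic_on ball 0 (cmod z)" by (intro holomorphic_intros) auto
  qed (use r in auto)
  ultimately show ?thesis using split[of \<rho>1] split[of \<rho>2] r eq by simp
qed

lemma holomorphic_on_Cauchy_transform:
  assumes "continuous_on (sphere 0 \<rho>) f" "0 < \<rho>"
  shows "(\<lambda>z. contour_integral (circlepath 0 \<rho>) (\<lambda>w. f w / (w - z))) holomorphic_on - sphere 0 \<rho>"
proof -
  have pi: "path_image (circlepath 0 \<rho>) = sphere 0 \<rho>" using assms by auto
  have int: "((\<lambda>u. f u / (u - w) ^ 1) has_contour_integral contour_integral (circlepath 0 \<rho>) (\<lambda>u. f u / (u - w))) (circlepath 0 \<rho>)"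
    if "w \<in> UNIV - path_image (circlepath 0 \<rho>)" for w
    using that assms unfolding power_one_right
    by (intro has_contour_integral_integral contour_integrable_continuous_circlepath)
       (auto intro!: continuous_intros simp: pi simp del: path_image_circlepath)
  show ?thesis
    unfolding holomorphic_on_open[OF open_Compl[OF closed_sphere]]
  proof (intro ballI exI)
    fix z :: complex assume "z \<in> - sphere 0 \<rho>"
    thus "((\<lambda>z. contour_integral (circlepath 0 \<rho>) (\<lambda>w. f w / (w - z))) has_field_derivative
      of_nat 1 * contour_integral (circlepath 0 \<rho>) (\<lambda>u. f u / (u - z) ^ Suc 1)) (at z)"
      by (intro Cauchy_next_derivative(2)[OF _ _ int _ open_UNIV, where B = "2 * pi * \<rho>"])
         (use assms pi in \<open>auto simp: vector_derivative_circlepath norm_mult\<close>)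
  qed
qed

section \<open>Quadratic means over circles\<close>

lemma circle_mean_square_alt:
  "circle_mean_square \<rho> f = integral\<^sup>L (lebesgue_on {0..2*pi}) (\<lambda>\<theta>. (cmod (f (of_real \<rho> * cis \<theta>)))\<^sup>2) / (2 * pi)"
  by (simp add: circle_mean_square_def set_lebesgue_integral_def integral_restrict_space)

lemma circle_mean_square_nonneg: "0 \<le> circle_mean_square \<rho> f"
  by (simp add: circle_mean_square_alt)

lemma continuous_on_circle_in_annulus:
  assumes "f holomorphic_on annulus r R" "0 \<le> r" "r < \<rho>" "\<rho> < R"
  shows "continuous_on A (\<lambda>\<theta>. f (of_real \<rho> * cis \<theta>))"
  by (intro continuous_on_compose2[OF holomorphic_on_imp_continuous_on[OF assms(1)]] continuous_intros)
     (use assms in \<open>auto simp: of_real_cis_in_annulus\<close>)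

lemma integrable_circle_sq:
  assumes "f holomorphic_on annulus r R" "0 \<le> r" "r < \<rho>" "\<rho> < R"
  shows "integrable (lebesgue_on {0..2*pi}) (\<lambda>\<theta>. (cmod (f (of_real \<rho> * cis \<theta>)))\<^sup>2)"
  by (intro continuous_imp_integrable_real continuous_intros continuous_on_circle_in_annulus[OF assms])

text \<open>The free weight \<open>t\<close> serves two purposes: small values prove continuity of
  the mean square, the optimal value gives the triangle inequality for the norm.\<close>

lemma norm_add_sq_le:
  fixes x y :: complex assumes "t > 0"
  shows "(cmod (x + y))\<^sup>2 \<le> (1 + t) * (cmod x)\<^sup>2 + (1 + 1 / t) * (cmod y)\<^sup>2"
proof -
  have "(cmod (x + y))\<^sup>2 \<le> (cmod x + cmod y)\<^sup>2" by (intro power_mono norm_triangle_ineq) auto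
  also have "\<dots> = (cmod x)\<^sup>2 + (cmod y)\<^sup>2 + 2 * cmod x * cmod y" by (simp add: power2_sum)
  also have "2 * cmod x * cmod y \<le> t * (cmod x)\<^sup>2 + (1 / t) * (cmod y)\<^sup>2"
  proof -
    have "0 \<le> (t * cmod x - cmod y)\<^sup>2" by simp
    hence "2 * (t * cmod x) * cmod y \<le> (t * cmod x)\<^sup>2 + (cmod y)\<^sup>2" by (simp add: power2_diff)
    hence "(2 * (t * cmod x) * cmod y) / t \<le> ((t * cmod x)\<^sup>2 + (cmod y)\<^sup>2) / t" using assms by (intro divide_right_mono) auto
    thus ?thesis using assms by (simp add: field_simps power2_eq_square)
  qed
  finally show ?thesis by (simp add: algebra_simps)
qed

lemma circle_mean_square_add_le:
  assumes f: "f holomorphic_on annulus r R" and g: "g holomorphic_on annulus r R"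
    and r: "0 \<le> r" "r < \<rho>" "\<rho> < R" and t: "t > 0"
  shows "circle_mean_square \<rho> (\<lambda>z. f z + g z) \<le> (1 + t) * circle_mean_square \<rho> f + (1 + 1 / t) * circle_mean_square \<rho> g"
proof -
  let ?M = "lebesgue_on {0..2*pi}"
  have h: "(\<lambda>z. f z + g z) holomorphic_on annulus r R" by (intro holomorphic_intros f g)
  have "integral\<^sup>L ?M (\<lambda>\<theta>. (cmod (f (of_real \<rho> * cis \<theta>) + g (of_real \<rho> * cis \<theta>)))\<^sup>2) \<le>
     integral\<^sup>L ?M (\<lambda>\<theta>. (1 + t) * (cmod (f (of_real \<rho> * cis \<theta>)))\<^sup>2 + (1 + 1/t) * (cmod (g (of_real \<rho> * cis \<theta>)))\<^sup>2)"
    by (intro integral_mono integrable_circle_sq[OF h r] norm_add_sq_le t Bochner_Integration.integrable_add integrable_mult_right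
           integrable_circle_sq[OF f r] integrable_circle_sq[OF g r])
  also have "\<dots> = (1 + t) * integral\<^sup>L ?M (\<lambda>\<theta>. (cmod (f (of_real \<rho> * cis \<theta>)))\<^sup>2) + (1 + 1/t) * integral\<^sup>L ?M (\<lambda>\<theta>. (cmod (g (of_real \<rho> * cis \<theta>)))\<^sup>2)"
    using integrable_circle_sq[OF f r] integrable_circle_sq[OF g r] by simp
  finally have "integral\<^sup>L ?M (\<lambda>\<theta>. (cmod (f (of_real \<rho> * cis \<theta>) + g (of_real \<rho> * cis \<theta>)))\<^sup>2) / (2*pi) \<le> \<dots> / (2*pi)"
    by (intro divide_right_mono) auto
  thus ?thesis unfolding circle_mean_square_alt by (simp add: add_divide_distrib)
qed

lemma circle_mean_square_cmult: "circle_mean_square \<rho> (\<lambda>z. c * f z) = (cmod c)\<^sup>2 * circle_mean_square \<rho> f"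
  by (simp add: circle_mean_square_alt norm_mult power_mult_distrib)

lemma circle_mean_square_le_sup:
  assumes "f holomorphic_on annulus r R" "0 \<le> r" "r < \<rho>" "\<rho> < R" "\<And>z. z \<in> annulus r R \<Longrightarrow> cmod (f z) \<le> c"
  shows "circle_mean_square \<rho> f \<le> c\<^sup>2"
proof -
  have "integral\<^sup>L (lebesgue_on {0..2*pi}) (\<lambda>\<theta>. (cmod (f (of_real \<rho> * cis \<theta>)))\<^sup>2) \<le> integral\<^sup>L (lebesgue_on {0..2*pi}) (\<lambda>\<theta>. c\<^sup>2)"
    by (intro integral_mono integrable_circle_sq[OF assms(1-4)] continuous_imp_integrable_real continuous_intros power_mono assms(5) of_real_cis_in_annulus assms(2-4)) auto
  also have "\<dots> = 2 * pi * c\<^sup>2" by (simp add: measure_restrict_space)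
  finally show ?thesis by (simp add: circle_mean_square_alt field_simps)
qed

lemma Bfun_nonneg_iff:
  fixes f :: "'a \<Rightarrow> real" assumes "\<And>x. 0 \<le> f x"
  shows "Bfun f F \<longleftrightarrow> (\<exists>C. \<forall>\<^sub>F x in F. f x \<le> C)"
proof
  assume "Bfun f F"
  then obtain B where "\<forall>\<^sub>F x in F. norm (f x) \<le> B" by (rule BfunE)
  hence "\<forall>\<^sub>F x in F. f x \<le> B" by eventually_elim auto
  thus "\<exists>C. \<forall>\<^sub>F x in F. f x \<le> C" ..
next
  assume "\<exists>C. \<forall>\<^sub>F x in F. f x \<le> C"
  then obtain C where "\<forall>\<^sub>F x in F. f x \<le> C" by blast
  thus "Bfun f F" using assms by (intro BfunI[of _ C]) (auto elim!: eventually_mono)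
qed

text \<open>\<open>norm_add_sq_le\<close> is applied in both directions, with \<open>t\<close> so
  small that \<open>t\<close> times the limit integral stays below \<open>e / 2\<close>; the terms
  weighted by \<open>1 + 1 / t\<close> are then eventually small.\<close>

lemma tendsto_integral_norm_sq:
  fixes X :: "'b \<Rightarrow> 'a \<Rightarrow> complex"
  assumes X: "\<forall>\<^sub>F i in F. integrable M (\<lambda>x. (cmod (X i x))\<^sup>2)"
    and D: "\<forall>\<^sub>F i in F. integrable M (\<lambda>x. (cmod (X i x - Y x))\<^sup>2)"
    and Y: "integrable M (\<lambda>x. (cmod (Y x))\<^sup>2)"
    and lim: "((\<lambda>i. integral\<^sup>L M (\<lambda>x. (cmod (X i x - Y x))\<^sup>2)) \<longlongrightarrow> 0) F"
  shows "((\<lambda>i. integral\<^sup>L M (\<lambda>x. (cmod (X i x))\<^sup>2)) \<longlongrightarrow> integral\<^sup>L M (\<lambda>x. (cmod (Y x))\<^sup>2)) F"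
proof (rule tendstoI)
  fix e :: real assume e: "e > 0"
  define a where "a = integral\<^sup>L M (\<lambda>x. (cmod (Y x))\<^sup>2)"
  have a: "a \<ge> 0" by (simp add: a_def)
  define t where "t = e / (2 * (a + 1))"
  have t: "t > 0" using e a by (simp add: t_def)
  have ta: "t * a < e / 2"
  proof -
    have "t * a < t * (a + 1)" using t by simp
    also have "\<dots> = e / 2" using a by (simp add: t_def field_simps)
    finally show ?thesis .
  qed
  have "((\<lambda>i. (1 + 1/t) * integral\<^sup>L M (\<lambda>x. (cmod (X i x - Y x))\<^sup>2)) \<longlongrightarrow> (1 + 1/t) * 0) F"
    by (intro tendsto_mult_left lim)
  from order_tendstoD(2)[OF this, of "e/2"]
  have "\<forall>\<^sub>F i in F. (1 + 1/t) * integral\<^sup>L M (\<lambda>x. (cmod (X i x - Y x))\<^sup>2) < e / 2" using e by simp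
  thus "\<forall>\<^sub>F i in F. dist (integral\<^sup>L M (\<lambda>x. (cmod (X i x))\<^sup>2)) (integral\<^sup>L M (\<lambda>x. (cmod (Y x))\<^sup>2)) < e"
    using X D
  proof eventually_elim
    case (elim i)
    define x where "x = integral\<^sup>L M (\<lambda>x. (cmod (X i x))\<^sup>2)"
    define d where "d = integral\<^sup>L M (\<lambda>x. (cmod (X i x - Y x))\<^sup>2)"
    have le: "integral\<^sup>L M (\<lambda>x. (cmod (P x))\<^sup>2) \<le> (1 + t) * integral\<^sup>L M (\<lambda>x. (cmod (Q x))\<^sup>2) + (1 + 1/t) * d"
      if "integrable M (\<lambda>x. (cmod (P x))\<^sup>2)" "integrable M (\<lambda>x. (cmod (Q x))\<^sup>2)" "\<And>x. cmod (P x - Q x) = cmod (X i x - Y x)" for P Q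
    proof -
      have "integral\<^sup>L M (\<lambda>x. (cmod (P x))\<^sup>2) \<le> integral\<^sup>L M (\<lambda>x. (1 + t) * (cmod (Q x))\<^sup>2 + (1 + 1/t) * (cmod (X i x - Y x))\<^sup>2)"
      proof (intro integral_mono that(1) Bochner_Integration.integrable_add integrable_mult_right that(2) elim(3))
        fix y show "(cmod (P y))\<^sup>2 \<le> (1 + t) * (cmod (Q y))\<^sup>2 + (1 + 1/t) * (cmod (X i y - Y y))\<^sup>2"
          using norm_add_sq_le[OF t, of "Q y" "P y - Q y"] that(3)[of y] by simp
      qed
      also have "\<dots> = (1 + t) * integral\<^sup>L M (\<lambda>x. (cmod (Q x))\<^sup>2) + (1 + 1/t) * d"
        unfolding d_def using that(2) elim(3) by simp
      finally show ?thesis .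
    qed
    have 1: "x \<le> (1 + t) * a + (1 + 1/t) * d"
      unfolding x_def a_def by (rule le[OF elim(2) Y refl])
    have 2: "a \<le> (1 + t) * x + (1 + 1/t) * d"
      unfolding x_def a_def by (rule le[OF Y elim(2)]) (simp add: norm_minus_commute)
    have d: "(1 + 1/t) * d < e / 2" using elim(1) by (simp add: d_def)
    have u1: "x - a < e" using 1 d ta by (simp only: distrib_right mult_1)
    have "a - x < e"
    proof (cases "x \<le> a")
      case True
      have "t * x \<le> t * a" using True t by simp
      thus ?thesis using 2 d ta by (simp only: distrib_right mult_1)
    qed (use e in simp)
    with u1 show ?case by (simp add: dist_real_def abs_less_iff flip: x_def a_def)
  qed
qed

section \<open>Boundary values on an annulus\<close>

text \<open>Laurent splitting by Cauchy integrals: \<open>f = Fp - Fm\<close> with \<open>Fp\<close>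
  holomorphic inside the outer circle and \<open>Fm\<close> holomorphic outside a smaller one.
  \<open>Fm\<close> is continuous across the outer circle, so \<open>Fp\<close> inherits bounded
  means from \<open>f\<close> and \<open>fatou_disc\<close> applies to it after rescaling.\<close>

lemma hardy_outer_limit:
  assumes r: "0 < r" "r < R" and hol: "f holomorphic_on annulus r R"
    and bd: "Bfun (\<lambda>\<rho>. circle_mean_square \<rho> f) (at_left R)"
  obtains F where
    "F \<in> borel_measurable (lebesgue_on {0..2*pi})"
    "AE \<theta> in lebesgue_on {0..2*pi}. ((\<lambda>\<rho>. f (of_real \<rho> * cis \<theta>)) \<longlongrightarrow> F \<theta>) (at_left R)"
    "integrable (lebesgue_on {0..2*pi}) (\<lambda>\<theta>. (cmod (F \<theta>))\<^sup>2)"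
    "((\<lambda>\<rho>. circle_mean_square \<rho> f) \<longlongrightarrow> integral\<^sup>L (lebesgue_on {0..2*pi}) (\<lambda>\<theta>. (cmod (F \<theta>))\<^sup>2) / (2*pi)) (at_left R)"
proof -
  let ?J = "lebesgue_on {0..2*pi}"
  have R: "R > 0" using r by simp
  define t where "t = (r + R) / 2"
  define t1 where "t1 = (t + R) / 2"
  have t_aux: "r < t" "0 < t" "t < R" using r by (auto simp: t_def)
  hence t: "r < t" "0 < t" "t < R" "t < t1" "t1 < R" "0 < t1" by (auto simp: t1_def)
  define CT where "CT \<rho> z = contour_integral (circlepath 0 \<rho>) (\<lambda>w. f w / (w - z)) / (2 * of_real pi * \<i>)" for \<rho> z
  define Fm where "Fm = CT t"
  \<comment> \<open>A radius beyond both \<open>t\<close> and \<open>cmod z\<close>. As the Cauchy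
    integral does not depend on the choice of such a radius, the transforms fit together to one
    function on the whole disc.\<close>
  define rad where "rad z = (max t (cmod z) + R) / 2" for z :: complex
  define Fp where "Fp z = CT (rad z) z" for z
  have cont_sphere: "continuous_on (sphere 0 \<rho>) f" if "r < \<rho>" "\<rho> < R" for \<rho>
    by (rule continuous_on_subset[OF holomorphic_on_imp_continuous_on[OF hol]]) (use that in \<open>auto simp: annulus_iff\<close>)
  have CT_hol: "CT \<rho> holomorphic_on - sphere 0 \<rho>" if "r < \<rho>" "\<rho> < R" for \<rho>
    unfolding CT_def by (intro holomorphic_intros holomorphic_on_Cauchy_transform cont_sphere) (use that r in auto)
  have Fp_eq: "Fp z = CT \<rho> z" if "cmod z < \<rho>" "t \<le> \<rho>" "\<rho> < R" for z \<rho>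
  proof -
    have "contour_integral (circlepath 0 (rad z)) (\<lambda>w. f w / (w - z)) = contour_integral (circlepath 0 \<rho>) (\<lambda>w. f w / (w - z))"
    proof (rule contour_integral_circlepath_radius_independent)
      show "(\<lambda>w. f w / (w - z)) holomorphic_on annulus (max r (cmod z)) R"
        by (intro holomorphic_intros holomorphic_on_subset[OF hol]) (auto simp: annulus_iff)
    qed (use that t r in \<open>auto simp: rad_def\<close>)
    thus ?thesis by (simp add: Fp_def CT_def)
  qed
  have Fp_hol: "Fp holomorphic_on ball 0 R"
    unfolding holomorphic_on_open[OF open_ball]
  proof
    fix z :: complex assume z: "z \<in> ball 0 R"
    have rz: "cmod z < rad z" "t \<le> rad z" "rad z < R" using z t by (auto simp: rad_def max_def)
    have "CT (rad z) field_differentiable at z"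
      by (rule holomorphic_on_imp_differentiable_at[OF holomorphic_on_subset[OF CT_hol, of _ "ball 0 (rad z)"]])
         (use rz t in auto)
    then obtain D where "(CT (rad z) has_field_derivative D) (at z)" by (auto simp: field_differentiable_def)
    hence "(Fp has_field_derivative D) (at z)"
      by (rule has_field_derivative_transform_within_open[of _ _ _ "ball 0 (rad z)"]) (use rz Fp_eq in auto)
    thus "\<exists>D. (Fp has_field_derivative D) (at z)" ..
  qed
  have Fm_hol: "Fm holomorphic_on {z. t < cmod z}"
    unfolding Fm_def by (rule holomorphic_on_subset[OF CT_hol]) (use t in auto)
  have f_eq: "f z = Fp z - Fm z" if "t < cmod z" "cmod z < R" for z
  proof -
    have rz: "cmod z < rad z" "rad z < R" using that t by (auto simp: rad_def max_def)
    have "2 * of_real pi * \<i> * f z = contour_integral (circlepath 0 (rad z)) (\<lambda>w. f w / (w - z)) - contour_integral (circlepath 0 t) (\<lambda>w. f w / (w - z))"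
      by (rule Cauchy_integral_annulus[OF hol]) (use t rz that r in auto)
    thus ?thesis by (simp add: Fp_def Fm_def CT_def field_simps)
  qed
  define K where "K = {z. t1 \<le> cmod z \<and> cmod z \<le> R}"
  have K_compact: "compact K"
  proof -
    have "K = cball 0 R - ball 0 t1" by (auto simp: K_def)
    thus ?thesis by (simp add: compact_diff)
  qed
  have Fm_K: "continuous_on K Fm"
    by (rule continuous_on_subset[OF holomorphic_on_imp_continuous_on[OF Fm_hol]]) (use t in \<open>auto simp: K_def\<close>)
  obtain c where c: "\<And>z. z \<in> K \<Longrightarrow> cmod (Fm z) \<le> c"
    using compact_imp_bounded[OF compact_continuous_image[OF Fm_K K_compact]] by (auto simp: bounded_iff)
  have div_le: "X \<le> 2 * pi * Y" if "X / (2 * pi) \<le> Y" for X Y :: real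
    using that by (simp add: field_simps)
  obtain C0 where C0: "\<forall>\<^sub>F \<rho> in at_left R. circle_mean_square \<rho> f \<le> C0"
    using bd by (auto simp: Bfun_nonneg_iff circle_mean_square_nonneg)
  have evR: "\<forall>\<^sub>F \<rho> in at_left R. t1 < \<rho> \<and> \<rho> < R"
  proof (rule eventually_conj)
    show "\<forall>\<^sub>F \<rho> in at_left R. t1 < \<rho>" using t by (intro order_tendstoD[OF tendsto_ident_at]) auto
    show "\<forall>\<^sub>F \<rho> in at_left R. \<rho> < R" by (simp add: eventually_at_filter)
  qed
  define g where "g z = Fp (of_real R * z)" for z
  have g_hol: "g holomorphic_on ball 0 1"
    unfolding g_def
    by (intro holomorphic_on_compose_gen[OF _ Fp_hol, unfolded o_def] holomorphic_intros)
       (use R in \<open>auto simp: norm_mult\<close>)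
  have scale1: "filterlim (\<lambda>\<rho>. R * \<rho>) (at_left R) (at_left 1)"
    unfolding filterlim_at
  proof (intro conjI)
    show "((\<lambda>\<rho>. R * \<rho>) \<longlongrightarrow> R) (at_left 1)" by (auto intro!: tendsto_eq_intros)
    have "\<forall>\<^sub>F \<rho> in at_left 1. \<rho> < (1::real)" by (simp add: eventually_at_filter)
    thus "\<forall>\<^sub>F \<rho> in at_left 1. R * \<rho> \<in> {..<R} \<and> R * \<rho> \<noteq> R" by eventually_elim (use R in auto)
  qed
  have scale2: "filterlim (\<lambda>\<rho>. \<rho> / R) (at_left 1) (at_left R)"
    unfolding filterlim_at
  proof (intro conjI)
    show "((\<lambda>\<rho>. \<rho> / R) \<longlongrightarrow> 1) (at_left R)" using R by (auto intro!: tendsto_eq_intros)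
    have "\<forall>\<^sub>F \<rho> in at_left R. \<rho> < R" by (simp add: eventually_at_filter)
    thus "\<forall>\<^sub>F \<rho> in at_left R. \<rho> / R \<in> {..<1} \<and> \<rho> / R \<noteq> 1" by eventually_elim (use R in auto)
  qed
  have g_bd: "\<forall>\<^sub>F \<rho> in at_left 1. integral {0..2*pi} (\<lambda>\<theta>. (cmod (g (of_real \<rho> * cis \<theta>)))\<^sup>2) \<le> 2 * pi * (2 * C0 + 2 * c\<^sup>2)"
    using filterlim_iff[THEN iffD1, OF scale1, rule_format, OF evR] filterlim_iff[THEN iffD1, OF scale1, rule_format, OF C0]
  proof eventually_elim
    case (elim \<rho>)
    have hf: "f holomorphic_on annulus t1 R" and hm: "Fm holomorphic_on annulus t1 R"
      by (rule holomorphic_on_subset[OF hol] holomorphic_on_subset[OF Fm_hol]; use t in \<open>auto simp: annulus_iff\<close>)+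
    have hs: "(\<lambda>z. f z + Fm z) holomorphic_on annulus t1 R" by (intro holomorphic_intros hf hm)
    have "circle_mean_square (R * \<rho>) (\<lambda>z. f z + Fm z) \<le> (1 + 1) * circle_mean_square (R * \<rho>) f + (1 + 1 / 1) * circle_mean_square (R * \<rho>) Fm"
      by (rule circle_mean_square_add_le[OF hf hm]) (use elim t in auto)
    also have "circle_mean_square (R * \<rho>) Fm \<le> c\<^sup>2"
      by (rule circle_mean_square_le_sup[OF hm]) (use elim t c in \<open>auto simp: annulus_iff K_def\<close>)
    finally have 1: "circle_mean_square (R * \<rho>) (\<lambda>z. f z + Fm z) \<le> 2 * C0 + 2 * c\<^sup>2" using elim(2) by simp
    have A: "integral\<^sup>L ?J (\<lambda>\<theta>. (cmod (f (of_real (R * \<rho>) * cis \<theta>) + Fm (of_real (R * \<rho>) * cis \<theta>)))\<^sup>2)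
        = integral {0..2*pi} (\<lambda>\<theta>. (cmod (f (of_real (R * \<rho>) * cis \<theta>) + Fm (of_real (R * \<rho>) * cis \<theta>)))\<^sup>2)"
      by (rule lebesgue_integral_eq_integral[OF integrable_circle_sq[OF hs]]) (use elim t in auto)
    have B: "(\<lambda>\<theta>. (cmod (f (of_real (R * \<rho>) * cis \<theta>) + Fm (of_real (R * \<rho>) * cis \<theta>)))\<^sup>2) = (\<lambda>\<theta>. (cmod (g (of_real \<rho> * cis \<theta>)))\<^sup>2)"
    proof
      fix \<theta>
      have "f (of_real (R * \<rho>) * cis \<theta>) = Fp (of_real (R * \<rho>) * cis \<theta>) - Fm (of_real (R * \<rho>) * cis \<theta>)"
      proof (rule f_eq)
        have "cmod (of_real (R * \<rho>) * cis \<theta>) = R * \<rho>" using elim t by (simp only: norm_mult norm_of_real norm_cis) simp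
        thus "t < cmod (of_real (R * \<rho>) * cis \<theta>)" "cmod (of_real (R * \<rho>) * cis \<theta>) < R" using elim t by auto
      qed
      thus "(cmod (f (of_real (R * \<rho>) * cis \<theta>) + Fm (of_real (R * \<rho>) * cis \<theta>)))\<^sup>2 = (cmod (g (of_real \<rho> * cis \<theta>)))\<^sup>2"
        by (simp add: g_def mult.assoc)
    qed
    have "integral\<^sup>L ?J (\<lambda>\<theta>. (cmod (f (of_real (R * \<rho>) * cis \<theta>) + Fm (of_real (R * \<rho>) * cis \<theta>)))\<^sup>2) \<le> 2 * pi * (2 * C0 + 2 * c\<^sup>2)"
      using 1 unfolding circle_mean_square_alt by (rule div_le)
    thus ?case unfolding A unfolding B .
  qed
  obtain G where G: "G \<in> borel_measurable ?J"
    "AE \<theta> in ?J. ((\<lambda>\<rho>. g (of_real \<rho> * cis \<theta>)) \<longlongrightarrow> G \<theta>) (at_left 1)"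
    "integrable ?J (\<lambda>\<theta>. (cmod (G \<theta>))\<^sup>2)"
    "((\<lambda>\<rho>. integral\<^sup>L ?J (\<lambda>\<theta>. (cmod (g (of_real \<rho> * cis \<theta>) - G \<theta>))\<^sup>2)) \<longlongrightarrow> 0) (at_left 1)"
    using fatou_disc[OF g_hol g_bd] by blast
  have gFp: "g (of_real (\<rho> / R) * cis \<theta>) = Fp (of_real \<rho> * cis \<theta>)" for \<rho> \<theta> using R by (simp add: g_def)
  define F where "F \<theta> = G \<theta> - Fm (of_real R * cis \<theta>)" for \<theta>
  have RK: "of_real \<rho> * cis \<theta> \<in> K" if "t1 \<le> \<rho>" "\<rho> \<le> R" for \<rho> \<theta>
    using that t by (simp add: K_def norm_mult)
  have cont_FmR: "continuous_on A (\<lambda>\<theta>. Fm (of_real \<rho> * cis \<theta>))" if "t1 \<le> \<rho>" "\<rho> \<le> R" for \<rho> A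
    by (intro continuous_on_compose2[OF Fm_K] continuous_intros) (use RK that in auto)
  have meas_FmR: "(\<lambda>\<theta>. Fm (of_real \<rho> * cis \<theta>)) \<in> borel_measurable ?J" if "t1 \<le> \<rho>" "\<rho> \<le> R" for \<rho>
    by (rule continuous_imp_measurable_on_sets_lebesgue[OF cont_FmR[OF that]]) simp
  have F_meas: "F \<in> borel_measurable ?J" unfolding F_def
    by (intro borel_measurable_diff G(1) meas_FmR) (use t in auto)
  have F_lim: "AE \<theta> in ?J. ((\<lambda>\<rho>. f (of_real \<rho> * cis \<theta>)) \<longlongrightarrow> F \<theta>) (at_left R)"
    using G(2)
  proof eventually_elim
    case (elim \<theta>)
    have l1: "((\<lambda>\<rho>. Fp (of_real \<rho> * cis \<theta>)) \<longlongrightarrow> G \<theta>) (at_left R)"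
      using filterlim_compose[OF elim scale2] by (simp only: gFp)
    have "continuous_on {z. t < cmod z} Fm" by (rule holomorphic_on_imp_continuous_on[OF Fm_hol])
    hence c: "isCont Fm (of_real R * cis \<theta>)"
      by (rule continuous_on_interior) (use t R in \<open>auto simp: interior_open open_Collect_less continuous_intros norm_mult\<close>)
    have l: "((\<lambda>\<rho>. of_real \<rho> * cis \<theta>) \<longlongrightarrow> of_real R * cis \<theta>) (at_left R)" by (intro tendsto_intros)
    have "((\<lambda>\<rho>. Fm (of_real \<rho> * cis \<theta>)) \<longlongrightarrow> Fm (of_real R * cis \<theta>)) (at_left R)"
      by (rule isCont_tendsto_compose[OF c l])
    hence "((\<lambda>\<rho>. Fp (of_real \<rho> * cis \<theta>) - Fm (of_real \<rho> * cis \<theta>)) \<longlongrightarrow> F \<theta>) (at_left R)"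
      unfolding F_def by (intro tendsto_diff l1)
    moreover have "\<forall>\<^sub>F \<rho> in at_left R. Fp (of_real \<rho> * cis \<theta>) - Fm (of_real \<rho> * cis \<theta>) = f (of_real \<rho> * cis \<theta>)"
      using evR by eventually_elim (subst f_eq, use t in \<open>auto simp: norm_mult\<close>)
    ultimately show ?case by (rule Lim_transform_eventually)
  qed
  have sq_add: "integrable ?J (\<lambda>\<theta>. (cmod (u \<theta> - v \<theta>))\<^sup>2)"
    if [measurable]: "u \<in> borel_measurable ?J" "v \<in> borel_measurable ?J"
    and "integrable ?J (\<lambda>\<theta>. (cmod (u \<theta>))\<^sup>2)" "integrable ?J (\<lambda>\<theta>. (cmod (v \<theta>))\<^sup>2)" for u v :: "real \<Rightarrow> complex"
  proof (rule Bochner_Integration.integrable_bound)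
    show "integrable ?J (\<lambda>\<theta>. 2 * (cmod (u \<theta>))\<^sup>2 + 2 * (cmod (v \<theta>))\<^sup>2)" using that by simp
    show "AE \<theta> in ?J. norm ((cmod (u \<theta> - v \<theta>))\<^sup>2) \<le> norm (2 * (cmod (u \<theta>))\<^sup>2 + 2 * (cmod (v \<theta>))\<^sup>2)"
    proof (rule AE_I2)
      fix \<theta>
      show "norm ((cmod (u \<theta> - v \<theta>))\<^sup>2) \<le> norm (2 * (cmod (u \<theta>))\<^sup>2 + 2 * (cmod (v \<theta>))\<^sup>2)"
        using norm_add_sq_le[of 1 "u \<theta>" "- v \<theta>"] by simp
    qed
  qed simp
  have int_FmR: "integrable ?J (\<lambda>\<theta>. (cmod (Fm (of_real \<rho> * cis \<theta>)))\<^sup>2)" if "t1 \<le> \<rho>" "\<rho> \<le> R" for \<rho>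
    by (intro continuous_imp_integrable_real continuous_intros cont_FmR that)
  have F_sq: "integrable ?J (\<lambda>\<theta>. (cmod (F \<theta>))\<^sup>2)"
    unfolding F_def by (intro sq_add G meas_FmR int_FmR) (use t in auto)
  have fint: "integrable ?J (\<lambda>\<theta>. (cmod (f (of_real \<rho> * cis \<theta>)))\<^sup>2)" if "t1 < \<rho>" "\<rho> < R" for \<rho>
    by (rule integrable_circle_sq[OF hol]) (use that t r in auto)
  have fmeas: "(\<lambda>\<theta>. f (of_real \<rho> * cis \<theta>)) \<in> borel_measurable ?J" if "t1 < \<rho>" "\<rho> < R" for \<rho>
    by (rule continuous_imp_measurable_on_sets_lebesgue[OF continuous_on_circle_in_annulus[OF hol]]) (use that t r in auto)
  have Dint: "integrable ?J (\<lambda>\<theta>. (cmod (f (of_real \<rho> * cis \<theta>) - F \<theta>))\<^sup>2)" if "t1 < \<rho>" "\<rho> < R" for \<rho>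
    by (intro sq_add fmeas fint F_meas F_sq that)
  \<comment> \<open>The part \<open>Fp\<close> converges in the quadratic mean by
    \<open>fatou_disc\<close>, the part \<open>Fm\<close> uniformly, being uniformly continuous on
    the compact annulus \<open>K\<close>.\<close>
  have D0: "((\<lambda>\<rho>. integral\<^sup>L ?J (\<lambda>\<theta>. (cmod (f (of_real \<rho> * cis \<theta>) - F \<theta>))\<^sup>2)) \<longlongrightarrow> 0) (at_left R)"
  proof (rule tendstoI)
    fix e :: real assume e: "e > 0"
    define e1 where "e1 = sqrt (e / (8 * pi))"
    have e1: "e1 > 0" "e1\<^sup>2 = e / (8 * pi)" using e by (auto simp: e1_def)
    have "uniformly_continuous_on K Fm" by (rule compact_uniformly_continuous[OF Fm_K K_compact])
    then obtain d where d: "d > 0" "\<And>x y. x \<in> K \<Longrightarrow> y \<in> K \<Longrightarrow> dist y x < d \<Longrightarrow> dist (Fm y) (Fm x) < e1"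
      using e1 unfolding uniformly_continuous_on_def by blast
    have l: "((\<lambda>\<rho>. integral\<^sup>L ?J (\<lambda>\<theta>. (cmod (Fp (of_real \<rho> * cis \<theta>) - G \<theta>))\<^sup>2)) \<longlongrightarrow> 0) (at_left R)"
      using filterlim_compose[OF G(4) scale2] by (simp only: gFp)
    have "\<forall>\<^sub>F \<rho> in at_left R. integral\<^sup>L ?J (\<lambda>\<theta>. (cmod (Fp (of_real \<rho> * cis \<theta>) - G \<theta>))\<^sup>2) < e / 4"
      using order_tendstoD(2)[OF l, of "e/4"] e by simp
    moreover have "\<forall>\<^sub>F \<rho> in at_left R. R - d < \<rho>" using d by (intro order_tendstoD[OF tendsto_ident_at]) auto
    ultimately show "\<forall>\<^sub>F \<rho> in at_left R. dist (integral\<^sup>L ?J (\<lambda>\<theta>. (cmod (f (of_real \<rho> * cis \<theta>) - F \<theta>))\<^sup>2)) 0 < e"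
      using evR
    proof eventually_elim
      case (elim \<rho>)
      have Fpc: "continuous_on {0..2*pi} (\<lambda>\<theta>. Fp (of_real \<rho> * cis \<theta>))"
        by (intro continuous_on_compose2[OF holomorphic_on_imp_continuous_on[OF Fp_hol]] continuous_intros)
           (use elim t in \<open>auto simp: norm_mult\<close>)
      have Gi: "integrable ?J (\<lambda>\<theta>. (cmod (Fp (of_real \<rho> * cis \<theta>) - G \<theta>))\<^sup>2)"
        by (intro sq_add G continuous_imp_integrable_real continuous_intros Fpc continuous_imp_measurable_on_sets_lebesgue[OF Fpc]) simp
      have pw: "(cmod (f (of_real \<rho> * cis \<theta>) - F \<theta>))\<^sup>2 \<le> 2 * (cmod (Fp (of_real \<rho> * cis \<theta>) - G \<theta>))\<^sup>2 + 2 * e1\<^sup>2" for \<theta>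
      proof -
        have "dist (of_real \<rho> * cis \<theta>) (of_real R * cis \<theta>) < d"
        proof -
          have "of_real \<rho> * cis \<theta> - of_real R * cis \<theta> = of_real (\<rho> - R) * cis \<theta>" by (simp add: algebra_simps)
          hence "dist (of_real \<rho> * cis \<theta>) (of_real R * cis \<theta>) = \<bar>\<rho> - R\<bar>" by (simp only: dist_norm norm_mult norm_of_real norm_cis mult_1_right)
          thus ?thesis using elim by simp
        qed
        hence "dist (Fm (of_real \<rho> * cis \<theta>)) (Fm (of_real R * cis \<theta>)) < e1"
          by (intro d RK) (use elim t in auto)
        hence "(cmod (Fm (of_real R * cis \<theta>) - Fm (of_real \<rho> * cis \<theta>)))\<^sup>2 \<le> e1\<^sup>2"
          by (intro power_mono) (auto simp: dist_norm norm_minus_commute)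
        moreover have "f (of_real \<rho> * cis \<theta>) - F \<theta> = (Fp (of_real \<rho> * cis \<theta>) - G \<theta>) + (Fm (of_real R * cis \<theta>) - Fm (of_real \<rho> * cis \<theta>))"
          unfolding F_def by (subst f_eq) (use elim t in \<open>auto simp: norm_mult\<close>)
        ultimately show "(cmod (f (of_real \<rho> * cis \<theta>) - F \<theta>))\<^sup>2 \<le> 2 * (cmod (Fp (of_real \<rho> * cis \<theta>) - G \<theta>))\<^sup>2 + 2 * e1\<^sup>2"
          using norm_add_sq_le[of 1 "Fp (of_real \<rho> * cis \<theta>) - G \<theta>" "Fm (of_real R * cis \<theta>) - Fm (of_real \<rho> * cis \<theta>)"] by simp
      qed
      have "integral\<^sup>L ?J (\<lambda>\<theta>. (cmod (f (of_real \<rho> * cis \<theta>) - F \<theta>))\<^sup>2) \<le>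
         integral\<^sup>L ?J (\<lambda>\<theta>. 2 * (cmod (Fp (of_real \<rho> * cis \<theta>) - G \<theta>))\<^sup>2 + 2 * e1\<^sup>2)"
        by (rule integral_mono[OF _ _ pw]; intro Dint Bochner_Integration.integrable_add integrable_mult_right Gi continuous_imp_integrable_real continuous_on_const)
           (use elim in auto)
      also have "\<dots> = 2 * integral\<^sup>L ?J (\<lambda>\<theta>. (cmod (Fp (of_real \<rho> * cis \<theta>) - G \<theta>))\<^sup>2) + 2 * pi * (2 * e1\<^sup>2)"
        using Gi by (subst Bochner_Integration.integral_add) (auto simp: measure_restrict_space intro!: continuous_imp_integrable_real)
      also have "2 * pi * (2 * e1\<^sup>2) = e / 2" by (simp add: e1)
      finally show ?case using elim(1) by simp
    qed
  qed
  have "((\<lambda>\<rho>. integral\<^sup>L ?J (\<lambda>\<theta>. (cmod (f (of_real \<rho> * cis \<theta>)))\<^sup>2)) \<longlongrightarrow> integral\<^sup>L ?J (\<lambda>\<theta>. (cmod (F \<theta>))\<^sup>2)) (at_left R)"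
    by (rule tendsto_integral_norm_sq[OF _ _ F_sq D0]) (use evR fint Dint in \<open>auto elim!: eventually_mono\<close>)
  hence "((\<lambda>\<rho>. circle_mean_square \<rho> f) \<longlongrightarrow> integral\<^sup>L ?J (\<lambda>\<theta>. (cmod (F \<theta>))\<^sup>2) / (2*pi)) (at_left R)"
    unfolding circle_mean_square_alt by (intro tendsto_divide tendsto_const) auto
  thus ?thesis using that F_meas F_lim F_sq by blast
qed

text \<open>The reflection \<open>1 / cnj z\<close> exchanges the two boundary circles up to the
  radii, and conjugating the values keeps the function holomorphic; circle means are
  preserved.\<close>

lemma hardy_inner_limit:
  assumes r: "0 < r" "r < R" and hol: "f holomorphic_on annulus r R"
    and bd: "Bfun (\<lambda>\<rho>. circle_mean_square \<rho> f) (at_right r)"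
  obtains F where
    "F \<in> borel_measurable (lebesgue_on {0..2*pi})"
    "AE \<theta> in lebesgue_on {0..2*pi}. ((\<lambda>\<rho>. f (of_real \<rho> * cis \<theta>)) \<longlongrightarrow> F \<theta>) (at_right r)"
    "((\<lambda>\<rho>. circle_mean_square \<rho> f) \<longlongrightarrow> integral\<^sup>L (lebesgue_on {0..2*pi}) (\<lambda>\<theta>. (cmod (F \<theta>))\<^sup>2) / (2*pi)) (at_right r)"
proof -
  define h where "h = cnj \<circ> (\<lambda>z. f (1 / z)) \<circ> cnj"
  have h_hol: "h holomorphic_on annulus (1 / R) (1 / r)"
    unfolding h_def
  proof (rule holomorphic_on_compose_cnj_cnj)
    have inv: "w \<noteq> 0 \<and> 1 / w \<in> annulus r R" if "w \<in> cnj ` annulus (1 / R) (1 / r)" for w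
    proof -
      have w: "1 / R < cmod w" "cmod w < 1 / r" using that by (auto simp: annulus_iff)
      moreover have "0 < 1 / R" using r by simp
      ultimately have "0 < cmod w" by linarith
      thus ?thesis using w r by (auto simp: annulus_iff norm_divide field_simps)
    qed
    show "(\<lambda>z. f (1 / z)) holomorphic_on cnj ` annulus (1 / R) (1 / r)"
      by (intro holomorphic_on_compose_gen[OF _ hol, unfolded o_def] holomorphic_intros) (use inv in auto)
  qed simp
  have h_polar: "h (of_real (1 / \<rho>) * cis \<theta>) = cnj (f (of_real \<rho> * cis \<theta>))" for \<rho> \<theta>
    by (simp add: h_def cis_cnj divide_inverse mult.commute)
  have cms: "circle_mean_square (1 / \<rho>) h = circle_mean_square \<rho> f" for \<rho>
    by (simp only: circle_mean_square_alt h_polar complex_mod_cnj)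
  have inv1: "filterlim (\<lambda>\<rho>. 1 / \<rho>) (at_right r) (at_left (1 / r))"
    unfolding filterlim_at
  proof (intro conjI)
    show "((\<lambda>\<rho>. 1 / \<rho>) \<longlongrightarrow> r) (at_left (1 / r))" using r by (auto intro!: tendsto_eq_intros)
    have "\<forall>\<^sub>F \<rho> in at_left (1/r). \<rho> < 1/r" by (simp add: eventually_at_filter)
    moreover have "\<forall>\<^sub>F \<rho> in at_left (1/r). 0 < \<rho>" using r by (intro order_tendstoD[OF tendsto_ident_at]) auto
    ultimately show "\<forall>\<^sub>F \<rho> in at_left (1/r). 1 / \<rho> \<in> {r<..} \<and> 1 / \<rho> \<noteq> r"
      by eventually_elim (use r in \<open>auto simp: field_simps\<close>)
  qed
  have inv2: "filterlim (\<lambda>\<rho>. 1 / \<rho>) (at_left (1 / r)) (at_right r)"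
    unfolding filterlim_at
  proof (intro conjI)
    show "((\<lambda>\<rho>. 1 / \<rho>) \<longlongrightarrow> 1 / r) (at_right r)" using r by (auto intro!: tendsto_eq_intros)
    have "\<forall>\<^sub>F \<rho> in at_right r. r < \<rho>" by (simp add: eventually_at_filter)
    thus "\<forall>\<^sub>F \<rho> in at_right r. 1 / \<rho> \<in> {..<1/r} \<and> 1 / \<rho> \<noteq> 1 / r"
      by eventually_elim (use r in \<open>auto simp: field_simps\<close>)
  qed
  have "Bfun (\<lambda>\<rho>. circle_mean_square \<rho> h) (at_left (1 / r))"
  proof -
    obtain C where "\<forall>\<^sub>F \<rho> in at_right r. circle_mean_square \<rho> f \<le> C"
      using bd by (auto simp: Bfun_nonneg_iff circle_mean_square_nonneg)
    hence "\<forall>\<^sub>F \<rho> in at_left (1/r). circle_mean_square (1/\<rho>) f \<le> C" by (rule filterlim_iff[THEN iffD1, OF inv1, rule_format])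
    hence "\<forall>\<^sub>F \<rho> in at_left (1/r). circle_mean_square \<rho> h \<le> C"
      using cms[of "1 / \<rho>" for \<rho>] by (auto elim!: eventually_mono)
    thus ?thesis by (auto simp: Bfun_nonneg_iff circle_mean_square_nonneg)
  qed
  moreover have "0 < 1 / R" "1 / R < 1 / r" using r by (auto simp: field_simps)
  ultimately obtain F where F: "F \<in> borel_measurable (lebesgue_on {0..2*pi})"
    "AE \<theta> in lebesgue_on {0..2*pi}. ((\<lambda>\<rho>. h (of_real \<rho> * cis \<theta>)) \<longlongrightarrow> F \<theta>) (at_left (1/r))"
    "((\<lambda>\<rho>. circle_mean_square \<rho> h) \<longlongrightarrow> integral\<^sup>L (lebesgue_on {0..2*pi}) (\<lambda>\<theta>. (cmod (F \<theta>))\<^sup>2) / (2*pi)) (at_left (1/r))"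
    using hardy_outer_limit[OF _ _ h_hol] by blast
  show ?thesis
  proof (rule that[of "\<lambda>\<theta>. cnj (F \<theta>)"])
    show "(\<lambda>\<theta>. cnj (F \<theta>)) \<in> borel_measurable (lebesgue_on {0..2*pi})"
      by (rule borel_measurable_continuous_on[OF _ F(1)]) (intro continuous_intros)
    show "AE \<theta> in lebesgue_on {0..2*pi}. ((\<lambda>\<rho>. f (of_real \<rho> * cis \<theta>)) \<longlongrightarrow> cnj (F \<theta>)) (at_right r)"
      using F(2)
    proof eventually_elim
      case (elim \<theta>)
      from filterlim_compose[OF elim inv2] have "((\<lambda>\<rho>. cnj (f (of_real \<rho> * cis \<theta>))) \<longlongrightarrow> F \<theta>) (at_right r)"
        by (simp only: h_polar)
      from tendsto_cnj[OF this] show ?case by simp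
    qed
    show "((\<lambda>\<rho>. circle_mean_square \<rho> f) \<longlongrightarrow> integral\<^sup>L (lebesgue_on {0..2*pi}) (\<lambda>\<theta>. (cmod (cnj (F \<theta>)))\<^sup>2) / (2*pi)) (at_right r)"
      using filterlim_compose[OF F(3) inv2] by (simp only: cms complex_mod_cnj)
  qed
qed

text \<open>\<open>u\<close> will be a pointwise \<open>Lim\<close>, about whose measurability
  nothing is assumed. Completeness of Lebesgue measure transfers measurability of the integrand from
  \<open>F\<close>.\<close>

lemma set_lebesgue_integral_mult_cnj_AE:
  fixes u F :: "real \<Rightarrow> complex"
  assumes F: "F \<in> borel_measurable (lebesgue_on {a..b})" and u: "AE \<theta> in lebesgue_on {a..b}. u \<theta> = F \<theta>"
  shows "(LINT \<theta>:{a..b}|lebesgue. u \<theta> * cnj (u \<theta>)) = of_real (integral\<^sup>L (lebesgue_on {a..b}) (\<lambda>\<theta>. (cmod (F \<theta>))\<^sup>2))"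
proof -
  let ?U = "\<lambda>\<theta>. indicator {a..b} \<theta> *\<^sub>R (u \<theta> * cnj (u \<theta>))"
  let ?F = "\<lambda>\<theta>. indicator {a..b} \<theta> *\<^sub>R (F \<theta> * cnj (F \<theta>))"
  have "(\<lambda>\<theta>. cnj (F \<theta>)) \<in> borel_measurable (lebesgue_on {a..b})"
    by (rule borel_measurable_continuous_on[OF _ F]) (intro continuous_intros)
  hence "(\<lambda>\<theta>. F \<theta> * cnj (F \<theta>)) \<in> borel_measurable (lebesgue_on {a..b})" by (intro borel_measurable_times F)
  hence mF: "?F \<in> borel_measurable lebesgue" by (subst (asm) borel_measurable_restrict_space_iff) auto
  have AE: "AE \<theta> in lebesgue. ?F \<theta> = ?U \<theta>"
    using u by (auto simp: AE_restrict_space_iff indicator_def elim!: eventually_mono)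
  have "integral\<^sup>L lebesgue ?F = integral\<^sup>L lebesgue ?U"
    by (rule integral_cong_AE[OF mF borel_measurable_AE[OF mF AE] AE])
  moreover have "integral\<^sup>L lebesgue ?F = integral\<^sup>L (lebesgue_on {a..b}) (\<lambda>\<theta>. F \<theta> * cnj (F \<theta>))"
    by (simp add: integral_restrict_space)
  moreover have "(\<lambda>\<theta>. F \<theta> * cnj (F \<theta>)) = (\<lambda>\<theta>. of_real ((cmod (F \<theta>))\<^sup>2))"
    by (intro ext) (rule complex_norm_square[symmetric])
  ultimately show ?thesis unfolding set_lebesgue_integral_def by (simp only: integral_complex_of_real)
qed

section \<open>The Hardy norm\<close>

text \<open>The link between the norm and the interior of the annulus: scaling, triangle inequality
  and upper bounds become statements on circle means that survive the passage to the
  boundary.\<close>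

lemma hardy_norm_limits:
  assumes r: "0 < r" "r < R" and f: "f \<in> hardy_space r R"
  obtains Lo Li where "0 \<le> Lo" "0 \<le> Li" "((\<lambda>\<rho>. circle_mean_square \<rho> f) \<longlongrightarrow> Lo) (at_left R)"
    "((\<lambda>\<rho>. circle_mean_square \<rho> f) \<longlongrightarrow> Li) (at_right r)" "hardy_norm r R f = sqrt (Lo + Li)"
proof -
  have hol: "f holomorphic_on annulus r R" and b1: "Bfun (\<lambda>\<rho>. circle_mean_square \<rho> f) (at_left R)"
    and b2: "Bfun (\<lambda>\<rho>. circle_mean_square \<rho> f) (at_right r)" using f by (auto simp: hardy_space_def)
  obtain F where F: "F \<in> borel_measurable (lebesgue_on {0..2*pi})"
    "AE \<theta> in lebesgue_on {0..2*pi}. ((\<lambda>\<rho>. f (of_real \<rho> * cis \<theta>)) \<longlongrightarrow> F \<theta>) (at_left R)"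
    "((\<lambda>\<rho>. circle_mean_square \<rho> f) \<longlongrightarrow> integral\<^sup>L (lebesgue_on {0..2*pi}) (\<lambda>\<theta>. (cmod (F \<theta>))\<^sup>2) / (2*pi)) (at_left R)"
    using hardy_outer_limit[OF r hol b1] by blast
  obtain G where G: "G \<in> borel_measurable (lebesgue_on {0..2*pi})"
    "AE \<theta> in lebesgue_on {0..2*pi}. ((\<lambda>\<rho>. f (of_real \<rho> * cis \<theta>)) \<longlongrightarrow> G \<theta>) (at_right r)"
    "((\<lambda>\<rho>. circle_mean_square \<rho> f) \<longlongrightarrow> integral\<^sup>L (lebesgue_on {0..2*pi}) (\<lambda>\<theta>. (cmod (G \<theta>))\<^sup>2) / (2*pi)) (at_right r)"
    using hardy_inner_limit[OF r hol b2] by blast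
  have o: "AE \<theta> in lebesgue_on {0..2*pi}. outer_boundary_value R f \<theta> = F \<theta>"
    using F(2) by eventually_elim (auto simp: outer_boundary_value_def intro!: tendsto_Lim)
  have i: "AE \<theta> in lebesgue_on {0..2*pi}. inner_boundary_value r f \<theta> = G \<theta>"
    using G(2) by eventually_elim (auto simp: inner_boundary_value_def intro!: tendsto_Lim)
  have "hardy_inner r R f f = of_real (integral\<^sup>L (lebesgue_on {0..2*pi}) (\<lambda>\<theta>. (cmod (F \<theta>))\<^sup>2) / (2*pi)
       + integral\<^sup>L (lebesgue_on {0..2*pi}) (\<lambda>\<theta>. (cmod (G \<theta>))\<^sup>2) / (2*pi))"
    unfolding hardy_inner_def set_lebesgue_integral_mult_cnj_AE[OF F(1) o] set_lebesgue_integral_mult_cnj_AE[OF G(1) i]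
    by simp
  hence "hardy_norm r R f = sqrt (integral\<^sup>L (lebesgue_on {0..2*pi}) (\<lambda>\<theta>. (cmod (F \<theta>))\<^sup>2) / (2*pi)
       + integral\<^sup>L (lebesgue_on {0..2*pi}) (\<lambda>\<theta>. (cmod (G \<theta>))\<^sup>2) / (2*pi))"
    unfolding hardy_norm_def by (simp only: Re_complex_of_real)
  with F(3) G(3) show ?thesis by (intro that) auto
qed

lemma eventually_at_left_annulus:
  assumes "r < (R::real)" shows "\<forall>\<^sub>F \<rho> in at_left R. r < \<rho> \<and> \<rho> < R"
proof (rule eventually_conj)
  show "\<forall>\<^sub>F \<rho> in at_left R. r < \<rho>" using assms by (intro order_tendstoD[OF tendsto_ident_at])
qed (simp add: eventually_at_filter)

lemma eventually_at_right_annulus: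
  assumes "r < (R::real)" shows "\<forall>\<^sub>F \<rho> in at_right r. r < \<rho> \<and> \<rho> < R"
proof (rule eventually_conj)
  show "\<forall>\<^sub>F \<rho> in at_right r. \<rho> < R" using assms by (intro order_tendstoD[OF tendsto_ident_at])
qed (simp add: eventually_at_filter)

text \<open>A real form valid for every function. Nonnegativity and symmetry of a metric are
  demanded for all functions, also outside the space, where boundary limits may fail to
  exist.\<close>

lemma hardy_inner_self:
  "hardy_inner r R f f = of_real (
     (LINT \<theta>:{0..2*pi}|lebesgue. (cmod (outer_boundary_value R f \<theta>))\<^sup>2) / (2*pi) +
     (LINT \<theta>:{0..2*pi}|lebesgue. (cmod (inner_boundary_value r f \<theta>))\<^sup>2) / (2*pi))"
proof -
  have "(LINT \<theta>:{0..2*pi}|lebesgue. u \<theta> * cnj (u \<theta>)) = of_real (LINT \<theta>:{0..2*pi}|lebesgue. (cmod (u \<theta>))\<^sup>2)" for u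
  proof -
    have "indicator {0..2*pi} \<theta> *\<^sub>R (u \<theta> * cnj (u \<theta>)) = complex_of_real (indicator {0..2*pi} \<theta> *\<^sub>R (cmod (u \<theta>))\<^sup>2)" for \<theta>
      unfolding complex_norm_square[symmetric] by (simp add: scaleR_conv_of_real)
    thus ?thesis unfolding set_lebesgue_integral_def by (simp only: integral_complex_of_real)
  qed
  thus ?thesis by (simp add: hardy_inner_def)
qed

lemma hardy_norm_nonneg [simp]: "0 \<le> hardy_norm r R f"
  unfolding hardy_norm_def hardy_inner_self Re_complex_of_real set_lebesgue_integral_def
  by (intro real_sqrt_ge_zero add_nonneg_nonneg divide_nonneg_nonneg Bochner_Integration.integral_nonneg) auto

text \<open>If there is no limit, then \<open>h\<close> and \<open>- h\<close> receive the same
  unspecified value; otherwise their limits are opposite.\<close>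

lemma cmod_Lim_minus:
  fixes h :: "'a \<Rightarrow> complex"
  assumes "F \<noteq> bot"
  shows "cmod (Lim F (\<lambda>x. - h x)) = cmod (Lim F h)"
proof (cases "\<exists>l. (h \<longlongrightarrow> l) F")
  case True
  then obtain l where "(h \<longlongrightarrow> l) F" by blast
  thus ?thesis using tendsto_Lim[OF assms, of h l] tendsto_Lim[OF assms tendsto_minus, of h l] by simp
next
  case False
  hence "\<not> (\<exists>l. ((\<lambda>x. - h x) \<longlongrightarrow> l) F)" using tendsto_minus_cancel_left by blast
  with False have "Lim F (\<lambda>x. - h x) = Lim F h" unfolding Topological_Spaces.Lim_def by simp
  thus ?thesis by simp
qed

lemma hardy_norm_minus_commute:
  "hardy_norm r R (\<lambda>z. f z - g z) = hardy_norm r R (\<lambda>z. g z - f z)"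
proof -
  have "cmod (outer_boundary_value R (\<lambda>z. f z - g z) \<theta>) = cmod (outer_boundary_value R (\<lambda>z. g z - f z) \<theta>)" for \<theta>
    unfolding outer_boundary_value_def by (subst cmod_Lim_minus[symmetric]) auto
  moreover have "cmod (inner_boundary_value r (\<lambda>z. f z - g z) \<theta>) = cmod (inner_boundary_value r (\<lambda>z. g z - f z) \<theta>)" for \<theta>
    unfolding inner_boundary_value_def by (subst cmod_Lim_minus[symmetric]) auto
  ultimately show ?thesis by (simp only: hardy_norm_def hardy_inner_self)
qed

lemma hardy_space_zero: "(\<lambda>z. 0) \<in> hardy_space r R"
  by (auto simp: hardy_space_def circle_mean_square_def Bfun_nonneg_iff intro!: always_eventually exI[of _ 0])

lemma hardy_space_cmult:
  assumes "f \<in> hardy_space r R" shows "(\<lambda>z. c * f z) \<in> hardy_space r R"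
proof -
  have "Bfun (\<lambda>\<rho>. circle_mean_square \<rho> (\<lambda>z. c * f z)) F" if f: "Bfun (\<lambda>\<rho>. circle_mean_square \<rho> f) F" for F
  proof -
    obtain C where "\<forall>\<^sub>F \<rho> in F. circle_mean_square \<rho> f \<le> C"
      using f by (auto simp: Bfun_nonneg_iff circle_mean_square_nonneg)
    hence "\<forall>\<^sub>F \<rho> in F. circle_mean_square \<rho> (\<lambda>z. c * f z) \<le> (cmod c)\<^sup>2 * C"
      by eventually_elim (simp add: circle_mean_square_cmult mult_left_mono)
    thus ?thesis by (auto simp: Bfun_nonneg_iff circle_mean_square_nonneg)
  qed
  thus ?thesis using assms by (auto simp: hardy_space_def intro!: holomorphic_intros)
qed

lemma hardy_space_add:
  assumes r: "0 < r" "r < R" and f: "f \<in> hardy_space r R" and g: "g \<in> hardy_space r R"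
  shows "(\<lambda>z. f z + g z) \<in> hardy_space r R"
proof -
  have hf: "f holomorphic_on annulus r R" and hg: "g holomorphic_on annulus r R"
    using f g by (auto simp: hardy_space_def)
  have le: "circle_mean_square \<rho> (\<lambda>z. f z + g z) \<le> 2 * circle_mean_square \<rho> f + 2 * circle_mean_square \<rho> g"
    if "r < \<rho>" "\<rho> < R" for \<rho>
    using circle_mean_square_add_le[OF hf hg, of \<rho> 1] that r by simp
  have B: "Bfun (\<lambda>\<rho>. circle_mean_square \<rho> (\<lambda>z. f z + g z)) F"
    if bf: "Bfun (\<lambda>\<rho>. circle_mean_square \<rho> f) F" and bg: "Bfun (\<lambda>\<rho>. circle_mean_square \<rho> g) F"
      and ev: "\<forall>\<^sub>F \<rho> in F. r < \<rho> \<and> \<rho> < R" for F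
  proof -
    obtain C where "\<forall>\<^sub>F \<rho> in F. circle_mean_square \<rho> f \<le> C"
      using bf by (auto simp: Bfun_nonneg_iff circle_mean_square_nonneg)
    moreover obtain D where "\<forall>\<^sub>F \<rho> in F. circle_mean_square \<rho> g \<le> D"
      using bg by (auto simp: Bfun_nonneg_iff circle_mean_square_nonneg)
    ultimately have "\<forall>\<^sub>F \<rho> in F. circle_mean_square \<rho> (\<lambda>z. f z + g z) \<le> 2 * C + 2 * D"
      using ev
    proof eventually_elim
      case (elim \<rho>) with le[of \<rho>] show ?case by linarith
    qed
    thus ?thesis by (auto simp: Bfun_nonneg_iff circle_mean_square_nonneg)
  qed
  show ?thesis
    using f g eventually_at_left_annulus[OF r(2)] eventually_at_right_annulus[OF r(2)]
    by (auto simp: hardy_space_def intro!: holomorphic_intros B)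
qed

lemma hardy_space_diff:
  assumes r: "0 < r" "r < R" and f: "f \<in> hardy_space r R" and g: "g \<in> hardy_space r R"
  shows "(\<lambda>z. f z - g z) \<in> hardy_space r R"
  using hardy_space_add[OF r f hardy_space_cmult[OF g, of "-1"]] by simp

lemma hardy_norm_cmult:
  assumes r: "0 < r" "r < R" and f: "f \<in> hardy_space r R"
  shows "hardy_norm r R (\<lambda>z. c * f z) = cmod c * hardy_norm r R f"
proof -
  obtain Lo Li where L: "0 \<le> Lo" "0 \<le> Li" "((\<lambda>\<rho>. circle_mean_square \<rho> f) \<longlongrightarrow> Lo) (at_left R)"
    "((\<lambda>\<rho>. circle_mean_square \<rho> f) \<longlongrightarrow> Li) (at_right r)" "hardy_norm r R f = sqrt (Lo + Li)"
    by (rule hardy_norm_limits[OF r f])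
  obtain Mo Mi where M: "((\<lambda>\<rho>. circle_mean_square \<rho> (\<lambda>z. c * f z)) \<longlongrightarrow> Mo) (at_left R)"
    "((\<lambda>\<rho>. circle_mean_square \<rho> (\<lambda>z. c * f z)) \<longlongrightarrow> Mi) (at_right r)" "hardy_norm r R (\<lambda>z. c * f z) = sqrt (Mo + Mi)"
    by (rule hardy_norm_limits[OF r hardy_space_cmult[OF f]])
  have "Mo = (cmod c)\<^sup>2 * Lo" "Mi = (cmod c)\<^sup>2 * Li"
    using tendsto_unique[OF _ M(1)] tendsto_unique[OF _ M(2)] tendsto_mult_left[OF L(3)] tendsto_mult_left[OF L(4)]
    unfolding circle_mean_square_cmult by auto
  hence "Mo + Mi = (cmod c)\<^sup>2 * (Lo + Li)" by (simp add: distrib_left)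
  thus ?thesis by (simp add: M(3) L(5) real_sqrt_mult)
qed

text \<open>The weighted inequality for circle means passes to the limit on both circles with a
  common weight; optimising the weight then gives \<open>(x + y)^2\<close>.\<close>

lemma hardy_norm_triangle:
  assumes r: "0 < r" "r < R" and f: "f \<in> hardy_space r R" and g: "g \<in> hardy_space r R"
  shows "hardy_norm r R (\<lambda>z. f z + g z) \<le> hardy_norm r R f + hardy_norm r R g"
proof -
  have hf: "f holomorphic_on annulus r R" and hg: "g holomorphic_on annulus r R"
    using f g by (auto simp: hardy_space_def)
  obtain Lo Li where L: "0 \<le> Lo" "0 \<le> Li" "((\<lambda>\<rho>. circle_mean_square \<rho> f) \<longlongrightarrow> Lo) (at_left R)"
    "((\<lambda>\<rho>. circle_mean_square \<rho> f) \<longlongrightarrow> Li) (at_right r)" "hardy_norm r R f = sqrt (Lo + Li)"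
    by (rule hardy_norm_limits[OF r f])
  obtain Mo Mi where M: "0 \<le> Mo" "0 \<le> Mi" "((\<lambda>\<rho>. circle_mean_square \<rho> g) \<longlongrightarrow> Mo) (at_left R)"
    "((\<lambda>\<rho>. circle_mean_square \<rho> g) \<longlongrightarrow> Mi) (at_right r)" "hardy_norm r R g = sqrt (Mo + Mi)"
    by (rule hardy_norm_limits[OF r g])
  obtain No Ni where N: "0 \<le> No" "0 \<le> Ni" "((\<lambda>\<rho>. circle_mean_square \<rho> (\<lambda>z. f z + g z)) \<longlongrightarrow> No) (at_left R)"
    "((\<lambda>\<rho>. circle_mean_square \<rho> (\<lambda>z. f z + g z)) \<longlongrightarrow> Ni) (at_right r)" "hardy_norm r R (\<lambda>z. f z + g z) = sqrt (No + Ni)"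
    by (rule hardy_norm_limits[OF r hardy_space_add[OF r f g]])
  define x where "x = hardy_norm r R f"
  define y where "y = hardy_norm r R g"
  have x: "0 \<le> x" "x\<^sup>2 = Lo + Li" and y: "0 \<le> y" "y\<^sup>2 = Mo + Mi" using L M by (auto simp: x_def y_def)
  have le: "No + Ni \<le> (1 + t) * x\<^sup>2 + (1 + 1 / t) * y\<^sup>2" if t: "t > 0" for t
  proof -
    have ev: "circle_mean_square \<rho> (\<lambda>z. f z + g z) \<le> (1 + t) * circle_mean_square \<rho> f + (1 + 1 / t) * circle_mean_square \<rho> g"
      if "r < \<rho> \<and> \<rho> < R" for \<rho>
      using circle_mean_square_add_le[OF hf hg, of \<rho> t] that r t by simp
    have "No \<le> (1 + t) * Lo + (1 + 1 / t) * Mo"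
    proof (rule tendsto_le[OF _ _ N(3)])
      show "((\<lambda>\<rho>. (1 + t) * circle_mean_square \<rho> f + (1 + 1 / t) * circle_mean_square \<rho> g) \<longlongrightarrow> (1 + t) * Lo + (1 + 1 / t) * Mo) (at_left R)"
        by (intro tendsto_intros L M)
    qed (use eventually_mono[OF eventually_at_left_annulus[OF r(2)] ev] in auto)
    moreover have "Ni \<le> (1 + t) * Li + (1 + 1 / t) * Mi"
    proof (rule tendsto_le[OF _ _ N(4)])
      show "((\<lambda>\<rho>. (1 + t) * circle_mean_square \<rho> f + (1 + 1 / t) * circle_mean_square \<rho> g) \<longlongrightarrow> (1 + t) * Li + (1 + 1 / t) * Mi) (at_right r)"
        by (intro tendsto_intros L M)
    qed (use eventually_mono[OF eventually_at_right_annulus[OF r(2)] ev] in auto)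
    ultimately have "No + Ni \<le> ((1 + t) * Lo + (1 + 1 / t) * Mo) + ((1 + t) * Li + (1 + 1 / t) * Mi)" by (rule add_mono)
    thus ?thesis by (simp add: x y distrib_left)
  qed
  have "No + Ni \<le> (x + y)\<^sup>2"
  proof (rule field_le_epsilon)
    fix e :: real assume e: "e > 0"
    have "((\<lambda>d. (x + y + 2 * d)\<^sup>2) \<longlongrightarrow> (x + y + 2 * 0)\<^sup>2) (at_right 0)" by (intro tendsto_intros)
    hence "\<forall>\<^sub>F d in at_right 0. (x + y + 2 * d)\<^sup>2 < (x + y)\<^sup>2 + e"
      using order_tendstoD(2)[of _ "(x + y + 2 * 0)\<^sup>2" _ "(x + y)\<^sup>2 + e"] e by simp
    moreover have "\<forall>\<^sub>F d in at_right 0. 0 < (d::real)" by (simp add: eventually_at_filter)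
    ultimately have "\<forall>\<^sub>F d in at_right 0. (x + y + 2 * d)\<^sup>2 < (x + y)\<^sup>2 + e \<and> 0 < d"
      by (rule eventually_conj)
    from eventually_happens'[OF trivial_limit_at_right_real this] obtain d where d: "(x + y + 2 * d)\<^sup>2 < (x + y)\<^sup>2 + e" "0 < d" by blast
    \<comment> \<open>The optimal weight is \<open>y / x\<close>; the shift by \<open>d\<close>
      keeps it defined and positive when one of the norms vanishes.\<close>
    define t where "t = (y + d) / (x + d)"
    have xd: "x + d > 0" "y + d > 0" using x y d by auto
    have t: "t > 0" using xd by (simp add: t_def)
    have "No + Ni \<le> (1 + t) * x\<^sup>2 + (1 + 1 / t) * y\<^sup>2" by (rule le[OF t])
    also have "\<dots> \<le> (1 + t) * (x + d)\<^sup>2 + (1 + 1 / t) * (y + d)\<^sup>2"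
      using t d x y by (intro add_mono mult_left_mono power_mono) auto
    also have "\<dots> = (x + y + 2 * d)\<^sup>2"
      using xd unfolding t_def by (simp add: divide_simps) (simp add: power2_eq_square algebra_simps)
    finally show "No + Ni \<le> (x + y)\<^sup>2 + e" using d by simp
  qed
  hence "sqrt (No + Ni) \<le> sqrt ((x + y)\<^sup>2)" by (rule real_sqrt_le_mono)
  thus ?thesis using x y by (simp add: N(5) x_def y_def)
qed

text \<open>The factor \<open>sqrt 2\<close> stems from the two boundary circles.\<close>

lemma bounded_in_hardy_space:
  assumes r: "0 < r" "r < R" and hol: "f holomorphic_on annulus r R"
    and zero: "\<And>z. z \<notin> annulus r R \<Longrightarrow> f z = 0" and bd: "\<And>z. z \<in> annulus r R \<Longrightarrow> cmod (f z) \<le> c"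
  shows "f \<in> hardy_space r R" "hardy_norm r R f \<le> sqrt 2 * c"
proof -
  have le: "circle_mean_square \<rho> f \<le> c\<^sup>2" if "r < \<rho> \<and> \<rho> < R" for \<rho>
    using circle_mean_square_le_sup[OF hol _ _ _ bd, of \<rho>] that r by auto
  have e1: "\<forall>\<^sub>F \<rho> in at_left R. circle_mean_square \<rho> f \<le> c\<^sup>2"
    by (rule eventually_mono[OF eventually_at_left_annulus[OF r(2)] le])
  have e2: "\<forall>\<^sub>F \<rho> in at_right r. circle_mean_square \<rho> f \<le> c\<^sup>2"
    by (rule eventually_mono[OF eventually_at_right_annulus[OF r(2)] le])
  show f: "f \<in> hardy_space r R"
    unfolding hardy_space_def using hol zero e1 e2
    by (auto simp: Bfun_nonneg_iff circle_mean_square_nonneg)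
  obtain Lo Li where L: "0 \<le> Lo" "0 \<le> Li" "((\<lambda>\<rho>. circle_mean_square \<rho> f) \<longlongrightarrow> Lo) (at_left R)"
    "((\<lambda>\<rho>. circle_mean_square \<rho> f) \<longlongrightarrow> Li) (at_right r)" "hardy_norm r R f = sqrt (Lo + Li)"
    by (rule hardy_norm_limits[OF r f])
  have "of_real ((r + R) / 2) \<in> annulus r R" unfolding annulus_iff norm_of_real using r by simp
  hence c: "0 \<le> c" by (rule order_trans[OF norm_ge_zero bd])
  have "Lo \<le> c\<^sup>2" by (rule tendsto_upperbound[OF L(3) e1]) simp
  moreover have "Li \<le> c\<^sup>2" by (rule tendsto_upperbound[OF L(4) e2]) simp
  ultimately have "sqrt (Lo + Li) \<le> sqrt (2 * c\<^sup>2)" by (intro real_sqrt_le_mono) simp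
  thus "hardy_norm r R f \<le> sqrt 2 * c" using c by (simp add: L(5) real_sqrt_mult)
qed

section \<open>Point evaluations and the metric\<close>

text \<open>The crude \<open>x \<le> 1 + x^2\<close> plays the part of the Cauchy-Schwarz
  inequality; \<open>hardy_point_evaluation_bound\<close> restores homogeneity.\<close>

lemma Cauchy_transform_bound:
  assumes hol: "f holomorphic_on annulus r R" and r: "0 \<le> r" "r < \<rho>" "\<rho> < R"
    and d: "d > 0" "\<And>w. cmod w = \<rho> \<Longrightarrow> d \<le> cmod (w - z)"
  shows "cmod (contour_integral (circlepath 0 \<rho>) (\<lambda>w. f w / (w - z))) \<le> 2 * pi * (\<rho> / d * (1 + circle_mean_square \<rho> f))"
proof -
  let ?J = "lebesgue_on {0..2*pi}"
  define q where "q \<theta> = f (of_real \<rho> * cis \<theta>) / (of_real \<rho> * cis \<theta> - z) * of_real \<rho> * \<i> * cis \<theta>" for \<theta>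
  have ne: "of_real \<rho> * cis \<theta> - z \<noteq> 0" for \<theta> using d(2)[of "of_real \<rho> * cis \<theta>"] d(1) r by (auto simp: norm_mult)
  have qc: "continuous_on {0..2*pi} q" unfolding q_def
    by (intro continuous_intros continuous_on_circle_in_annulus[OF hol r] ballI ne)
  have qi: "(q has_integral integral {0..2*pi} q) {0..2*pi}"
    using integrable_continuous_interval[OF qc] by (rule integrable_integral)
  have "((\<lambda>w. f w / (w - z)) has_contour_integral integral {0..2*pi} q) (circlepath 0 \<rho>)"
    unfolding circlepath_def using qi by (subst has_contour_integral_part_circlepath_iff) (simp_all add: q_def[abs_def])
  hence eq: "contour_integral (circlepath 0 \<rho>) (\<lambda>w. f w / (w - z)) = integral {0..2*pi} q"
    by (rule contour_integral_unique)
  have "cmod (integral {0..2*pi} q) = cmod (integral\<^sup>L ?J q)"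
    by (simp add: lebesgue_integral_eq_integral continuous_imp_integrable_real qc)
  also have "\<dots> \<le> integral\<^sup>L ?J (\<lambda>\<theta>. cmod (q \<theta>))" by (rule integral_norm_bound)
  also have "\<dots> \<le> integral\<^sup>L ?J (\<lambda>\<theta>. \<rho> / d * (1 + (cmod (f (of_real \<rho> * cis \<theta>)))\<^sup>2))"
  proof (rule integral_mono)
    show "integrable ?J (\<lambda>\<theta>. cmod (q \<theta>))" by (intro integrable_norm continuous_imp_integrable_real qc)
    show "integrable ?J (\<lambda>\<theta>. \<rho> / d * (1 + (cmod (f (of_real \<rho> * cis \<theta>)))\<^sup>2))"
      by (intro continuous_imp_integrable_real continuous_intros continuous_on_circle_in_annulus[OF hol r])
    fix \<theta>
    define x where "x = cmod (f (of_real \<rho> * cis \<theta>))"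
    have "0 \<le> (x - 1)\<^sup>2" by simp
    hence x: "x \<le> 1 + x\<^sup>2" using norm_ge_zero[of "f (of_real \<rho> * cis \<theta>)"] unfolding x_def[symmetric] by (simp add: power2_diff)
    have "cmod (q \<theta>) = x / cmod (of_real \<rho> * cis \<theta> - z) * \<rho>" using r by (simp add: q_def norm_mult norm_divide x_def)
    also have "\<dots> \<le> (1 + x\<^sup>2) / d * \<rho>"
      using r d(1) d(2)[of "of_real \<rho> * cis \<theta>"] x
      by (intro mult_right_mono frac_le) (auto simp: norm_mult)
    finally show "cmod (q \<theta>) \<le> \<rho> / d * (1 + (cmod (f (of_real \<rho> * cis \<theta>)))\<^sup>2)" by (simp add: x_def mult_ac)
  qed
  also have "\<dots> = \<rho> / d * integral\<^sup>L ?J (\<lambda>\<theta>. 1 + (cmod (f (of_real \<rho> * cis \<theta>)))\<^sup>2)"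
    by (rule integral_mult_right_zero)
  also have "integral\<^sup>L ?J (\<lambda>\<theta>. 1 + (cmod (f (of_real \<rho> * cis \<theta>)))\<^sup>2) = 2 * pi + integral\<^sup>L ?J (\<lambda>\<theta>. (cmod (f (of_real \<rho> * cis \<theta>)))\<^sup>2)"
    using integrable_circle_sq[OF hol r]
    by (subst Bochner_Integration.integral_add) (auto simp: measure_restrict_space intro!: continuous_imp_integrable_real)
  also have "\<dots> = 2 * pi * (1 + circle_mean_square \<rho> f)"
    by (simp add: circle_mean_square_alt distrib_left)
  also have "\<rho> / d * (2 * pi * (1 + circle_mean_square \<rho> f)) = 2 * pi * (\<rho> / d * (1 + circle_mean_square \<rho> f))"
    by (rule mult.left_commute)
  finally show ?thesis by (simp add: eq)
qed

text \<open>Cauchy's formula on circles approaching both boundary circles bounds \<open>f z\<close>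
  by a multiple of 2 plus the squared norm. Applied to multiples of \<open>f\<close> this becomes a
  linear bound.\<close>

lemma hardy_point_evaluation_bound:
  assumes r: "0 < r" "r < t1" "t2 < R"
  obtains C where "C \<ge> 0" "\<And>f z. f \<in> hardy_space r R \<Longrightarrow> t1 \<le> cmod z \<Longrightarrow> cmod z \<le> t2 \<Longrightarrow> cmod (f z) \<le> C * hardy_norm r R f"
proof (cases "t1 \<le> t2")
  case False
  thus ?thesis using that[of 0] by auto
next
  case t12: True
  have rR: "r < R" using r t12 by simp
  \<comment> \<open>Circles within \<open>d\<close> of the boundary keep at least the distance
    \<open>d\<close> from every \<open>z\<close> under consideration.\<close>
  define d where "d = min ((t1 - r) / 2) ((R - t2) / 2)"
  have d: "d > 0" using r by (simp add: d_def)
  define K where "K = R / d"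
  have K: "K > 0" using d r t12 by (simp add: K_def)
  have est: "cmod (f z) \<le> K * (2 + (hardy_norm r R f)\<^sup>2)"
    if f: "f \<in> hardy_space r R" and z: "t1 \<le> cmod z" "cmod z \<le> t2" for f z
  proof -
    have hol: "f holomorphic_on annulus r R" using f by (auto simp: hardy_space_def)
    obtain Lo Li where L: "0 \<le> Lo" "0 \<le> Li" "((\<lambda>\<rho>. circle_mean_square \<rho> f) \<longlongrightarrow> Lo) (at_left R)"
      "((\<lambda>\<rho>. circle_mean_square \<rho> f) \<longlongrightarrow> Li) (at_right r)" "hardy_norm r R f = sqrt (Lo + Li)"
      by (rule hardy_norm_limits[OF r(1) rR f])
    have bound: "cmod (f z) \<le> K * (1 + circle_mean_square \<rho>2 f) + K * (1 + circle_mean_square \<rho>1 f)"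
      if \<rho>: "r < \<rho>1" "\<rho>1 < r + d" "R - d < \<rho>2" "\<rho>2 < R" for \<rho>1 \<rho>2
    proof -
      have d': "d \<le> (t1 - r) / 2" "d \<le> (R - t2) / 2" unfolding d_def by (rule min.cobounded1, rule min.cobounded2)
      have o1: "\<rho>1 + d \<le> cmod z" using \<rho> z d' d r by (simp add: field_simps)
      have o2: "cmod z + d \<le> \<rho>2" using \<rho> z d' d r by (simp add: field_simps)
      have "2 * of_real pi * \<i> * f z = contour_integral (circlepath 0 \<rho>2) (\<lambda>w. f w / (w - z)) - contour_integral (circlepath 0 \<rho>1) (\<lambda>w. f w / (w - z))"
        by (rule Cauchy_integral_annulus[OF hol]) (use \<rho> z o1 o2 d r in linarith)+
      hence "cmod (2 * of_real pi * \<i> * f z) \<le> cmod (contour_integral (circlepath 0 \<rho>2) (\<lambda>w. f w / (w - z))) + cmod (contour_integral (circlepath 0 \<rho>1) (\<lambda>w. f w / (w - z)))"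
        by (simp only: norm_triangle_ineq4)
      also have "\<dots> \<le> 2 * pi * (\<rho>2 / d * (1 + circle_mean_square \<rho>2 f)) + 2 * pi * (\<rho>1 / d * (1 + circle_mean_square \<rho>1 f))"
      proof (intro add_mono Cauchy_transform_bound[OF hol] d)
        fix w :: complex
        show "d \<le> cmod (w - z)" if "cmod w = \<rho>2" using norm_triangle_ineq2[of w z] o2 that by linarith
        show "d \<le> cmod (w - z)" if "cmod w = \<rho>1" using norm_triangle_ineq3[of w z] o1 that by linarith
      qed (use \<rho> d o1 o2 r z t12 norm_ge_zero[of z] in linarith)+
      finally have "2 * pi * cmod (f z) \<le> 2 * pi * (\<rho>2 / d * (1 + circle_mean_square \<rho>2 f) + \<rho>1 / d * (1 + circle_mean_square \<rho>1 f))"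
        by (simp add: norm_mult distrib_left)
      hence "cmod (f z) \<le> \<rho>2 / d * (1 + circle_mean_square \<rho>2 f) + \<rho>1 / d * (1 + circle_mean_square \<rho>1 f)" by simp
      also have "\<dots> \<le> K * (1 + circle_mean_square \<rho>2 f) + K * (1 + circle_mean_square \<rho>1 f)"
      proof (intro add_mono mult_right_mono)
        have "\<rho>1 \<le> R" using \<rho> o1 d z r by linarith
        thus "\<rho>1 / d \<le> K" "\<rho>2 / d \<le> K" using d \<rho> by (auto simp: K_def divide_right_mono)
      qed (auto simp: circle_mean_square_nonneg)
      finally show ?thesis .
    qed
    have l1: "cmod (f z) \<le> K * (1 + Lo) + K * (1 + circle_mean_square \<rho>1 f)" if "r < \<rho>1" "\<rho>1 < r + d" for \<rho>1
    proof (rule tendsto_lowerbound)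
      show "((\<lambda>\<rho>2. K * (1 + circle_mean_square \<rho>2 f) + K * (1 + circle_mean_square \<rho>1 f)) \<longlongrightarrow> K * (1 + Lo) + K * (1 + circle_mean_square \<rho>1 f)) (at_left R)"
        by (intro tendsto_intros L)
      show "\<forall>\<^sub>F \<rho>2 in at_left R. cmod (f z) \<le> K * (1 + circle_mean_square \<rho>2 f) + K * (1 + circle_mean_square \<rho>1 f)"
        by (rule eventually_mono[OF eventually_at_left_annulus[of "R - d"]]) (use d bound that in auto)
    qed simp
    have "cmod (f z) \<le> K * (1 + Lo) + K * (1 + Li)"
    proof (rule tendsto_lowerbound)
      show "((\<lambda>\<rho>1. K * (1 + Lo) + K * (1 + circle_mean_square \<rho>1 f)) \<longlongrightarrow> K * (1 + Lo) + K * (1 + Li)) (at_right r)"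
        by (intro tendsto_intros L)
      show "\<forall>\<^sub>F \<rho>1 in at_right r. cmod (f z) \<le> K * (1 + Lo) + K * (1 + circle_mean_square \<rho>1 f)"
        by (rule eventually_mono[OF eventually_at_right_annulus[of r "r + d"]]) (use d l1 in auto)
    qed simp
    also have "\<dots> = K * (2 + (hardy_norm r R f)\<^sup>2)" using L by (simp add: algebra_simps)
    finally show ?thesis .
  qed
  have "cmod (f z) \<le> (3 * K) * hardy_norm r R f"
    if f: "f \<in> hardy_space r R" and z: "t1 \<le> cmod z" "cmod z \<le> t2" for f z
  proof -
    define \<nu> where "\<nu> = hardy_norm r R f"
    have \<nu>: "\<nu> \<ge> 0" by (simp add: \<nu>_def)
    \<comment> \<open>The factor \<open>k\<close> is the reciprocal of the norm if that is positive.
      If the norm is zero, \<open>k = 3 * K / cmod (f z)\<close> would give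
      \<open>3 * K \<le> 2 * K\<close>.\<close>
    have sc: "k * cmod (f z) \<le> K * (2 + (k * \<nu>)\<^sup>2)" if "k > 0" for k :: real
      using est[OF hardy_space_cmult[OF f, of "of_real k"] z] that
      by (simp add: norm_mult hardy_norm_cmult[OF r(1) rR f] \<nu>_def)
    show ?thesis
    proof (cases "\<nu> = 0")
      case True
      have "cmod (f z) = 0"
      proof (rule ccontr)
        assume "cmod (f z) \<noteq> 0"
        hence p: "cmod (f z) > 0" by simp
        have "(3 * K / cmod (f z)) * cmod (f z) \<le> K * (2 + (3 * K / cmod (f z) * \<nu>)\<^sup>2)" by (rule sc) (use p K in simp)
        thus False using p K True by simp
      qed
      thus ?thesis using True by (simp add: \<nu>_def)
    next
      case False
      hence p: "\<nu> > 0" using \<nu> by simp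
      have "(1 / \<nu>) * cmod (f z) \<le> K * (2 + (1 / \<nu> * \<nu>)\<^sup>2)" by (rule sc) (use p in simp)
      thus ?thesis using p by (simp add: field_simps flip: \<nu>_def)
    qed
  qed
  thus ?thesis using that[of "3 * K"] K by auto
qed

lemma hardy_norm_eq_0D:
  assumes r: "0 < r" "r < R" and f: "f \<in> hardy_space r R" and 0: "hardy_norm r R f = 0"
  shows "f = (\<lambda>z. 0)"
proof
  fix z
  show "f z = 0"
  proof (cases "z \<in> annulus r R")
    case True
    have z: "r < cmod z" "cmod z < R" using True by (auto simp: annulus_iff)
    obtain C where "\<And>f' w. f' \<in> hardy_space r R \<Longrightarrow> cmod z \<le> cmod w \<Longrightarrow> cmod w \<le> cmod z \<Longrightarrow> cmod (f' w) \<le> C * hardy_norm r R f'"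
      by (rule hardy_point_evaluation_bound[OF r(1) z]) blast
    from this[OF f, of z] 0 show ?thesis by simp
  qed (use f in \<open>auto simp: hardy_space_def\<close>)
qed

lemma Metric_space_hardy:
  assumes r: "0 < r" "r < R"
  shows "Metric_space (hardy_space r R) (\<lambda>f g. hardy_norm r R (\<lambda>z. f z - g z))"
proof
  show "0 \<le> hardy_norm r R (\<lambda>z. f z - g z)" for f g by simp
  show "hardy_norm r R (\<lambda>z. f z - g z) = hardy_norm r R (\<lambda>z. g z - f z)" for f g by (rule hardy_norm_minus_commute)
  show "(hardy_norm r R (\<lambda>z. f z - g z) = 0) = (f = g)" if "f \<in> hardy_space r R" "g \<in> hardy_space r R" for f g
  proof
    assume "hardy_norm r R (\<lambda>z. f z - g z) = 0"
    hence "(\<lambda>z. f z - g z) = (\<lambda>z. 0)" by (rule hardy_norm_eq_0D[OF r hardy_space_diff[OF r that]])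
    thus "f = g" by (simp add: fun_eq_iff)
  next
    assume "f = g"
    thus "hardy_norm r R (\<lambda>z. f z - g z) = 0" using hardy_norm_cmult[OF r hardy_space_zero, of 0] by simp
  qed
  show "hardy_norm r R (\<lambda>z. f z - h z) \<le> hardy_norm r R (\<lambda>z. f z - g z) + hardy_norm r R (\<lambda>z. g z - h z)"
    if "f \<in> hardy_space r R" "g \<in> hardy_space r R" "h \<in> hardy_space r R" for f g h
    using hardy_norm_triangle[OF r hardy_space_diff[OF r that(1,2)] hardy_space_diff[OF r that(2,3)]] by simp
qed

text \<open>With \<open>d\<close> the least distance from a point of \<open>S\<close> to the circle,
  the outer radius \<open>1 + d\<close> is as large as possible and the inner radius
  \<open>1 / (1 + d)\<close> is at least \<open>1 - d\<close>.\<close>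

lemma compact_avoiding_circle:
  assumes S: "compact S" and avoid: "\<And>z. z \<in> S \<Longrightarrow> cmod z \<noteq> 1"
  shows "\<exists>t. 0 < t \<and> t < 1 \<and> (\<forall>z\<in>S. z \<notin> annulus t (1 / t))"
proof (cases "S = {}")
  case True
  thus ?thesis by (intro exI[of _ "1/2"]) auto
next
  case False
  have "continuous_on S (\<lambda>z. \<bar>cmod z - 1\<bar>)" by (intro continuous_intros)
  from continuous_attains_inf[OF S False this] obtain x where x: "x \<in> S" "\<And>z. z \<in> S \<Longrightarrow> \<bar>cmod x - 1\<bar> \<le> \<bar>cmod z - 1\<bar>" by blast
  define d where "d = \<bar>cmod x - 1\<bar>"
  have d: "d > 0" using avoid[OF x(1)] by (simp add: d_def)
  have "1 - d \<le> 1 / (1 + d)"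
  proof -
    have "(1 - d) * (1 + d) \<le> 1" by (simp add: algebra_simps)
    thus ?thesis using d by (simp add: pos_le_divide_eq)
  qed
  moreover have "cmod z \<le> 1 - d \<or> 1 + d \<le> cmod z" if "z \<in> S" for z
    using x(2)[OF that] d_def by linarith
  ultimately have "z \<notin> annulus (1 / (1 + d)) (1 / (1 / (1 + d)))" if "z \<in> S" for z
    using that by (fastforce simp: annulus_iff)
  thus ?thesis using d by (intro exI[of _ "1 / (1 + d)"]) auto
qed

subsection \<open>Finite Blaschke products\<close>

lemma one_minus_cnj_mult_nonzero:
  fixes a z :: complex
  assumes "cmod a < 1" "cmod z \<le> 1" shows "1 - cnj a * z \<noteq> 0"
proof
  assume "1 - cnj a * z = 0"
  hence "cnj a * z = 1" by simp
  hence "cmod a * cmod z = 1" by (metis complex_mod_cnj norm_mult norm_one)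
  moreover have "cmod a * cmod z \<le> cmod a * 1" using assms by (intro mult_left_mono) auto
  ultimately show False using assms by simp
qed

text \<open>This rests on the identity
  \<open>|1 - cnj a * z|^2 - |z - a|^2 = (1 - |a|^2) * (1 - |z|^2)\<close>.\<close>

lemma norm_sq_blaschke_factor:
  fixes a z :: complex
  assumes "1 - cnj a * z \<noteq> 0"
  shows "(cmod ((z - a) / (1 - cnj a * z)))\<^sup>2 = 1 - (1 - (cmod a)\<^sup>2) * (1 - (cmod z)\<^sup>2) / (cmod (1 - cnj a * z))\<^sup>2"
proof -
  have "complex_of_real ((cmod (1 - cnj a * z))\<^sup>2 - (cmod (z - a))\<^sup>2) = of_real ((1 - (cmod a)\<^sup>2) * (1 - (cmod z)\<^sup>2))"
    unfolding of_real_diff of_real_mult complex_norm_square of_real_1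
    by (simp add: algebra_simps)
  hence "(cmod (1 - cnj a * z))\<^sup>2 - (cmod (z - a))\<^sup>2 = (1 - (cmod a)\<^sup>2) * (1 - (cmod z)\<^sup>2)"
    by (simp only: of_real_eq_iff)
  hence eq: "(cmod (z - a))\<^sup>2 = (cmod (1 - cnj a * z))\<^sup>2 - (1 - (cmod a)\<^sup>2) * (1 - (cmod z)\<^sup>2)" by simp
  have "(cmod (1 - cnj a * z))\<^sup>2 \<noteq> 0" using assms by simp
  thus ?thesis unfolding norm_divide power_divide eq by (simp add: diff_divide_distrib)
qed

locale blaschke =
  fixes C :: complex and n :: nat and a :: "nat \<Rightarrow> complex" and B :: "complex \<Rightarrow> complex"
  assumes n: "n \<ge> 2" and norm_C: "cmod C = 1" and norm_a: "\<And>i. i \<in> {1..n} \<Longrightarrow> cmod (a i) < 1"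
    and B_eq: "B = (\<lambda>z. C * (\<Prod>i=1..n. (z - a i) / (1 - cnj (a i) * z)))"
begin

definition P :: "complex poly" where "P = smult C (\<Prod>i=1..n. [:- a i, 1:])"
definition Q :: "complex poly" where "Q = (\<Prod>i=1..n. [:1, - cnj (a i):])"

lemma poly_P: "poly P z = C * (\<Prod>i=1..n. (z - a i))"
  by (simp add: P_def poly_prod)

lemma poly_Q: "poly Q z = (\<Prod>i=1..n. (1 - cnj (a i) * z))"
  by (simp add: Q_def poly_prod mult.commute)

lemma C_nz: "C \<noteq> 0" using norm_C by auto

lemma C_cnj: "C * cnj C = 1" using norm_C by (simp add: complex_norm_square[symmetric])

text \<open>Valid at the poles too: there a factor of the product and the quotient of polynomials
  both divide by zero and have the value zero.\<close>

lemma B_PQ: "B z = poly P z / poly Q z"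
  by (simp add: B_eq poly_P poly_Q prod_dividef)

lemma Q_nz: "cmod z \<le> 1 \<Longrightarrow> poly Q z \<noteq> 0"
  unfolding poly_Q prod_zero_iff[OF finite_atLeastAtMost]
  using one_minus_cnj_mult_nonzero[OF norm_a] by blast

lemma PQ_no_common_root: "poly P z = 0 \<Longrightarrow> poly Q z \<noteq> 0"
proof -
  assume "poly P z = 0"
  then obtain i where "i \<in> {1..n}" "z = a i" using C_nz by (auto simp: poly_P)
  thus "poly Q z \<noteq> 0" using norm_a[of i] by (intro Q_nz) simp
qed

lemma has_field_derivative_B:
  assumes "poly Q z \<noteq> 0"
  shows "(B has_field_derivative (poly (pderiv P) z * poly Q z - poly P z * poly (pderiv Q) z) / (poly Q z * poly Q z)) (at z)"
proof -
  have "B = (\<lambda>z. poly P z / poly Q z)" by (intro ext B_PQ)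
  thus ?thesis using DERIV_divide[OF poly_DERIV poly_DERIV assms] by simp
qed

lemma holomorphic_B: "(\<And>z. z \<in> S \<Longrightarrow> poly Q z \<noteq> 0) \<Longrightarrow> B holomorphic_on S"
  unfolding holomorphic_on_def field_differentiable_def
  using has_field_derivative_B has_field_derivative_at_within by blast

text \<open>Reflection exchanges \<open>P\<close> and \<open>Q\<close> up to conjugation and a
  common factor. Zeros and poles other than 0 are covered, both sides being zero there by the
  convention on division.\<close>

lemma B_reflect:
  assumes z: "z \<noteq> 0" shows "B (1 / cnj z) = 1 / cnj (B z)"
proof -
  have "poly P (1 / cnj z) = C * (\<Prod>i=1..n. (1 - a i * cnj z) / cnj z)"
    unfolding poly_P using z by (intro arg_cong[where f = "\<lambda>x. C * x"] prod.cong) (auto simp: field_simps)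
  also have "\<dots> = C * cnj (poly Q z) / cnj z ^ n"
    by (simp add: poly_Q prod_dividef)
  finally have p: "poly P (1 / cnj z) = C * cnj (poly Q z) / cnj z ^ n" .
  have "poly Q (1 / cnj z) = (\<Prod>i=1..n. (cnj z - cnj (a i)) / cnj z)"
    unfolding poly_Q using z by (intro prod.cong) (auto simp: field_simps)
  also have "\<dots> = (C * cnj C) * (\<Prod>i=1..n. (cnj z - cnj (a i))) / cnj z ^ n"
    by (simp add: C_cnj prod_dividef)
  also have "\<dots> = C * cnj (poly P z) / cnj z ^ n" by (simp add: poly_P mult.assoc)
  finally have q: "poly Q (1 / cnj z) = C * cnj (poly P z) / cnj z ^ n" .
  show ?thesis using z C_nz by (simp add: B_PQ p q)
qed

text \<open>On the unit circle the summands are the Poisson kernels at the \<open>a i\<close>, and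
  the sum is the modulus of \<open>deriv B\<close>. Inside the disc it measures how fast the modulus
  of \<open>B\<close> decreases.\<close>

definition Psum :: "complex \<Rightarrow> real" where
  "Psum z = (\<Sum>i=1..n. (1 - (cmod (a i))\<^sup>2) / (cmod (1 - cnj (a i) * z))\<^sup>2)"

text \<open>Every factor has squared modulus \<open>1 - x\<close>, where \<open>x\<close> is
  \<open>1 - (cmod z)^2\<close> times its summand in \<open>Psum\<close>, and
  \<open>1 - x \<le> exp (- x)\<close>.\<close>

lemma norm_B_sq_le:
  assumes z: "cmod z \<le> 1"
  shows "(cmod (B z))\<^sup>2 \<le> exp (- ((1 - (cmod z)\<^sup>2) * Psum z))"
proof -
  have "(cmod (B z))\<^sup>2 = (\<Prod>i=1..n. (cmod ((z - a i) / (1 - cnj (a i) * z)))\<^sup>2)"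
    unfolding B_eq by (simp add: norm_mult norm_C prod_norm[symmetric] prod_power_distrib[symmetric] power_mult_distrib)
  also have "\<dots> \<le> (\<Prod>i=1..n. exp (- ((1 - (cmod z)\<^sup>2) * ((1 - (cmod (a i))\<^sup>2) / (cmod (1 - cnj (a i) * z))\<^sup>2))))"
  proof (rule prod_mono, intro conjI)
    fix i assume i: "i \<in> {1..n}"
    have "(cmod ((z - a i) / (1 - cnj (a i) * z)))\<^sup>2 = 1 + - ((1 - (cmod z)\<^sup>2) * ((1 - (cmod (a i))\<^sup>2) / (cmod (1 - cnj (a i) * z))\<^sup>2))"
      by (subst norm_sq_blaschke_factor) (use one_minus_cnj_mult_nonzero[OF norm_a[OF i] z] in auto)
    also have "\<dots> \<le> exp (- ((1 - (cmod z)\<^sup>2) * ((1 - (cmod (a i))\<^sup>2) / (cmod (1 - cnj (a i) * z))\<^sup>2)))"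
      by (rule exp_ge_add_one_self)
    finally show "(cmod ((z - a i) / (1 - cnj (a i) * z)))\<^sup>2 \<le> exp (- ((1 - (cmod z)\<^sup>2) * ((1 - (cmod (a i))\<^sup>2) / (cmod (1 - cnj (a i) * z))\<^sup>2)))" .
  qed simp
  also have "\<dots> = exp (- ((1 - (cmod z)\<^sup>2) * Psum z))"
    by (simp add: exp_sum[symmetric] Psum_def sum_distrib_left sum_negf)
  finally show ?thesis .
qed

lemma norm_a_sq: "i \<in> {1..n} \<Longrightarrow> (cmod (a i))\<^sup>2 < 1"
  using norm_a[of i] by (simp add: power_less_one_iff abs_square_less_1)

lemma Psum_pos: "cmod z \<le> 1 \<Longrightarrow> Psum z > 0"
  unfolding Psum_def
proof (rule sum_pos)
  fix i assume "cmod z \<le> 1" "i \<in> {1..n}"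
  thus "0 < (1 - (cmod (a i))\<^sup>2) / (cmod (1 - cnj (a i) * z))\<^sup>2"
    using one_minus_cnj_mult_nonzero[OF norm_a] norm_a_sq by (intro divide_pos_pos) auto
qed (use n in auto)

lemma norm_B_less_1: "cmod z < 1 \<Longrightarrow> cmod (B z) < 1"
proof -
  assume z: "cmod z < 1"
  have "(cmod z)\<^sup>2 < 1" using z by (simp add: abs_square_less_1)
  hence "(1 - (cmod z)\<^sup>2) * Psum z > 0" using Psum_pos[of z] z by simp
  hence "exp (- ((1 - (cmod z)\<^sup>2) * Psum z)) < 1" by simp
  hence "(cmod (B z))\<^sup>2 < 1" using norm_B_sq_le[of z] z by linarith
  thus ?thesis by (simp add: abs_square_less_1)
qed

lemma norm_B_circle: "cmod z = 1 \<Longrightarrow> cmod (B z) = 1"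
proof -
  assume z: "cmod z = 1"
  have "cmod ((z - a i) / (1 - cnj (a i) * z)) = 1" if i: "i \<in> {1..n}" for i
  proof -
    have "(cmod ((z - a i) / (1 - cnj (a i) * z)))\<^sup>2 = 1"
      by (subst norm_sq_blaschke_factor) (use one_minus_cnj_mult_nonzero[OF norm_a[OF i]] z in auto)
    thus ?thesis by (simp add: power2_eq_1_iff) (metis norm_ge_zero norm_divide not_one_le_zero neg_0_le_iff_le)
  qed
  thus ?thesis unfolding B_eq by (simp only: norm_mult norm_C prod_norm[symmetric]) simp
qed

text \<open>At a point \<open>z\<close> of the circle the logarithmic derivative of each factor is a
  positive multiple of \<open>1 / z\<close>. The contributions share one direction, so the moduli
  add up without cancellation.\<close>

lemma norm_deriv_B_circle:
  assumes z: "cmod z = 1" shows "cmod (deriv B z) = Psum z"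
proof -
  define \<phi> where "\<phi> i w = (w - a i) / (1 - cnj (a i) * w)" for i w
  define c where "c i = (1 - (cmod (a i))\<^sup>2) / (cmod (1 - cnj (a i) * z))\<^sup>2" for i
  have z0: "z \<noteq> 0" using z by auto
  have zz: "z * cnj z = 1" using z by (simp add: complex_norm_square[symmetric])
  have fac: "(\<phi> i has_field_derivative \<phi> i z * (of_real (c i) / z)) (at z)" if i: "i \<in> {1..n}" for i
  proof -
    have nz: "1 - cnj (a i) * z \<noteq> 0" by (rule one_minus_cnj_mult_nonzero[OF norm_a[OF i]]) (simp add: z)
    have "(\<phi> i has_field_derivative (1 * (1 - cnj (a i) * z) - (z - a i) * (- cnj (a i))) / ((1 - cnj (a i) * z) * (1 - cnj (a i) * z))) (at z)"
      unfolding \<phi>_def using nz by (auto intro!: derivative_eq_intros)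
    moreover have "(1 * (1 - cnj (a i) * z) - (z - a i) * (- cnj (a i))) / ((1 - cnj (a i) * z) * (1 - cnj (a i) * z)) = \<phi> i z * (of_real (c i) / z)"
    proof -
      have e1: "1 * (1 - cnj (a i) * z) - (z - a i) * (- cnj (a i)) = of_real (1 - (cmod (a i))\<^sup>2)"
        unfolding of_real_diff complex_norm_square by (simp add: algebra_simps)
      have e2: "complex_of_real ((cmod (1 - cnj (a i) * z))\<^sup>2) = (1 - cnj (a i) * z) * cnj (1 - cnj (a i) * z)"
        by (rule complex_norm_square)
      have e3: "z * cnj (1 - cnj (a i) * z) = z - a i" using zz by (simp add: algebra_simps)
      have nzc: "cnj (1 - cnj (a i) * z) \<noteq> 0" using nz by (simp only: complex_cnj_zero_iff not_False_eq_True)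
      have "\<phi> i z * (of_real (c i) / z) = (z * cnj (1 - cnj (a i) * z)) / (1 - cnj (a i) * z) * (of_real (1 - (cmod (a i))\<^sup>2) / ((1 - cnj (a i) * z) * cnj (1 - cnj (a i) * z)) / z)"
        unfolding e3 \<phi>_def c_def of_real_divide e2 ..
      also have "\<dots> = of_real (1 - (cmod (a i))\<^sup>2) / ((1 - cnj (a i) * z) * (1 - cnj (a i) * z))"
        using nz nzc z0 by (simp del: complex_cnj_diff complex_cnj_mult add: divide_simps)
      finally show ?thesis unfolding e1 by simp
    qed
    ultimately show ?thesis by simp
  qed
  have "((\<lambda>w. \<Prod>i\<in>I. \<phi> i w) has_field_derivative (\<Prod>i\<in>I. \<phi> i z) * (of_real (\<Sum>i\<in>I. c i) / z)) (at z)"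
    if "finite I" "I \<subseteq> {1..n}" for I
    using that
  proof (induction rule: finite_induct)
    case empty thus ?case by simp
  next
    case (insert j I)
    have "((\<lambda>w. \<phi> j w * (\<Prod>i\<in>I. \<phi> i w)) has_field_derivative
        (\<phi> j z * (of_real (c j) / z)) * (\<Prod>i\<in>I. \<phi> i z) + ((\<Prod>i\<in>I. \<phi> i z) * (of_real (\<Sum>i\<in>I. c i) / z)) * \<phi> j z) (at z)"
      by (rule DERIV_mult[OF fac insert.IH]) (use insert.prems in auto)
    thus ?case using insert.hyps by (simp add: algebra_simps add_divide_distrib)
  qed
  hence "((\<lambda>w. \<Prod>i=1..n. \<phi> i w) has_field_derivative (\<Prod>i=1..n. \<phi> i z) * (of_real (Psum z) / z)) (at z)"
    unfolding Psum_def c_def by simp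
  hence "(B has_field_derivative C * ((\<Prod>i=1..n. \<phi> i z) * (of_real (Psum z) / z))) (at z)"
    unfolding B_eq \<phi>_def by (rule DERIV_cmult)
  hence "deriv B z = B z * (of_real (Psum z) / z)" by (simp add: DERIV_imp_deriv B_eq \<phi>_def)
  thus ?thesis using z norm_B_circle[OF z] Psum_pos[of z] by (simp add: norm_mult norm_divide)
qed

lemma deriv_B_continuous: "(\<And>z. z \<in> S \<Longrightarrow> poly Q z \<noteq> 0) \<Longrightarrow> continuous_on S (deriv B)"
proof -
  assume S: "\<And>z. z \<in> S \<Longrightarrow> poly Q z \<noteq> 0"
  have "continuous_on S (\<lambda>z. (poly (pderiv P) z * poly Q z - poly P z * poly (pderiv Q) z) / (poly Q z * poly Q z))"
    by (intro continuous_intros) (use S in auto)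
  thus ?thesis using has_field_derivative_B[THEN DERIV_imp_deriv] S by (simp cong: continuous_on_cong)
qed
end

text \<open>A coefficient and an upper bound in place of the exact degree, since some
  \<open>c i\<close> may vanish: for \<open>Q\<close> this happens when an \<open>a i\<close> is
  zero.\<close>

lemma degree_prod_linear:
  fixes b c :: "nat \<Rightarrow> complex"
  assumes "finite I"
  shows "degree (\<Prod>i\<in>I. [:b i, c i:]) \<le> card I \<and> coeff (\<Prod>i\<in>I. [:b i, c i:]) (card I) = (\<Prod>i\<in>I. c i)"
  using assms
proof (induction rule: finite_induct)
  case (insert j I)
  define p where "p = (\<Prod>i\<in>I. [:b i, c i:])"
  have "degree ([:b j, c j:] * p) \<le> degree [:b j, c j:] + degree p" by (rule degree_mult_le)
  also have "\<dots> \<le> Suc (card I)" using insert.IH by (simp add: p_def)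
  finally have "degree ([:b j, c j:] * p) \<le> Suc (card I)" .
  moreover have "coeff p (Suc (card I)) = 0" using insert.IH by (intro coeff_eq_0) (simp add: p_def)
  hence "coeff ([:b j, c j:] * p) (Suc (card I)) = c j * (\<Prod>i\<in>I. c i)"
    using insert.IH by (simp add: p_def)
  ultimately show ?case using insert.hyps by (simp add: p_def)
qed auto

section \<open>Radii adapted to an expanding product\<close>

context blaschke
begin

text \<open>By compactness \<open>Psum\<close> exceeds some \<open>m > 1\<close> near the circle.
  With \<open>u = (cmod z)^2\<close> and \<open>1 / u < m\<close> one has
  \<open>ln (1 / u) \<le> (1 - u) / u < (1 - u) * Psum z\<close>, so the exponential in
  \<open>norm_B_sq_le\<close> is below \<open>u\<close>.\<close>

lemma near_circle_contracting:
  assumes expanding: "\<And>z. cmod z = 1 \<Longrightarrow> Psum z > 1"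
  obtains t where "0 < t" "t < 1" "\<And>z. t < cmod z \<Longrightarrow> cmod z < 1 \<Longrightarrow> cmod (B z) < cmod z"
proof -
  have cont: "continuous_on (cball 0 1) Psum"
    unfolding Psum_def using one_minus_cnj_mult_nonzero[OF norm_a] by (intro continuous_intros) auto
  have cont': "continuous_on (sphere 0 1) Psum" by (rule continuous_on_subset[OF cont]) auto
  have "compact (sphere (0::complex) 1)" "sphere (0::complex) 1 \<noteq> {}" by auto
  from continuous_attains_inf[OF this cont'] obtain x where x: "cmod x = 1" "\<And>z. cmod z = 1 \<Longrightarrow> Psum x \<le> Psum z" by auto
  define m where "m = (1 + Psum x) / 2"
  have m: "1 < m" "m < Psum x" using expanding[OF x(1)] by (auto simp: m_def)
  define S where "S = {z \<in> cball 0 1. Psum z \<le> m}"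
  have "closed S"
  proof -
    have "S = cball 0 1 \<inter> Psum -` {..m}" by (auto simp: S_def)
    thus ?thesis using continuous_closed_preimage[OF cont closed_cball closed_atMost] by simp
  qed
  hence "compact (cball 0 1 \<inter> S)" by (rule compact_Int_closed[OF compact_cball])
  hence "compact S" by (rule back_subst[of compact]) (auto simp: S_def)
  moreover have "cmod z \<noteq> 1" if "z \<in> S" for z using x(2)[of z] m that by (auto simp: S_def)
  ultimately obtain t where t: "0 < t" "t < 1" "\<And>z. z \<in> S \<Longrightarrow> z \<notin> annulus t (1 / t)"
    using compact_avoiding_circle[of S] by blast
  define t' where "t' = max t (sqrt (1 / m))"
  have t': "t' < 1" "0 < t'" "t \<le> t'" using t m by (auto simp: t'_def)
  show ?thesis
  proof (rule that[OF t'(2,1)])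
    fix z assume z: "t' < cmod z" "cmod z < 1"
    define u where "u = (cmod z)\<^sup>2"
    have u: "u < 1" "0 < u" using z t' by (auto simp: u_def abs_square_less_1)
    have "sqrt (1 / m) < cmod z" using z by (simp add: t'_def)
    hence "(sqrt (1 / m))\<^sup>2 < u" unfolding u_def using m by (intro power_strict_mono) auto
    hence um: "1 / u < m" using m u by (simp add: field_simps)
    have "1 < 1 / t" using t by simp
    hence "z \<in> annulus t (1/t)" using z t' unfolding annulus_iff by linarith
    hence "z \<notin> S" using t(3) by blast
    hence Pm: "m < Psum z" using z by (auto simp: S_def)
    have "ln (1 / u) \<le> 1 / u - 1" using u by (intro ln_le_minus_one) simp
    also have "\<dots> = (1 - u) * (1 / u)" using u by (simp add: field_simps)
    also have "\<dots> < (1 - u) * Psum z" using u um Pm by (intro mult_strict_left_mono) auto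
    finally have "- ((1 - u) * Psum z) < ln u" using u by (simp add: ln_div)
    hence "exp (- ((1 - u) * Psum z)) < exp (ln u)" by (simp only: exp_less_mono)
    hence "exp (- ((1 - u) * Psum z)) < u" using u by simp
    hence "(cmod (B z))\<^sup>2 < (cmod z)\<^sup>2" using norm_B_sq_le[of z] z by (simp add: u_def)
    thus "cmod (B z) < cmod z" by (rule power2_less_imp_less) simp
  qed
qed

lemma P_nonzero: "P \<noteq> 0" and Q_nonzero: "Q \<noteq> 0"
proof -
  have "poly P 1 \<noteq> 0" using norm_B_circle[of 1] by (auto simp: B_PQ)
  thus "P \<noteq> 0" by auto
  show "Q \<noteq> 0" using Q_nz[of 1] by auto
qed

text \<open>Zeros, poles and critical points near the circle form compact sets off the circle and
  are avoided by an annulus. \<open>t\<close> lies close enough to 1 for \<open>B\<close> to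
  decrease the modulus on the circle of radius \<open>t\<close>, and the maximum principle gives
  \<open>s < t\<close>. The parameter \<open>c\<close> lets the radii be pushed beyond given points
  of the disc.\<close>

lemma radii_exist:
  assumes expanding: "\<And>z. cmod z = 1 \<Longrightarrow> Psum z > 1" and c: "c < 1"
  obtains s r t where "0 < s" "s < r" "r < t" "t < 1" "c < r" "\<And>w. cmod w \<le> t \<Longrightarrow> cmod (B w) \<le> s"
    "\<And>z. z \<in> annulus r (1 / r) \<Longrightarrow> poly Q z \<noteq> 0 \<and> B z \<noteq> 0 \<and> deriv B z \<noteq> 0"
proof -
  obtain t0 where t0: "0 < t0" "t0 < 1" "\<And>z. t0 < cmod z \<Longrightarrow> cmod z < 1 \<Longrightarrow> cmod (B z) < cmod z"
    using near_circle_contracting[OF expanding] by blast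
  define S1 where "S1 = {z. poly P z = 0} \<union> {z. poly Q z = 0}"
  have "finite S1" unfolding S1_def using poly_roots_finite[OF P_nonzero] poly_roots_finite[OF Q_nonzero] by simp
  hence "compact S1" by (rule finite_imp_compact)
  moreover have "cmod z \<noteq> 1" if "z \<in> S1" for z
    using that norm_B_circle[of z] by (auto simp: S1_def B_PQ)
  ultimately obtain t1 where t1: "0 < t1" "t1 < 1" "\<And>z. z \<in> S1 \<Longrightarrow> z \<notin> annulus t1 (1 / t1)"
    using compact_avoiding_circle[of S1] by blast
  \<comment> \<open>The closed annulus \<open>K\<close> of inner radius \<open>t1'\<close> contains
    no zeros and poles, so \<open>deriv B\<close> is continuous on it and its zeros there form a
    compact set.\<close>
  define t1' where "t1' = (t1 + 1) / 2"
  have t1': "t1 < t1'" "t1' < 1" "0 < t1'" using t1 by (auto simp: t1'_def)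
  have i1: "1 / t1' < 1 / t1" using t1 t1' by (simp add: frac_less2)
  define K where "K = cball 0 (1 / t1') - ball (0::complex) t1'"
  have K: "compact K" by (simp add: K_def compact_diff)
  have KQ: "poly Q z \<noteq> 0" if "z \<in> K" for z
    using t1(3)[of z] that i1 t1' by (auto simp: S1_def K_def annulus_iff)
  define S2 where "S2 = {z \<in> K. deriv B z = 0}"
  have "closed S2"
  proof -
    have "closed (K \<inter> deriv B -` {0})"
      by (rule continuous_closed_preimage[OF deriv_B_continuous[OF KQ] compact_imp_closed[OF K]]) auto
    moreover have "K \<inter> deriv B -` {0} = S2" by (auto simp: S2_def)
    ultimately show ?thesis by simp
  qed
  hence "compact (K \<inter> S2)" by (rule compact_Int_closed[OF K])
  hence "compact S2" by (rule back_subst[of compact]) (auto simp: S2_def)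
  moreover have "cmod z \<noteq> 1" if "z \<in> S2" for z
    using that norm_deriv_B_circle[of z] expanding[of z] by (auto simp: S2_def)
  ultimately obtain t2 where t2: "0 < t2" "t2 < 1" "\<And>z. z \<in> S2 \<Longrightarrow> z \<notin> annulus t2 (1 / t2)"
    using compact_avoiding_circle[of S2] by blast
  define b where "b = Max {c, t0, t1', t2}"
  have b: "c \<le> b" "t0 \<le> b" "t1' \<le> b" "t2 \<le> b" "b < 1" "0 < b" using c t0 t1' t2
    by (auto simp: b_def intro: less_le_trans[OF t0(1)])
  define t where "t = (b + 1) / 2"
  have t: "b < t" "t < 1" "0 < t" using b by (auto simp: t_def)
  have holt: "B holomorphic_on cball 0 t" by (rule holomorphic_B) (use t in \<open>auto intro!: Q_nz\<close>)
  have contt: "continuous_on (sphere 0 t) (\<lambda>w. cmod (B w))"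
    by (intro continuous_intros continuous_on_subset[OF holomorphic_on_imp_continuous_on[OF holt]]) auto
  have "compact (sphere (0::complex) t)" "sphere (0::complex) t \<noteq> {}" using t by auto
  from continuous_attains_sup[OF this contt] obtain x where x: "cmod x = t" "\<And>w. cmod w = t \<Longrightarrow> cmod (B w) \<le> cmod (B x)" by auto
  have xt: "cmod (B x) < t" using t0(3)[of x] x(1) t b by simp
  have Bt: "cmod (B w) \<le> cmod (B x)" if "cmod w \<le> t" for w
  proof (rule maximum_modulus_frontier[of B "cball 0 t"])
    show "B holomorphic_on interior (cball 0 t)" using holt by (rule holomorphic_on_subset) (auto simp: interior_cball)
    show "continuous_on (closure (cball 0 t)) B" using holt by (simp add: holomorphic_on_imp_continuous_on)
    show "cmod (B z) \<le> cmod (B x)" if "z \<in> frontier (cball 0 t)" for z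
      using that t by (intro x) auto
  qed (use that in auto)
  \<comment> \<open>The second entry guarantees \<open>0 < s\<close>.\<close>
  define s where "s = max (cmod (B x)) (t / 2)"
  have s: "0 < s" "s < t" "cmod (B x) \<le> s" using t xt by (auto simp: s_def)
  define r where "r = (max s b + t) / 2"
  have r: "s < r" "b < r" "r < t" using s t by (auto simp: r_def)
  show ?thesis
  proof (rule that[of s r t])
    show "cmod (B w) \<le> s" if "cmod w \<le> t" for w using Bt[OF that] s by linarith
    fix z assume z: "z \<in> annulus r (1 / r)"
    have ri: "1 / r < 1 / t1'" "1 / r < 1 / t2" using r b t1' t2 by (auto intro!: frac_less2)
    have "z \<in> annulus t1 (1 / t1)" using z r b t1' ri i1 by (auto simp: annulus_iff)
    hence z1: "poly P z \<noteq> 0" "poly Q z \<noteq> 0" using t1(3)[of z] by (auto simp: S1_def)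
    have "z \<in> annulus t2 (1 / t2)" using z r b ri by (auto simp: annulus_iff)
    hence "z \<notin> S2" using t2(3) by blast
    moreover have "z \<in> K" using z r b t1' ri by (auto simp: annulus_iff K_def)
    ultimately have "deriv B z \<noteq> 0" by (simp add: S2_def)
    thus "poly Q z \<noteq> 0 \<and> B z \<noteq> 0 \<and> deriv B z \<noteq> 0" using z1 by (simp add: B_PQ)
  qed (use s r t b in auto)
qed

end

subsection \<open>The transfer operator\<close>

locale blaschke_annulus = blaschke +
  fixes s r t :: real
  assumes s_pos: "0 < s" and s_r: "s < r" and r_t: "r < t" and t_1: "t < 1"
    and B_cball: "\<And>w. cmod w \<le> t \<Longrightarrow> cmod (B w) \<le> s"
    and regular: "\<And>z. z \<in> annulus r (1 / r) \<Longrightarrow> poly Q z \<noteq> 0 \<and> B z \<noteq> 0 \<and> deriv B z \<noteq> 0"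
begin

abbreviation A where "A \<equiv> annulus r (1 / r)"
abbreviation A' where "A' \<equiv> annulus s (1 / s)"

lemma t_pos: "0 < t" and r_pos: "0 < r" using s_pos s_r r_t by linarith+

lemma radii_inverse: "1 < 1 / t" "1 / t < 1 / r" "1 / r < 1 / s"
  using s_pos s_r r_t t_1 by (auto intro!: frac_less2)

lemma A_subset: "A \<subseteq> A'" using s_r radii_inverse by (auto simp: annulus_iff)

section \<open>Fibres as roots of a polynomial\<close>

definition fiber :: "complex \<Rightarrow> complex set" where "fiber z = {w. B w = z}"

text \<open>Points with modulus at most \<open>t\<close> have images of modulus at most
  \<open>s\<close>, outside \<open>A'\<close>; the upper bound follows by reflection. Hence
  \<open>L f\<close> on the large annulus \<open>A'\<close> depends only on the values of
  \<open>f\<close> on a compact part of the small one.\<close>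

lemma fiber_bounds:
  assumes z: "z \<in> A'" and w: "w \<in> fiber z"
  shows "t < cmod w" "cmod w < 1 / t"
proof -
  have Bw: "B w = z" using w by (simp add: fiber_def)
  show "t < cmod w" using B_cball[of w] z Bw by (force simp: annulus_iff)
  show "cmod w < 1 / t"
  proof (rule ccontr)
    assume "\<not> cmod w < 1 / t"
    hence wt: "1 / t \<le> cmod w" by simp
    hence w0: "w \<noteq> 0" using radii_inverse t_pos by auto
    define q where "q = 1 / cnj w"
    have "cmod q = 1 / cmod w" by (simp add: q_def norm_divide)
    hence "cmod q \<le> t" using wt w0 t_pos by (simp add: pos_divide_le_eq mult.commute)
    hence "cmod (B q) \<le> s" by (rule B_cball)
    hence "1 / cmod z \<le> s" unfolding q_def B_reflect[OF w0] Bw by (simp add: norm_divide)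
    moreover have "0 < cmod z" "cmod z < 1 / s" using z s_pos by (auto simp: annulus_iff)
    ultimately have "1 \<le> s * cmod z" "s * cmod z < 1" using s_pos by (auto simp: pos_divide_le_eq pos_less_divide_eq mult.commute)
    thus False by simp
  qed
qed

lemma fiber_subset: "z \<in> A' \<Longrightarrow> fiber z \<subseteq> A"
  using fiber_bounds r_t radii_inverse by (fastforce simp: annulus_iff)

definition F :: "complex \<Rightarrow> complex poly" where "F z = P - smult z Q"

definition lead_Q :: complex where "lead_Q = (\<Prod>i=1..n. - cnj (a i))"

text \<open>Here \<open>z \<noteq> 0\<close> matters: at a pole \<open>B\<close> has the value zero
  by convention, so only the fibre over 0 could contain poles.\<close>

lemma fiber_poly: assumes z: "z \<in> A'" shows "fiber z = {w. poly (F z) w = 0}"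
proof -
  have z0: "z \<noteq> 0" using z s_pos by (auto simp: annulus_iff)
  show ?thesis
  proof (intro set_eqI iffI)
    fix w assume "w \<in> fiber z"
    hence "poly P w / poly Q w = z" by (simp add: fiber_def B_PQ)
    moreover from this have "poly Q w \<noteq> 0" using z0 by auto
    ultimately show "w \<in> {w. poly (F z) w = 0}" by (auto simp: F_def)
  next
    fix w assume "w \<in> {w. poly (F z) w = 0}"
    hence "poly P w = z * poly Q w" by (simp add: F_def)
    moreover from this have "poly Q w \<noteq> 0" using PQ_no_common_root[of w] by auto
    ultimately show "w \<in> fiber z" by (simp add: fiber_def B_PQ)
  qed
qed

lemma B_0: "B 0 = C * cnj lead_Q"
  by (simp add: B_eq lead_Q_def)

lemma norm_lead_Q: "cmod lead_Q \<le> s"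
proof -
  have "cmod (B 0) \<le> s" using s_pos s_r r_t by (intro B_cball) auto
  thus ?thesis by (simp add: B_0 norm_mult norm_C)
qed

text \<open>Keeps the degree of \<open>F z\<close> equal to \<open>n\<close>, so that no root
  escapes to infinity. The reason is
  \<open>cmod lead_Q = cmod (B 0) \<le> s < 1 / cmod z\<close>.\<close>

lemma lead_nz: assumes z: "z \<in> A'" shows "C - z * lead_Q \<noteq> 0"
proof
  assume "C - z * lead_Q = 0"
  hence "C = z * lead_Q" by simp
  hence "1 = cmod z * cmod lead_Q" using norm_C by (metis norm_mult)
  also have "\<dots> \<le> cmod z * s" using norm_lead_Q by (intro mult_left_mono) auto
  also have "\<dots> < 1" using z s_pos by (simp add: annulus_iff field_simps)
  finally show False by simp
qed

lemma degree_Q: "degree Q \<le> n" "coeff Q n = lead_Q"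
  using degree_prod_linear[of "{1..n}" "\<lambda>i. 1" "\<lambda>i. - cnj (a i)"] by (simp_all add: Q_def lead_Q_def)

lemma degree_P: "degree P \<le> n" "coeff P n = C"
  using degree_prod_linear[of "{1..n}" "\<lambda>i. - a i" "\<lambda>i. 1"] by (simp_all add: P_def order_trans[OF degree_smult_le])

lemma degree_F: assumes z: "z \<in> A'" shows "degree (F z) = n" "lead_coeff (F z) = C - z * lead_Q"
proof -
  have "coeff (F z) n = C - z * lead_Q" by (simp add: F_def degree_P degree_Q)
  moreover have "degree (F z) \<le> n"
    unfolding F_def using degree_P degree_Q by (intro degree_diff_le) (auto intro: order_trans[OF degree_smult_le])
  ultimately show "degree (F z) = n" using lead_nz[OF z] le_degree[of "F z" n] by auto
  thus "lead_coeff (F z) = C - z * lead_Q" using \<open>coeff (F z) n = C - z * lead_Q\<close> by simp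
qed

lemma fiber_regular:
  assumes z: "z \<in> A'" and w: "w \<in> fiber z"
  shows "poly Q w \<noteq> 0" "deriv B w \<noteq> 0" "deriv B w = poly (pderiv (F z)) w / poly Q w"
proof -
  show Qw: "poly Q w \<noteq> 0" and "deriv B w \<noteq> 0" using regular fiber_subset[OF z] w by auto
  have Pw: "poly P w = z * poly Q w" using w unfolding fiber_poly[OF z] by (simp add: F_def)
  have "deriv B w = (poly (pderiv P) w * poly Q w - poly P w * poly (pderiv Q) w) / (poly Q w * poly Q w)"
    using has_field_derivative_B[OF Qw] by (rule DERIV_imp_deriv)
  also have "\<dots> = poly (pderiv (F z)) w / poly Q w"
    using Qw by (simp add: Pw F_def pderiv_diff pderiv_smult field_simps)
  finally show "deriv B w = poly (pderiv (F z)) w / poly Q w" .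
qed

lemma F_decompose:
  assumes z: "z \<in> A'" shows "F z = smult (C - z * lead_Q) (\<Prod>w\<in>fiber z. [:- w, 1:])"
proof -
  have "rsquarefree (F z)"
    unfolding rsquarefree_roots using fiber_regular[OF z] fiber_poly[OF z] by fastforce
  from complex_poly_decompose_rsquarefree[OF this] show ?thesis
    by (simp add: degree_F(2)[OF z] fiber_poly[OF z])
qed

lemma finite_fiber: assumes z: "z \<in> A'" shows "finite (fiber z)"
proof -
  have "F z \<noteq> 0" using degree_F[OF z] n by auto
  thus ?thesis by (simp add: fiber_poly[OF z] poly_roots_finite)
qed

lemma card_fiber: assumes z: "z \<in> A'" shows "card (fiber z) = n"
proof -
  have "degree (F z) = degree (\<Prod>w\<in>fiber z. [:- w, 1:])"
    using F_decompose[OF z] lead_nz[OF z] by (metis degree_smult_eq)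
  also have "\<dots> = (\<Sum>w\<in>fiber z. degree [:- w, 1:])" by (rule degree_prod_eq_sum_degree) auto
  finally show ?thesis using degree_F[OF z] by simp
qed

text \<open>Lagrange interpolation at the simple roots of \<open>F z\<close>, evaluated at
  \<open>p\<close>: the residue of \<open>Q / F z\<close> at a root \<open>w\<close> is
  \<open>1 / deriv B w\<close>. As \<open>Q\<close> may have degree \<open>n\<close>, a multiple of
  \<open>F z\<close> is split off first, which produces the term with \<open>lead_Q\<close>.\<close>

lemma partial_fractions:
  assumes z: "z \<in> A'" and p: "poly (F z) p \<noteq> 0"
  shows "(\<Sum>w\<in>fiber z. 1 / (deriv B w * (w - p))) = lead_Q / (C - z * lead_Q) - poly Q p / poly (F z) p"
proof -
  define W where "W = fiber z"
  define lc where "lc = C - z * lead_Q"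
  have lc: "lc \<noteq> 0" using lead_nz[OF z] by (simp add: lc_def)
  have W: "finite W" "card W = n" using finite_fiber[OF z] card_fiber[OF z] by (auto simp: W_def)
  define l where "l w = smult lc (\<Prod>v\<in>W-{w}. [:- v, 1:])" for w
  have Fl: "F z = [:- w, 1:] * l w" if "w \<in> W" for w
    using F_decompose[OF z] that W by (simp add: l_def lc_def W_def prod.remove[of _ w])
  have l_same: "poly (l w) w = poly (pderiv (F z)) w" if "w \<in> W" for w
    unfolding Fl[OF that] pderiv_mult poly_add poly_mult by (simp add: pderiv_pCons)
  have l_other: "poly (l w) v = 0" if "v \<in> W" "v \<noteq> w" for v w
    using that W by (auto simp: l_def poly_prod)
  have l_deg: "degree (l w) < n" if "w \<in> W" for w
  proof -
    have "degree (l w) \<le> degree (\<Prod>v\<in>W-{w}. [:- v, 1:])" by (simp add: l_def degree_smult_le)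
    also have "\<dots> = card (W - {w})" by (subst degree_prod_eq_sum_degree) auto
    also have "\<dots> < n" using W that card_Diff1_less[of W w] by simp
    finally show ?thesis .
  qed
  define G where "G = Q - smult (lead_Q / lc) (F z)"
  have G_deg: "degree G < n"
  proof -
    have "degree G \<le> n" unfolding G_def using degree_Q degree_F[OF z]
      by (intro degree_diff_le) (auto intro: order_trans[OF degree_smult_le])
    moreover have "coeff (F z) n = lc" using degree_F[OF z] by (simp add: lc_def)
    hence "coeff G n = 0" using lc degree_Q by (simp add: G_def)
    hence "degree G \<noteq> n" using n by (metis leading_coeff_0_iff degree_0 not_numeral_le_zero)
    ultimately show ?thesis by simp
  qed
  \<comment> \<open>The interpolation error has degree below \<open>n\<close> and vanishes at the
    \<open>n\<close> points of the fibre.\<close>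
  define D where "D = G - (\<Sum>w\<in>W. smult (poly Q w / poly (pderiv (F z)) w) (l w))"
  have D_deg: "degree D < n"
    unfolding D_def
    by (intro degree_diff_less G_deg degree_sum_less) (use l_deg n in \<open>auto intro: le_less_trans[OF degree_smult_le]\<close>)
  have D_root: "poly D v = 0" if v: "v \<in> W" for v
  proof -
    have "(\<Sum>w\<in>W. poly Q w / poly (pderiv (F z)) w * poly (l w) v) = (\<Sum>w\<in>{v}. poly Q w / poly (pderiv (F z)) w * poly (l w) v)"
      by (rule sum.mono_neutral_right) (use W v l_other in auto)
    also have "\<dots> = poly Q v"
      using l_same[OF v] fiber_regular[OF z, of v] v by (auto simp: W_def)
    finally show ?thesis using v fiber_poly[OF z] by (auto simp: D_def G_def poly_sum W_def)
  qed
  have "D = 0"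
  proof (rule ccontr)
    assume "D \<noteq> 0"
    hence "card {x. poly D x = 0} \<le> degree D" "finite {x. poly D x = 0}" by (auto simp: card_poly_roots_bound poly_roots_finite)
    moreover have "card W \<le> card {x. poly D x = 0}" by (rule card_mono) (use \<open>finite {x. poly D x = 0}\<close> D_root in auto)
    ultimately show False using D_deg W by simp
  qed
  hence "poly D p = 0" by simp
  hence "poly Q p - lead_Q / lc * poly (F z) p = (\<Sum>w\<in>W. poly Q w / poly (pderiv (F z)) w * poly (l w) p)"
    by (simp add: D_def G_def poly_sum)
  also have "\<dots> = (\<Sum>w\<in>W. poly (F z) p * (- (1 / (deriv B w * (w - p)))))"
  proof (rule sum.cong[OF refl])
    fix w assume w: "w \<in> W"
    have "w \<noteq> p" using w p fiber_poly[OF z] by (auto simp: W_def)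
    moreover have "poly (F z) p = (p - w) * poly (l w) p" unfolding Fl[OF w] poly_mult by simp
    ultimately have "poly (l w) p = poly (F z) p / (p - w)" by simp
    moreover have "poly Q w / poly (pderiv (F z)) w = 1 / deriv B w"
      using fiber_regular(3)[OF z, of w] w by (simp add: W_def)
    moreover have "w - p = - (p - w)" by simp
    ultimately show "poly Q w / poly (pderiv (F z)) w * poly (l w) p = poly (F z) p * (- (1 / (deriv B w * (w - p))))"
      by (simp only: mult_minus_right divide_minus_right minus_minus) simp
  qed
  also have "\<dots> = poly (F z) p * (- (\<Sum>w\<in>W. 1 / (deriv B w * (w - p))))"
    by (simp add: sum_distrib_left sum_negf)
  finally show ?thesis using p by (simp add: W_def lc_def field_simps)
qed

section \<open>Action on Cauchy kernels\<close>

text \<open>\<open>hk z q\<close> has its pole at \<open>z = q\<close>. For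
  \<open>q \<noteq> 0\<close>, \<open>cnj (gk z q) = 1 / (1 / cnj q - z)\<close> has its pole at the
  reflection of \<open>q\<close>. Written without \<open>1 / cnj q\<close> it is meaningful at
  \<open>q = 0\<close>, and keeping the conjugation outside makes \<open>gk z\<close> holomorphic in
  \<open>q\<close>.\<close>

definition hk :: "complex \<Rightarrow> complex \<Rightarrow> complex" where "hk z q = 1 / (z - q)"
definition gk :: "complex \<Rightarrow> complex \<Rightarrow> complex" where "gk z q = q / (1 - q * cnj z)"

definition L :: "(complex \<Rightarrow> complex) \<Rightarrow> complex \<Rightarrow> complex" where
  "L f z = (\<Sum>w\<in>fiber z. f w / deriv B w)"

text \<open>The term left over by the partial fractions is itself a reflected kernel, with parameter
  \<open>B 0\<close>. Therefore \<open>L_hk\<close> and \<open>L_gk\<close> stay within the two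
  families of kernels and can be iterated.\<close>

lemma lead_Q_term: assumes z: "z \<in> A'" shows "lead_Q / (C - z * lead_Q) = cnj (gk z (B 0))"
proof -
  have "cnj (gk z (B 0)) = (cnj C * lead_Q) / (1 - cnj C * lead_Q * z)"
    by (simp add: gk_def B_0)
  also have "\<dots> = (C * (cnj C * lead_Q)) / (C * (1 - cnj C * lead_Q * z))" using C_nz by simp
  also have "\<dots> = ((C * cnj C) * lead_Q) / (C - (C * cnj C) * lead_Q * z)" by (simp add: algebra_simps)
  finally show ?thesis by (simp add: C_cnj mult.commute)
qed

lemma F_nz_inner: assumes z: "z \<in> A'" and q: "cmod q \<le> t" shows "poly (F z) q \<noteq> 0"
  using fiber_bounds(1)[OF z, of q] q fiber_poly[OF z] by force

lemma L_hk:
  assumes z: "z \<in> A'" and q: "cmod q \<le> t"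
  shows "L (\<lambda>w. hk w q) z = hk z (B q) + cnj (gk z (B 0))"
proof -
  have Qq: "poly Q q \<noteq> 0" using q t_1 by (intro Q_nz) auto
  have "L (\<lambda>w. hk w q) z = (\<Sum>w\<in>fiber z. 1 / (deriv B w * (w - q)))"
    by (simp add: L_def hk_def mult.commute)
  also have "\<dots> = lead_Q / (C - z * lead_Q) - poly Q q / poly (F z) q"
    by (rule partial_fractions[OF z F_nz_inner[OF z q]])
  also have "poly Q q / poly (F z) q = - hk z (B q)"
    using Qq F_nz_inner[OF z q] by (simp add: F_def hk_def B_PQ divide_simps) (simp add: algebra_simps)
  finally show ?thesis by (simp add: lead_Q_term[OF z])
qed

text \<open>Partial fractions at the reflected point \<open>p = 1 / cnj q\<close>, where
  \<open>P\<close> and \<open>Q\<close> exchange roles up to conjugation and the common factor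
  \<open>C / cnj q ^ n\<close>. For \<open>q = 0\<close> the pole would be at infinity and the
  kernel is zero.\<close>

lemma L_gk:
  assumes z: "z \<in> A'" and q: "cmod q \<le> t"
  shows "L (\<lambda>w. cnj (gk w q)) z = cnj (gk z (B q)) - cnj (gk z (B 0))"
proof (cases "q = 0")
  case True
  thus ?thesis by (simp add: L_def gk_def)
next
  case False
  define p where "p = 1 / cnj q"
  have p: "1 / t \<le> cmod p" using q False s_pos s_r r_t by (simp add: p_def norm_divide frac_le)
  have Fp: "poly (F z) p \<noteq> 0" using fiber_bounds(2)[OF z, of p] p fiber_poly[OF z] by force
  have Qq: "poly Q q \<noteq> 0" using q t_1 by (intro Q_nz) auto
  have pP: "poly P p = C * cnj (poly Q q) / cnj q ^ n"
  proof -
    have "poly P p = C * (\<Prod>i=1..n. (1 - a i * cnj q) / cnj q)"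
      unfolding poly_P p_def using False by (intro arg_cong[where f = "\<lambda>x. C * x"] prod.cong) (auto simp: field_simps)
    thus ?thesis by (simp add: poly_Q prod_dividef)
  qed
  have pQ: "poly Q p = C * cnj (poly P q) / cnj q ^ n"
  proof -
    have "poly Q p = (\<Prod>i=1..n. (cnj q - cnj (a i)) / cnj q)"
      unfolding poly_Q p_def using False by (intro prod.cong) (auto simp: field_simps)
    also have "\<dots> = (C * cnj C) * (\<Prod>i=1..n. (cnj q - cnj (a i))) / cnj q ^ n"
      by (simp add: C_cnj prod_dividef)
    finally show ?thesis by (simp add: poly_P mult.assoc)
  qed
  have "1 / (deriv B w * (w - p)) = - (cnj (gk w q) / deriv B w)" if w: "w \<in> fiber z" for w
  proof -
    have "w \<noteq> p" using w Fp fiber_poly[OF z] by auto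
    hence "1 - cnj q * w \<noteq> 0" using False by (auto simp: p_def field_simps)
    thus ?thesis using False \<open>w \<noteq> p\<close> fiber_regular(2)[OF z w]
      by (simp add: gk_def p_def divide_simps) (simp add: algebra_simps)
  qed
  hence "L (\<lambda>w. cnj (gk w q)) z = - (\<Sum>w\<in>fiber z. 1 / (deriv B w * (w - p)))"
    by (simp add: L_def sum_negf)
  also have "\<dots> = poly Q p / poly (F z) p - lead_Q / (C - z * lead_Q)"
    by (simp add: partial_fractions[OF z Fp])
  also have "poly Q p / poly (F z) p = cnj (gk z (B q))"
  proof -
    have "poly Q p / poly (F z) p = cnj (poly P q) / (cnj (poly Q q) - z * cnj (poly P q))"
      using False C_nz by (simp add: F_def pP pQ diff_divide_distrib[symmetric] mult.left_commute[of z] right_diff_distrib[symmetric])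
    also have "\<dots> = cnj (gk z (B q))"
      using Qq by (simp add: gk_def B_PQ divide_simps)
    finally show ?thesis .
  qed
  finally show ?thesis by (simp add: lead_Q_term[OF z])
qed

end

section \<open>Inverse branches and the covering\<close>

context blaschke_annulus
begin

lemma holomorphic_B_A: "B holomorphic_on A" by (rule holomorphic_B) (use regular in blast)

lemma locally_injective:
  assumes "w \<in> A" "open S" "w \<in> S"
  obtains e where "e > 0" "ball w e \<subseteq> A \<inter> S" "inj_on B (ball w e)"
  by (rule has_complex_derivative_locally_injective[of B "A \<inter> S" w])
     (use assms regular holomorphic_B_A in \<open>auto intro: holomorphic_on_subset\<close>)

text \<open>The set of agreement is closed by continuity and open because \<open>B\<close> is
  locally injective on \<open>A\<close>.\<close>

lemma branches_agree:
  assumes U: "connected U" and \<phi>: "continuous_on U \<phi>" "\<phi> ` U \<subseteq> A" "\<And>z. z \<in> U \<Longrightarrow> B (\<phi> z) = z"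
    and \<psi>: "continuous_on U \<psi>" "\<psi> ` U \<subseteq> A" "\<And>z. z \<in> U \<Longrightarrow> B (\<psi> z) = z"
    and x: "x \<in> U" "\<phi> x = \<psi> x" and y: "y \<in> U"
  shows "\<phi> y = \<psi> y"
proof -
  define E where "E = {z \<in> U. \<phi> z - \<psi> z = 0}"
  have "openin (top_of_set U) E"
  proof (subst openin_subopen, intro ballI)
    fix z assume z: "z \<in> E"
    hence zU: "z \<in> U" "\<phi> z = \<psi> z" by (auto simp: E_def)
    obtain e where e: "e > 0" "inj_on B (ball (\<phi> z) e)"
      using locally_injective[of "\<phi> z" UNIV] zU \<phi>(2) by blast
    define N where "N = (U \<inter> \<phi> -` ball (\<phi> z) e) \<inter> (U \<inter> \<psi> -` ball (\<phi> z) e)"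
    have "openin (top_of_set U) N" unfolding N_def
      by (intro openin_Int continuous_openin_preimage_gen \<phi>(1) \<psi>(1) open_ball)
    moreover have "z \<in> N" using zU e by (auto simp: N_def)
    moreover have "N \<subseteq> E"
    proof
      fix v assume v: "v \<in> N"
      hence "B (\<phi> v) = B (\<psi> v)" using \<phi>(3) \<psi>(3) by (auto simp: N_def)
      hence "\<phi> v = \<psi> v" using e(2) v by (auto simp: N_def dest: inj_onD)
      thus "v \<in> E" using v by (auto simp: E_def N_def)
    qed
    ultimately show "\<exists>T. openin (top_of_set U) T \<and> z \<in> T \<and> T \<subseteq> E" by blast
  qed
  moreover have "closedin (top_of_set U) E"
    unfolding E_def by (intro continuous_closedin_preimage_constant continuous_intros \<phi>(1) \<psi>(1))
  ultimately have "E = {} \<or> E = U" using U by (simp add: connected_clopen)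
  moreover have "x \<in> E" using x by (simp add: E_def)
  ultimately show ?thesis using y by (auto simp: E_def)
qed

lemma branch_derivative:
  assumes "open U" "continuous_on U \<phi>" "\<phi> ` U \<subseteq> A" "\<And>z. z \<in> U \<Longrightarrow> B (\<phi> z) = z" "z \<in> U"
  shows "(\<phi> has_field_derivative 1 / deriv B (\<phi> z)) (at z)"
proof -
  have "\<phi> z \<in> A" using assms by auto
  hence "(B has_field_derivative deriv B (\<phi> z)) (at (\<phi> z))" "deriv B (\<phi> z) \<noteq> 0"
    using holomorphic_derivI[OF holomorphic_B_A open_annulus] regular by blast+
  moreover have "isCont \<phi> z" using assms by (simp add: continuous_on_eq_continuous_at)
  ultimately have "(\<phi> has_field_derivative inverse (deriv B (\<phi> z))) (at z)"
    using assms by (intro has_field_derivative_inverse_basic[of B "deriv B (\<phi> z)" \<phi> z U]) auto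
  thus ?thesis by (simp add: inverse_eq_divide)
qed

text \<open>Branches that differ at one point differ everywhere, and all fibres have
  \<open>n\<close> points; so branches exhausting one fibre exhaust every fibre. Consequently all
  admissible choices in \<open>transfer_value\<close> produce the same sum.\<close>

lemma branches_list_fibers:
  fixes K :: nat
  assumes U: "open U" "connected U" "U \<subseteq> A'"
    and \<phi>: "\<And>k. k < K \<Longrightarrow> continuous_on U (\<phi> k)" "\<And>k. k < K \<Longrightarrow> \<phi> k ` U \<subseteq> A"
      "\<And>k z. k < K \<Longrightarrow> z \<in> U \<Longrightarrow> B (\<phi> k z) = z"
    and x: "x \<in> U" "bij_betw (\<lambda>k. \<phi> k x) {..<K} (fiber x)" and z: "z \<in> U"
  shows "bij_betw (\<lambda>k. \<phi> k z) {..<K} (fiber z)"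
    and "(\<Sum>k<K. deriv (\<phi> k) z * (f \<circ> \<phi> k) z) = L f z"
proof -
  have Kn: "K = n" using bij_betw_same_card[OF x(2)] card_fiber[of x] x(1) U(3) by auto
  have inj: "inj_on (\<lambda>k. \<phi> k z) {..<K}"
  proof (rule inj_onI)
    fix i j assume ij: "i \<in> {..<K}" "j \<in> {..<K}" "\<phi> i z = \<phi> j z"
    have "\<phi> i x = \<phi> j x"
      by (rule branches_agree[OF U(2), of "\<phi> i" "\<phi> j" z x]) (use ij \<phi> z x in auto)
    thus "i = j" using x(2) ij by (auto simp: bij_betw_def dest: inj_onD)
  qed
  moreover have "(\<lambda>k. \<phi> k z) ` {..<K} = fiber z"
  proof (rule card_subset_eq)
    show "finite (fiber z)" by (rule finite_fiber) (use z U in auto)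
    show "(\<lambda>k. \<phi> k z) ` {..<K} \<subseteq> fiber z" using \<phi>(3) z by (auto simp: fiber_def)
    show "card ((\<lambda>k. \<phi> k z) ` {..<K}) = card (fiber z)"
      using card_image[OF inj] card_fiber[of z] z U(3) Kn by auto
  qed
  ultimately show bij: "bij_betw (\<lambda>k. \<phi> k z) {..<K} (fiber z)" by (simp add: bij_betw_def)
  have "(\<Sum>k<K. deriv (\<phi> k) z * (f \<circ> \<phi> k) z) = (\<Sum>k<K. f (\<phi> k z) / deriv B (\<phi> k z))"
  proof (rule sum.cong[OF refl])
    fix k assume k: "k \<in> {..<K}"
    have "(\<phi> k has_field_derivative 1 / deriv B (\<phi> k z)) (at z)"
      by (rule branch_derivative[OF U(1)]) (use \<phi> k z in auto)
    thus "deriv (\<phi> k) z * (f \<circ> \<phi> k) z = f (\<phi> k z) / deriv B (\<phi> k z)" by (simp add: DERIV_imp_deriv)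
  qed
  also have "\<dots> = L f z"
    unfolding L_def by (rule sum.reindex_bij_betw[OF bij])
  finally show "(\<Sum>k<K. deriv (\<phi> k) z * (f \<circ> \<phi> k) z) = L f z" .
qed

lemma fiber_circle:
  assumes z: "cmod z = 1" shows "fiber z = {w \<in> sphere 0 1. B w = z}"
proof -
  have "cmod w = 1" if w: "B w = z" for w
  proof (rule ccontr)
    assume "cmod w \<noteq> 1"
    then consider "cmod w < 1" | "cmod w > 1" by linarith
    thus False
    proof cases
      case 1 thus False using norm_B_less_1[of w] w z by simp
    next
      case 2
      hence w0: "w \<noteq> 0" by auto
      have "cmod (B (1 / cnj w)) < 1" by (rule norm_B_less_1) (use 2 in \<open>simp add: norm_divide divide_less_eq\<close>)
      thus False unfolding B_reflect[OF w0] w using z by (simp add: norm_divide)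
    qed
  qed
  thus ?thesis by (auto simp: fiber_def)
qed

lemma circle_subset_A': "cmod z = 1 \<Longrightarrow> z \<in> A'"
  using s_pos s_r r_t t_1 radii_inverse by (simp add: annulus_iff)

definition preim :: "complex set" where "preim = {w. B w \<in> A'}"

lemma preim_subset: "preim \<subseteq> A" using fiber_subset by (auto simp: preim_def fiber_def)

lemma open_preim: "open preim"
proof -
  have "open (A \<inter> B -` A')"
    by (rule continuous_open_preimage) (use holomorphic_B_A holomorphic_on_imp_continuous_on in auto)
  moreover have "A \<inter> B -` A' = preim" using preim_subset by (auto simp: preim_def)
  ultimately show ?thesis by simp
qed

text \<open>Choose disjoint discs around the points of a fibre on which \<open>B\<close> is
  injective, and let \<open>T\<close> be the part of \<open>A'\<close> common to their images. Over
  \<open>T\<close> each disc holds one preimage; since every fibre has \<open>n\<close> points there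
  are no others, and the discs restricted to the preimage of \<open>T\<close> are the
  sheets.\<close>

lemma covering_B: "covering_space preim B A'"
  unfolding covering_space_def
proof (intro conjI ballI)
  show contB: "continuous_on preim B"
    by (rule continuous_on_subset[OF holomorphic_on_imp_continuous_on[OF holomorphic_B_A] preim_subset])
  show "B ` preim = A'"
  proof
    show "A' \<subseteq> B ` preim"
    proof
      fix z assume z: "z \<in> A'"
      have "fiber z \<noteq> {}" using card_fiber[OF z] n by auto
      thus "z \<in> B ` preim" using z by (auto simp: fiber_def preim_def)
    qed
  qed (auto simp: preim_def)
  fix z assume z: "z \<in> A'"
  let ?W = "fiber z"
  \<comment> \<open>Radii of at most half the distance to the other points of the fibre make the
    discs disjoint.\<close>
  have "\<forall>w\<in>?W. \<exists>e. e > 0 \<and> ball w e \<subseteq> preim \<and> inj_on B (ball w e) \<and> (\<forall>v\<in>?W. v \<noteq> w \<longrightarrow> 2 * e \<le> dist w v)"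
  proof
    fix w assume w: "w \<in> ?W"
    have wp: "w \<in> preim" "w \<in> A" using w z fiber_subset[OF z] by (auto simp: preim_def fiber_def)
    obtain e1 where e1: "e1 > 0" "ball w e1 \<subseteq> A \<inter> preim" "inj_on B (ball w e1)"
      by (rule locally_injective[OF wp(2) open_preim wp(1)])
    obtain d where d: "d > 0" "\<And>v. v \<in> ?W \<Longrightarrow> v \<noteq> w \<Longrightarrow> d \<le> dist w v"
      using finite_set_avoid[OF finite_fiber[OF z], of w] by blast
    define e where "e = min e1 (d / 2)"
    have "e > 0" "ball w e \<subseteq> ball w e1" using e1 d by (auto simp: e_def)
    moreover have "2 * e \<le> dist w v" if "v \<in> ?W" "v \<noteq> w" for v using d(2)[OF that] by (simp add: e_def min_def)
    ultimately show "\<exists>e. e > 0 \<and> ball w e \<subseteq> preim \<and> inj_on B (ball w e) \<and> (\<forall>v\<in>?W. v \<noteq> w \<longrightarrow> 2 * e \<le> dist w v)"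
      using e1(2) inj_on_subset[OF e1(3)] by blast
  qed
  from bchoice[OF this] obtain e where e: "\<And>w. w \<in> ?W \<Longrightarrow> e w > 0 \<and> ball w (e w) \<subseteq> preim \<and> inj_on B (ball w (e w)) \<and> (\<forall>v\<in>?W. v \<noteq> w \<longrightarrow> 2 * e w \<le> dist w v)"
    by blast
  define N where "N w = ball w (e w)" for w
  have N: "w \<in> N w" "N w \<subseteq> preim" "inj_on B (N w)" if "w \<in> ?W" for w using e[OF that] by (auto simp: N_def)
  have N_disj: "N w \<inter> N v = {}" if "w \<in> ?W" "v \<in> ?W" "w \<noteq> v" for w v
  proof (rule ccontr)
    assume "N w \<inter> N v \<noteq> {}"
    then obtain x where "dist w x < e w" "dist v x < e v" by (auto simp: N_def)
    hence "dist w v < e w + e v" using dist_triangle2[of w v x] by linarith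
    moreover have "2 * e w \<le> dist w v" "2 * e v \<le> dist v w" using e[OF that(1)] e[OF that(2)] that by auto
    moreover have "dist v w = dist w v" by (rule dist_commute)
    ultimately show False by linarith
  qed
  have open_img: "open (B ` S)" if "w \<in> ?W" "S \<subseteq> N w" "open S" for w S
  proof (rule open_mapping_thm3)
    show "B holomorphic_on S" by (rule holomorphic_on_subset[OF holomorphic_B_A]) (use that N preim_subset in blast)
    show "inj_on B S" using N(3)[OF that(1)] that(2) by (rule inj_on_subset)
  qed fact
  define T where "T = A' \<inter> (\<Inter>w\<in>?W. B ` N w)"
  have T_open: "open T" unfolding T_def
    using finite_fiber[OF z] open_img by (intro open_Int open_INT) (auto simp: N_def)
  have zT: "z \<in> T" using z N(1) by (auto simp: T_def fiber_def)
  define v where "v = (\<lambda>w. N w \<inter> B -` T) ` ?W"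
  have sheets: "\<Union>v = preim \<inter> B -` T"
  proof
    show "\<Union>v \<subseteq> preim \<inter> B -` T" unfolding v_def using N(2) by blast
    show "preim \<inter> B -` T \<subseteq> \<Union>v"
    proof
      fix x assume x: "x \<in> preim \<inter> B -` T"
      have "\<forall>w\<in>?W. \<exists>y. y \<in> N w \<and> B y = B x"
      proof
        fix w assume "w \<in> ?W"
        hence "B x \<in> B ` N w" using x by (auto simp: T_def)
        thus "\<exists>y. y \<in> N w \<and> B y = B x" by force
      qed
      from bchoice[OF this] obtain y where y: "\<And>w. w \<in> ?W \<Longrightarrow> y w \<in> N w \<and> B (y w) = B x" by blast
      have BxA: "B x \<in> A'" using x by (auto simp: T_def)
      have inj: "inj_on y ?W"
      proof (rule inj_onI)
        fix w w' assume ww: "w \<in> ?W" "w' \<in> ?W" "y w = y w'"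
        show "w = w'"
        proof (rule ccontr)
          assume "w \<noteq> w'"
          hence "N w \<inter> N w' = {}" using N_disj ww by blast
          moreover have "y w \<in> N w" "y w \<in> N w'" using y[OF ww(1)] y[OF ww(2)] ww(3) by simp_all
          ultimately show False by blast
        qed
      qed
      have y_im: "y ` ?W \<subseteq> fiber (B x)" using y by (auto simp: fiber_def)
      have "y ` ?W = fiber (B x)"
        using card_image[OF inj] card_fiber[OF z] card_fiber[OF BxA]
        by (intro card_subset_eq finite_fiber BxA y_im) simp
      moreover have "x \<in> fiber (B x)" by (simp add: fiber_def)
      ultimately obtain w where w: "w \<in> ?W" "x = y w" by blast
      hence "x \<in> N w \<inter> B -` T" using y[OF w(1)] x by blast
      thus "x \<in> \<Union>v" unfolding v_def using w(1) by blast
    qed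
  qed
  have B_open_preim: "open (N w \<inter> B -` T)" if "w \<in> ?W" for w
    by (rule continuous_open_preimage) (use continuous_on_subset[OF contB N(2)[OF that]] T_open in \<open>simp_all add: N_def\<close>)
  show "\<exists>T. z \<in> T \<and> openin (top_of_set A') T \<and> (\<exists>v. \<Union>v = preim \<inter> B -` T \<and> (\<forall>u\<in>v. openin (top_of_set preim) u) \<and>
     pairwise disjnt v \<and> (\<forall>u\<in>v. \<exists>q. homeomorphism u T B q))"
  proof (rule exI[of _ T], intro conjI exI[of _ v])
    show "z \<in> T" by (rule zT)
    show "openin (top_of_set A') T" using T_open by (auto simp: T_def intro!: open_subset)
    show "\<Union>v = preim \<inter> B -` T" by (rule sheets)
    show "\<forall>u\<in>v. openin (top_of_set preim) u"
    proof
      fix u assume "u \<in> v"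
      show "openin (top_of_set preim) u"
      proof (rule open_subset)
        show "u \<subseteq> preim" using \<open>u \<in> v\<close> sheets by blast
        show "open u" using \<open>u \<in> v\<close> B_open_preim unfolding v_def by blast
      qed
    qed
    show "pairwise disjnt v"
      unfolding pairwise_def
    proof (intro ballI impI)
      fix X Y assume "X \<in> v" "Y \<in> v" "X \<noteq> Y"
      then obtain w w' where "w \<in> ?W" "w' \<in> ?W" "X = N w \<inter> B -` T" "Y = N w' \<inter> B -` T" "w \<noteq> w'" by (auto simp: v_def)
      thus "disjnt X Y" using N_disj[of w w'] by (auto simp: disjnt_def)
    qed
    show "\<forall>u\<in>v. \<exists>q. homeomorphism u T B q"
    proof
      fix u assume "u \<in> v"
      obtain w where w: "w \<in> ?W" "u = N w \<inter> B -` T" using \<open>u \<in> v\<close> unfolding v_def by blast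
      have uo: "open u" using B_open_preim[OF w(1)] w(2) by simp
      have "continuous_on u B" by (rule continuous_on_subset[OF contB]) (use N(2)[OF w(1)] w(2) in blast)
      moreover have "B ` u = T"
      proof
        have "T \<subseteq> B ` N w" using w(1) unfolding T_def by blast
        thus "T \<subseteq> B ` u" unfolding w(2) by blast
        show "B ` u \<subseteq> T" unfolding w(2) by blast
      qed
      moreover have "inj_on B u" by (rule inj_on_subset[OF N(3)[OF w(1)]]) (use w(2) in blast)
      moreover have "openin (top_of_set T) (B ` S)" if "openin (top_of_set u) S" for S
      proof -
        have S: "S \<subseteq> u" "open S" using that uo by (auto simp: openin_open_eq)
        have "B ` S \<subseteq> T" using S(1) \<open>B ` u = T\<close> by blast
        moreover have "open (B ` S)" by (rule open_img[OF w(1) _ S(2)]) (use S(1) w(2) in blast)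
        ultimately show ?thesis by (rule open_subset)
      qed
      ultimately show "\<exists>q. homeomorphism u T B q" using homeomorphism_injective_open_map[of u B T] by blast
    qed
  qed
qed

text \<open>Half of an annulus around the direction \<open>u\<close>. It is the injective image of a
  convex \<open>strip\<close> under \<open>u * exp x\<close>, so maps lift on it, and it meets the
  circle, as \<open>inverse_branches\<close> requires. Each point of the annulus lies in the sector
  of its own direction.\<close>

definition sector :: "complex \<Rightarrow> real \<Rightarrow> complex set" where
  "sector u \<rho> = {z \<in> annulus \<rho> (1 / \<rho>). 0 < Re (z * cnj u)}"

definition strip :: "real \<Rightarrow> complex set" where
  "strip \<rho> = {x. ln \<rho> < Re x \<and> Re x < - ln \<rho> \<and> - pi / 2 < Im x \<and> Im x < pi / 2}"

lemma convex_strip: "convex (strip \<rho>)"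
proof -
  have "strip \<rho> = {x. ln \<rho> < Re x} \<inter> {x. Re x < - ln \<rho>} \<inter> {x. - pi / 2 < Im x} \<inter> {x. Im x < pi / 2}"
    by (auto simp: strip_def)
  thus ?thesis
    by (simp only: convex_Int convex_halfspace_Re_gt convex_halfspace_Re_lt convex_halfspace_Im_gt convex_halfspace_Im_lt)
qed

lemma open_sector: "open (sector u \<rho>)"
proof -
  have "sector u \<rho> = annulus \<rho> (1 / \<rho>) \<inter> {z. 0 < Re (z * cnj u)}" by (auto simp: sector_def)
  thus ?thesis by (simp add: open_Int open_Collect_less continuous_intros)
qed

lemma exp_strip_in_sector:
  assumes u: "cmod u = 1" and \<rho>: "0 < \<rho>" and x: "x \<in> strip \<rho>"
  shows "u * exp x \<in> sector u \<rho>"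
proof -
  have "ln \<rho> < Re x" using x by (simp add: strip_def)
  hence "exp (ln \<rho>) < exp (Re x)" by (simp only: exp_less_mono)
  hence "\<rho> < exp (Re x)" using \<rho> by simp
  moreover have "Re x < - ln \<rho>" using x by (simp add: strip_def)
  hence "exp (Re x) < exp (- ln \<rho>)" by (simp only: exp_less_mono)
  hence "exp (Re x) < 1 / \<rho>" using \<rho> by (simp add: exp_minus inverse_eq_divide)
  moreover have eq: "u * exp x * cnj u = exp x"
  proof -
    have "u * cnj u = 1" using u by (simp add: complex_norm_square[symmetric])
    thus ?thesis by (simp add: mult.commute mult.left_commute)
  qed
  moreover have "0 < Re (exp x)" unfolding Re_exp using x by (intro mult_pos_pos cos_gt_zero_pi) (auto simp: strip_def)
  ultimately show ?thesis unfolding sector_def mem_Collect_eq eq using u by (simp add: annulus_iff norm_mult)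
qed

lemma Ln_sector_in_strip:
  assumes u: "cmod u = 1" and \<rho>: "0 < \<rho>" and z: "z \<in> sector u \<rho>"
  shows "Ln (z * cnj u) \<in> strip \<rho>" "u * exp (Ln (z * cnj u)) = z"
proof -
  have zb: "\<rho> < cmod z" "cmod z < 1 / \<rho>" "0 < Re (z * cnj u)" using z by (auto simp: sector_def annulus_iff)
  hence nz: "z * cnj u \<noteq> 0" by auto
  have nm: "cmod (z * cnj u) = cmod z" using u by (simp add: norm_mult)
  have re: "Re (Ln (z * cnj u)) = ln (cmod z)" using nz by (simp add: Re_Ln nm)
  have zpos: "0 < cmod z" using zb(1) \<rho> by linarith
  have "ln \<rho> < ln (cmod z)" using zb(1) by (simp only: ln_less_cancel_iff[OF \<rho> zpos])
  moreover have "ln (cmod z) < ln (1 / \<rho>)" using zb(2) \<rho> zpos by (subst ln_less_cancel_iff) simp_all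
  hence "ln (cmod z) < - ln \<rho>" using \<rho> by (simp add: ln_div)
  moreover have "\<bar>Im (Ln (z * cnj u))\<bar> < pi / 2" by (rule Re_Ln_pos_lt_imp[OF zb(3)])
  ultimately show "Ln (z * cnj u) \<in> strip \<rho>" unfolding strip_def using re by auto
  have "u * cnj u = 1" using u by (simp add: complex_norm_square[symmetric])
  thus "u * exp (Ln (z * cnj u)) = z" using nz by (simp add: mult.left_commute[of u])
qed

lemma connected_sector:
  assumes u: "cmod u = 1" and \<rho>: "0 < \<rho>" shows "connected (sector u \<rho>)"
proof -
  have "sector u \<rho> = (\<lambda>x. u * exp x) ` strip \<rho>"
    using exp_strip_in_sector[OF u \<rho>] Ln_sector_in_strip[OF u \<rho>] by (auto intro!: image_eqI[where x = "Ln (z * cnj u)" for z])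
  moreover have "connected ((\<lambda>x. u * exp x) ` strip \<rho>)"
    by (intro connected_continuous_image continuous_intros convex_connected convex_strip)
  ultimately show ?thesis by simp
qed

lemma circle_in_sector: "cmod u = 1 \<Longrightarrow> 0 < \<rho> \<Longrightarrow> \<rho> < 1 \<Longrightarrow> u \<in> sector u \<rho>"
  unfolding sector_def mem_Collect_eq complex_norm_square[symmetric] by (simp add: annulus_iff)

text \<open>The map \<open>u * exp y\<close> on the simply connected strip is lifted through
  \<open>covering_B\<close>, once for each point of the fibre over \<open>u\<close>. Composition
  with \<open>Ln (z * cnj u)\<close> turns the lifts into branches.\<close>

lemma branches_on_sector:
  assumes u: "cmod u = 1"
  shows "\<exists>\<phi>. (\<forall>k<n. continuous_on (sector u s) (\<phi> k) \<and> \<phi> k ` sector u s \<subseteq> A \<and> (\<forall>z\<in>sector u s. B (\<phi> k z) = z)) \<and>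
    bij_betw (\<lambda>k. \<phi> k u) {..<n} (fiber u)"
proof -
  have s1: "s < 1" using s_r r_t t_1 by simp
  have sec_sub: "sector u s \<subseteq> A'" by (auto simp: sector_def)
  have "\<exists>\<phi>. continuous_on (sector u s) \<phi> \<and> \<phi> ` sector u s \<subseteq> A \<and> (\<forall>z\<in>sector u s. B (\<phi> z) = z) \<and> \<phi> u = w" if w: "w \<in> fiber u" for w
  proof -
    have 0: "0 \<in> strip s" using s_pos s1 by (simp add: strip_def)
    have lp: "locally path_connected (strip s)" by (rule convex_imp_locally_path_connected[OF convex_strip])
    have sc: "simply_connected (strip s)" by (rule convex_imp_simply_connected[OF convex_strip])
    have wp: "w \<in> preim" using w circle_subset_A'[OF u] by (auto simp: preim_def fiber_def)
    obtain g where g: "continuous_on (strip s) g" "g \<in> strip s \<rightarrow> preim" "g 0 = w" "\<And>y. y \<in> strip s \<Longrightarrow> B (g y) = u * exp y"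
    proof (rule covering_space_lift_strong[OF covering_B wp 0 sc lp, of "\<lambda>y. u * exp y"])
      show "continuous_on (strip s) (\<lambda>y. u * exp y)" by (intro continuous_intros)
      show "(\<lambda>y. u * exp y) \<in> strip s \<rightarrow> A'" using exp_strip_in_sector[OF u s_pos] sec_sub by auto
      show "u * exp 0 = B w" using w by (simp add: fiber_def)
    qed blast
    define \<phi> where "\<phi> z = g (Ln (z * cnj u))" for z
    have "continuous_on (sector u s) \<phi>"
      unfolding \<phi>_def
    proof (rule continuous_on_compose2[OF g(1)])
      show "continuous_on (sector u s) (\<lambda>z. Ln (z * cnj u))"
        by (intro continuous_intros) (auto simp: sector_def complex_nonpos_Reals_iff)
      show "(\<lambda>z. Ln (z * cnj u)) ` sector u s \<subseteq> strip s" using Ln_sector_in_strip[OF u s_pos] by auto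
    qed
    moreover have "\<phi> ` sector u s \<subseteq> A" using g(2) preim_subset Ln_sector_in_strip[OF u s_pos] by (auto simp: \<phi>_def)
    moreover have "\<forall>z\<in>sector u s. B (\<phi> z) = z" using g(4) Ln_sector_in_strip[OF u s_pos] by (auto simp: \<phi>_def)
    moreover have "\<phi> u = w" using g(3) u by (simp add: \<phi>_def complex_norm_square[symmetric])
    ultimately show ?thesis by blast
  qed
  then obtain \<Phi> where \<Phi>: "\<And>w. w \<in> fiber u \<Longrightarrow> continuous_on (sector u s) (\<Phi> w) \<and> \<Phi> w ` sector u s \<subseteq> A \<and> (\<forall>z\<in>sector u s. B (\<Phi> w z) = z) \<and> \<Phi> w u = w"
    by metis
  have uA: "u \<in> A'" by (rule circle_subset_A'[OF u])
  obtain h where h: "bij_betw h {0..<n} (fiber u)"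
    using ex_bij_betw_nat_finite[OF finite_fiber[OF uA]] card_fiber[OF uA] by auto
  have hk: "h k \<in> fiber u" if "k < n" for k using h that by (auto simp: bij_betw_def)
  have "bij_betw (\<lambda>k. \<Phi> (h k) u) {0..<n} (fiber u)"
    by (rule bij_betw_cong[THEN iffD1, OF _ h]) (use hk \<Phi> in auto)
  hence "bij_betw (\<lambda>k. \<Phi> (h k) u) {..<n} (fiber u)" by (simp add: lessThan_atLeast0)
  thus ?thesis using \<Phi> hk by (intro exI[of _ "\<lambda>k. \<Phi> (h k)"]) blast
qed

text \<open>Locally the fibre sum is a sum over holomorphic branches. They are defined on sectors of
  the large annulus and take values in the small one, whence the gain in domain.\<close>

lemma L_holomorphic:
  assumes f: "f holomorphic_on A" shows "L f holomorphic_on A'"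
  unfolding holomorphic_on_open[OF open_annulus]
proof
  fix z assume z: "z \<in> A'"
  have z0: "z \<noteq> 0" using z s_pos by (auto simp: annulus_iff)
  define u where "u = z / of_real (cmod z)"
  have u: "cmod u = 1" using z0 by (simp add: u_def norm_divide)
  have "z * cnj u = of_real (cmod z)" using z0 by (simp add: u_def complex_norm_square[symmetric] power2_eq_square)
  hence zs: "z \<in> sector u s" unfolding sector_def mem_Collect_eq using z z0 by (simp only:) simp
  have sub: "sector u s \<subseteq> A'" by (auto simp: sector_def)
  have s1: "s < 1" using s_r r_t t_1 by simp
  obtain \<phi> where "(\<forall>k<n. continuous_on (sector u s) (\<phi> k) \<and> \<phi> k ` sector u s \<subseteq> A \<and> (\<forall>z\<in>sector u s. B (\<phi> k z) = z)) \<and>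
    bij_betw (\<lambda>k. \<phi> k u) {..<n} (fiber u)"
    using branches_on_sector[OF u] by (rule exE)
  hence \<phi>: "\<And>k. k < n \<Longrightarrow> continuous_on (sector u s) (\<phi> k)" "\<And>k. k < n \<Longrightarrow> \<phi> k ` sector u s \<subseteq> A"
    "\<And>k z. k < n \<Longrightarrow> z \<in> sector u s \<Longrightarrow> B (\<phi> k z) = z" "bij_betw (\<lambda>k. \<phi> k u) {..<n} (fiber u)"
    by auto
  have eq: "(\<Sum>k<n. deriv (\<phi> k) y * (f \<circ> \<phi> k) y) = L f y" if "y \<in> sector u s" for y
    by (rule branches_list_fibers(2)[OF open_sector connected_sector[OF u s_pos] sub \<phi>(1-3) circle_in_sector[OF u s_pos s1] \<phi>(4) that])
  have hol: "\<phi> k holomorphic_on sector u s" if "k < n" for k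
    unfolding holomorphic_on_open[OF open_sector]
    using branch_derivative[OF open_sector \<phi>(1-3)] that by blast
  have "(\<lambda>y. \<Sum>k<n. deriv (\<phi> k) y * (f \<circ> \<phi> k) y) holomorphic_on sector u s"
    by (intro holomorphic_intros holomorphic_deriv hol open_sector holomorphic_on_compose_gen[OF hol f] \<phi>(2)) auto
  hence "(L f) holomorphic_on sector u s" by (rule holomorphic_transform) (use eq in auto)
  thus "\<exists>D. (L f has_field_derivative D) (at z)" using zs by (auto simp: holomorphic_on_open[OF open_sector])
qed

lemma transfer_value_unique:
  assumes "transfer_value B A f z w" shows "w = L f z"
proof -
  obtain U K \<phi> where ib: "inverse_branches B A U K \<phi>" and z: "z \<in> U" and w: "w = (\<Sum>k<K. deriv (\<phi> k) z * (f \<circ> \<phi> k) z)"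
    using assms unfolding transfer_value_def by blast
  obtain x where x: "x \<in> U" "cmod x = 1" using ib by (auto simp: inverse_branches_def)
  have bij: "bij_betw (\<lambda>k. \<phi> k x) {..<K} (fiber x)"
    using ib x by (auto simp: inverse_branches_def fiber_circle[OF x(2)])
  have U: "open U" "connected U" "U \<subseteq> A'" using ib A_subset unfolding inverse_branches_def by blast+
  have \<phi>: "\<phi> k holomorphic_on U" "\<phi> k ` U \<subseteq> A" "\<And>z. z \<in> U \<Longrightarrow> B (\<phi> k z) = z" if "k < K" for k
    using ib that unfolding inverse_branches_def by blast+
  show ?thesis unfolding w
    by (rule branches_list_fibers(2)[where U = U and K = K and \<phi> = \<phi> and x = x and z = z and f = f,
          OF U holomorphic_on_imp_continuous_on[OF \<phi>(1)] \<phi>(2,3) x(1) bij z])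
qed

text \<open>The branches are restricted from the sector of \<open>A'\<close> to that of
  \<open>A\<close>, because \<open>inverse_branches\<close> confines their domain to
  \<open>A\<close>.\<close>

lemma transfer_value_exists:
  assumes z: "z \<in> A" shows "transfer_value B A f z (L f z)"
proof -
  have z0: "z \<noteq> 0" using z r_pos by (auto simp: annulus_iff)
  define u where "u = z / of_real (cmod z)"
  have u: "cmod u = 1" using z0 by (simp add: u_def norm_divide)
  have "z * cnj u = of_real (cmod z)" using z0 by (simp add: u_def complex_norm_square[symmetric] power2_eq_square)
  hence zs: "z \<in> sector u r" unfolding sector_def mem_Collect_eq using z z0 by (simp only:) simp
  have sub: "sector u r \<subseteq> sector u s" "sector u r \<subseteq> A" "sector u s \<subseteq> A'" using A_subset by (auto simp: sector_def)
  have s1: "s < 1" "r < 1" using s_r r_t t_1 by simp_all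
  obtain \<phi> where "(\<forall>k<n. continuous_on (sector u s) (\<phi> k) \<and> \<phi> k ` sector u s \<subseteq> A \<and> (\<forall>z\<in>sector u s. B (\<phi> k z) = z)) \<and>
    bij_betw (\<lambda>k. \<phi> k u) {..<n} (fiber u)"
    using branches_on_sector[OF u] by (rule exE)
  hence \<phi>: "\<And>k. k < n \<Longrightarrow> continuous_on (sector u s) (\<phi> k)" "\<And>k. k < n \<Longrightarrow> \<phi> k ` sector u s \<subseteq> A"
    "\<And>k z. k < n \<Longrightarrow> z \<in> sector u s \<Longrightarrow> B (\<phi> k z) = z" "bij_betw (\<lambda>k. \<phi> k u) {..<n} (fiber u)"
    by auto
  note lf = branches_list_fibers[OF open_sector connected_sector[OF u s_pos] sub(3) \<phi>(1-3) circle_in_sector[OF u s_pos s1(1)] \<phi>(4)]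
  have hol: "\<phi> k holomorphic_on sector u r" if "k < n" for k
    unfolding holomorphic_on_open[OF open_sector]
    using branch_derivative[OF open_sector \<phi>(1-3)] that sub by blast
  have "\<forall>k<n. \<phi> k holomorphic_on sector u r \<and> \<phi> k ` sector u r \<subseteq> A \<and> (\<forall>z\<in>sector u r. B (\<phi> k z) = z)"
    using hol \<phi>(2,3) sub(1) by blast
  moreover have "\<forall>y\<in>sector u r \<inter> sphere 0 1. bij_betw (\<lambda>k. \<phi> k y) {..<n} {w \<in> sphere 0 1. B w = y}"
  proof
    fix y assume y: "y \<in> sector u r \<inter> sphere 0 1"
    hence "fiber y = {w \<in> sphere 0 1. B w = y}" by (intro fiber_circle) simp
    moreover have "y \<in> sector u s" using y sub by blast
    ultimately show "bij_betw (\<lambda>k. \<phi> k y) {..<n} {w \<in> sphere 0 1. B w = y}"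
      using lf(1)[of y] by simp
  qed
  moreover have "sector u r \<inter> sphere 0 1 \<noteq> {}"
  proof -
    have "u \<in> sector u r \<inter> sphere 0 1" using circle_in_sector[OF u r_pos s1(2)] u by simp
    thus ?thesis by blast
  qed
  ultimately have "inverse_branches B A (sector u r) n \<phi>"
    unfolding inverse_branches_def using open_sector connected_sector[OF u r_pos] sub(2) by (intro conjI)
  moreover have "L f z = (\<Sum>k<n. deriv (\<phi> k) z * (f \<circ> \<phi> k) z)" using lf(2)[of z f] subsetD[OF sub(1) zs] by simp
  ultimately show ?thesis using zs unfolding transfer_value_def by blast
qed

lemma transfer_operator_eq: "transfer_operator B A f z = (if z \<in> A then L f z else 0)"
  unfolding transfer_operator_def using transfer_value_exists transfer_value_unique by (auto intro!: the_equality)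

lemma L_cong: "(\<And>w. w \<in> fiber z \<Longrightarrow> f w = g w) \<Longrightarrow> L f z = L g z"
  by (simp add: L_def)

lemma L_add: "L (\<lambda>w. f w + g w) z = L f z + L g z"
  by (simp add: L_def add_divide_distrib sum.distrib)

lemma L_cmult: "L (\<lambda>w. c * f w) z = c * L f z"
  by (simp add: L_def sum_distrib_left)

text \<open>Fibres stay in a compact annulus on which \<open>deriv B\<close> has a positive least
  modulus. A bound on this part of \<open>A\<close> controls \<open>L f\<close> on all of
  \<open>A'\<close>, which is the source of compactness.\<close>

lemma L_bound:
  obtains M where "M > 0" "\<And>f c z. z \<in> A' \<Longrightarrow> (\<And>w. t \<le> cmod w \<Longrightarrow> cmod w \<le> 1 / t \<Longrightarrow> cmod (f w) \<le> c) \<Longrightarrow> cmod (L f z) \<le> M * c"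
proof -
  define K where "K = cball 0 (1 / t) - ball (0::complex) t"
  have KA: "K \<subseteq> A" using r_t radii_inverse by (auto simp: K_def annulus_iff)
  have K: "compact K" by (simp add: K_def compact_diff)
  have "1 \<in> K" using t_1 radii_inverse by (simp add: K_def)
  hence K0: "K \<noteq> {}" by blast
  have cont: "continuous_on K (\<lambda>w. cmod (deriv B w))"
    by (intro continuous_intros deriv_B_continuous) (use KA regular in blast)
  from continuous_attains_inf[OF K K0 cont]
  obtain x where x: "x \<in> K" "\<And>w. w \<in> K \<Longrightarrow> cmod (deriv B x) \<le> cmod (deriv B w)" by blast
  define m where "m = cmod (deriv B x)"
  have m: "m > 0" using regular[OF subsetD[OF KA x(1)]] by (simp add: m_def)
  show ?thesis
  proof (rule that[of "n / m"])
    show "0 < n / m" using m n by simp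
    fix f :: "complex \<Rightarrow> complex" and c z assume z: "z \<in> A'" and f: "\<And>w. t \<le> cmod w \<Longrightarrow> cmod w \<le> 1 / t \<Longrightarrow> cmod (f w) \<le> c"
    have c: "0 \<le> c" using order_trans[OF norm_ge_zero f[of 1]] t_1 radii_inverse by simp
    have "cmod (L f z) \<le> (\<Sum>w\<in>fiber z. cmod (f w / deriv B w))" unfolding L_def by (rule norm_sum)
    also have "\<dots> \<le> (\<Sum>w\<in>fiber z. c / m)"
    proof (rule sum_mono)
      fix w assume w: "w \<in> fiber z"
      have "w \<in> K" using fiber_bounds[OF z w] by (simp add: K_def)
      thus "cmod (f w / deriv B w) \<le> c / m"
        using fiber_bounds[OF z w] x(2)[of w] m c unfolding norm_divide m_def by (intro frac_le f) simp_all
    qed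
    also have "\<dots> = n / m * c" by (simp add: card_fiber[OF z])
    finally show "cmod (L f z) \<le> n / m * c" .
  qed
qed

end

subsection \<open>Attracting fixed points\<close>

text \<open>Conjugating the fixed point to the centre of the disc, the Schwarz lemma turns relative
  compactness of the image into a uniform contraction rate.\<close>

lemma attracting_fixpoint_unit_disc:
  fixes \<gamma> :: "complex \<Rightarrow> complex"
  assumes hol: "\<gamma> holomorphic_on ball 0 1" and into: "\<And>q. cmod q < 1 \<Longrightarrow> cmod (\<gamma> q) \<le> \<sigma>" and \<sigma>: "\<sigma> < 1"
    and c: "cmod c < 1" "\<gamma> c = c"
  obtains \<kappa> where "0 < \<kappa>" "\<kappa> < 1" "\<And>k q. cmod q < 1 \<Longrightarrow> cmod ((\<gamma> ^^ k) q - c) \<le> 2 * \<kappa> ^ k"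
proof -
  define \<psi> where "\<psi> = Moebius_function 0 c"
  define \<psi>i where "\<psi>i = Moebius_function 0 (- c)"
  have \<psi>_lt: "cmod (\<psi> q) < 1" and \<psi>i_lt: "cmod (\<psi>i q) < 1" if "cmod q < 1" for q
    unfolding \<psi>_def \<psi>i_def using c that by (auto intro: Moebius_function_norm_lt_1)
  have \<psi>_hol: "\<psi> holomorphic_on ball 0 1" and \<psi>i_hol: "\<psi>i holomorphic_on ball 0 1"
    unfolding \<psi>_def \<psi>i_def using c by (auto intro: Moebius_function_holomorphic)
  have inv: "\<psi>i (\<psi> q) = q" if "cmod q < 1" for q
    unfolding \<psi>_def \<psi>i_def by (rule Moebius_function_compose) (use c that in auto)
  have \<sigma>0: "0 \<le> \<sigma>" using into[of c] c order_trans[OF norm_ge_zero] by blast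
  have cont: "continuous_on (cball 0 \<sigma>) (\<lambda>q. cmod (\<psi> q))"
    by (intro continuous_intros continuous_on_subset[OF holomorphic_on_imp_continuous_on[OF \<psi>_hol]]) (use \<sigma> in auto)
  have "compact (cball (0::complex) \<sigma>)" "cball (0::complex) \<sigma> \<noteq> {}" using \<sigma>0 by auto
  from continuous_attains_sup[OF this cont] obtain x where x: "cmod x \<le> \<sigma>" "\<And>y. cmod y \<le> \<sigma> \<Longrightarrow> cmod (\<psi> y) \<le> cmod (\<psi> x)" by auto
  \<comment> \<open>Strictly between the maximum and 1, so that the rescaled map \<open>G\<close>
    sends the disc into itself and \<open>\<kappa>\<close> is positive even for maximum
    zero.\<close>
  define \<kappa> where "\<kappa> = (1 + cmod (\<psi> x)) / 2"
  have "cmod (\<psi> x) < 1" by (rule \<psi>_lt) (use x \<sigma> in linarith)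
  hence \<kappa>: "0 < \<kappa>" "\<kappa> < 1" "cmod (\<psi> x) < \<kappa>" using norm_ge_zero[of "\<psi> x"] by (simp_all add: \<kappa>_def add_pos_nonneg)
  define G where "G \<zeta> = \<psi> (\<gamma> (\<psi>i \<zeta>)) / of_real \<kappa>" for \<zeta>
  have "cmod (\<gamma> (\<psi>i \<zeta>)) < 1" if "cmod \<zeta> < 1" for \<zeta> using into[OF \<psi>i_lt[OF that]] \<sigma> by linarith
  hence G_hol: "G holomorphic_on ball 0 1"
    unfolding G_def
    by (intro holomorphic_intros holomorphic_on_compose_gen[OF _ \<psi>_hol, unfolded o_def]
          holomorphic_on_compose_gen[OF \<psi>i_hol hol, unfolded o_def])
       (use \<psi>i_lt \<kappa> in auto)
  have "\<psi>i 0 = c" by (simp add: \<psi>i_def Moebius_function_simple)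
  hence G0: "G 0 = 0" using c by (simp add: G_def \<psi>_def Moebius_function_simple)
  have G_lt: "cmod (G \<zeta>) < 1" if "cmod \<zeta> < 1" for \<zeta>
  proof -
    have "cmod (\<psi> (\<gamma> (\<psi>i \<zeta>))) \<le> cmod (\<psi> x)" using x(2) into \<psi>i_lt that by blast
    thus ?thesis using \<kappa> by (simp add: G_def norm_divide)
  qed
  have step: "cmod (\<psi> (\<gamma> q)) \<le> \<kappa> * cmod (\<psi> q)" if q: "cmod q < 1" for q
  proof -
    have "cmod (G (\<psi> q)) \<le> cmod (\<psi> q)" by (rule Schwarz_Lemma(1)[OF G_hol G0 G_lt \<psi>_lt[OF q]])
    thus ?thesis using \<kappa> by (simp add: G_def inv[OF q] norm_divide field_simps)
  qed
  have it: "cmod ((\<gamma> ^^ k) q) < 1 \<and> cmod (\<psi> ((\<gamma> ^^ k) q)) \<le> \<kappa> ^ k" if q: "cmod q < 1" for k q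
  proof (induction k)
    case 0 thus ?case using q \<psi>_lt[OF q] by simp
  next
    case (Suc k)
    have "cmod (\<psi> (\<gamma> ((\<gamma> ^^ k) q))) \<le> \<kappa> * cmod (\<psi> ((\<gamma> ^^ k) q))" using step Suc.IH by blast
    also have "\<dots> \<le> \<kappa> * \<kappa> ^ k" using \<kappa> Suc.IH by simp
    finally show ?case using into[of "(\<gamma> ^^ k) q"] Suc.IH \<sigma> by auto
  qed
  have "cmod ((\<gamma> ^^ k) q - c) \<le> 2 * \<kappa> ^ k" if q: "cmod q < 1" for k q
  proof -
    define y where "y = (\<gamma> ^^ k) q"
    have y: "cmod y < 1" "cmod (\<psi> y) \<le> \<kappa> ^ k" using it[OF q, of k] by (auto simp: y_def)
    have nz: "1 - cnj c * y \<noteq> 0" by (rule one_minus_cnj_mult_nonzero) (use c y in auto)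
    have "cmod (1 - cnj c * y) \<le> cmod (1::complex) + cmod (cnj c * y)" by (rule norm_triangle_ineq4)
    also have "\<dots> \<le> 2" using c y mult_mono[of "cmod c" 1 "cmod y" 1] by (simp add: norm_mult)
    finally have "cmod (1 - cnj c * y) \<le> 2" .
    moreover have "y - c = \<psi> y * (1 - cnj c * y)" using nz by (simp add: \<psi>_def Moebius_function_simple)
    hence "cmod (y - c) = cmod (\<psi> y) * cmod (1 - cnj c * y)" by (simp only: norm_mult)
    moreover have "0 \<le> \<kappa> ^ k" using \<kappa> by simp
    ultimately have "cmod (y - c) \<le> \<kappa> ^ k * 2" using mult_mono[OF y(2), of "cmod (1 - cnj c * y)" 2] by simp
    thus ?thesis by (simp add: y_def)
  qed
  thus ?thesis using that \<kappa> by blast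
qed

lemma attracting_fixpoint_disc:
  fixes \<beta> :: "complex \<Rightarrow> complex"
  assumes hol: "\<beta> holomorphic_on ball 0 R" and into: "\<And>q. cmod q < R \<Longrightarrow> cmod (\<beta> q) \<le> s" and s: "0 < s" "s < R"
    and c: "cmod c < R" "\<beta> c = c"
  obtains \<kappa> where "0 < \<kappa>" "\<kappa> < 1" "\<And>k q. cmod q < R \<Longrightarrow> cmod ((\<beta> ^^ k) q - c) \<le> 2 * R * \<kappa> ^ k"
proof -
  have R: "R > 0" using s by simp
  define \<gamma> where "\<gamma> q = \<beta> (of_real R * q) / of_real R" for q
  have lt: "cmod (of_real R * q) < R" if "cmod q < 1" for q using that R by (simp add: norm_mult)
  have "\<gamma> holomorphic_on ball 0 1"
    unfolding \<gamma>_def by (intro holomorphic_intros holomorphic_on_compose_gen[OF _ hol, unfolded o_def]) (use lt R in auto)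
  moreover have "cmod (\<gamma> q) \<le> s / R" if "cmod q < 1" for q
    using into[OF lt[OF that]] R by (simp add: \<gamma>_def norm_divide divide_right_mono)
  moreover have "s / R < 1" "cmod (c / of_real R) < 1" "\<gamma> (c / of_real R) = c / of_real R" using s R c by (auto simp: norm_divide \<gamma>_def)
  ultimately obtain \<kappa> where \<kappa>: "0 < \<kappa>" "\<kappa> < 1" "\<And>k q. cmod q < 1 \<Longrightarrow> cmod ((\<gamma> ^^ k) q - c / of_real R) \<le> 2 * \<kappa> ^ k"
    using attracting_fixpoint_unit_disc by blast
  have it: "(\<beta> ^^ k) q = of_real R * (\<gamma> ^^ k) (q / of_real R)" for k q
    by (induction k) (use R in \<open>auto simp: \<gamma>_def\<close>)
  have "cmod ((\<beta> ^^ k) q - c) \<le> 2 * R * \<kappa> ^ k" if q: "cmod q < R" for k q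
  proof -
    have "(\<beta> ^^ k) q - c = of_real R * ((\<gamma> ^^ k) (q / of_real R) - c / of_real R)" using R by (simp add: it right_diff_distrib)
    hence "cmod ((\<beta> ^^ k) q - c) = R * cmod ((\<gamma> ^^ k) (q / of_real R) - c / of_real R)" using R by (simp add: norm_mult)
    also have "\<dots> \<le> R * (2 * \<kappa> ^ k)" using \<kappa>(3)[of "q / of_real R" k] q R by (simp add: norm_divide)
    finally show ?thesis by (simp add: mult_ac)
  qed
  thus ?thesis using that \<kappa> by blast
qed

text \<open>The \<open>k\<close>-th iterate has derivative \<open>deriv \<beta> c ^ k\<close> at
  \<open>c\<close>, and Cauchy's inequality bounds it by a multiple of \<open>\<kappa> ^ k\<close>.
  The powers of the derivative therefore tend to zero.\<close>

lemma deriv_attracting_lt_1: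
  fixes \<beta> :: "complex \<Rightarrow> complex"
  assumes hol: "\<beta> holomorphic_on ball 0 R" and into: "\<And>q. cmod q < R \<Longrightarrow> cmod (\<beta> q) \<le> s" and s: "0 < s" "s < R"
    and c: "cmod c < R" "\<beta> c = c"
  shows "cmod (deriv \<beta> c) < 1"
proof (rule ccontr)
  assume "\<not> cmod (deriv \<beta> c) < 1"
  hence ge: "cmod (deriv \<beta> c) \<ge> 1" by simp
  obtain \<kappa> where \<kappa>: "0 < \<kappa>" "\<kappa> < 1" "\<And>k q. cmod q < R \<Longrightarrow> cmod ((\<beta> ^^ k) q - c) \<le> 2 * R * \<kappa> ^ k"
    using attracting_fixpoint_disc[OF assms] by blast
  have into': "cmod ((\<beta> ^^ k) q) < R" if "cmod q < R" for k q
    by (induction k) (use that into s in \<open>auto intro: le_less_trans\<close>)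
  have itc: "(\<beta> ^^ k) c = c" for k by (induction k) (auto simp: c)
  have hol_it: "(\<beta> ^^ k) holomorphic_on ball 0 R" for k
  proof (induction k)
    case 0 show ?case by (simp add: id_def)
  next
    case (Suc k)
    have "(\<lambda>q. \<beta> ((\<beta> ^^ k) q)) holomorphic_on ball 0 R"
      by (rule holomorphic_on_compose_gen[OF Suc.IH hol, unfolded o_def]) (use into' in auto)
    thus ?case by (simp add: o_def)
  qed
  have der: "((\<beta> ^^ k) has_field_derivative deriv \<beta> c ^ k) (at c)" for k
  proof (induction k)
    case 0 show ?case by (simp add: id_def)
  next
    case (Suc k)
    have "(\<beta> has_field_derivative deriv \<beta> c) (at ((\<beta> ^^ k) c))"
      unfolding itc using c by (intro holomorphic_derivI[OF hol]) auto
    from DERIV_chain[OF this Suc.IH] show ?case by (simp add: o_def)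
  qed
  define d where "d = (R - cmod c) / 2"
  have d: "d > 0" "\<And>q. q \<in> cball c d \<Longrightarrow> cmod q < R"
  proof -
    show "d > 0" using c by (simp add: d_def)
    fix q assume "q \<in> cball c d"
    hence "cmod (q - c) \<le> d" by (simp add: dist_norm norm_minus_commute)
    moreover have "cmod q \<le> cmod c + cmod (q - c)" using norm_triangle_ineq[of c "q - c"] by simp
    ultimately show "cmod q < R" using c(1) by (simp add: d_def field_simps)
  qed
  have bound: "1 \<le> 2 * R * \<kappa> ^ k / d" for k
  proof -
    have h: "(\<lambda>q. (\<beta> ^^ k) q - c) holomorphic_on cball c d"
      by (intro holomorphic_intros holomorphic_on_subset[OF hol_it]) (use d(2) in auto)
    have D: "((\<lambda>q. (\<beta> ^^ k) q - c) has_field_derivative deriv \<beta> c ^ k - 0) (at c)"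
      by (intro derivative_intros der)
    have "cmod ((deriv ^^ 1) (\<lambda>q. (\<beta> ^^ k) q - c) c) \<le> fact 1 * (2 * R * \<kappa> ^ k) / d ^ 1"
    proof (rule Cauchy_inequality)
      show "(\<lambda>q. (\<beta> ^^ k) q - c) holomorphic_on ball c d" using h by (rule holomorphic_on_subset) auto
      show "continuous_on (cball c d) (\<lambda>q. (\<beta> ^^ k) q - c)" using h by (rule holomorphic_on_imp_continuous_on)
      show "cmod ((\<beta> ^^ k) x - c) \<le> 2 * R * \<kappa> ^ k" if "cmod (c - x) = d" for x
        by (rule \<kappa>(3)) (use that in \<open>auto intro!: d(2) simp: dist_norm\<close>)
    qed (rule d)
    hence "cmod (deriv \<beta> c ^ k) \<le> 2 * R * \<kappa> ^ k / d" using DERIV_imp_deriv[OF D] by simp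
    moreover have "1 \<le> cmod (deriv \<beta> c ^ k)" using ge by (simp add: norm_power one_le_power)
    ultimately show ?thesis by linarith
  qed
  have "(\<lambda>k. 2 * R * \<kappa> ^ k / d) \<longlonglongrightarrow> 2 * R * 0 / d"
    using \<kappa> d by (intro tendsto_intros LIMSEQ_realpow_zero) auto
  hence "1 \<le> 2 * R * 0 / d" by (rule LIMSEQ_le_const) (use bound in auto)
  thus False by simp
qed

section \<open>Composition with B near the inner fixed point\<close>

locale blaschke_fixpoint = blaschke_annulus +
  fixes z0 :: complex
  assumes z0_t: "cmod z0 < t" and fix_z0: "B z0 = z0"
begin

abbreviation "\<nu> \<equiv> deriv B z0"

text \<open>Larger than \<open>s\<close>, so that \<open>B\<close> maps the disc of radius
  \<open>t\<close> into \<open>D\<close>; smaller than \<open>r\<close>, so that the kernels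
  \<open>hk z\<close> and \<open>gk z\<close> with \<open>z \<in> A\<close> have no poles in
  \<open>D\<close>.\<close>

definition \<rho>D :: real where "\<rho>D = (s + r) / 2"
abbreviation D where "D \<equiv> ball (0::complex) \<rho>D"

lemma \<rho>D: "s < \<rho>D" "\<rho>D < r" "0 < \<rho>D" "\<rho>D < t" using s_pos s_r r_t by (auto simp: \<rho>D_def)

lemma z0_s: "cmod z0 \<le> s" using B_cball[of z0] z0_t fix_z0 by simp

lemma z0_D: "z0 \<in> D" using z0_s \<rho>D by simp

lemma holomorphic_B_cball: "B holomorphic_on cball 0 t"
  by (rule holomorphic_B) (use t_1 in \<open>auto intro!: Q_nz\<close>)

lemma holomorphic_B_D: "B holomorphic_on D"
  by (rule holomorphic_on_subset[OF holomorphic_B_cball]) (use \<rho>D in auto)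

lemma B_D: "q \<in> D \<Longrightarrow> cmod (B q) \<le> s" "q \<in> D \<Longrightarrow> B q \<in> D"
  using B_cball[of q] \<rho>D by auto

lemma norm_\<nu>: "cmod \<nu> < 1"
  by (rule deriv_attracting_lt_1[OF holomorphic_B_D, of s]) (use B_D s_pos \<rho>D z0_D fix_z0 in auto)

text \<open>The exponent is one less than the number of iterations: the first one moves
  \<open>q\<close> into \<open>D\<close>, where the contraction rate is available.\<close>

lemma B_contracting:
  obtains \<kappa> where "0 < \<kappa>" "\<kappa> < 1" "\<And>k q. cmod q \<le> t \<Longrightarrow> cmod ((B ^^ Suc k) q - z0) \<le> 2 * \<rho>D * \<kappa> ^ k"
proof -
  obtain \<kappa> where \<kappa>: "0 < \<kappa>" "\<kappa> < 1" "\<And>k q. cmod q < \<rho>D \<Longrightarrow> cmod ((B ^^ k) q - z0) \<le> 2 * \<rho>D * \<kappa> ^ k"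
    by (rule attracting_fixpoint_disc[OF holomorphic_B_D, of s z0]) (use B_D s_pos \<rho>D z0_D fix_z0 in auto)
  have "cmod ((B ^^ Suc k) q - z0) \<le> 2 * \<rho>D * \<kappa> ^ k" if "cmod q \<le> t" for k q
    using \<kappa>(3)[of "B q" k] B_cball[OF that] \<rho>D by (simp add: funpow_swap1)
  thus ?thesis using that \<kappa> by blast
qed

lemma unique_fixpoint: assumes "cmod q < t" "B q = q" shows "q = z0"
proof -
  obtain \<kappa> where \<kappa>: "0 < \<kappa>" "\<kappa> < 1" "\<And>k q. cmod q \<le> t \<Longrightarrow> cmod ((B ^^ Suc k) q - z0) \<le> 2 * \<rho>D * \<kappa> ^ k"
    using B_contracting by blast
  have "(B ^^ k) q = q" for k by (induction k) (auto simp: assms)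
  hence "cmod (q - z0) \<le> 2 * \<rho>D * \<kappa> ^ k" for k using \<kappa>(3)[of q k] assms by simp
  moreover have "(\<lambda>k. 2 * \<rho>D * \<kappa> ^ k) \<longlonglongrightarrow> 2 * \<rho>D * 0" using \<kappa> by (intro tendsto_intros LIMSEQ_realpow_zero) auto
  ultimately have "cmod (q - z0) \<le> 2 * \<rho>D * 0" by (intro LIMSEQ_le_const) auto
  thus ?thesis by simp
qed

lemma funpow_B_cball: "cmod q \<le> t \<Longrightarrow> cmod ((B ^^ k) q) \<le> t" "cmod q \<le> t \<Longrightarrow> cmod ((B ^^ Suc k) q) \<le> s"
proof -
  assume q: "cmod q \<le> t"
  show 1: "cmod ((B ^^ k) q) \<le> t" for k
  proof (induction k)
    case (Suc k) thus ?case using B_cball[of "(B ^^ k) q"] s_r r_t by simp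
  qed (simp add: q)
  show "cmod ((B ^^ Suc k) q) \<le> s" using B_cball[OF 1[of k]] by simp
qed

text \<open>A polynomial in the operator of composition with \<open>B\<close>, given by the list of
  its roots.\<close>

fun comp_poly :: "complex list \<Rightarrow> (complex \<Rightarrow> complex) \<Rightarrow> complex \<Rightarrow> complex" where
  "comp_poly [] h = h"
| "comp_poly (c # cs) h = (\<lambda>q. comp_poly cs h (B q) - c * comp_poly cs h q)"

definition vanish :: "nat \<Rightarrow> (complex \<Rightarrow> complex) \<Rightarrow> bool" where
  "vanish N H \<longleftrightarrow> (\<exists>G. G holomorphic_on D \<and> (\<forall>q\<in>D. H q = (q - z0) ^ N * G q))"

lemma comp_poly_holomorphic: "h holomorphic_on D \<Longrightarrow> comp_poly cs h holomorphic_on D"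
proof (induction cs)
  case (Cons c cs)
  have "(\<lambda>q. comp_poly cs h (B q)) holomorphic_on D"
    by (rule holomorphic_on_compose_gen[OF holomorphic_B_D Cons.IH[OF Cons.prems], unfolded o_def]) (use B_D in auto)
  thus ?case using Cons by (auto intro!: holomorphic_intros)
qed simp

lemma comp_poly_bound:
  assumes "\<And>q. q \<in> D \<Longrightarrow> cmod (h q) \<le> M" "\<And>c. c \<in> set cs \<Longrightarrow> cmod c \<le> 1" "q \<in> D"
  shows "cmod (comp_poly cs h q) \<le> 2 ^ length cs * M"
  using assms(2,3)
proof (induction cs arbitrary: q)
  case Nil thus ?case using assms(1) by simp
next
  case (Cons c cs)
  have 1: "cmod (comp_poly cs h (B q)) \<le> 2 ^ length cs * M" using Cons B_D by auto
  have 2: "cmod (comp_poly cs h q) \<le> 2 ^ length cs * M" using Cons by auto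
  have "cmod (c * comp_poly cs h q) \<le> 1 * (2 ^ length cs * M)"
    unfolding norm_mult using Cons.prems 2 by (intro mult_mono) auto
  thus ?case using 1 norm_triangle_ineq4[of "comp_poly cs h (B q)" "c * comp_poly cs h q"] by simp
qed

lemma comp_poly_add: "comp_poly cs (\<lambda>q. h q + g q) q = comp_poly cs h q + comp_poly cs g q"
  by (induction cs arbitrary: q) (auto simp: algebra_simps)

lemma comp_poly_cmult: "comp_poly cs (\<lambda>q. k * h q) q = k * comp_poly cs h q"
  by (induction cs arbitrary: q) (auto simp: algebra_simps)

lemma comp_poly_sum: "comp_poly cs (\<lambda>q. \<Sum>i\<in>I. h i q) q = (\<Sum>i\<in>I. comp_poly cs (h i) q)"
  by (induction cs arbitrary: q) (auto simp: sum_subtractf sum_distrib_left)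

lemma comp_poly_comp: "comp_poly cs (\<lambda>q. h (B q)) q = comp_poly cs h (B q)"
  by (induction cs arbitrary: q) auto

lemma comp_poly_const: "\<exists>k'. \<forall>q. comp_poly cs (\<lambda>_. k) q = k'"
proof (induction cs)
  case (Cons c cs)
  then obtain k' where "\<forall>q. comp_poly cs (\<lambda>_. k) q = k'" by blast
  thus ?case by (intro exI[of _ "k' - c * k'"]) simp
qed simp

lemma comp_poly_cong: "(\<And>q. q \<in> D \<Longrightarrow> h q = g q) \<Longrightarrow> q \<in> D \<Longrightarrow> comp_poly cs h q = comp_poly cs g q"
proof (induction cs arbitrary: q)
  case (Cons c cs)
  have "comp_poly cs h q = comp_poly cs g q" "comp_poly cs h (B q) = comp_poly cs g (B q)"
    using Cons.IH[of q] Cons.IH[of "B q"] Cons.prems B_D(2)[of q] by blast+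
  thus ?case by simp
qed simp

lemma factor_at_z0:
  assumes "h holomorphic_on D"
  obtains b where "b holomorphic_on D" "\<And>q. h q - h z0 = (q - z0) * b q" "b z0 = deriv h z0"
proof (rule that[of "\<lambda>q. if q = z0 then deriv h z0 else (h q - h z0) / (q - z0)"])
  show "(\<lambda>q. if q = z0 then deriv h z0 else (h q - h z0) / (q - z0)) holomorphic_on D"
    by (rule pole_lemma[OF assms]) (use z0_D in \<open>simp add: interior_open\<close>)
qed auto

lemma vanish_0: "h holomorphic_on D \<Longrightarrow> vanish 0 h"
  by (auto simp: vanish_def)

text \<open>Composition with \<open>B\<close> is triangular for the order of vanishing at
  \<open>z0\<close>: from \<open>B q - z0 = (q - z0) * b q\<close> with \<open>b z0 = \<nu>\<close>
  it multiplies the leading coefficient at order \<open>N\<close> by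
  \<open>\<nu> ^ N\<close>.\<close>

lemma comp_factor:
  assumes G: "G holomorphic_on D" and H: "\<And>q. q \<in> D \<Longrightarrow> H q = (q - z0) ^ N * G q"
  obtains K where "K holomorphic_on D" "\<And>q. q \<in> D \<Longrightarrow> H (B q) - c * H q = (q - z0) ^ N * K q" "K z0 = (\<nu> ^ N - c) * G z0"
proof -
  obtain b where b: "b holomorphic_on D" "\<And>q. B q - B z0 = (q - z0) * b q" "b z0 = \<nu>"
    using factor_at_z0[OF holomorphic_B_D] by blast
  define K where "K q = b q ^ N * G (B q) - c * G q" for q
  have "(\<lambda>q. G (B q)) holomorphic_on D"
    by (rule holomorphic_on_compose_gen[OF holomorphic_B_D G, unfolded o_def]) (use B_D in auto)
  hence "K holomorphic_on D" unfolding K_def by (intro holomorphic_intros b G)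
  moreover have "H (B q) - c * H q = (q - z0) ^ N * K q" if "q \<in> D" for q
  proof -
    have "B q - z0 = (q - z0) * b q" using b(2)[of q] by (simp add: fix_z0)
    hence "H (B q) = (q - z0) ^ N * (b q ^ N * G (B q))" using H[OF B_D(2)[OF that]] by (simp only: power_mult_distrib mult.assoc)
    thus ?thesis using H[OF that] by (simp add: K_def algebra_simps)
  qed
  moreover have "K z0 = (\<nu> ^ N - c) * G z0" by (simp add: K_def b(3) fix_z0 algebra_simps)
  ultimately show ?thesis using that by blast
qed

lemma vanish_comp: "vanish N H \<Longrightarrow> vanish N (\<lambda>q. H (B q) - c * H q)"
  unfolding vanish_def by (metis comp_factor)

lemma vanish_Suc: assumes "vanish N H" shows "vanish (Suc N) (\<lambda>q. H (B q) - \<nu> ^ N * H q)"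
proof -
  obtain G where G: "G holomorphic_on D" "\<And>q. q \<in> D \<Longrightarrow> H q = (q - z0) ^ N * G q" using assms by (auto simp: vanish_def)
  obtain K where K: "K holomorphic_on D" "\<And>q. q \<in> D \<Longrightarrow> H (B q) - \<nu> ^ N * H q = (q - z0) ^ N * K q" "K z0 = (\<nu> ^ N - \<nu> ^ N) * G z0"
    using comp_factor[OF G, of "\<nu> ^ N"] by blast
  obtain k where k: "k holomorphic_on D" "\<And>q. K q - K z0 = (q - z0) * k q" using factor_at_z0[OF K(1)] by blast
  have "H (B q) - \<nu> ^ N * H q = (q - z0) ^ Suc N * k q" if "q \<in> D" for q
    using K(2)[OF that] K(3) k(2)[of q] by (simp add: mult_ac)
  thus ?thesis using k(1) by (auto simp: vanish_def)
qed

text \<open>A Schwarz lemma of order \<open>N\<close>, by the maximum principle for \<open>H\<close>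
  divided by \<open>(q - z0) ^ N\<close>.\<close>

lemma vanish_decay:
  assumes H: "vanish N H" and M: "\<And>q. q \<in> D \<Longrightarrow> cmod (H q) \<le> M" and x: "cmod x \<le> s"
  shows "cmod (H x) \<le> M * (cmod (x - z0) / ((\<rho>D - s) / 2)) ^ N"
proof -
  obtain G where G: "G holomorphic_on D" "\<And>q. q \<in> D \<Longrightarrow> H q = (q - z0) ^ N * G q" using H by (auto simp: vanish_def)
  \<comment> \<open>On this circle the distance to \<open>z0\<close>, which has modulus at most
    \<open>s\<close>, is at least \<open>(\<rho>D - s) / 2\<close>.\<close>
  define R where "R = (\<rho>D + s) / 2"
  have R: "s < R" "R < \<rho>D" "R - s = (\<rho>D - s) / 2" using \<rho>D unfolding R_def by (auto simp: field_simps)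
  have d: "(\<rho>D - s) / 2 > 0" using \<rho>D by simp
  have "cmod (G x) \<le> M / ((\<rho>D - s) / 2) ^ N"
  proof (rule maximum_modulus_frontier[of G "cball 0 R"])
    show "G holomorphic_on interior (cball 0 R)" by (rule holomorphic_on_subset[OF G(1)]) (use R in auto)
    show "continuous_on (closure (cball 0 R)) G"
      by (rule continuous_on_subset[OF holomorphic_on_imp_continuous_on[OF G(1)]]) (use R in auto)
    show "x \<in> cball 0 R" using x R by simp
    fix q assume "q \<in> frontier (cball (0::complex) R)"
    hence q: "cmod q = R" using R s_pos by simp
    hence qD: "q \<in> D" using R by simp
    have ge: "(\<rho>D - s) / 2 \<le> cmod (q - z0)" using norm_triangle_ineq2[of q z0] q z0_s R by linarith
    have "cmod (q - z0) ^ N * cmod (G q) \<le> M" using M[OF qD] G(2)[OF qD] by (simp add: norm_mult norm_power)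
    moreover have "((\<rho>D - s) / 2) ^ N * cmod (G q) \<le> cmod (q - z0) ^ N * cmod (G q)"
      using ge d by (intro mult_right_mono power_mono) auto
    ultimately have "((\<rho>D - s) / 2) ^ N * cmod (G q) \<le> M" by linarith
    moreover have "0 < ((\<rho>D - s) / 2) ^ N" using d by (rule zero_less_power)
    ultimately show "cmod (G q) \<le> M / ((\<rho>D - s) / 2) ^ N" by (simp add: pos_le_divide_eq mult.commute)
  qed auto
  hence "cmod (x - z0) ^ N * cmod (G x) \<le> cmod (x - z0) ^ N * (M / ((\<rho>D - s) / 2) ^ N)"
    by (intro mult_left_mono) auto
  moreover have "x \<in> D" using x \<rho>D by simp
  hence "cmod (H x) = cmod (x - z0) ^ N * cmod (G x)" using G(2) by (simp add: norm_mult norm_power)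
  ultimately have "cmod (H x) \<le> cmod (x - z0) ^ N * (M / ((\<rho>D - s) / 2) ^ N)" by simp
  thus ?thesis by (simp add: power_divide mult_ac)
qed

text \<open>The roots occur in conjugate pairs: the list acts as it stands on the symbol of the
  Cauchy kernel and conjugated on that of the reflected kernel, and both have to vanish to order
  \<open>N\<close>.\<close>

fun eig_list :: "nat \<Rightarrow> complex list" where
  "eig_list 0 = []"
| "eig_list (Suc N) = cnj (\<nu> ^ N) # \<nu> ^ N # eig_list N"

lemma set_eig_list: "set (eig_list N) = (\<lambda>j. \<nu> ^ j) ` {..<N} \<union> (\<lambda>j. cnj (\<nu> ^ j)) ` {..<N}"
  by (induction N) (auto simp: lessThan_Suc)

lemma norm_eig_list: "c \<in> set (eig_list N) \<Longrightarrow> cmod c \<le> 1"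
  using norm_\<nu> by (auto simp: set_eig_list norm_power power_le_one)

lemma vanish_eig_list: "h holomorphic_on D \<Longrightarrow> vanish N (comp_poly (eig_list N) h)"
proof (induction N)
  case (Suc N)
  from vanish_comp[OF vanish_Suc[OF Suc.IH[OF Suc.prems]], of "cnj (\<nu> ^ N)"]
  show ?case by (simp only: eig_list.simps comp_poly.simps)
qed (simp add: vanish_0)

text \<open>Conjugation exchanges the two entries of each pair, so here it is the outer factor that
  raises the order.\<close>

lemma vanish_cnj_eig_list: "h holomorphic_on D \<Longrightarrow> vanish N (comp_poly (map cnj (eig_list N)) h)"
proof (induction N)
  case (Suc N)
  from vanish_Suc[OF vanish_comp[OF Suc.IH[OF Suc.prems], of "cnj (\<nu> ^ N)"]]
  show ?case by (simp only: eig_list.simps list.map complex_cnj_cnj comp_poly.simps)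
qed (simp add: vanish_0)

subsection \<open>Iterates of the transfer operator\<close>

definition T :: "(complex \<Rightarrow> complex) \<Rightarrow> complex \<Rightarrow> complex" where
  "T f z = (if z \<in> A then L f z else 0)"

lemma T_eq: "transfer_operator B A = T"
  by (intro ext) (simp add: transfer_operator_eq T_def)

lemma T_add: "T (\<lambda>w. f w + g w) = (\<lambda>z. T f z + T g z)"
  by (auto simp: T_def L_add)

lemma T_cmult: "T (\<lambda>w. c * f w) = (\<lambda>z. c * T f z)"
  by (auto simp: T_def L_cmult)

lemma T_diff: "T (\<lambda>w. f w - c * g w) = (\<lambda>z. T f z - c * T g z)"
  using T_add[of f "\<lambda>w. (- c) * g w"] unfolding T_cmult by simp

fun op_poly :: "complex list \<Rightarrow> (complex \<Rightarrow> complex) \<Rightarrow> complex \<Rightarrow> complex" where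
  "op_poly [] f = f"
| "op_poly (c # cs) f = op_poly cs (\<lambda>z. T f z - c * f z)"

lemma op_poly_add: "op_poly cs (\<lambda>w. f w + g w) = (\<lambda>z. op_poly cs f z + op_poly cs g z)"
proof (induction cs arbitrary: f g)
  case (Cons c cs)
  have "(\<lambda>z. T (\<lambda>w. f w + g w) z - c * (f z + g z)) = (\<lambda>z. (T f z - c * f z) + (T g z - c * g z))"
    by (auto simp: T_add algebra_simps)
  thus ?case using Cons.IH by simp
qed simp

lemma op_poly_cmult: "op_poly cs (\<lambda>w. k * f w) = (\<lambda>z. k * op_poly cs f z)"
proof (induction cs arbitrary: f)
  case (Cons c cs)
  have "(\<lambda>z. T (\<lambda>w. k * f w) z - c * (k * f z)) = (\<lambda>z. k * (T f z - c * f z))"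
    by (auto simp: T_cmult algebra_simps)
  thus ?case using Cons.IH by simp
qed simp

lemma op_poly_diff: "op_poly cs (\<lambda>w. f w - c * g w) = (\<lambda>z. op_poly cs f z - c * op_poly cs g z)"
  using op_poly_add[of cs f "\<lambda>w. (- c) * g w"] unfolding op_poly_cmult by simp

lemma T_op_poly: "T (op_poly cs f) = op_poly cs (T f)"
proof (induction cs arbitrary: f)
  case (Cons c cs) show ?case by (simp add: Cons.IH T_diff)
qed simp

lemma op_poly_outside: "(\<And>z. z \<notin> A \<Longrightarrow> f z = 0) \<Longrightarrow> z \<notin> A \<Longrightarrow> op_poly cs f z = 0"
  by (induction cs arbitrary: f) (auto simp: T_def)

text \<open>At \<open>j = 0\<close> these are the Cauchy kernels \<open>1 / (p - w)\<close> for the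
  outer and \<open>1 / (w - p)\<close> for the inner circle, since \<open>gk w 0 = 0\<close>. The
  corrections at the orbit of 0 are chosen so that the terms with \<open>B 0\<close> in
  \<open>L_hk\<close> and \<open>L_gk\<close> cancel and \<open>L\<close> merely advances
  \<open>j\<close>.\<close>

definition \<alpha> :: "nat \<Rightarrow> complex \<Rightarrow> complex \<Rightarrow> complex" where
  "\<alpha> j w p = cnj (gk w ((B ^^ j) (1 / cnj p)) - gk w ((B ^^ j) 0))"
definition \<beta> :: "nat \<Rightarrow> complex \<Rightarrow> complex \<Rightarrow> complex" where
  "\<beta> j w p = hk w ((B ^^ j) p) + cnj (gk w ((B ^^ j) 0))"

lemma L_contour_integral:
  assumes "\<And>w. w \<in> fiber z \<Longrightarrow> (\<lambda>p. f p * k w p) contour_integrable_on g" and z: "z \<in> A'"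
  shows "L (\<lambda>w. contour_integral g (\<lambda>p. f p * k w p)) z = contour_integral g (\<lambda>p. f p * L (\<lambda>w. k w p) z)"
proof -
  have "contour_integral g (\<lambda>p. f p * L (\<lambda>w. k w p) z) = contour_integral g (\<lambda>p. \<Sum>w\<in>fiber z. (f p * k w p) / deriv B w)"
    by (simp add: L_def sum_distrib_left)
  also have "\<dots> = (\<Sum>w\<in>fiber z. contour_integral g (\<lambda>p. (f p * k w p) / deriv B w))"
    by (rule contour_integral_sum) (use assms finite_fiber[OF z] in \<open>auto intro: contour_integrable_div\<close>)
  also have "\<dots> = L (\<lambda>w. contour_integral g (\<lambda>p. f p * k w p)) z"
    unfolding L_def by (intro sum.cong refl contour_integral_div assms)
  finally show ?thesis by simp
qed

lemma gk_denominator_nz: "cmod q \<le> t \<Longrightarrow> cmod w < 1 / t \<Longrightarrow> 1 - q * cnj w \<noteq> 0"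
proof
  assume q: "cmod q \<le> t" "cmod w < 1 / t" "1 - q * cnj w = 0"
  hence "q * cnj w = 1" by simp
  hence "cmod q * cmod w = 1" by (metis complex_mod_cnj norm_mult norm_one)
  moreover have "cmod q * cmod w \<le> t * cmod w" using q by (intro mult_right_mono) auto
  moreover have "t * cmod w < 1" using q t_pos by (simp add: field_simps)
  ultimately show False by simp
qed

lemma continuous_on_funpow_B: "continuous_on (cball 0 t) (B ^^ j)"
proof (induction j)
  case 0 show ?case by (simp add: id_def)
next
  case (Suc j)
  have "continuous_on (cball 0 t) (\<lambda>q. B ((B ^^ j) q))"
    by (rule continuous_on_compose2[OF holomorphic_on_imp_continuous_on[OF holomorphic_B_cball] Suc.IH])
       (use funpow_B_cball in auto)
  thus ?case by (simp add: o_def)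
qed

lemma reflect_outer: "cmod p = 1 / t \<Longrightarrow> cmod (1 / cnj p) = t" "cmod p = 1 / t \<Longrightarrow> p \<noteq> 0"
  using t_pos by (auto simp: norm_divide)

lemma kernel_integrable:
  assumes f: "f holomorphic_on A" and w: "t < cmod w" "cmod w < 1 / t"
  shows "(\<lambda>p. f p * \<alpha> j w p) contour_integrable_on circlepath 0 (1 / t)"
    "(\<lambda>p. f p * \<beta> j w p) contour_integrable_on circlepath 0 t"
proof -
  have fo: "continuous_on (sphere 0 (1 / t)) f" "continuous_on (sphere 0 t) f"
    by (rule continuous_on_subset[OF holomorphic_on_imp_continuous_on[OF f]]; use r_t t_1 radii_inverse in \<open>auto simp: annulus_iff\<close>)+
  have gc: "continuous_on (cball 0 t) (gk w)"
    unfolding gk_def by (intro continuous_intros ballI gk_denominator_nz w(2)) auto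
  have hc: "continuous_on (cball 0 t) (hk w)"
    unfolding hk_def by (intro continuous_intros) (use w in auto)
  have Bj: "(B ^^ j) ` cball 0 t \<subseteq> cball 0 t" using funpow_B_cball by auto
  have gBc: "continuous_on (cball 0 t) (\<lambda>q. gk w ((B ^^ j) q))"
    by (rule continuous_on_compose2[OF gc continuous_on_funpow_B Bj])
  have hBc: "continuous_on (cball 0 t) (\<lambda>q. hk w ((B ^^ j) q))"
    by (rule continuous_on_compose2[OF hc continuous_on_funpow_B Bj])
  have refl: "continuous_on (sphere 0 (1 / t)) (\<lambda>p. gk w ((B ^^ j) (1 / cnj p)))"
    by (rule continuous_on_compose2[OF gBc])
       (use reflect_outer in \<open>auto intro!: continuous_intros simp: norm_divide\<close>)
  show "(\<lambda>p. f p * \<alpha> j w p) contour_integrable_on circlepath 0 (1 / t)"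
    unfolding \<alpha>_def
    by (rule contour_integrable_continuous_circlepath) (use t_pos fo refl in \<open>auto intro!: continuous_intros\<close>)
  show "(\<lambda>p. f p * \<beta> j w p) contour_integrable_on circlepath 0 t"
    unfolding \<beta>_def
    by (rule contour_integrable_continuous_circlepath)
       (use t_pos fo continuous_on_subset[OF hBc] in \<open>auto intro!: continuous_intros\<close>)
qed

lemma L_\<alpha>: assumes z: "z \<in> A'" and p: "cmod p = 1 / t" shows "L (\<lambda>w. \<alpha> j w p) z = \<alpha> (Suc j) z p"
proof -
  define x y where "x = (B ^^ j) (1 / cnj p)" and "y = (B ^^ j) 0"
  have xy: "cmod x \<le> t" "cmod y \<le> t"
    unfolding x_def y_def by (rule funpow_B_cball; use reflect_outer[OF p] t_pos in simp)+
  have "L (\<lambda>w. \<alpha> j w p) z = L (\<lambda>w. cnj (gk w x) + (-1) * cnj (gk w y)) z" by (simp add: \<alpha>_def x_def y_def)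
  also have "\<dots> = cnj (gk z (B x)) - cnj (gk z (B y))"
    unfolding L_add L_cmult L_gk[OF z xy(1)] L_gk[OF z xy(2)] by simp
  finally show ?thesis by (simp add: \<alpha>_def x_def y_def)
qed

lemma L_\<beta>: assumes z: "z \<in> A'" and p: "cmod p = t" shows "L (\<lambda>w. \<beta> j w p) z = \<beta> (Suc j) z p"
proof -
  define x y where "x = (B ^^ j) p" and "y = (B ^^ j) 0"
  have xy: "cmod x \<le> t" "cmod y \<le> t" unfolding x_def y_def by (rule funpow_B_cball; use p t_pos in simp)+
  have "L (\<lambda>w. \<beta> j w p) z = L (\<lambda>w. hk w x + cnj (gk w y)) z" by (simp add: \<beta>_def x_def y_def)
  also have "\<dots> = hk z (B x) + cnj (gk z (B y))"
    unfolding L_add L_gk[OF z xy(2)] L_hk[OF z xy(1)] by simp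
  finally show ?thesis by (simp add: \<beta>_def x_def y_def)
qed

definition rep :: "(complex \<Rightarrow> complex) \<Rightarrow> nat \<Rightarrow> complex \<Rightarrow> complex" where
  "rep f j z = (contour_integral (circlepath 0 (1 / t)) (\<lambda>p. f p * \<alpha> j z p) +
     contour_integral (circlepath 0 t) (\<lambda>p. f p * \<beta> j z p)) / (2 * of_real pi * \<i>)"

lemma rep_0:
  assumes f: "f holomorphic_on A" and w: "t < cmod w" "cmod w < 1 / t"
  shows "f w = rep f 0 w"
proof -
  have "2 * of_real pi * \<i> * f w = contour_integral (circlepath 0 (1/t)) (\<lambda>p. f p / (p - w)) - contour_integral (circlepath 0 t) (\<lambda>p. f p / (p - w))"
    by (rule Cauchy_integral_annulus[OF f]) (use w r_pos r_t radii_inverse in auto)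
  also have "contour_integral (circlepath 0 (1/t)) (\<lambda>p. f p / (p - w)) = contour_integral (circlepath 0 (1/t)) (\<lambda>p. f p * \<alpha> 0 w p)"
  proof (rule contour_integral_cong[OF refl])
    fix p assume "p \<in> path_image (circlepath 0 (1/t))"
    hence p: "cmod p = 1 / t" using t_pos by simp
    have "p \<noteq> w" "p \<noteq> 0" using p w t_pos by auto
    moreover have "1 - w / p \<noteq> 0" using calculation by (simp add: field_simps)
    ultimately have "cnj (gk w (1 / cnj p)) = 1 / (p - w)" by (simp add: gk_def field_simps)
    thus "f p / (p - w) = f p * \<alpha> 0 w p" by (simp add: \<alpha>_def gk_def)
  qed
  also have "contour_integral (circlepath 0 t) (\<lambda>p. f p / (p - w)) = contour_integral (circlepath 0 t) (\<lambda>p. - (f p * \<beta> 0 w p))"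
  proof (rule contour_integral_cong[OF refl])
    fix p assume "p \<in> path_image (circlepath 0 t)"
    hence p: "cmod p = t" using t_pos by simp
    have "p \<noteq> w" using p w by auto
    have "w - p = - (p - w)" by simp
    hence "hk w p = - (1 / (p - w))" unfolding hk_def by (simp only: divide_minus_right)
    hence "\<beta> 0 w p = - (1 / (p - w))" by (simp add: \<beta>_def gk_def)
    thus "f p / (p - w) = - (f p * \<beta> 0 w p)" by simp
  qed
  also have "\<dots> = - contour_integral (circlepath 0 t) (\<lambda>p. f p * \<beta> 0 w p)"
    by (rule contour_integral_neg)
  finally show ?thesis by (simp add: rep_def field_simps)
qed

lemma L_rep:
  assumes f: "f holomorphic_on A" and z: "z \<in> A'"
  shows "L (rep f j) z = rep f (Suc j) z"
proof -
  have fb: "t < cmod w" "cmod w < 1 / t" if "w \<in> fiber z" for w using fiber_bounds[OF z that] by auto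
  have rep_eq: "rep f j = (\<lambda>w. (1 / (2 * of_real pi * \<i>)) * (contour_integral (circlepath 0 (1 / t)) (\<lambda>p. f p * \<alpha> j w p) +
      contour_integral (circlepath 0 t) (\<lambda>p. f p * \<beta> j w p)))"
    by (simp add: rep_def fun_eq_iff)
  have "L (rep f j) z = (1 / (2 * of_real pi * \<i>)) * (L (\<lambda>w. contour_integral (circlepath 0 (1 / t)) (\<lambda>p. f p * \<alpha> j w p)) z +
      L (\<lambda>w. contour_integral (circlepath 0 t) (\<lambda>p. f p * \<beta> j w p)) z)"
    unfolding rep_eq L_cmult L_add ..
  also have "L (\<lambda>w. contour_integral (circlepath 0 (1 / t)) (\<lambda>p. f p * \<alpha> j w p)) z = contour_integral (circlepath 0 (1 / t)) (\<lambda>p. f p * L (\<lambda>w. \<alpha> j w p) z)"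
    by (rule L_contour_integral[OF kernel_integrable(1)[OF f fb] z])
  also have "\<dots> = contour_integral (circlepath 0 (1 / t)) (\<lambda>p. f p * \<alpha> (Suc j) z p)"
    by (rule contour_integral_cong[OF refl]) (use t_pos L_\<alpha>[OF z] in simp)
  also have "L (\<lambda>w. contour_integral (circlepath 0 t) (\<lambda>p. f p * \<beta> j w p)) z = contour_integral (circlepath 0 t) (\<lambda>p. f p * L (\<lambda>w. \<beta> j w p) z)"
    by (rule L_contour_integral[OF kernel_integrable(2)[OF f fb] z])
  also have "\<dots> = contour_integral (circlepath 0 t) (\<lambda>p. f p * \<beta> (Suc j) z p)"
    by (rule contour_integral_cong[OF refl]) (use t_pos L_\<beta>[OF z] in simp)
  finally show ?thesis by (simp add: rep_def[abs_def])
qed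

text \<open>Cauchy's formula with circles of radii \<open>t\<close> and \<open>1 / t\<close> holds
  only between them. All fibres lie there, so one application of \<open>L\<close> extends the
  formula to the whole of \<open>A\<close>; this is why the exponent is
  \<open>Suc j\<close>.\<close>

lemma funpow_T_rep:
  assumes f: "f holomorphic_on A" and z: "z \<in> A"
  shows "(T ^^ Suc j) f z = rep f (Suc j) z"
proof -
  have "(T ^^ j) f w = rep f j w" if "t < cmod w" "cmod w < 1 / t" for j w
    using that
  proof (induction j arbitrary: w)
    case 0 thus ?case using rep_0[OF f] by simp
  next
    case (Suc j)
    have w: "w \<in> A" "w \<in> A'" using Suc.prems r_t radii_inverse s_r by (auto simp: annulus_iff)
    have "(T ^^ Suc j) f w = L ((T ^^ j) f) w" using w by (simp add: T_def)
    also have "\<dots> = L (rep f j) w" by (rule L_cong) (use fiber_bounds[OF w(2)] Suc.IH in auto)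
    finally show ?case using L_rep[OF f w(2)] by simp
  qed
  note claim = this
  have z': "z \<in> A'" using z A_subset by auto
  have "(T ^^ Suc j) f z = L ((T ^^ j) f) z" using z by (simp add: T_def)
  also have "\<dots> = L (rep f j) z" by (rule L_cong) (use fiber_bounds[OF z'] claim in auto)
  finally show ?thesis using L_rep[OF f z'] by simp
qed

text \<open>The same integral with general symbols in place of the two Cauchy kernels; it intertwines
  the transfer operator with composition by \<open>B\<close> on the symbols.\<close>

definition symb :: "(complex \<Rightarrow> complex) \<Rightarrow> nat \<Rightarrow> (complex \<Rightarrow> complex) \<Rightarrow> (complex \<Rightarrow> complex) \<Rightarrow> complex" where
  "symb f j H G = (contour_integral (circlepath 0 (1 / t)) (\<lambda>p. f p * cnj (G ((B ^^ j) (1 / cnj p)) - G ((B ^^ j) 0))) +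
     contour_integral (circlepath 0 t) (\<lambda>p. f p * (H ((B ^^ j) p) + cnj (G ((B ^^ j) 0))))) / (2 * of_real pi * \<i>)"

text \<open>At least one application of \<open>B\<close> is needed to bring the arguments into
  \<open>D\<close>, where the symbols are defined.\<close>

lemma symb_integrable:
  assumes f: "f holomorphic_on A" and H: "continuous_on D H" and G: "continuous_on D G"
  shows "(\<lambda>p. f p * cnj (G ((B ^^ Suc j) (1 / cnj p)) - G ((B ^^ Suc j) 0))) contour_integrable_on circlepath 0 (1 / t)"
    "(\<lambda>p. f p * (H ((B ^^ Suc j) p) + cnj (G ((B ^^ Suc j) 0)))) contour_integrable_on circlepath 0 t"
proof -
  have fo: "continuous_on (sphere 0 (1 / t)) f" "continuous_on (sphere 0 t) f"
    by (rule continuous_on_subset[OF holomorphic_on_imp_continuous_on[OF f]]; use r_t t_1 radii_inverse in \<open>auto simp: annulus_iff\<close>)+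
  have Bj: "(B ^^ Suc j) ` cball 0 t \<subseteq> D"
  proof
    fix x assume "x \<in> (B ^^ Suc j) ` cball 0 t"
    then obtain q where q: "x = (B ^^ Suc j) q" "cmod q \<le> t" by auto
    thus "x \<in> D" using funpow_B_cball(2)[OF q(2), of j] \<rho>D by simp
  qed
  have gBc: "continuous_on (cball 0 t) (\<lambda>q. G ((B ^^ Suc j) q))"
    by (rule continuous_on_compose2[OF G continuous_on_funpow_B Bj])
  have hBc: "continuous_on (cball 0 t) (\<lambda>q. H ((B ^^ Suc j) q))"
    by (rule continuous_on_compose2[OF H continuous_on_funpow_B Bj])
  have refl: "continuous_on (sphere 0 (1 / t)) (\<lambda>p. G ((B ^^ Suc j) (1 / cnj p)))"
    by (rule continuous_on_compose2[OF gBc])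
       (use reflect_outer in \<open>auto intro!: continuous_intros simp: norm_divide\<close>)
  show "(\<lambda>p. f p * cnj (G ((B ^^ Suc j) (1 / cnj p)) - G ((B ^^ Suc j) 0))) contour_integrable_on circlepath 0 (1 / t)"
    by (rule contour_integrable_continuous_circlepath) (use t_pos fo refl in \<open>auto intro!: continuous_intros simp del: funpow.simps\<close>)
  show "(\<lambda>p. f p * (H ((B ^^ Suc j) p) + cnj (G ((B ^^ Suc j) 0)))) contour_integrable_on circlepath 0 t"
    by (rule contour_integrable_continuous_circlepath)
       (use t_pos fo continuous_on_subset[OF hBc, of "sphere 0 t"] in \<open>auto intro!: continuous_intros simp del: funpow.simps\<close>)
qed

lemma symb_diff:
  assumes f: "f holomorphic_on A" and "continuous_on D H" "continuous_on D G" "continuous_on D H'" "continuous_on D G'"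
  shows "symb f (Suc j) (\<lambda>q. H q - c * H' q) (\<lambda>q. G q - cnj c * G' q) = symb f (Suc j) H G - c * symb f (Suc j) H' G'"
proof -
  note i = symb_integrable[OF f assms(2,3)]
  note i' = symb_integrable[OF f assms(4,5)]
  let ?k1 = "\<lambda>G p. f p * cnj (G ((B ^^ Suc j) (1 / cnj p)) - G ((B ^^ Suc j) 0))"
  let ?k2 = "\<lambda>H G p. f p * (H ((B ^^ Suc j) p) + cnj (G ((B ^^ Suc j) 0)))"
  have "contour_integral (circlepath 0 (1/t)) (?k1 (\<lambda>q. G q - cnj c * G' q)) = contour_integral (circlepath 0 (1/t)) (\<lambda>p. ?k1 G p - c * ?k1 G' p)"
    by (rule arg_cong[where f = "contour_integral _"]) (simp add: fun_eq_iff algebra_simps)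
  also have "\<dots> = contour_integral (circlepath 0 (1/t)) (?k1 G) - c * contour_integral (circlepath 0 (1/t)) (?k1 G')"
    using contour_integral_diff[OF i(1) contour_integrable_lmul[OF i'(1)]] contour_integral_lmul[OF i'(1)] by simp
  finally have 1: "contour_integral (circlepath 0 (1/t)) (?k1 (\<lambda>q. G q - cnj c * G' q)) = contour_integral (circlepath 0 (1/t)) (?k1 G) - c * contour_integral (circlepath 0 (1/t)) (?k1 G')" .
  have "contour_integral (circlepath 0 t) (?k2 (\<lambda>q. H q - c * H' q) (\<lambda>q. G q - cnj c * G' q)) = contour_integral (circlepath 0 t) (\<lambda>p. ?k2 H G p - c * ?k2 H' G' p)"
    by (rule arg_cong[where f = "contour_integral _"]) (simp add: fun_eq_iff algebra_simps)
  also have "\<dots> = contour_integral (circlepath 0 t) (?k2 H G) - c * contour_integral (circlepath 0 t) (?k2 H' G')"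
    using contour_integral_diff[OF i(2) contour_integrable_lmul[OF i'(2)]] contour_integral_lmul[OF i'(2)] by simp
  finally have 2: "contour_integral (circlepath 0 t) (?k2 (\<lambda>q. H q - c * H' q) (\<lambda>q. G q - cnj c * G' q)) = contour_integral (circlepath 0 t) (?k2 H G) - c * contour_integral (circlepath 0 t) (?k2 H' G')" .
  show ?thesis unfolding symb_def 1 2 by (simp add: diff_divide_distrib add_divide_distrib algebra_simps)
qed

lemma symb_comp: "symb f j (\<lambda>q. H (B q)) (\<lambda>q. G (B q)) = symb f (Suc j) H G"
  by (simp add: symb_def)

lemma symb_bound:
  assumes H: "\<And>q. cmod q \<le> t \<Longrightarrow> cmod (H ((B ^^ j) q)) \<le> m" and G: "\<And>q. cmod q \<le> t \<Longrightarrow> cmod (G ((B ^^ j) q)) \<le> m"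
    and f: "\<And>p. cmod p = t \<or> cmod p = 1 / t \<Longrightarrow> cmod (f p) \<le> c" and fh: "f holomorphic_on A"
    and cont: "continuous_on D H" "continuous_on D G" and j: "j = Suc i"
  shows "cmod (symb f j H G) \<le> (4 / t) * c * m"
proof -
  have c: "0 \<le> c" using f[of "of_real t"] t_pos by (auto intro: order_trans[OF norm_ge_zero])
  have m: "0 \<le> m" using H[of 0] t_pos by (auto intro: order_trans[OF norm_ge_zero])
  have b1: "cmod (contour_integral (circlepath 0 (1 / t)) (\<lambda>p. f p * cnj (G ((B ^^ j) (1 / cnj p)) - G ((B ^^ j) 0)))) \<le> (c * (2 * m)) * (2 * pi * (1 / t))"
  proof (rule has_contour_integral_bound_circlepath[OF has_contour_integral_integral])
    show "(\<lambda>p. f p * cnj (G ((B ^^ j) (1 / cnj p)) - G ((B ^^ j) 0))) contour_integrable_on circlepath 0 (1 / t)"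
      unfolding j by (rule symb_integrable(1)[OF fh cont])
    fix p :: complex assume "cmod (p - 0) = 1 / t"
    hence p: "cmod p = 1 / t" by simp
    have "cmod (G ((B ^^ j) (1 / cnj p)) - G ((B ^^ j) 0)) \<le> m + m"
      by (rule order_trans[OF norm_triangle_ineq4 add_mono[OF G G]]) (use reflect_outer[OF p] t_pos in auto)
    thus "cmod (f p * cnj (G ((B ^^ j) (1 / cnj p)) - G ((B ^^ j) 0))) \<le> c * (2 * m)"
      unfolding norm_mult complex_mod_cnj using f[of p] p c by (intro mult_mono) auto
  qed (use c m t_pos in auto)
  have b2: "cmod (contour_integral (circlepath 0 t) (\<lambda>p. f p * (H ((B ^^ j) p) + cnj (G ((B ^^ j) 0))))) \<le> (c * (2 * m)) * (2 * pi * t)"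
  proof (rule has_contour_integral_bound_circlepath[OF has_contour_integral_integral])
    show "(\<lambda>p. f p * (H ((B ^^ j) p) + cnj (G ((B ^^ j) 0)))) contour_integrable_on circlepath 0 t"
      unfolding j by (rule symb_integrable(2)[OF fh cont])
    fix p :: complex assume "cmod (p - 0) = t"
    hence p: "cmod p = t" by simp
    have "cmod (H ((B ^^ j) p)) \<le> m" "cmod (cnj (G ((B ^^ j) 0))) \<le> m" using H[of p] G[of 0] p t_pos by auto
    hence "cmod (H ((B ^^ j) p) + cnj (G ((B ^^ j) 0))) \<le> m + m"
      by (rule order_trans[OF norm_triangle_ineq add_mono])
    thus "cmod (f p * (H ((B ^^ j) p) + cnj (G ((B ^^ j) 0)))) \<le> c * (2 * m)"
      unfolding norm_mult using f[of p] p c by (intro mult_mono) auto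
  qed (use c m t_pos in auto)
  have tt: "t \<le> 1 / t" using t_1 radii_inverse by linarith
  have "cmod (symb f j H G) \<le> ((c * (2 * m)) * (2 * pi * (1 / t)) + (c * (2 * m)) * (2 * pi * t)) / (2 * pi)"
    unfolding symb_def norm_divide using norm_triangle_mono[OF b1 b2] by (simp add: norm_mult divide_right_mono)
  also have "\<dots> = c * (2 * m) * (1 / t + t)" by (simp add: field_simps)
  also have "\<dots> \<le> c * (2 * m) * (2 * (1 / t))" using tt c m by (intro mult_left_mono) auto
  finally show ?thesis by (simp add: mult_ac)
qed

lemma hk_holomorphic: "z \<in> A \<Longrightarrow> hk z holomorphic_on D"
  unfolding hk_def using \<rho>D by (intro holomorphic_intros) (auto simp: annulus_iff)

lemma gk_holomorphic: "z \<in> A \<Longrightarrow> gk z holomorphic_on D"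
proof -
  assume z: "z \<in> A"
  have "1 - q * cnj z \<noteq> 0" if "q \<in> D" for q
  proof
    assume "1 - q * cnj z = 0"
    hence "q * cnj z = 1" by simp
    hence e: "cmod q * cmod z = 1" by (metis complex_mod_cnj norm_mult norm_one)
    have "cmod q * cmod z \<le> r * cmod z" using that \<rho>D by (intro mult_right_mono) auto
    also have "\<dots> < 1" using z r_pos by (simp add: annulus_iff field_simps)
    finally show False using e by simp
  qed
  thus ?thesis unfolding gk_def by (intro holomorphic_intros) auto
qed

text \<open>A factor \<open>T - c\<close> becomes composition with \<open>B\<close> minus
  \<open>c\<close> on the first symbol, and minus \<open>cnj c\<close> on the second, which enters
  the integral conjugated.\<close>

lemma op_poly_funpow_T:
  assumes f: "f holomorphic_on A" and z: "z \<in> A"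
  shows "op_poly cs ((T ^^ Suc j) f) z = symb f (Suc j) (comp_poly cs (hk z)) (comp_poly (map cnj cs) (gk z))"
proof (induction cs arbitrary: j)
  case Nil
  show ?case using funpow_T_rep[OF f z, of j] by (simp add: rep_def symb_def \<alpha>_def \<beta>_def)
next
  case (Cons c cs)
  have ch: "continuous_on D (comp_poly cs (hk z))" "continuous_on D (comp_poly (map cnj cs) (gk z))"
    using comp_poly_holomorphic[OF hk_holomorphic[OF z]] comp_poly_holomorphic[OF gk_holomorphic[OF z]]
    by (auto intro: holomorphic_on_imp_continuous_on)
  have chB: "continuous_on D (\<lambda>q. comp_poly cs (hk z) (B q))" "continuous_on D (\<lambda>q. comp_poly (map cnj cs) (gk z) (B q))"
    by (rule continuous_on_compose2[OF ch(1) holomorphic_on_imp_continuous_on[OF holomorphic_B_D]]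
          continuous_on_compose2[OF ch(2) holomorphic_on_imp_continuous_on[OF holomorphic_B_D]]; use B_D in auto)+
  have "op_poly (c # cs) ((T ^^ Suc j) f) z = op_poly cs ((T ^^ Suc (Suc j)) f) z - c * op_poly cs ((T ^^ Suc j) f) z"
    by (simp add: op_poly_diff)
  also have "\<dots> = symb f (Suc j) (\<lambda>q. comp_poly cs (hk z) (B q)) (\<lambda>q. comp_poly (map cnj cs) (gk z) (B q)) -
       c * symb f (Suc j) (comp_poly cs (hk z)) (comp_poly (map cnj cs) (gk z))"
    unfolding Cons.IH symb_comp ..
  also have "\<dots> = symb f (Suc j) (comp_poly (c # cs) (hk z)) (comp_poly (map cnj (c # cs)) (gk z))"
    using symb_diff[OF f chB ch, of j c] by simp
  finally show ?case .
qed

text \<open>After \<open>Suc j\<close> applications of \<open>B\<close> all points are within a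
  multiple of \<open>\<kappa> ^ j\<close> of \<open>z0\<close>, where both symbols vanish to order
  \<open>N\<close>; this gives \<open>(\<kappa> ^ N) ^ j\<close>. As \<open>\<kappa>\<close> is
  independent of \<open>N\<close>, any rate can be reached.\<close>

lemma op_poly_decay:
  obtains \<kappa> where "0 < \<kappa>" "\<kappa> < 1"
    "\<And>N. \<exists>K>0. \<forall>f c j z. f holomorphic_on A \<longrightarrow> (\<forall>p. t \<le> cmod p \<longrightarrow> cmod p \<le> 1 / t \<longrightarrow> cmod (f p) \<le> c) \<longrightarrow> z \<in> A \<longrightarrow>
        cmod (op_poly (eig_list N) ((T ^^ Suc j) f) z) \<le> K * c * (\<kappa> ^ N) ^ j"
proof -
  obtain \<kappa> where \<kappa>: "0 < \<kappa>" "\<kappa> < 1" "\<And>k q. cmod q \<le> t \<Longrightarrow> cmod ((B ^^ Suc k) q - z0) \<le> 2 * \<rho>D * \<kappa> ^ k"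
    using B_contracting by blast
  \<comment> \<open>A bound for both kernels, uniform for \<open>z \<in> A\<close> and
    \<open>q \<in> D\<close>, whose closures are separated by \<open>r - \<rho>D\<close>.\<close>
  define M0 where "M0 = max (1 / (r - \<rho>D)) (\<rho>D / (1 - \<rho>D / r))"
  have den: "0 < r - \<rho>D" "0 < 1 - \<rho>D / r" using \<rho>D by auto
  have M0: "M0 > 0" using den by (simp add: M0_def less_max_iff_disj)
  have hb: "cmod (hk z q) \<le> M0" if "z \<in> A" "q \<in> D" for z q
  proof -
    have "r - \<rho>D \<le> cmod (z - q)" using that norm_triangle_ineq2[of z q] by (simp add: annulus_iff)
    hence "cmod (hk z q) \<le> 1 / (r - \<rho>D)" using den by (simp add: hk_def norm_divide frac_le)
    thus ?thesis by (simp add: M0_def)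
  qed
  have gb: "cmod (gk z q) \<le> M0" if "z \<in> A" "q \<in> D" for z q
  proof -
    have "cmod (q * cnj z) \<le> \<rho>D * (1 / r)" unfolding norm_mult complex_mod_cnj using that \<rho>D(3) by (intro mult_mono) (simp_all add: annulus_iff)
    hence "1 - \<rho>D / r \<le> cmod (1 - q * cnj z)" using norm_triangle_ineq2[of 1 "q * cnj z"] by simp
    hence "cmod (gk z q) \<le> \<rho>D / (1 - \<rho>D / r)" unfolding gk_def norm_divide using den that \<rho>D by (intro frac_le) auto
    thus ?thesis by (simp add: M0_def)
  qed
  have "\<exists>K>0. \<forall>f c j z. f holomorphic_on A \<longrightarrow> (\<forall>p. t \<le> cmod p \<longrightarrow> cmod p \<le> 1 / t \<longrightarrow> cmod (f p) \<le> c) \<longrightarrow> z \<in> A \<longrightarrow>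
        cmod (op_poly (eig_list N) ((T ^^ Suc j) f) z) \<le> K * c * (\<kappa> ^ N) ^ j" for N
  proof -
    define M1 where "M1 = 2 ^ length (eig_list N) * M0"
    define a where "a = 2 * \<rho>D / ((\<rho>D - s) / 2)"
    have a: "a > 0" using \<rho>D by (simp add: a_def)
    have M1: "M1 > 0" using M0 by (simp add: M1_def)
    have decay: "cmod (H ((B ^^ Suc j) q)) \<le> M1 * a ^ N * (\<kappa> ^ N) ^ j"
      if H: "vanish N H" "\<And>q. q \<in> D \<Longrightarrow> cmod (H q) \<le> M1" and q: "cmod q \<le> t" for H j q
    proof -
      have "cmod (H ((B ^^ Suc j) q)) \<le> M1 * (cmod ((B ^^ Suc j) q - z0) / ((\<rho>D - s) / 2)) ^ N"
        by (rule vanish_decay[OF H funpow_B_cball(2)[OF q]])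
      also have "\<dots> \<le> M1 * (2 * \<rho>D * \<kappa> ^ j / ((\<rho>D - s) / 2)) ^ N"
        using M1 \<rho>D \<kappa>(3)[OF q, of j] by (intro mult_left_mono power_mono divide_right_mono) auto
      also have "2 * \<rho>D * \<kappa> ^ j / ((\<rho>D - s) / 2) = a * \<kappa> ^ j" by (simp add: a_def)
      also have "(a * \<kappa> ^ j) ^ N = a ^ N * (\<kappa> ^ N) ^ j" by (simp add: power_mult_distrib power_mult[symmetric] mult.commute)
      finally show ?thesis by (simp add: mult.assoc)
    qed
    show ?thesis
    proof (intro exI[of _ "4 / t * (M1 * a ^ N)"] conjI allI impI)
      show "0 < 4 / t * (M1 * a ^ N)" using t_pos M1 a by simp
      fix f c j z assume f: "f holomorphic_on A" "\<forall>p. t \<le> cmod p \<longrightarrow> cmod p \<le> 1 / t \<longrightarrow> cmod (f p) \<le> c" and z: "z \<in> A"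
      have hol: "comp_poly (eig_list N) (hk z) holomorphic_on D" "comp_poly (map cnj (eig_list N)) (gk z) holomorphic_on D"
        by (intro comp_poly_holomorphic hk_holomorphic gk_holomorphic z)+
      have nc: "cmod x \<le> 1" if "x \<in> set (map cnj (eig_list N))" for x using that norm_eig_list by auto
      have "cmod (symb f (Suc j) (comp_poly (eig_list N) (hk z)) (comp_poly (map cnj (eig_list N)) (gk z))) \<le> (4 / t) * c * (M1 * a ^ N * (\<kappa> ^ N) ^ j)"
      proof (rule symb_bound[OF _ _ _ f(1) holomorphic_on_imp_continuous_on[OF hol(1)] holomorphic_on_imp_continuous_on[OF hol(2)] refl])
        fix q assume q: "cmod q \<le> t"
        show "cmod (comp_poly (eig_list N) (hk z) ((B ^^ Suc j) q)) \<le> M1 * a ^ N * (\<kappa> ^ N) ^ j"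
          by (rule decay[OF vanish_eig_list[OF hk_holomorphic[OF z]] _ q])
             (use comp_poly_bound[where h = "hk z" and M = M0 and cs = "eig_list N", OF hb[OF z] norm_eig_list] in \<open>simp add: M1_def\<close>)
        show "cmod (comp_poly (map cnj (eig_list N)) (gk z) ((B ^^ Suc j) q)) \<le> M1 * a ^ N * (\<kappa> ^ N) ^ j"
          by (rule decay[OF vanish_cnj_eig_list[OF gk_holomorphic[OF z]] _ q])
             (use comp_poly_bound[where h = "gk z" and M = M0 and cs = "map cnj (eig_list N)", OF gb[OF z] nc] in \<open>simp add: M1_def\<close>)
      next
        fix p :: complex assume "cmod p = t \<or> cmod p = 1 / t"
        thus "cmod (f p) \<le> c" using f(2) t_1 radii_inverse by auto
      qed
      thus "cmod (op_poly (eig_list N) ((T ^^ Suc j) f) z) \<le> 4 / t * (M1 * a ^ N) * c * (\<kappa> ^ N) ^ j"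
        unfolding op_poly_funpow_T[OF f(1) z] by (simp add: mult_ac)
    qed
  qed
  thus ?thesis using that \<kappa>(1,2) by blast
qed

subsection \<open>Compactness and resolvents\<close>

abbreviation V where "V \<equiv> hardy_space r (1 / r)"
abbreviation Nm where "Nm \<equiv> hardy_norm r (1 / r)"

lemma r_lt: "r < 1 / r"
  using radii_inverse r_t t_1 by linarith

lemma V_holomorphic: "f \<in> V \<Longrightarrow> f holomorphic_on A" and V_outside: "f \<in> V \<Longrightarrow> z \<notin> A \<Longrightarrow> f z = 0"
  by (auto simp: hardy_space_def)

lemma T_holomorphic: assumes "f holomorphic_on A" shows "T f holomorphic_on A"
proof (rule holomorphic_transform)
  show "L f holomorphic_on A" by (rule holomorphic_on_subset[OF L_holomorphic[OF assms] A_subset])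
qed (simp add: T_def)

lemma op_poly_holomorphic: "f holomorphic_on A \<Longrightarrow> op_poly cs f holomorphic_on A"
proof (induction cs arbitrary: f)
  case (Cons c cs)
  have "(\<lambda>z. T f z - c * f z) holomorphic_on A"
    by (rule holomorphic_on_diff[OF T_holomorphic[OF Cons.prems] holomorphic_on_mult[OF holomorphic_on_const Cons.prems]])
  from Cons.IH[OF this] show ?case by simp
qed simp

lemma funpow_T_holomorphic: "f holomorphic_on A \<Longrightarrow> (T ^^ k) f holomorphic_on A"
  by (induction k) (simp_all add: T_holomorphic)

lemma evaluation_bound:
  obtains Ce where "Ce > 0" "\<And>f p. f \<in> V \<Longrightarrow> t \<le> cmod p \<Longrightarrow> cmod p \<le> 1 / t \<Longrightarrow> cmod (f p) \<le> Ce * Nm f"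
proof -
  obtain Ce where Ce: "Ce \<ge> 0" "\<And>f p. f \<in> V \<Longrightarrow> t \<le> cmod p \<Longrightarrow> cmod p \<le> 1 / t \<Longrightarrow> cmod (f p) \<le> Ce * Nm f"
    by (rule hardy_point_evaluation_bound[OF r_pos r_t, of "1 / t" "1 / r"]) (use radii_inverse in auto)
  have "cmod (f p) \<le> (Ce + 1) * Nm f" if "f \<in> V" "t \<le> cmod p" "cmod p \<le> 1 / t" for f p
    using Ce(2)[OF that] hardy_norm_nonneg[of r "1 / r" f] unfolding distrib_right mult_1 by linarith
  thus ?thesis using that[of "Ce + 1"] Ce(1) by auto
qed

lemma L_V_bound:
  obtains Ce where "Ce > 0" "\<And>f z. f \<in> V \<Longrightarrow> z \<in> A' \<Longrightarrow> cmod (L f z) \<le> Ce * Nm f"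
proof -
  obtain Ce where Ce: "Ce > 0" "\<And>f p. f \<in> V \<Longrightarrow> t \<le> cmod p \<Longrightarrow> cmod p \<le> 1 / t \<Longrightarrow> cmod (f p) \<le> Ce * Nm f"
    using evaluation_bound by blast
  obtain M where M: "M > 0" "\<And>f c z. z \<in> A' \<Longrightarrow> (\<And>w. t \<le> cmod w \<Longrightarrow> cmod w \<le> 1 / t \<Longrightarrow> cmod (f w) \<le> c) \<Longrightarrow> cmod (L f z) \<le> M * c"
    using L_bound by blast
  have "cmod (L f z) \<le> M * Ce * Nm f" if "f \<in> V" "z \<in> A'" for f z
    using M(2)[OF that(2) Ce(2)[OF that(1)]] by (simp add: mult.assoc)
  thus ?thesis using that[of "M * Ce"] M(1) Ce(1) by simp
qed

lemma bounded_in_V: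
  assumes "f holomorphic_on A" "\<And>z. z \<notin> A \<Longrightarrow> f z = 0" "\<And>z. z \<in> A \<Longrightarrow> cmod (f z) \<le> c"
  shows "f \<in> V" "Nm f \<le> sqrt 2 * c"
  using bounded_in_hardy_space[OF r_pos r_lt assms] by auto

lemma bounded_operator_T: "bounded_operator V Nm T"
proof -
  obtain Ce where Ce: "Ce > 0" "\<And>f z. f \<in> V \<Longrightarrow> z \<in> A' \<Longrightarrow> cmod (L f z) \<le> Ce * Nm f"
    using L_V_bound by blast
  have b: "T f \<in> V" "Nm (T f) \<le> sqrt 2 * (Ce * Nm f)" if f: "f \<in> V" for f
  proof -
    have hol: "T f holomorphic_on A" by (rule T_holomorphic[OF V_holomorphic[OF f]])
    have out: "T f z = 0" if "z \<notin> A" for z using that by (simp add: T_def)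
    have bd: "cmod (T f z) \<le> Ce * Nm f" if "z \<in> A" for z
      using Ce(2)[OF f, of z] A_subset that by (simp add: T_def subsetD)
    show "T f \<in> V" "Nm (T f) \<le> sqrt 2 * (Ce * Nm f)" using bounded_in_V[OF hol out bd] by simp_all
  qed
  show ?thesis unfolding bounded_operator_def linear_operator_def
  proof (intro conjI ballI allI)
    show "\<exists>Ce. \<forall>f\<in>V. Nm (T f) \<le> Ce * Nm f"
      using b(2) by (intro exI[of _ "sqrt 2 * Ce"]) (simp add: mult.assoc)
  qed (simp_all add: b T_add T_cmult)
qed

lemma T_V: "f \<in> V \<Longrightarrow> T f \<in> V"
  using bounded_operator_T by (auto simp: bounded_operator_def linear_operator_def)

lemma transfer_well_defined: "transfer_operator_well_defined B A V"
  unfolding transfer_operator_well_defined_def T_eq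
  using transfer_value_exists transfer_value_unique T_V by blast

text \<open>Images of the unit ball extend to \<open>A'\<close> with a common bound. A subsequence
  converges uniformly on the closure of \<open>A\<close>, a compact part of \<open>A'\<close>, and
  uniform convergence controls the norm. So every infinite set of images has a limit point, the
  Bolzano-Weierstrass form of compactness.\<close>

lemma compact_operator_T: "compact_operator V Nm T"
proof -
  interpret Metric_space V "\<lambda>f g. Nm (\<lambda>z. f z - g z)" by (rule Metric_space_hardy[OF r_pos r_lt])
  obtain Ce where Ce: "Ce > 0" "\<And>f z. f \<in> V \<Longrightarrow> z \<in> A' \<Longrightarrow> cmod (L f z) \<le> Ce * Nm f"
    using L_V_bound by blast
  have "mtopology derived_set_of X \<noteq> {}" if X: "infinite X" "X \<subseteq> T ` {f \<in> V. Nm f \<le> 1}" for X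
  proof -
    obtain \<sigma> :: "nat \<Rightarrow> complex \<Rightarrow> complex" where \<sigma>: "inj \<sigma>" "range \<sigma> \<subseteq> X" using infinite_countable_subset[OF X(1)] by blast
    have "\<forall>k. \<exists>f. f \<in> V \<and> Nm f \<le> 1 \<and> \<sigma> k = T f" using \<sigma>(2) X(2) by blast
    from choice[OF this] obtain f where f: "\<And>k. f k \<in> V" "\<And>k. Nm (f k) \<le> 1" "\<And>k. \<sigma> k = T (f k)" by blast
    define F where "F k = L (f k)" for k
    define H where "H = {h. h holomorphic_on A' \<and> (\<forall>z\<in>A'. cmod (h z) \<le> Ce)}"
    have FH: "F k \<in> H" for k
    proof -
      have "cmod (F k z) \<le> Ce" if "z \<in> A'" for z
        using Ce(2)[OF f(1) that, of k] mult_left_mono[OF f(2)[of k], of Ce] Ce(1) unfolding F_def by linarith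
      thus ?thesis using L_holomorphic[OF V_holomorphic[OF f(1)]] by (simp add: H_def F_def)
    qed
    obtain g \<rho> where g: "g holomorphic_on A'" "strict_mono (\<rho> :: nat \<Rightarrow> nat)"
      "\<And>x. x \<in> A' \<Longrightarrow> ((\<lambda>k. F (\<rho> k) x) \<longlongrightarrow> g x) sequentially"
      "\<And>K. compact K \<Longrightarrow> K \<subseteq> A' \<Longrightarrow> uniform_limit K (F \<circ> \<rho>) g sequentially"
    proof (rule Montel[of A' H F])
      show "range F \<subseteq> H" using FH by blast
      show "\<exists>B. \<forall>h\<in>H. \<forall>z\<in>K. cmod (h z) \<le> B" if "K \<subseteq> A'" for K using that by (auto simp: H_def)
    qed (auto simp: H_def)
    define K where "K = cball 0 (1 / r) - ball (0::complex) r"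
    have K: "compact K" "K \<subseteq> A'" "A \<subseteq> K" using s_r radii_inverse by (auto simp: K_def compact_diff annulus_iff)
    have unif: "uniform_limit K (F \<circ> \<rho>) g sequentially" by (rule g(4)[OF K(1,2)])
    define g0 where "g0 z = (if z \<in> A then g z else 0)" for z
    have gC: "cmod (g z) \<le> Ce" if "z \<in> A'" for z
      by (rule LIMSEQ_le_const2[OF tendsto_norm[OF g(3)[OF that]]]) (use FH that in \<open>auto simp: H_def\<close>)
    have g0V: "g0 \<in> V"
    proof (rule bounded_in_V(1))
      show "g0 holomorphic_on A" by (rule holomorphic_transform[OF holomorphic_on_subset[OF g(1) A_subset]]) (auto simp: g0_def)
      show "cmod (g0 z) \<le> Ce" if "z \<in> A" for z using gC[of z] that A_subset by (auto simp: g0_def)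
    qed (auto simp: g0_def)
    have \<sigma>V: "\<sigma> k \<in> V" for k using T_V f by simp
    have lim: "\<exists>k0. \<forall>k\<ge>k0. Nm (\<lambda>z. g0 z - \<sigma> (\<rho> k) z) < e" if e: "e > 0" for e
    proof -
      have "e / 2 > 0" using e by simp
      from uniform_limitD[OF unif this] obtain k0 where k0: "\<And>k z. k \<ge> k0 \<Longrightarrow> z \<in> K \<Longrightarrow> dist (F (\<rho> k) z) (g z) < e / 2"
        by (auto simp: eventually_sequentially)
      have "Nm (\<lambda>z. g0 z - \<sigma> (\<rho> k) z) < e" if "k \<ge> k0" for k
      proof -
        have "Nm (\<lambda>z. g0 z - \<sigma> (\<rho> k) z) \<le> sqrt 2 * (e / 2)"
        proof (rule bounded_in_V(2))
          show "(\<lambda>z. g0 z - \<sigma> (\<rho> k) z) holomorphic_on A"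
            by (intro holomorphic_intros V_holomorphic g0V \<sigma>V)
          show "g0 z - \<sigma> (\<rho> k) z = 0" if "z \<notin> A" for z using V_outside[OF g0V that] V_outside[OF \<sigma>V that] by simp
          fix z assume z: "z \<in> A"
          have "dist (F (\<rho> k) z) (g z) < e / 2" using k0 \<open>k \<ge> k0\<close> z K(3) by blast
          thus "cmod (g0 z - \<sigma> (\<rho> k) z) \<le> e / 2" using z by (simp add: g0_def f(3) T_def F_def dist_norm norm_minus_commute)
        qed
        also have "\<dots> < e" using e sqrt2_less_2 by simp
        finally show ?thesis .
      qed
      thus ?thesis by blast
    qed
    have inj: "\<sigma> (\<rho> i) \<noteq> \<sigma> (\<rho> j)" if "i \<noteq> j" for i j
      using that \<sigma>(1) strict_mono_eq[OF g(2)] by (auto dest: injD)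
    have "g0 \<in> mtopology derived_set_of X"
      unfolding metric_derived_set_of
    proof (intro CollectI conjI allI impI)
      show "g0 \<in> V" by (rule g0V)
      fix e :: real assume "e > 0"
      then obtain k0 where k0: "\<And>k. k \<ge> k0 \<Longrightarrow> Nm (\<lambda>z. g0 z - \<sigma> (\<rho> k) z) < e" using lim by blast
      have in_ball: "\<sigma> (\<rho> k) \<in> mball g0 e" if "k \<ge> k0" for k using k0[OF that] g0V \<sigma>V by (simp add: in_mball)
      \<comment> \<open>The terms are pairwise distinct, so at most one of two consecutive ones
        equals the limit.\<close>
      have "\<sigma> (\<rho> k0) \<noteq> g0 \<or> \<sigma> (\<rho> (Suc k0)) \<noteq> g0" using inj[of k0 "Suc k0"] by auto
      then obtain k where "k \<ge> k0" "\<sigma> (\<rho> k) \<noteq> g0" using le_refl le_SucI by blast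
      thus "\<exists>y\<in>X. y \<noteq> g0 \<and> y \<in> mball g0 e" using in_ball \<sigma>(2) by blast
    qed
    thus ?thesis by blast
  qed
  hence "compactin mtopology (mtopology closure_of (T ` {f \<in> V. Nm f \<le> 1}))"
    unfolding compact_closure_of_eq_Bolzano_Weierstrass by blast
  moreover have "linear_operator V T" using bounded_operator_T by (simp add: bounded_operator_def)
  ultimately show ?thesis by (simp add: compact_operator_def)
qed

lemma bounded_operator_combine:
  assumes "bounded_operator V Nm S" "bounded_operator V Nm R"
  shows "bounded_operator V Nm (\<lambda>f z. k * (S f z + c * R f z))"
proof -
  obtain CS where CS: "\<And>f. f \<in> V \<Longrightarrow> Nm (S f) \<le> CS * Nm f" using assms(1) by (auto simp: bounded_operator_def)
  obtain CR where CR: "\<And>f. f \<in> V \<Longrightarrow> Nm (R f) \<le> CR * Nm f" using assms(2) by (auto simp: bounded_operator_def)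
  have S: "S f \<in> V" and R: "R f \<in> V" if "f \<in> V" for f using assms that by (auto simp: bounded_operator_def linear_operator_def)
  have V: "(\<lambda>z. k * (S f z + c * R f z)) \<in> V" if "f \<in> V" for f
    by (intro hardy_space_cmult hardy_space_add r_pos r_lt S R that)
  have "Nm (\<lambda>z. k * (S f z + c * R f z)) \<le> (cmod k * (CS + cmod c * CR)) * Nm f" if f: "f \<in> V" for f
  proof -
    have "Nm (\<lambda>z. k * (S f z + c * R f z)) = cmod k * Nm (\<lambda>z. S f z + c * R f z)"
      by (intro hardy_norm_cmult hardy_space_cmult hardy_space_add r_pos r_lt S R f)
    also have "\<dots> \<le> cmod k * (Nm (S f) + Nm (\<lambda>z. c * R f z))"
      by (intro mult_left_mono hardy_norm_triangle hardy_space_cmult r_pos r_lt S R f) auto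
    also have "Nm (\<lambda>z. c * R f z) = cmod c * Nm (R f)" by (intro hardy_norm_cmult r_pos r_lt R f)
    also have "cmod k * (Nm (S f) + cmod c * Nm (R f)) \<le> cmod k * (CS * Nm f + cmod c * (CR * Nm f))"
      by (intro mult_left_mono add_mono CS CR f) auto
    finally show ?thesis by (simp add: algebra_simps)
  qed
  moreover have "(\<lambda>z. k * (S (\<lambda>z. f z + g z) z + c * R (\<lambda>z. f z + g z) z)) =
      (\<lambda>z. k * (S f z + c * R f z) + k * (S g z + c * R g z))" if "f \<in> V" "g \<in> V" for f g
    using assms that by (simp add: bounded_operator_def linear_operator_def algebra_simps)
  moreover have "(\<lambda>z. k * (S (\<lambda>z. d * f z) z + c * R (\<lambda>z. d * f z) z)) = (\<lambda>z. d * (k * (S f z + c * R f z)))" if "f \<in> V" for f d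
    using assms that by (simp add: bounded_operator_def linear_operator_def algebra_simps)
  ultimately show ?thesis using V unfolding bounded_operator_def linear_operator_def by blast
qed

lemma bounded_operator_id: "bounded_operator V Nm (\<lambda>f. f)"
  unfolding bounded_operator_def linear_operator_def by (auto intro: exI[of _ 1])

lemma op_poly_V: "f \<in> V \<Longrightarrow> op_poly cs f \<in> V"
proof (induction cs arbitrary: f)
  case (Cons c cs)
  have "(\<lambda>z. T f z - c * f z) \<in> V" by (intro hardy_space_diff hardy_space_cmult T_V r_pos r_lt Cons.prems)
  thus ?case using Cons.IH by simp
qed simp

lemma bounded_operator_op_poly: "bounded_operator V Nm (op_poly cs)"
proof (induction cs)
  case Nil
  have "op_poly [] = (\<lambda>f. f)" by (intro ext) simp
  thus ?case using bounded_operator_id by simp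
next
  case (Cons c cs)
  obtain Ce where Ce: "\<And>f. f \<in> V \<Longrightarrow> Nm (op_poly cs f) \<le> Ce * Nm f" using Cons.IH by (auto simp: bounded_operator_def)
  have b: "bounded_operator V Nm (\<lambda>f z. 1 * (T f z + (- c) * f z))"
    by (rule bounded_operator_combine[OF bounded_operator_T bounded_operator_id])
  then obtain Ce' where Ce': "\<And>f. f \<in> V \<Longrightarrow> Nm (\<lambda>z. T f z - c * f z) \<le> Ce' * Nm f" by (auto simp: bounded_operator_def)
  have V: "(\<lambda>z. T f z - c * f z) \<in> V" if "f \<in> V" for f
    by (intro hardy_space_diff hardy_space_cmult T_V r_pos r_lt that)
  have "Nm (op_poly (c # cs) f) \<le> (max Ce 0 * Ce') * Nm f" if f: "f \<in> V" for f
  proof -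
    have "Nm (op_poly (c # cs) f) \<le> Ce * Nm (\<lambda>z. T f z - c * f z)" using Ce[OF V[OF f]] by simp
    also have "\<dots> \<le> max Ce 0 * Nm (\<lambda>z. T f z - c * f z)" by (intro mult_right_mono) auto
    also have "\<dots> \<le> max Ce 0 * (Ce' * Nm f)" by (intro mult_left_mono Ce' f) auto
    finally show ?thesis by (simp add: mult.assoc)
  qed
  thus ?case unfolding bounded_operator_def linear_operator_def
    using op_poly_V op_poly_add op_poly_cmult by blast
qed

section \<open>Enclosure of the spectrum\<close>

text \<open>\<open>S\<close> stands for the resolvent at \<open>\<mu>\<close> times the polynomial
  in \<open>T\<close> with roots \<open>cs\<close>; for the empty list it is the resolvent
  itself.\<close>

definition resolves :: "complex \<Rightarrow> complex list \<Rightarrow> bool" where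
  "resolves \<mu> cs \<longleftrightarrow> (\<exists>S. bounded_operator V Nm S \<and>
     (\<forall>f\<in>V. S (\<lambda>z. \<mu> * f z - T f z) = op_poly cs f) \<and>
     (\<forall>f\<in>V. (\<lambda>z. \<mu> * S f z - T (S f) z) = op_poly cs f))"

text \<open>With \<open>R\<close> the resolvent and \<open>q\<close> the polynomial of the remaining
  roots, \<open>R (T - c) q = (\<mu> - c) R q - q\<close>. Solving for \<open>R q\<close> gives the
  formula for \<open>S'\<close>.\<close>

lemma resolves_peel:
  assumes "resolves \<mu> (c # cs)" and c: "c \<noteq> \<mu>" shows "resolves \<mu> cs"
proof -
  obtain S where S: "bounded_operator V Nm S" "\<And>f. f \<in> V \<Longrightarrow> S (\<lambda>z. \<mu> * f z - T f z) = op_poly (c # cs) f"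
    "\<And>f. f \<in> V \<Longrightarrow> (\<lambda>z. \<mu> * S f z - T (S f) z) = op_poly (c # cs) f"
    using assms by (auto simp: resolves_def)
  define k where "k = 1 / (\<mu> - c)"
  have k: "k * (\<mu> - c) = 1" using c by (simp add: k_def)
  define S' where "S' f z = k * (S f z + 1 * op_poly cs f z)" for f z
  have b: "bounded_operator V Nm S'"
    unfolding S'_def[abs_def] by (rule bounded_operator_combine[OF S(1) bounded_operator_op_poly])
  have poly: "op_poly (c # cs) f z = op_poly cs (T f) z - c * op_poly cs f z" for f z
    by (simp add: op_poly_diff)
  have poly2: "op_poly cs (\<lambda>z. \<mu> * f z - T f z) z = \<mu> * op_poly cs f z - op_poly cs (T f) z" for f z
    using op_poly_diff[of cs "\<lambda>w. \<mu> * f w" 1 "T f"] by (simp add: op_poly_cmult)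
  have 1: "S' (\<lambda>z. \<mu> * f z - T f z) = op_poly cs f" if f: "f \<in> V" for f
  proof
    fix z
    have "S' (\<lambda>z. \<mu> * f z - T f z) z = k * (op_poly (c # cs) f z + op_poly cs (\<lambda>z. \<mu> * f z - T f z) z)"
      by (simp only: S'_def S(2)[OF f] mult_1)
    also have "\<dots> = k * (\<mu> - c) * op_poly cs f z" unfolding poly poly2 by (simp add: algebra_simps)
    finally show "S' (\<lambda>z. \<mu> * f z - T f z) z = op_poly cs f z" by (simp add: k)
  qed
  have 2: "(\<lambda>z. \<mu> * S' f z - T (S' f) z) = op_poly cs f" if f: "f \<in> V" for f
  proof
    fix z
    have "T (S' f) z = k * (T (S f) z + op_poly cs (T f) z)"
      unfolding S'_def[abs_def] by (simp add: T_cmult T_add T_op_poly)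
    hence "\<mu> * S' f z - T (S' f) z = k * ((\<mu> * S f z - T (S f) z) + (\<mu> * op_poly cs f z - op_poly cs (T f) z))"
      by (simp add: S'_def algebra_simps)
    also have "\<mu> * S f z - T (S f) z = op_poly (c # cs) f z" using fun_cong[OF S(3)[OF f], of z] by simp
    also have "k * (op_poly (c # cs) f z + (\<mu> * op_poly cs f z - op_poly cs (T f) z)) = k * (\<mu> - c) * op_poly cs f z"
      unfolding poly by (simp add: algebra_simps)
    finally show "\<mu> * S' f z - T (S' f) z = op_poly cs f z" by (simp add: k)
  qed
  show ?thesis unfolding resolves_def using b 1 2 by blast
qed

lemma resolves_peel_all:
  "resolves \<mu> cs \<Longrightarrow> (\<And>c. c \<in> set cs \<Longrightarrow> c \<noteq> \<mu>) \<Longrightarrow> resolves \<mu> []"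
  by (induction cs) (auto dest: resolves_peel)

text \<open>The decay estimate is available from the first iterate of \<open>T\<close> on, so the
  series starts one power later than the resolvent series. The price is the additional root 0, which
  is harmless because \<open>\<mu> \<noteq> 0\<close>.\<close>

lemma resolves_eig_list:
  assumes \<mu>: "\<mu> \<noteq> 0"
  shows "\<exists>N. resolves \<mu> (0 # eig_list N)"
proof -
  obtain \<kappa> where \<kappa>: "0 < \<kappa>" "\<kappa> < 1"
    and decay: "\<And>N. \<exists>K>0. \<forall>f c j z. f holomorphic_on A \<longrightarrow> (\<forall>p. t \<le> cmod p \<longrightarrow> cmod p \<le> 1 / t \<longrightarrow> cmod (f p) \<le> c) \<longrightarrow> z \<in> A \<longrightarrow>
        cmod (op_poly (eig_list N) ((T ^^ Suc j) f) z) \<le> K * c * (\<kappa> ^ N) ^ j"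
    using op_poly_decay by blast
  have "0 < cmod \<mu>" using \<mu> by simp
  \<comment> \<open>The order \<open>N\<close> depends on \<open>\<mu>\<close>: the rate
    \<open>\<kappa> ^ N\<close> has to beat the growth of the powers of
    \<open>1 / \<mu>\<close>.\<close>
  then obtain N where N: "\<kappa> ^ N < cmod \<mu>" using real_arch_pow_inv[of "cmod \<mu>" \<kappa>] \<kappa> by blast
  define cs where "cs = eig_list N"
  define \<theta> where "\<theta> = \<kappa> ^ N / cmod \<mu>"
  have \<theta>: "0 \<le> \<theta>" "\<theta> < 1" using N \<mu> \<kappa> by (auto simp: \<theta>_def)
  obtain K where K: "K > 0" "\<And>f c j z. f holomorphic_on A \<Longrightarrow> (\<And>p. t \<le> cmod p \<Longrightarrow> cmod p \<le> 1 / t \<Longrightarrow> cmod (f p) \<le> c) \<Longrightarrow> z \<in> A \<Longrightarrow>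
        cmod (op_poly cs ((T ^^ Suc j) f) z) \<le> K * c * (\<kappa> ^ N) ^ j"
    using decay[of N] unfolding cs_def by blast
  obtain Ce where Ce: "Ce > 0" "\<And>f p. f \<in> V \<Longrightarrow> t \<le> cmod p \<Longrightarrow> cmod p \<le> 1 / t \<Longrightarrow> cmod (f p) \<le> Ce * Nm f"
    using evaluation_bound by blast
  define ak where "ak k f z = op_poly cs ((T ^^ Suc k) f) z / \<mu> ^ Suc k" for k f z
  define E where "E = K * Ce / cmod \<mu>"
  have E: "E > 0" using K Ce \<mu> by (simp add: E_def)
  have a_bound: "cmod (ak k f z) \<le> E * Nm f * \<theta> ^ k" if "f \<in> V" "z \<in> A" for k f z
  proof -
    have "cmod (ak k f z) = cmod (op_poly cs ((T ^^ Suc k) f) z) / (cmod \<mu>) ^ Suc k"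
      by (simp add: ak_def norm_divide norm_power norm_mult)
    also have "\<dots> \<le> K * (Ce * Nm f) * (\<kappa> ^ N) ^ k / (cmod \<mu>) ^ Suc k"
      by (intro divide_right_mono K(2) V_holomorphic that Ce) auto
    finally show ?thesis using \<mu> by (simp add: E_def \<theta>_def power_divide field_simps)
  qed
  have a_out: "ak k f z = 0" if "z \<notin> A" for k f z
  proof -
    have "op_poly cs ((T ^^ Suc k) f) z = 0" by (rule op_poly_outside[OF _ that]) (simp add: T_def)
    thus ?thesis by (simp add: ak_def)
  qed
  have geo: "summable (\<lambda>k. E * Nm f * \<theta> ^ k)" for f using \<theta> by (intro summable_mult summable_geometric) auto
  have a_summable: "summable (\<lambda>k. ak k f z)" if "f \<in> V" for f z
  proof (cases "z \<in> A")
    case True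
    show ?thesis by (rule summable_comparison_test'[OF geo[of f], of 0]) (use a_bound[OF that True] in auto)
  qed (simp add: a_out)
  define S where "S f z = (\<Sum>k. ak k f z)" for f z
  have S_bound: "cmod (S f z) \<le> E / (1 - \<theta>) * Nm f" if "f \<in> V" "z \<in> A" for f z
  proof -
    have "cmod (S f z) \<le> (\<Sum>k. E * Nm f * \<theta> ^ k)"
      unfolding S_def by (rule norm_suminf_le[OF a_bound[OF that] geo])
    also have "\<dots> = E * Nm f * (1 / (1 - \<theta>))"
      using \<theta> by (subst suminf_mult) (auto simp: suminf_geometric intro: summable_geometric)
    finally show ?thesis by simp
  qed
  have S_hol: "S f holomorphic_on A" if f: "f \<in> V" for f
  proof (rule holomorphic_uniform_sequence[OF open_annulus])
    show "(\<lambda>z. \<Sum>k<m. ak k f z) holomorphic_on A" for m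
      unfolding ak_def using \<mu>
      by (intro holomorphic_intros op_poly_holomorphic funpow_T_holomorphic V_holomorphic f) auto
    have "uniform_limit A (\<lambda>m z. \<Sum>k<m. ak k f z) (S f) sequentially"
      unfolding S_def[abs_def] by (rule Weierstrass_m_test[OF a_bound[OF f] geo])
    moreover fix x assume "x \<in> A"
    then obtain d where "d > 0" "cball x d \<subseteq> A" using open_annulus open_contains_cball by blast
    ultimately show "\<exists>d>0. cball x d \<subseteq> A \<and> uniform_limit (cball x d) (\<lambda>m z. \<Sum>k<m. ak k f z) (S f) sequentially"
      using uniform_limit_on_subset by blast
  qed
  have S_V: "S f \<in> V \<and> Nm (S f) \<le> (sqrt 2 * (E / (1 - \<theta>))) * Nm f" if f: "f \<in> V" for f
  proof -
    have "S f z = 0" if "z \<notin> A" for z using a_out[OF that] by (simp add: S_def)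
    from bounded_in_V[OF S_hol[OF f] this S_bound[OF f]] show ?thesis by (simp add: mult.assoc)
  qed
  have T_lin: "(T ^^ k) (\<lambda>z. f z + g z) = (\<lambda>z. (T ^^ k) f z + (T ^^ k) g z)" for k f g
    by (induction k) (auto simp: T_add)
  have T_scal: "(T ^^ k) (\<lambda>z. c * f z) = (\<lambda>z. c * (T ^^ k) f z)" for k c f
    by (induction k) (auto simp: T_cmult)
  have a_add: "ak k (\<lambda>z. f z + g z) z = ak k f z + ak k g z" for k f g z
    unfolding ak_def T_lin op_poly_add by (simp add: add_divide_distrib)
  have a_cmult: "ak k (\<lambda>z. c * f z) z = c * ak k f z" for k c f z
    unfolding ak_def T_scal op_poly_cmult by simp
  have a_T: "ak k (T f) z = \<mu> * ak (Suc k) f z" for k f z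
    using \<mu> by (simp add: ak_def funpow_swap1)
  have T_a: "T (ak k f) = (\<lambda>z. \<mu> * ak (Suc k) f z)" for k f
  proof -
    have "T (ak k f) = (\<lambda>z. (1 / \<mu> ^ Suc k) * T (op_poly cs ((T ^^ Suc k) f)) z)"
      unfolding ak_def[abs_def] by (subst T_cmult[symmetric]) simp
    thus ?thesis using \<mu> by (simp add: T_op_poly ak_def fun_eq_iff)
  qed
  have tele: "(\<Sum>k. \<mu> * ak k f z - \<mu> * ak (Suc k) f z) = op_poly (0 # cs) f z" if f: "f \<in> V" for f z
  proof -
    have "(\<lambda>k. \<mu> * ak k f z) \<longlonglongrightarrow> \<mu> * 0"
      by (intro tendsto_mult_left summable_LIMSEQ_zero a_summable f)
    hence "(\<lambda>k. \<mu> * ak k f z - \<mu> * ak (Suc k) f z) sums (\<mu> * ak 0 f z - \<mu> * 0)" by (rule telescope_sums')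
    thus ?thesis using \<mu> by (simp add: sums_iff ak_def)
  qed
  have "bounded_operator V Nm S"
    unfolding bounded_operator_def linear_operator_def
  proof (intro conjI ballI allI)
    show "S (\<lambda>z. f z + g z) = (\<lambda>z. S f z + S g z)" if "f \<in> V" "g \<in> V" for f g
      unfolding S_def[abs_def] a_add using a_summable that by (intro ext suminf_add[symmetric])
    show "S (\<lambda>z. c * f z) = (\<lambda>z. c * S f z)" if "f \<in> V" for c f
      unfolding S_def[abs_def] a_cmult using a_summable that by (intro ext suminf_mult)
    show "\<exists>Ce. \<forall>f\<in>V. Nm (S f) \<le> Ce * Nm f" using S_V by blast
  qed (use S_V in blast)
  moreover have "S (\<lambda>z. \<mu> * f z - T f z) = op_poly (0 # cs) f" if f: "f \<in> V" for f
  proof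
    fix z
    have "ak k (\<lambda>z. \<mu> * f z - T f z) z = \<mu> * ak k f z - \<mu> * ak (Suc k) f z" for k
      using a_add[of k "\<lambda>z. \<mu> * f z" "\<lambda>z. (-1) * T f z" z] unfolding a_cmult a_T by simp
    thus "S (\<lambda>z. \<mu> * f z - T f z) z = op_poly (0 # cs) f z" using tele[OF f, of z] by (simp add: S_def)
  qed
  moreover have "(\<lambda>z. \<mu> * S f z - T (S f) z) = op_poly (0 # cs) f" if f: "f \<in> V" for f
  proof
    fix z
    \<comment> \<open>\<open>T\<close> may be applied term by term because its value at a point is a
      finite sum over the fibre.\<close>
    have T_S: "T (S f) z = (\<Sum>k. \<mu> * ak (Suc k) f z)"
    proof (cases "z \<in> A")
      case True
      hence z': "z \<in> A'" using A_subset by blast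
      have "T (S f) z = (\<Sum>w\<in>fiber z. (\<Sum>k. ak k f w) / deriv B w)" using True by (simp add: T_def L_def S_def)
      also have "\<dots> = (\<Sum>w\<in>fiber z. \<Sum>k. ak k f w / deriv B w)"
        by (intro sum.cong refl suminf_divide[symmetric] a_summable f)
      also have "\<dots> = (\<Sum>k. \<Sum>w\<in>fiber z. ak k f w / deriv B w)"
        by (rule suminf_sum[symmetric]) (intro summable_divide a_summable f)
      also have "\<dots> = (\<Sum>k. T (ak k f) z)" using True by (simp add: T_def L_def)
      finally show ?thesis by (simp add: T_a)
    qed (simp add: T_def a_out)
    have "\<mu> * S f z - T (S f) z = (\<Sum>k. \<mu> * ak k f z) - (\<Sum>k. \<mu> * ak (Suc k) f z)"
      unfolding T_S S_def using suminf_mult[OF a_summable[OF f], of \<mu> z] by simp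
    also have "\<dots> = (\<Sum>k. \<mu> * ak k f z - \<mu> * ak (Suc k) f z)"
      using a_summable[OF f, of z] by (intro suminf_diff summable_mult) (simp_all add: summable_Suc_iff[of "\<lambda>k. ak k f z"])
    finally show "\<mu> * S f z - T (S f) z = op_poly (0 # cs) f z" using tele[OF f, of z] by simp
  qed
  ultimately show ?thesis unfolding resolves_def cs_def by blast
qed

lemma spectrum_subset:
  assumes "\<mu> \<in> operator_spectrum V Nm T" "\<mu> \<noteq> 0"
  shows "\<exists>j. \<mu> = \<nu> ^ j \<or> \<mu> = cnj (\<nu> ^ j)"
proof (rule ccontr)
  assume no: "\<nexists>j. \<mu> = \<nu> ^ j \<or> \<mu> = cnj (\<nu> ^ j)"
  obtain N where N: "resolves \<mu> (0 # eig_list N)" using resolves_eig_list[OF assms(2)] by blast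
  have "c \<noteq> \<mu>" if "c \<in> set (0 # eig_list N)" for c
    using that no assms(2) by (auto simp: set_eig_list simp del: complex_cnj_power)
  hence "resolves \<mu> []" by (rule resolves_peel_all[OF N])
  thus False using assms(1) by (auto simp: resolves_def operator_spectrum_def)
qed

lemma eigenvalue_in_spectrum:
  assumes f: "f \<in> V" "T f = (\<lambda>z. \<mu> * f z)" and z: "f z \<noteq> 0"
  shows "\<mu> \<in> operator_spectrum V Nm T"
proof (rule ccontr)
  assume "\<mu> \<notin> operator_spectrum V Nm T"
  then obtain S where S: "bounded_operator V Nm S" "\<And>f. f \<in> V \<Longrightarrow> S (\<lambda>z. \<mu> * f z - T f z) = f"
    by (auto simp: operator_spectrum_def)
  have "f = S (\<lambda>z. 0 * f z)" using S(2)[OF f(1)] by (simp add: f(2))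
  also have "\<dots> = (\<lambda>z. 0 * S f z)" using S(1) f(1) unfolding bounded_operator_def linear_operator_def by blast
  finally show False using z by (metis mult_zero_left)
qed

lemma zero_in_spectrum: "0 \<in> operator_spectrum V Nm T"
proof (rule ccontr)
  assume "0 \<notin> operator_spectrum V Nm T"
  then obtain S where S: "bounded_operator V Nm S" "\<And>f. f \<in> V \<Longrightarrow> (\<lambda>z. 0 * S f z - T (S f) z) = f"
    by (auto simp: operator_spectrum_def)
  \<comment> \<open>The pole lies beyond the outer radius of \<open>A\<close> and within that of
    \<open>A'\<close>.\<close>
  define x where "x = (1 / r + 1 / s) / 2"
  have x: "1 / r < x" "x < 1 / s" using radii_inverse by (auto simp: x_def)
  have x0: "x > 0" using x r_pos by (meson less_trans zero_less_divide_1_iff)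
  define f where "f z = (if z \<in> A then 1 / (z - of_real x) else 0)" for z
  have far: "x - 1 / r \<le> cmod (z - of_real x)" if "z \<in> A" for z
  proof -
    have "cmod z < 1 / r" using that by (simp add: annulus_iff)
    thus ?thesis using norm_triangle_ineq2[of "of_real x" z] x0 by (simp add: norm_minus_commute)
  qed
  have "f \<in> V"
  proof (rule bounded_in_V(1))
    have "(\<lambda>z. 1 / (z - of_real x)) holomorphic_on A"
      by (intro holomorphic_intros) (use far x in fastforce)
    thus "f holomorphic_on A" by (rule holomorphic_transform) (simp add: f_def)
    show "cmod (f z) \<le> 1 / (x - 1 / r)" if "z \<in> A" for z
      using far[OF that] x that by (simp add: f_def norm_divide frac_le)
  qed (simp add: f_def)
  define h where "h = S f"
  have hV: "h \<in> V" using S(1) \<open>f \<in> V\<close> by (auto simp: h_def bounded_operator_def linear_operator_def)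
  have eq: "L h z * (z - of_real x) = -1" if z: "z \<in> A" for z
  proof -
    have "- L h z = 1 / (z - of_real x)" using fun_cong[OF S(2)[OF \<open>f \<in> V\<close>], of z] z by (simp add: h_def T_def f_def)
    moreover have "z - of_real x \<noteq> 0" using far[OF z] x by auto
    ultimately show ?thesis by (simp add: field_simps)
  qed
  have "connected A'"
    using connected_annulus(1)[of s "0::complex" "1 / s"] by (simp add: annulus_def dist_norm norm_minus_commute)
  \<comment> \<open>A preimage \<open>h\<close> of the pole function would satisfy
    \<open>L h z * (z - x) = -1\<close> on \<open>A\<close>. Both sides are holomorphic on the
    connected \<open>A'\<close>, so the identity persists at the pole, where the left side is
    zero.\<close>
  have "L h (of_real x) * (of_real x - of_real x) = -1"
  proof (rule analytic_continuation_open[of A A' "\<lambda>z. L h z * (z - of_real x)" "\<lambda>_. -1"])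
    show "(\<lambda>z. L h z * (z - of_real x)) holomorphic_on A'"
      by (intro holomorphic_intros L_holomorphic V_holomorphic hV)
    have "1 \<in> A" using r_t t_1 radii_inverse by (simp add: annulus_iff)
    thus "A \<noteq> {}" by blast
    have "s < x" using x s_r r_t t_1 radii_inverse by linarith
    thus "of_real x \<in> A'" using x x0 by (simp add: annulus_iff)
  qed (use eq A_subset \<open>connected A'\<close> in auto)
  thus False by simp
qed

subsection \<open>Eigenfunctions\<close>

text \<open>Holomorphy on the larger annulus makes \<open>f\<close> bounded on \<open>A\<close>, so
  that its restriction belongs to the Hardy space.\<close>

lemma eigenfunction_in_spectrum:
  assumes f: "f holomorphic_on A'" and eq: "\<And>z. z \<in> A \<Longrightarrow> L f z = \<mu> * f z" and p: "p \<in> A" "f p \<noteq> 0"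
  shows "\<mu> \<in> operator_spectrum V Nm T"
proof (rule eigenvalue_in_spectrum)
  define g where "g z = (if z \<in> A then f z else 0)" for z
  define K where "K = cball 0 (1 / r) - ball (0::complex) r"
  have K: "compact K" "K \<subseteq> A'" "A \<subseteq> K" using s_r radii_inverse by (auto simp: K_def compact_diff annulus_iff)
  have "compact (f ` K)"
    by (rule compact_continuous_image[OF holomorphic_on_imp_continuous_on[OF holomorphic_on_subset[OF f K(2)]] K(1)])
  then obtain b where b: "\<And>z. z \<in> K \<Longrightarrow> cmod (f z) \<le> b" using compact_imp_bounded bounded_iff by (metis imageI)
  show "g \<in> V"
  proof (rule bounded_in_V(1))
    show "g holomorphic_on A" by (rule holomorphic_transform[OF holomorphic_on_subset[OF f A_subset]]) (simp add: g_def)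
    show "cmod (g z) \<le> b" if "z \<in> A" for z using b K(3) that by (auto simp: g_def)
  qed (simp add: g_def)
  show "T g = (\<lambda>z. \<mu> * g z)"
  proof
    fix z
    have "L g z = L f z" if "z \<in> A"
    proof (rule L_cong)
      fix w assume "w \<in> fiber z"
      hence "t < cmod w" "cmod w < 1 / t" using fiber_bounds[of z w] A_subset that by auto
      hence "w \<in> A" using r_t radii_inverse by (simp add: annulus_iff)
      thus "g w = f w" by (simp add: g_def)
    qed
    thus "T g z = \<mu> * g z" using eq by (simp add: T_def g_def)
  qed
  show "g p \<noteq> 0" using p by (simp add: g_def)
qed

lemma one_in_A: "1 \<in> A" using r_t t_1 radii_inverse by (simp add: annulus_iff)

lemma reflect_in_A: "z \<in> A \<Longrightarrow> 1 / cnj z \<in> A" "z \<in> A' \<Longrightarrow> z \<noteq> 0"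
proof -
  assume "z \<in> A"
  hence z: "r < cmod z" "cmod z < 1 / r" "0 < cmod z" using r_pos by (auto simp: annulus_iff)
  hence "r * cmod z < 1" using r_pos by (simp add: field_simps)
  thus "1 / cnj z \<in> A"
    using z r_pos by (simp add: annulus_iff norm_divide pos_less_divide_eq pos_divide_less_eq)
next
  show "z \<in> A' \<Longrightarrow> z \<noteq> 0" using s_pos by (auto simp: annulus_iff)
qed

lemma A'_minus_z0: "z \<in> A' \<Longrightarrow> z - z0 \<noteq> 0" "z \<in> A' \<Longrightarrow> 1 / z - cnj z0 \<noteq> 0"
proof -
  assume z: "z \<in> A'"
  thus "z - z0 \<noteq> 0" using z0_s by (auto simp: annulus_iff)
  have z': "s < cmod z" "cmod z < 1 / s" "0 < cmod z" using z s_pos by (auto simp: annulus_iff)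
  hence "s * cmod z < 1" using s_pos by (simp add: field_simps)
  hence "s < cmod (1 / z)" using z' by (simp add: norm_divide pos_less_divide_eq)
  thus "1 / z - cnj z0 \<noteq> 0" using z0_s by (metis complex_mod_cnj eq_iff_diff_eq_0 not_le)
qed

text \<open>The two kernels at the fixed point are added, whereby the terms with \<open>B 0\<close>
  cancel. The sum is \<open>(1 - |z0|^2) / ((z - z0) * (1 - cnj z0 * z))\<close>, on the circle the
  Poisson kernel at \<open>z0\<close> divided by \<open>z\<close>.\<close>

lemma one_in_spectrum: "1 \<in> operator_spectrum V Nm T"
proof (rule eigenfunction_in_spectrum)
  define f where "f z = 1 / (z - z0) + cnj z0 / (z * (1 / z - cnj z0))" for z
  have f_eq: "f z = hk z z0 + cnj (gk z z0)" if "z \<in> A'" for z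
    using reflect_in_A(2)[OF that] A'_minus_z0(2)[OF that] by (simp add: f_def hk_def gk_def field_simps)
  show "f holomorphic_on A'" unfolding f_def
    by (intro holomorphic_intros) (use reflect_in_A A'_minus_z0 in auto)
  show "L f z = 1 * f z" if z: "z \<in> A" for z
  proof -
    have z': "z \<in> A'" using z A_subset by blast
    have "L f z = L (\<lambda>w. hk w z0 + cnj (gk w z0)) z"
    proof (rule L_cong, rule f_eq)
      fix w assume "w \<in> fiber z"
      hence "t < cmod w" "cmod w < 1 / t" using fiber_bounds[OF z'] by auto
      thus "w \<in> A'" using s_r r_t radii_inverse by (simp add: annulus_iff)
    qed
    also have "\<dots> = hk z z0 + cnj (gk z z0)"
      using L_hk[OF z', of z0] L_gk[OF z', of z0] z0_t by (simp add: L_add fix_z0)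
    finally show ?thesis using f_eq[OF z'] by simp
  qed
  show "1 \<in> A" by (rule one_in_A)
  have 1: "1 - z0 \<noteq> 0" "1 - cnj z0 \<noteq> 0" using A'_minus_z0[of 1] one_in_A A_subset by auto
  show "f 1 \<noteq> 0"
  proof
    assume "f 1 = 0"
    hence "(1 - z0) * (1 - cnj z0) * (1 / (1 - z0) + cnj z0 / (1 - cnj z0)) = 0" by (simp add: f_def)
    moreover have "(1 - z0) * (1 - cnj z0) * (1 / (1 - z0) + cnj z0 / (1 - cnj z0)) = (1 - cnj z0) + cnj z0 * (1 - z0)"
      using 1 by (simp add: distrib_left)
    ultimately have "z0 * cnj z0 = 1" by (simp add: algebra_simps)
    hence "cmod z0 * cmod z0 = 1" by (metis complex_mod_cnj norm_mult norm_one)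
    moreover have "cmod z0 < 1" using z0_t t_1 by simp
    ultimately show False by (metis mult_less_cancel_left1 norm_not_less_zero less_asym mult_strict_mono' norm_ge_zero mult.right_neutral less_irrefl)
  qed
qed

section \<open>Eigenfunctionals of composition with B\<close>

text \<open>The exponents start at 1; the constant part is removed separately by subtracting the
  value at \<open>z0\<close>.\<close>

fun lower_powers :: "nat \<Rightarrow> complex list" where
  "lower_powers 0 = []"
| "lower_powers (Suc k) = \<nu> ^ Suc k # lower_powers k"

lemma set_lower_powers: "c \<in> set (lower_powers k) \<Longrightarrow> \<exists>j. 1 \<le> j \<and> j \<le> k \<and> c = \<nu> ^ j"
  by (induction k) (auto intro: le_SucI exI[of _ "Suc _"])

lemma vanish_lower_powers: "vanish 1 h \<Longrightarrow> vanish (Suc k) (comp_poly (lower_powers k) h)"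
proof (induction k)
  case (Suc k)
  from vanish_Suc[OF Suc.IH[OF Suc.prems]] show ?case by (simp only: lower_powers.simps comp_poly.simps)
qed simp

lemma vanish_comp_poly: "vanish N h \<Longrightarrow> vanish N (comp_poly cs h)"
proof (induction cs)
  case (Cons c cs)
  from vanish_comp[OF Cons.IH[OF Cons.prems]] show ?case by (simp only: comp_poly.simps)
qed simp

text \<open>Each factor with root \<open>c\<close> multiplies the leading coefficient by
  \<open>\<nu> ^ N - c\<close>, by \<open>comp_factor\<close>.\<close>

lemma comp_poly_power_factor:
  assumes "\<And>c. c \<in> set cs \<Longrightarrow> c \<noteq> \<nu> ^ N"
  shows "\<exists>G. G holomorphic_on D \<and> (\<forall>q\<in>D. comp_poly cs (\<lambda>q. (q - z0) ^ N) q = (q - z0) ^ N * G q) \<and> G z0 \<noteq> 0"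
  using assms
proof (induction cs)
  case Nil
  show ?case by (intro exI[of _ "\<lambda>_. 1"]) simp
next
  case (Cons c cs)
  then obtain G where G: "G holomorphic_on D" "\<And>q. q \<in> D \<Longrightarrow> comp_poly cs (\<lambda>q. (q - z0) ^ N) q = (q - z0) ^ N * G q" "G z0 \<noteq> 0"
    by auto
  obtain K where K: "K holomorphic_on D" "K z0 = (\<nu> ^ N - c) * G z0"
    "\<And>q. q \<in> D \<Longrightarrow> comp_poly cs (\<lambda>q. (q - z0) ^ N) (B q) - c * comp_poly cs (\<lambda>q. (q - z0) ^ N) q = (q - z0) ^ N * K q"
    using comp_factor[OF G(1,2), where c = c] by blast
  have "K z0 \<noteq> 0" using K(2) G(3) Cons.prems[of c] by simp
  thus ?case using K(1,3) by auto
qed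

definition coef_path :: "real \<Rightarrow> complex" where "coef_path = circlepath z0 ((\<rho>D - s) / 2)"

lemma coef_path: "valid_path coef_path" "path_image coef_path \<subseteq> D - {z0}" "pathfinish coef_path = pathstart coef_path"
  and coef_cball: "0 < (\<rho>D - s) / 2" "cball z0 ((\<rho>D - s) / 2) \<subseteq> D"
proof -
  show e: "0 < (\<rho>D - s) / 2" using \<rho>D by simp
  show sub: "cball z0 ((\<rho>D - s) / 2) \<subseteq> D"
  proof
    fix q assume "q \<in> cball z0 ((\<rho>D - s) / 2)"
    hence "cmod (q - z0) \<le> (\<rho>D - s) / 2" by (simp add: dist_norm norm_minus_commute)
    thus "q \<in> D" using norm_triangle_ineq2[of q z0] z0_s \<rho>D by simp
  qed
  have "sphere z0 ((\<rho>D - s) / 2) \<subseteq> cball z0 ((\<rho>D - s) / 2)" by auto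
  thus "path_image coef_path \<subseteq> D - {z0}" using e sub by (auto simp: coef_path_def path_image_circlepath)
qed (simp_all add: coef_path_def)

text \<open>The \<open>N\<close>-th Taylor coefficient at \<open>z0\<close> times
  \<open>2 * pi * \<i>\<close>; the factor is kept, as eigenvectors may be scaled.\<close>

definition coef :: "nat \<Rightarrow> (complex \<Rightarrow> complex) \<Rightarrow> complex" where
  "coef N H = contour_integral coef_path (\<lambda>q. H q / (q - z0) ^ Suc N)"

lemma coef_integrable: "H holomorphic_on D \<Longrightarrow> (\<lambda>q. H q / (q - z0) ^ Suc N) contour_integrable_on coef_path"
proof -
  assume H: "H holomorphic_on D"
  have "(\<lambda>q. H q / (q - z0) ^ Suc N) holomorphic_on D - {z0}"
    by (intro holomorphic_intros holomorphic_on_subset[OF H]) auto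
  moreover have "open (D - {z0})" by (intro open_delete open_ball)
  ultimately show ?thesis using contour_integrable_holomorphic_simple coef_path by blast
qed

lemma coef_cong: "(\<And>q. q \<in> D \<Longrightarrow> H q = G q) \<Longrightarrow> coef N H = coef N G"
  unfolding coef_def using coef_path(2) by (intro contour_integral_cong) auto

lemma coef_add: "H holomorphic_on D \<Longrightarrow> G holomorphic_on D \<Longrightarrow> coef N (\<lambda>q. H q + G q) = coef N H + coef N G"
  unfolding coef_def add_divide_distrib by (rule contour_integral_add[OF coef_integrable coef_integrable])

lemma coef_cmult: "H holomorphic_on D \<Longrightarrow> coef N (\<lambda>q. c * H q) = c * coef N H"
  unfolding coef_def times_divide_eq_right[symmetric] by (rule contour_integral_lmul[OF coef_integrable])

lemma coef_vanish: assumes "vanish (Suc N) H" shows "coef N H = 0"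
proof -
  obtain G where G: "G holomorphic_on D" "\<And>q. q \<in> D \<Longrightarrow> H q = (q - z0) ^ Suc N * G q" using assms by (auto simp: vanish_def)
  have "H q / (q - z0) ^ Suc N = G q" if "q \<in> path_image coef_path" for q
  proof -
    have "q \<in> D" "q - z0 \<noteq> 0" using coef_path(2) that by auto
    thus ?thesis using G(2) by (simp del: power_Suc)
  qed
  hence "coef N H = contour_integral coef_path G"
    unfolding coef_def by (intro contour_integral_cong) auto
  also have "\<dots> = 0"
    by (rule contour_integral_unique[OF Cauchy_theorem_convex_simple[OF G(1)]]) (use coef_path in auto)
  finally show ?thesis .
qed

lemma coef_leading:
  assumes G: "G holomorphic_on D" and H: "\<And>q. q \<in> D \<Longrightarrow> H q = (q - z0) ^ N * G q"
  shows "coef N H = 2 * of_real pi * \<i> * G z0"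
proof -
  have "H q / (q - z0) ^ Suc N = G q / (q - z0)" if "q \<in> path_image coef_path" for q
  proof -
    have "q \<in> D" "q - z0 \<noteq> 0" using coef_path(2) that by auto
    thus ?thesis using H by simp
  qed
  hence "coef N H = contour_integral coef_path (\<lambda>q. G q / (q - z0))"
    unfolding coef_def by (intro contour_integral_cong) auto
  also have "\<dots> = 2 * of_real pi * \<i> * G z0"
    unfolding coef_path_def
    by (rule contour_integral_unique, rule Cauchy_integral_circlepath_simple[OF holomorphic_on_subset[OF G coef_cball(2)]])
       (use coef_cball(1) in simp)
  finally show ?thesis .
qed

lemma coef_const: "N > 0 \<Longrightarrow> coef N (\<lambda>_. c) = 0"
proof -
  assume "N > 0"
  hence "(deriv ^^ N) (\<lambda>_. c) = (\<lambda>_. 0)" by (simp add: higher_deriv_const)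
  moreover have "z0 \<in> ball z0 ((\<rho>D - s) / 2)" using coef_cball(1) by simp
  from contour_integral_unique[OF Cauchy_has_contour_integral_higher_derivative_circlepath[OF _ _ this, where f = "\<lambda>_. c" and k = N]]
  have "coef N (\<lambda>_. c) = complex_of_real (2 * pi) * \<i> / fact N * (deriv ^^ N) (\<lambda>_. c) z0"
    unfolding coef_def coef_path_def by simp
  ultimately show ?thesis by simp
qed

lemma coef_sum:
  assumes "finite I" "\<And>i. i \<in> I \<Longrightarrow> H i holomorphic_on D"
  shows "coef N (\<lambda>q. \<Sum>i\<in>I. c i * H i q) = (\<Sum>i\<in>I. c i * coef N (H i))"
  using assms
proof (induction I rule: finite_induct)
  case empty
  have "coef N (\<lambda>q. 0 * (0::complex)) = 0 * coef N (\<lambda>_. 0)" by (rule coef_cmult) simp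
  thus ?case by simp
next
  case (insert i I)
  have "(\<lambda>q. \<Sum>i\<in>I. c i * H i q) holomorphic_on D" by (intro holomorphic_intros insert.prems) auto
  moreover have "(\<lambda>q. c i * H i q) holomorphic_on D" by (intro holomorphic_intros insert.prems) auto
  ultimately show ?case using insert by (simp add: coef_add coef_cmult)
qed

text \<open>The index is shifted: the eigenvalue belonging to \<open>k\<close> is
  \<open>\<nu> ^ Suc k\<close>, the exponent 0 being treated in
  \<open>one_in_spectrum\<close>.\<close>

definition eig_fun :: "nat \<Rightarrow> (complex \<Rightarrow> complex) \<Rightarrow> complex" where
  "eig_fun k h = coef (Suc k) (comp_poly (lower_powers k) h)"

lemma eig_fun_cong: "(\<And>q. q \<in> D \<Longrightarrow> h q = g q) \<Longrightarrow> eig_fun k h = eig_fun k g"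
  unfolding eig_fun_def using coef_cong comp_poly_cong by metis

lemma eig_fun_sum:
  assumes "finite I" "\<And>i. i \<in> I \<Longrightarrow> h i holomorphic_on D"
  shows "eig_fun k (\<lambda>q. \<Sum>i\<in>I. c i * h i q) = (\<Sum>i\<in>I. c i * eig_fun k (h i))"
  unfolding eig_fun_def
  by (subst coef_sum[OF assms(1) comp_poly_holomorphic[OF assms(2)], symmetric])
     (auto simp: comp_poly_sum comp_poly_cmult intro!: coef_cong)

text \<open>Constants are annihilated since the coefficient has positive order. This disposes of the
  terms with \<open>B 0\<close> in \<open>L_hk\<close> and \<open>L_gk\<close>, which are constant
  in \<open>q\<close>.\<close>

lemma eig_fun_affine:
  assumes h: "h holomorphic_on D"
  shows "eig_fun k (\<lambda>q. c * h q + d) = c * eig_fun k h"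
proof -
  obtain d' where d': "\<And>q. comp_poly (lower_powers k) (\<lambda>_. d) q = d'" using comp_poly_const by blast
  have H: "comp_poly (lower_powers k) h holomorphic_on D" by (rule comp_poly_holomorphic[OF h])
  have "eig_fun k (\<lambda>q. c * h q + d) = coef (Suc k) (\<lambda>q. c * comp_poly (lower_powers k) h q + d')"
    unfolding eig_fun_def by (intro coef_cong) (simp add: comp_poly_add comp_poly_cmult d')
  also have "\<dots> = c * eig_fun k h"
    unfolding eig_fun_def using H
    by (subst coef_add) (auto intro!: holomorphic_intros simp: coef_cmult coef_const)
  finally show ?thesis .
qed

text \<open>With \<open>h z0\<close> subtracted, the factors in \<open>lower_powers k\<close> raise
  the order of vanishing to \<open>Suc k\<close>. One more factor, with root
  \<open>\<nu> ^ Suc k\<close>, raises it once again, so the coefficient of order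
  \<open>Suc k\<close> of the result is zero; this is the eigenvalue equation.\<close>

lemma eig_fun_comp:
  assumes h: "h holomorphic_on D"
  shows "eig_fun k (\<lambda>q. h (B q)) = \<nu> ^ Suc k * eig_fun k h"
proof -
  define g where "g q = h q - h z0" for q
  have g: "g holomorphic_on D" unfolding g_def by (intro holomorphic_intros h)
  obtain b where b: "b holomorphic_on D" "\<And>q. h q - h z0 = (q - z0) * b q" using factor_at_z0[OF h] by blast
  have "vanish 1 g" unfolding vanish_def g_def using b by auto
  define H where "H = comp_poly (lower_powers k) g"
  have H: "H holomorphic_on D" unfolding H_def by (rule comp_poly_holomorphic[OF g])
  have HB: "(\<lambda>q. H (B q)) holomorphic_on D"
    by (rule holomorphic_on_compose_gen[OF holomorphic_B_D H, unfolded o_def]) (use B_D in auto)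
  have gB: "(\<lambda>q. g (B q)) holomorphic_on D"
    by (rule holomorphic_on_compose_gen[OF holomorphic_B_D g, unfolded o_def]) (use B_D in auto)
  have "vanish (Suc k) H" unfolding H_def by (rule vanish_lower_powers) fact
  from coef_vanish[OF vanish_Suc[OF this]]
  have 0: "coef (Suc k) (\<lambda>q. H (B q) + (- (\<nu> ^ Suc k)) * H q) = 0" by simp
  have "coef (Suc k) (\<lambda>q. H (B q)) + (- (\<nu> ^ Suc k)) * coef (Suc k) H = 0"
    using 0 coef_add[OF HB holomorphic_on_mult[OF holomorphic_on_const H]] coef_cmult[OF H] by metis
  hence eq: "eig_fun k (\<lambda>q. g (B q)) = \<nu> ^ Suc k * eig_fun k g"
    unfolding eig_fun_def comp_poly_comp H_def by simp
  have "eig_fun k (\<lambda>q. h (B q)) = eig_fun k (\<lambda>q. 1 * g (B q) + h z0)" by (simp add: g_def)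
  moreover have "eig_fun k h = eig_fun k (\<lambda>q. 1 * g q + h z0)" by (simp add: g_def)
  ultimately show ?thesis unfolding eig_fun_affine[OF g] eig_fun_affine[OF gB] using eq by simp
qed

lemma fiber_in_A: "z \<in> A \<Longrightarrow> w \<in> fiber z \<Longrightarrow> w \<in> A"
  using fiber_bounds[of z w] A_subset r_t radii_inverse by (auto simp: annulus_iff)

text \<open>The functional is applied to the variable \<open>q\<close> in \<open>L_hk\<close>. It
  commutes with the finite fibre sum, kills the constant and turns composition with \<open>B\<close>
  into a factor.\<close>

lemma L_eig_fun_hk:
  assumes z: "z \<in> A"
  shows "L (\<lambda>w. eig_fun k (hk w)) z = \<nu> ^ Suc k * eig_fun k (hk z)"
proof -
  have z': "z \<in> A'" using z A_subset by blast
  have hkB: "(\<lambda>q. hk z (B q)) holomorphic_on D"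
    by (rule holomorphic_on_compose_gen[OF holomorphic_B_D hk_holomorphic[OF z], unfolded o_def]) (use B_D in auto)
  have "L (\<lambda>w. eig_fun k (hk w)) z = (\<Sum>w\<in>fiber z. (1 / deriv B w) * eig_fun k (hk w))" by (simp add: L_def)
  also have "\<dots> = eig_fun k (\<lambda>q. \<Sum>w\<in>fiber z. (1 / deriv B w) * hk w q)"
    by (rule eig_fun_sum[symmetric]) (use finite_fiber[OF z'] hk_holomorphic fiber_in_A[OF z] in auto)
  also have "\<dots> = eig_fun k (\<lambda>q. 1 * hk z (B q) + cnj (gk z (B 0)))"
  proof (rule eig_fun_cong)
    fix q assume "q \<in> D"
    hence "cmod q \<le> t" using \<rho>D by simp
    from L_hk[OF z' this] show "(\<Sum>w\<in>fiber z. (1 / deriv B w) * hk w q) = 1 * hk z (B q) + cnj (gk z (B 0))"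
      by (simp add: L_def)
  qed
  also have "\<dots> = \<nu> ^ Suc k * eig_fun k (hk z)"
    unfolding eig_fun_affine[OF hkB] eig_fun_comp[OF hk_holomorphic[OF z]] by simp
  finally show ?thesis .
qed

text \<open>The same for the conjugate of \<open>L_gk\<close>, because it is \<open>gk\<close>
  without conjugation that is holomorphic in \<open>q\<close>; this is how the conjugate eigenvalues
  arise.\<close>

lemma L_eig_fun_gk:
  assumes z: "z \<in> A"
  shows "L (\<lambda>w. cnj (eig_fun k (gk w))) z = cnj (\<nu> ^ Suc k) * cnj (eig_fun k (gk z))"
proof -
  have z': "z \<in> A'" using z A_subset by blast
  have gkB: "(\<lambda>q. gk z (B q)) holomorphic_on D"
    by (rule holomorphic_on_compose_gen[OF holomorphic_B_D gk_holomorphic[OF z], unfolded o_def]) (use B_D in auto)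
  have "cnj (L (\<lambda>w. cnj (eig_fun k (gk w))) z) = (\<Sum>w\<in>fiber z. (1 / cnj (deriv B w)) * eig_fun k (gk w))"
    by (simp add: L_def)
  also have "\<dots> = eig_fun k (\<lambda>q. \<Sum>w\<in>fiber z. (1 / cnj (deriv B w)) * gk w q)"
    by (rule eig_fun_sum[symmetric]) (use finite_fiber[OF z'] gk_holomorphic fiber_in_A[OF z] in auto)
  also have "\<dots> = eig_fun k (\<lambda>q. 1 * gk z (B q) + (- gk z (B 0)))"
  proof (rule eig_fun_cong)
    fix q assume "q \<in> D"
    hence "cmod q \<le> t" using \<rho>D by simp
    from arg_cong[OF L_gk[OF z' this], of cnj]
    show "(\<Sum>w\<in>fiber z. (1 / cnj (deriv B w)) * gk w q) = 1 * gk z (B q) + (- gk z (B 0))"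
      by (simp add: L_def)
  qed
  also have "\<dots> = \<nu> ^ Suc k * eig_fun k (gk z)"
    unfolding eig_fun_affine[OF gkB] eig_fun_comp[OF gk_holomorphic[OF z]] by simp
  finally show ?thesis by (metis complex_cnj_cnj complex_cnj_mult)
qed

text \<open>Geometric expansion of \<open>1 / (z - q)\<close> about \<open>z0\<close>, cut off where
  the remainder vanishes to an order invisible to the functional. The eigenfunction appears as a
  polynomial in \<open>1 / (z - z0)\<close>, which extends it to \<open>A'\<close> and allows it to
  be tested for zeros.\<close>

lemma eig_fun_hk:
  assumes z: "z \<in> A"
  shows "eig_fun k (hk z) = (\<Sum>i\<le>Suc k. eig_fun k (\<lambda>q. (q - z0) ^ i) * (1 / (z - z0)) ^ Suc i)"
proof -
  have x: "z - z0 \<noteq> 0" using A'_minus_z0 z A_subset by blast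
  define x where "x = 1 / (z - z0)"
  define R where "R q = (q - z0) ^ Suc (Suc k) * (x ^ Suc (Suc k) * hk z q)" for q
  have Rhol: "R holomorphic_on D" unfolding R_def by (intro holomorphic_intros hk_holomorphic z)
  have "vanish (Suc (Suc k)) R"
    unfolding vanish_def R_def using hk_holomorphic[OF z]
    by (intro exI[of _ "\<lambda>q. x ^ Suc (Suc k) * hk z q"]) (auto intro!: holomorphic_intros)
  hence R0: "eig_fun k R = 0" unfolding eig_fun_def by (intro coef_vanish vanish_comp_poly)
  have expand: "hk z q = (\<Sum>i\<le>Suc k. x ^ Suc i * (q - z0) ^ i) + R q" if q: "q \<in> D" for q
  proof -
    define y where "y = x * (q - z0)"
    have zq: "z - q \<noteq> 0" using q z \<rho>D by (auto simp: annulus_iff)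
    have xz: "x * (z - z0) = 1" using x by (simp add: x_def)
    have y1: "1 - y = x * (z - q)" using xz by (simp add: y_def algebra_simps)
    have hkx: "x = hk z q * (1 - y)" using zq by (simp add: y1 hk_def)
    have "hk z q * (1 - y ^ Suc (Suc k)) = hk z q * ((1 - y) * (\<Sum>i\<le>Suc k. y ^ i))"
      using one_diff_power_eq[of y "Suc (Suc k)"] unfolding lessThan_Suc_atMost by simp
    also have "\<dots> = x * (\<Sum>i\<le>Suc k. y ^ i)" using hkx by (simp add: mult.assoc)
    also have "\<dots> = (\<Sum>i\<le>Suc k. x ^ Suc i * (q - z0) ^ i)"
      unfolding sum_distrib_left y_def power_mult_distrib power_Suc by (simp add: mult.assoc)
    finally have "hk z q = (\<Sum>i\<le>Suc k. x ^ Suc i * (q - z0) ^ i) + hk z q * y ^ Suc (Suc k)"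
      by (simp only: right_diff_distrib mult_1_right diff_eq_eq)
    moreover have "hk z q * y ^ Suc (Suc k) = R q"
      unfolding R_def y_def power_mult_distrib by (simp only: mult_ac)
    ultimately show ?thesis by simp
  qed
  \<comment> \<open>The remainder is made the summand of index \<open>Suc (Suc k)\<close>, so that
    \<open>eig_fun_sum\<close> handles everything at once.\<close>
  have "eig_fun k (hk z) = eig_fun k (\<lambda>q. \<Sum>i\<in>{..Suc (Suc k)}. (if i \<le> Suc k then x ^ Suc i else 1) * (if i \<le> Suc k then \<lambda>q. (q - z0) ^ i else R) q)"
    by (rule eig_fun_cong) (simp add: expand del: power_Suc)
  also have "\<dots> = (\<Sum>i\<in>{..Suc (Suc k)}. (if i \<le> Suc k then x ^ Suc i else 1) * eig_fun k (if i \<le> Suc k then \<lambda>q. (q - z0) ^ i else R))"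
    by (rule eig_fun_sum) (auto intro!: holomorphic_intros Rhol)
  also have "\<dots> = (\<Sum>i\<le>Suc k. eig_fun k (\<lambda>q. (q - z0) ^ i) * x ^ Suc i)"
    using R0 by (simp add: mult.commute del: power_Suc)
  finally show ?thesis by (simp add: x_def)
qed

text \<open>For \<open>0 < cmod \<nu> < 1\<close> the powers have strictly decreasing moduli, hence
  none of the factors \<open>\<nu> ^ Suc k - \<nu> ^ j\<close> vanishes.\<close>

lemma eig_fun_leading:
  assumes "\<nu> \<noteq> 0" shows "eig_fun k (\<lambda>q. (q - z0) ^ Suc k) \<noteq> 0"
proof -
  have "c \<noteq> \<nu> ^ Suc k" if c: "c \<in> set (lower_powers k)" for c
  proof -
    obtain j where j: "1 \<le> j" "j \<le> k" "c = \<nu> ^ j" using set_lower_powers[OF c] by blast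
    have "cmod \<nu> ^ Suc k < cmod \<nu> ^ j" by (rule power_strict_decreasing) (use j norm_\<nu> assms in auto)
    thus ?thesis using j(3) by (metis norm_power less_irrefl)
  qed
  from comp_poly_power_factor[OF this] obtain G where G: "G holomorphic_on D" "G z0 \<noteq> 0"
    "\<And>q. q \<in> D \<Longrightarrow> comp_poly (lower_powers k) (\<lambda>q. (q - z0) ^ Suc k) q = (q - z0) ^ Suc k * G q" by blast
  have "eig_fun k (\<lambda>q. (q - z0) ^ Suc k) = 2 * of_real pi * \<i> * G z0"
    unfolding eig_fun_def by (rule coef_leading[OF G(1,3)])
  thus ?thesis using G(2) by simp
qed

lemma infinite_A: "infinite A"
  using one_in_A open_annulus finite_imp_not_open by blast

text \<open>A polynomial with nonzero leading coefficient cannot vanish at the infinitely many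
  points \<open>1 / (z - z0)\<close>.\<close>

lemma eig_fun_hk_nonzero:
  assumes "\<nu> \<noteq> 0" obtains z where "z \<in> A" "eig_fun k (hk z) \<noteq> 0"
proof -
  define p where "p = (\<Sum>i\<le>Suc k. monom (eig_fun k (\<lambda>q. (q - z0) ^ i)) (Suc i))"
  have "coeff p (Suc (Suc k)) = eig_fun k (\<lambda>q. (q - z0) ^ Suc k)"
    by (simp add: p_def coeff_sum if_distrib cong: if_cong)
  hence "p \<noteq> 0" using eig_fun_leading[OF assms, of k] by auto
  hence fin: "finite {x. poly p x = 0}" by (rule poly_roots_finite)
  have ev: "eig_fun k (hk z) = poly p (1 / (z - z0))" if "z \<in> A" for z
    unfolding eig_fun_hk[OF that] p_def poly_sum poly_monom ..
  have "inj_on (\<lambda>z. 1 / (z - z0)) A" by (rule inj_onI) (simp add: divide_inverse)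
  hence "infinite ((\<lambda>z. 1 / (z - z0)) ` A)" using infinite_A finite_imageD by blast
  hence "\<not> (\<lambda>z. 1 / (z - z0)) ` A \<subseteq> {x. poly p x = 0}" using fin finite_subset by blast
  thus ?thesis using that ev by fastforce
qed

lemma power_in_spectrum:
  assumes "\<nu> \<noteq> 0" shows "\<nu> ^ Suc k \<in> operator_spectrum V Nm T"
proof -
  \<comment> \<open>The explicit sum replaces \<open>eig_fun k (hk z)\<close> because for
    \<open>z \<in> A'\<close> near the inner circle the pole of \<open>hk z\<close> may lie in
    \<open>D\<close>.\<close>
  define f where "f z = (\<Sum>i\<le>Suc k. eig_fun k (\<lambda>q. (q - z0) ^ i) * (1 / (z - z0)) ^ Suc i)" for z
  obtain p where p: "p \<in> A" "eig_fun k (hk p) \<noteq> 0" using eig_fun_hk_nonzero[OF assms] by blast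
  have f_eq: "f z = eig_fun k (hk z)" if "z \<in> A" for z using eig_fun_hk[OF that] by (simp add: f_def)
  show ?thesis
  proof (rule eigenfunction_in_spectrum)
    show "f holomorphic_on A'" unfolding f_def
      by (intro holomorphic_intros) (use A'_minus_z0 in auto)
    show "L f z = \<nu> ^ Suc k * f z" if z: "z \<in> A" for z
      using L_eig_fun_hk[OF z, of k] L_cong[of z f "\<lambda>w. eig_fun k (hk w)"] f_eq fiber_in_A[OF z] z
      by (simp del: power_Suc)
    show "p \<in> A" "f p \<noteq> 0" using p f_eq by auto
  qed
qed

text \<open>With \<open>y = 1 / cnj z\<close>, \<open>gk z q = y^2 * hk y q - y\<close> is affine in
  a Cauchy kernel, so nonvanishing and extension to \<open>A'\<close> are inherited from
  \<open>eig_fun_hk\<close>.\<close>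

lemma eig_fun_gk:
  assumes z: "z \<in> A"
  shows "eig_fun k (gk z) = (1 / cnj z)\<^sup>2 * eig_fun k (hk (1 / cnj z))"
proof -
  define y where "y = 1 / cnj z"
  have y: "y \<in> A" using reflect_in_A(1)[OF z] by (simp add: y_def)
  have "gk z q = y\<^sup>2 * hk y q + (- y)" if q: "q \<in> D" for q
  proof -
    have yq: "y - q \<noteq> 0" using q y \<rho>D by (auto simp: annulus_iff)
    have "cnj z \<noteq> 0" using z r_pos by (auto simp: annulus_iff)
    hence zy: "cnj z = 1 / y" "y \<noteq> 0" by (auto simp: y_def)
    have "gk z q = y * q / (y - q)" unfolding gk_def zy(1) using zy(2) yq by (simp add: field_simps)
    also have "\<dots> = y\<^sup>2 * hk y q + (- y)" using yq by (simp add: hk_def field_simps power2_eq_square)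
    finally show ?thesis .
  qed
  hence "eig_fun k (gk z) = eig_fun k (\<lambda>q. y\<^sup>2 * hk y q + (- y))" by (rule eig_fun_cong)
  also have "\<dots> = y\<^sup>2 * eig_fun k (hk y)" by (rule eig_fun_affine[OF hk_holomorphic[OF y]])
  finally show ?thesis by (simp add: y_def)
qed

lemma cnj_power_in_spectrum:
  assumes "\<nu> \<noteq> 0" shows "cnj \<nu> ^ Suc k \<in> operator_spectrum V Nm T"
proof -
  define f where "f z = (1 / z)\<^sup>2 * (\<Sum>i\<le>Suc k. cnj (eig_fun k (\<lambda>q. (q - z0) ^ i)) * (1 / (1 / z - cnj z0)) ^ Suc i)" for z
  obtain y where y: "y \<in> A" "eig_fun k (hk y) \<noteq> 0" using eig_fun_hk_nonzero[OF assms] by blast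
  have f_eq: "f z = cnj (eig_fun k (gk z))" if z: "z \<in> A" for z
    unfolding eig_fun_gk[OF z] eig_fun_hk[OF reflect_in_A(1)[OF z]] f_def by simp
  define p where "p = 1 / cnj y"
  have p: "p \<in> A" using reflect_in_A(1)[OF y(1)] by (simp add: p_def)
  have "y \<noteq> 0" using y(1) r_pos by (auto simp: annulus_iff)
  hence "1 / cnj p = y" by (simp add: p_def)
  hence fp: "f p \<noteq> 0" using f_eq[OF p] eig_fun_gk[OF p, of k] y(2) \<open>y \<noteq> 0\<close> by simp
  show ?thesis
  proof (rule eigenfunction_in_spectrum)
    show "p \<in> A" "f p \<noteq> 0" by (fact p, fact fp)
    show "f holomorphic_on A'" unfolding f_def
      by (intro holomorphic_intros) (use A'_minus_z0 reflect_in_A(2) in auto)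
    show "L f z = cnj \<nu> ^ Suc k * f z" if z: "z \<in> A" for z
      using L_eig_fun_gk[OF z, of k] L_cong[of z f "\<lambda>w. cnj (eig_fun k (gk w))"] f_eq fiber_in_A[OF z] z
      by (simp del: power_Suc)
  qed
qed

text \<open>If \<open>\<nu> = 0\<close>, all positive powers are 0, whose membership comes from
  \<open>zero_in_spectrum\<close> instead of an eigenfunction.\<close>

theorem spectrum_T: "operator_spectrum V Nm T = {\<nu> ^ n |n. n \<in> (UNIV :: nat set)} \<union> {cnj \<nu> ^ n |n. n \<ge> (1::nat)} \<union> {0}"
proof (intro set_eqI iffI)
  fix \<mu> assume \<mu>: "\<mu> \<in> operator_spectrum V Nm T"
  show "\<mu> \<in> {\<nu> ^ n |n. n \<in> (UNIV :: nat set)} \<union> {cnj \<nu> ^ n |n. n \<ge> (1::nat)} \<union> {0}"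
  proof (cases "\<mu> = 0")
    case False
    then obtain j where j: "\<mu> = \<nu> ^ j \<or> \<mu> = cnj (\<nu> ^ j)" using spectrum_subset[OF \<mu>] by blast
    show ?thesis
    proof (cases "j = 0")
      case True
      hence "\<mu> = \<nu> ^ 0" using j by auto
      thus ?thesis by blast
    next
      case False
      hence "j \<ge> 1" by simp
      thus ?thesis using j unfolding complex_cnj_power by blast
    qed
  qed simp
next
  fix \<mu> assume "\<mu> \<in> {\<nu> ^ n |n. n \<in> (UNIV :: nat set)} \<union> {cnj \<nu> ^ n |n. n \<ge> (1::nat)} \<union> {0}"
  then consider "\<mu> = 0" | j where "\<mu> = \<nu> ^ j" | j where "\<mu> = cnj \<nu> ^ j" "j \<ge> 1" by blast
  thus "\<mu> \<in> operator_spectrum V Nm T"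
  proof cases
    case 1 thus ?thesis using zero_in_spectrum by simp
  next
    case (2 j)
    show ?thesis
    proof (cases j)
      case 0 thus ?thesis using 2 one_in_spectrum by simp
    next
      case (Suc k)
      show ?thesis
      proof (cases "\<nu> = 0")
        case True
        hence "\<mu> = 0" using 2 Suc by simp
        thus ?thesis using zero_in_spectrum by simp
      next
        case False
        show ?thesis unfolding 2 Suc by (rule power_in_spectrum[OF False])
      qed
    qed
  next
    case (3 j)
    then obtain k where k: "j = Suc k" by (cases j) auto
    show ?thesis
    proof (cases "\<nu> = 0")
      case True
      hence "\<mu> = 0" using 3 k by simp
      thus ?thesis using zero_in_spectrum by simp
    next
      case False
      show ?thesis unfolding 3 k by (rule cnj_power_in_spectrum[OF False])
    qed
  qed
qed

end

subsection \<open>The multiplier of the outer fixed point\<close>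

context blaschke
begin

lemma fixpoint_in_disc_unique:
  assumes expanding: "\<And>z. cmod z = 1 \<Longrightarrow> Psum z > 1"
    and p: "cmod p < 1" "B p = p" and q: "cmod q < 1" "B q = q"
  shows "p = q"
proof -
  \<comment> \<open>The radii are pushed beyond both fixed points, so that uniqueness in the disc of
    radius \<open>t\<close> applies to them.\<close>
  have "max (cmod p) (cmod q) < 1" using p q by simp
  from radii_exist[OF expanding this] obtain s r t where srt: "0 < s" "s < r" "r < t" "t < 1" "max (cmod p) (cmod q) < r"
    "\<And>w. cmod w \<le> t \<Longrightarrow> cmod (B w) \<le> s"
    "\<And>z. z \<in> annulus r (1 / r) \<Longrightarrow> poly Q z \<noteq> 0 \<and> B z \<noteq> 0 \<and> deriv B z \<noteq> 0" by blast
  interpret blaschke_fixpoint C n a B s r t q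
    by unfold_locales (use srt q in auto)
  show ?thesis using unique_fixpoint[of p] p srt by simp
qed

text \<open>By \<open>B_reflect\<close>, away from 0 the map \<open>B\<close> is the conjugate by
  \<open>cnj\<close> of \<open>1 / B (1 / v)\<close>, which the chain rule differentiates at
  \<open>1 / x\<close>.\<close>

lemma deriv_B_reflect:
  assumes x: "x \<noteq> 0" "cmod x < 1" "B x \<noteq> 0"
  shows "deriv B (1 / cnj x) = cnj (deriv B x * x\<^sup>2 / (B x)\<^sup>2)"
proof -
  have dB: "(B has_field_derivative deriv B x) (at x)"
    using has_field_derivative_B[OF Q_nz[OF less_imp_le[OF x(2)]]] by (simp only: DERIV_imp_deriv)
  define F where "F v = 1 / B (1 / v)" for v
  have v: "1 / (1 / x) = x" "1 / x \<noteq> 0" using x by auto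
  have "((\<lambda>v. 1 / v) has_field_derivative - (x\<^sup>2)) (at (1 / x))"
    using DERIV_inverse[OF v(2)] by (simp add: inverse_eq_divide power2_eq_square[symmetric] power_one_over)
  hence "((\<lambda>v. B (1 / v)) has_field_derivative deriv B x * - (x\<^sup>2)) (at (1 / x))"
    using dB v(1) by (intro DERIV_chain2[of B]) simp_all
  hence "(F has_field_derivative (0 * B (1 / (1 / x)) - 1 * (deriv B x * - (x\<^sup>2))) / (B (1 / (1 / x)) * B (1 / (1 / x)))) (at (1 / x))"
    unfolding F_def by (intro DERIV_divide DERIV_const) (use x(3) v(1) in simp_all)
  hence F: "(F has_field_derivative deriv B x * x\<^sup>2 / (B x)\<^sup>2) (at (cnj (1 / cnj x)))"
    by (simp add: power2_eq_square)
  have "((cnj \<circ> F \<circ> cnj) has_field_derivative cnj (deriv B x * x\<^sup>2 / (B x)\<^sup>2)) (at (1 / cnj x))"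
    by (rule has_field_derivative_cnj_cnj[OF F])
  hence "(B has_field_derivative cnj (deriv B x * x\<^sup>2 / (B x)\<^sup>2)) (at (1 / cnj x))"
  proof (rule has_field_derivative_transform_within_open)
    show "open (- {0::complex})" by (intro open_Compl) simp
    show "(cnj \<circ> F \<circ> cnj) u = B u" if "u \<in> - {0}" for u
      using B_reflect[of "1 / cnj u"] that by (simp add: F_def)
  qed (use x in simp)
  thus ?thesis by (rule DERIV_imp_deriv)
qed

text \<open>With \<open>m\<close> the order of the zero, \<open>B w = w ^ m * g w\<close> turns the quotient into
  \<open>w ^ (m - 1) * (g w)\<^sup>2 / (m * g w + w * deriv g w)\<close>, so that a critical fixed point is covered as well.\<close>

lemma multiplier_quotient_tendsto:
  assumes "B 0 = 0"
  shows "((\<lambda>w. (B w)\<^sup>2 / (w\<^sup>2 * deriv B w)) \<longlongrightarrow> deriv B 0) (at 0)"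
proof -
  have hol: "B holomorphic_on ball 0 1" by (rule holomorphic_B, rule Q_nz) simp
  have nonconst: "\<not> B constant_on ball 0 1"
  proof
    assume "B constant_on ball 0 1"
    hence "B w = 0" if "w \<in> ball 0 1" for w using assms that unfolding constant_on_def using centre_in_ball zero_less_one by metis
    hence "poly P w = 0" if "w \<in> ball 0 1" for w using Q_nz[of w] that by (auto simp: B_PQ)
    hence "ball 0 1 \<subseteq> {w. poly P w = 0}" by blast
    hence "finite (ball (0::complex) 1)" using poly_roots_finite[OF P_nonzero] finite_subset by blast
    thus False using finite_imp_not_open[of "ball (0::complex) 1"] by simp
  qed
  have z1: "0 \<in> ball (0::complex) 1" by simp
  obtain g \<epsilon> m where g: "0 < m" "0 < \<epsilon>" "ball (0::complex) \<epsilon> \<subseteq> ball 0 1" "g holomorphic_on ball 0 \<epsilon>"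
    "\<And>w. w \<in> ball 0 \<epsilon> \<Longrightarrow> B w = (w - 0) ^ m * g w" "\<And>w. w \<in> ball 0 \<epsilon> \<Longrightarrow> g w \<noteq> 0"
    by (rule holomorphic_factor_zero_nonconstant[OF hol open_ball connected_ball z1 assms nonconst]) (rule that)
  obtain k where k: "m = Suc k" using g(1) by (cases m) auto
  have dB: "deriv B w = w ^ k * (of_nat m * g w + w * deriv g w)" if w: "w \<in> ball 0 \<epsilon>" for w
  proof -
    have "(g has_field_derivative deriv g w) (at w)" using holomorphic_derivI[OF g(4) open_ball w] .
    moreover have "((\<lambda>w. w ^ m) has_field_derivative of_nat m * w ^ k) (at w)"
      using DERIV_power[OF DERIV_ident, of m] k by simp
    ultimately have "((\<lambda>w. w ^ m * g w) has_field_derivative w ^ m * deriv g w + of_nat m * w ^ k * g w) (at w)"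
      by (intro DERIV_mult')
    hence "((\<lambda>w. w ^ m * g w) has_field_derivative w ^ k * (of_nat m * g w + w * deriv g w)) (at w)"
      unfolding k by (simp add: algebra_simps)
    hence "(B has_field_derivative w ^ k * (of_nat m * g w + w * deriv g w)) (at w)"
      by (rule has_field_derivative_transform_within_open[OF _ open_ball w]) (use g(5) in simp)
    thus ?thesis by (rule DERIV_imp_deriv)
  qed
  have z: "0 \<in> ball (0::complex) \<epsilon>" using g(2) by simp
  have "continuous_on (ball 0 \<epsilon>) g" "continuous_on (ball 0 \<epsilon>) (deriv g)"
    using g(4) holomorphic_deriv[OF g(4) open_ball] holomorphic_on_imp_continuous_on by blast+
  hence lim: "(g \<longlongrightarrow> g 0) (at 0)" "(deriv g \<longlongrightarrow> deriv g 0) (at 0)"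
    using z unfolding continuous_on_eq_continuous_at[OF open_ball] isCont_def by blast+
  have "((\<lambda>w. w ^ k * (g w)\<^sup>2 / (of_nat m * g w + w * deriv g w)) \<longlongrightarrow> 0 ^ k * (g 0)\<^sup>2 / (of_nat m * g 0 + 0 * deriv g 0)) (at 0)"
    using g(1) g(6)[OF z] by (intro tendsto_intros lim) auto
  \<comment> \<open>For a simple zero \<open>k = 0\<close>, \<open>0 ^ 0 = 1\<close> and both sides
    are \<open>g 0\<close>; for a multiple zero both sides vanish.\<close>
  moreover have "0 ^ k * (g 0)\<^sup>2 / (of_nat m * g 0 + 0 * deriv g 0) = deriv B 0"
    using g(6)[OF z] dB[OF z] k by (cases k) (auto simp: power2_eq_square)
  moreover have "\<forall>\<^sub>F w in at 0. w ^ k * (g w)\<^sup>2 / (of_nat m * g w + w * deriv g w) = (B w)\<^sup>2 / (w\<^sup>2 * deriv B w)"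
  proof -
    have "\<forall>\<^sub>F w in at 0. w \<in> ball (0::complex) \<epsilon> - {0}"
      using g(2) by (intro eventually_at_in_open) auto
    moreover have "w ^ k * (g w)\<^sup>2 / (of_nat m * g w + w * deriv g w) = (B w)\<^sup>2 / (w\<^sup>2 * deriv B w)" if w: "w \<in> ball 0 \<epsilon> - {0}" for w
    proof -
      have w': "w \<in> ball 0 \<epsilon>" "w \<noteq> 0" using w by auto
      have "(B w)\<^sup>2 = (w\<^sup>2 * w ^ k) * (w ^ k * (g w)\<^sup>2)" using g(5)[OF w'(1)] unfolding k by (simp add: power2_eq_square)
      moreover have "w\<^sup>2 * deriv B w = (w\<^sup>2 * w ^ k) * (of_nat m * g w + w * deriv g w)" using dB[OF w'(1)] by (simp only: mult.assoc)
      ultimately show ?thesis using w'(2) by simp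
    qed
    ultimately show ?thesis by (auto elim: eventually_mono)
  qed
  ultimately show ?thesis using Lim_transform_eventually[where f = "\<lambda>w. w ^ k * (g w)\<^sup>2 / (of_nat m * g w + w * deriv g w)"] by simp
qed

lemma cnj_tendsto_at_0: "filterlim cnj (at 0) (at 0)"
  by (rule filterlim_atI) (auto intro!: tendsto_eq_intros simp: eventually_at_filter)

text \<open>The points near infinity are \<open>1 / cnj w\<close> with small \<open>w\<close>, where
  \<open>deriv_B_reflect\<close> expresses \<open>1 / deriv B\<close> as the conjugate of the
  quotient in \<open>multiplier_quotient_tendsto\<close>. Besides \<open>w = 0\<close>, the other
  zeros of \<open>B\<close> have to be kept away from.\<close>

lemma multiplier_at_infinity:
  assumes "B 0 = 0" shows "multiplier B None = cnj (deriv B 0)"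
proof -
  define h where "h w = (B w)\<^sup>2 / (w\<^sup>2 * deriv B w)" for w
  have h: "(h \<longlongrightarrow> deriv B 0) (at 0)" unfolding h_def by (rule multiplier_quotient_tendsto[OF assms])
  have fin: "finite {x. poly P x = 0}" by (rule poly_roots_finite[OF P_nonzero])
  have "\<forall>\<^sub>F w in at 0. w \<in> ball 0 1 - ({x. poly P x = 0} - {0}) - {0}"
    by (intro eventually_at_in_open open_Diff finite_imp_closed) (use fin in auto)
  hence ev: "\<forall>\<^sub>F w in at 0. cnj (h w) = 1 / deriv B (1 / cnj w)"
  proof (rule eventually_mono)
    fix w assume w: "w \<in> ball 0 1 - ({x. poly P x = 0} - {0}) - {0}"
    hence w': "w \<noteq> 0" "cmod w < 1" "B w \<noteq> 0" using Q_nz[of w] by (auto simp: B_PQ)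
    show "cnj (h w) = 1 / deriv B (1 / cnj w)" unfolding deriv_B_reflect[OF w'] h_def by (simp add: mult.commute)
  qed
  have "((\<lambda>w. cnj (h w)) \<longlongrightarrow> cnj (deriv B 0)) (at 0)" by (intro tendsto_cnj h)
  from Lim_transform_eventually[OF this ev]
  have "((\<lambda>w. 1 / deriv B (1 / cnj w)) \<longlongrightarrow> cnj (deriv B 0)) (at 0)" .
  from filterlim_compose[OF this cnj_tendsto_at_0]
  have "(((\<lambda>z. 1 / deriv B z) \<circ> inverse) \<longlongrightarrow> cnj (deriv B 0)) (at 0)" by (simp add: o_def inverse_eq_divide)
  hence "((\<lambda>z. 1 / deriv B z) \<longlongrightarrow> cnj (deriv B 0)) at_infinity" by (simp only: lim_at_infinity_0)
  from tendsto_Lim[OF _ this] show ?thesis unfolding multiplier_def by (simp add: trivial_limit_at_infinity)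
qed

text \<open>Otherwise \<open>B\<close> would have the finite limit \<open>1 / cnj (B 0)\<close> at
  infinity by reflection.\<close>

lemma B_0_of_fixed_infinity:
  assumes "filterlim B at_infinity at_infinity" shows "B 0 = 0"
proof (rule ccontr)
  assume nz: "B 0 \<noteq> 0"
  have "isCont B 0" by (rule DERIV_isCont[OF has_field_derivative_B[OF Q_nz]]) simp
  hence "((\<lambda>w. 1 / cnj (B w)) \<longlongrightarrow> 1 / cnj (B 0)) (at 0)" using nz by (intro tendsto_intros) (auto simp: isCont_def)
  moreover have "\<forall>\<^sub>F w in at 0. 1 / cnj (B w) = B (1 / cnj w)"
    using B_reflect by (auto simp: eventually_at_filter)
  ultimately have "((\<lambda>w. B (1 / cnj w)) \<longlongrightarrow> 1 / cnj (B 0)) (at 0)" by (rule Lim_transform_eventually)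
  from filterlim_compose[OF this cnj_tendsto_at_0]
  have "((B \<circ> inverse) \<longlongrightarrow> 1 / cnj (B 0)) (at 0)" by (simp add: o_def inverse_eq_divide)
  hence "(B \<longlongrightarrow> 1 / cnj (B 0)) at_infinity" by (simp only: lim_at_infinity_0)
  from not_tendsto_and_filterlim_at_infinity[OF _ this assms] show False by (simp add: trivial_limit_at_infinity)
qed

text \<open>The reflection of a finite outer fixed point is a fixed point in the disc and therefore
  \<open>z0\<close>; the factor \<open>x^2 / (B x)^2\<close> in \<open>deriv_B_reflect\<close> is
  then 1. A fixed point at infinity forces \<open>z0 = 0\<close>.\<close>

lemma multiplier_reflected_fixpoint:
  assumes expanding: "\<And>z. cmod z = 1 \<Longrightarrow> Psum z > 1"
    and z0: "cmod z0 < 1" "B z0 = z0"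
    and zh: "zh \<notin> Some ` cball 0 1" "sphere_map B zh = zh"
  shows "multiplier B zh = cnj (deriv B z0)"
proof (cases zh)
  case None
  hence "filterlim B at_infinity at_infinity" using zh(2) by (simp add: sphere_map_def split: if_splits)
  hence B0: "B 0 = 0" by (rule B_0_of_fixed_infinity)
  have "z0 = 0" by (rule fixpoint_in_disc_unique[OF expanding z0]) (use B0 in auto)
  thus ?thesis using multiplier_at_infinity[OF B0] None by simp
next
  case (Some w)
  hence w: "1 < cmod w" "B w = w" using zh by (auto simp: sphere_map_def split: if_splits)
  have w0: "w \<noteq> 0" using w by auto
  have z1: "cmod (1 / cnj w) < 1" "B (1 / cnj w) = 1 / cnj w"
    using w B_reflect[OF w0] w0 by (simp_all add: norm_divide divide_less_eq)
  have eq: "1 / cnj w = z0" by (rule fixpoint_in_disc_unique[OF expanding z1 z0])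
  have z0_nz: "z0 \<noteq> 0" unfolding eq[symmetric] using w0 by simp
  have "1 / cnj z0 = w" unfolding eq[symmetric] by simp
  hence "deriv B w = cnj (deriv B z0)" using deriv_B_reflect[of z0] z0 z0_nz by simp
  thus ?thesis using Some by (simp add: multiplier_def)
qed

end

theorem theorem5p4:
  fixes B :: "complex \<Rightarrow> complex" and z0 :: complex and z0_hat :: "complex option"
  assumes "finite_blaschke_product B"
    and "analytic_expanding_circle_map B"
    and "z0 \<in> ball 0 1" and "sphere_map B (Some z0) = Some z0"
    and "z0_hat \<notin> Some ` cball 0 1" and "sphere_map B z0_hat = z0_hat"
  shows "multiplier B z0_hat = cnj (multiplier B (Some z0)) \<and>
    (\<exists>r R. admissible_annulus B r R \<and>
       transfer_operator_well_defined B (annulus r R) (hardy_space r R) \<and>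
       compact_operator (hardy_space r R) (hardy_norm r R) (transfer_operator B (annulus r R)) \<and>
       operator_spectrum (hardy_space r R) (hardy_norm r R) (transfer_operator B (annulus r R)) =
         {multiplier B (Some z0) ^ n |n. n \<in> (UNIV :: nat set)} \<union>
         {multiplier B z0_hat ^ n |n. n \<ge> (1 :: nat)} \<union> {0})"
proof -
  obtain C n a where Cna: "n \<ge> 2" "cmod C = 1" "\<forall>i\<in>{1..n::nat}. a i \<in> ball 0 1"
    "B = (\<lambda>z. C * (\<Prod>i=1..n. (z - a i) / (1 - cnj (a i) * z)))"
    using assms(1) unfolding finite_blaschke_product_def by blast
  interpret b: blaschke C n a B by unfold_locales (use Cna in auto)
  have expanding: "b.Psum z > 1" if "cmod z = 1" for z
    using assms(2) that unfolding b.norm_deriv_B_circle[OF that, symmetric] analytic_expanding_circle_map_def by simp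
  have z0: "cmod z0 < 1" "B z0 = z0" using assms(3,4) by (auto simp: sphere_map_def split: if_splits)
  have mult: "multiplier B z0_hat = cnj (deriv B z0)"
    by (rule b.multiplier_reflected_fixpoint[OF expanding z0 assms(5,6)])
  \<comment> \<open>With \<open>c = cmod z0\<close> the fixed point lies inside the inner circle of
    the annulus.\<close>
  from b.radii_exist[OF expanding z0(1)] obtain s r t where srt: "0 < s" "s < r" "r < t" "t < 1" "cmod z0 < r"
    "\<And>w. cmod w \<le> t \<Longrightarrow> cmod (B w) \<le> s"
    "\<And>z. z \<in> annulus r (1 / r) \<Longrightarrow> poly b.Q z \<noteq> 0 \<and> B z \<noteq> 0 \<and> deriv B z \<noteq> 0" by blast
  interpret f: blaschke_fixpoint C n a B s r t z0
    by unfold_locales (use srt z0 in auto)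
  have "admissible_annulus B r (1 / r)"
    unfolding admissible_annulus_def using srt f.holomorphic_B_A f.regular
    by (auto intro!: holomorphic_intros)
  moreover have "multiplier B (Some z0) = deriv B z0" by (simp add: multiplier_def)
  ultimately show ?thesis
    using f.transfer_well_defined f.compact_operator_T f.spectrum_T mult
    unfolding f.T_eq by (intro conjI exI[of _ r] exI[of _ "1 / r"]) (simp_all add: f.T_eq)
qed

end
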